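(* Let $a>-1$, $b>-1/2$, $0<\sigma<\infty$, and let $a_n(\epsilon)$ satisfy $a_n(\epsilon)\log\log n\to\tau\in\mathbb R$ as $n\to\infty$ and $\epsilon\searrow\sqrt{1+a}$ jointly. Let $\{X,X_n;n\ge1\}$ be i.i.d. random variables (no moment assumptions). Suppose that either $$\lim_{\epsilon\searrow\sqrt{1+a}}(\epsilon^2-a-1)^{b+1/2}\sum_{n=1}^\infty\frac{(\log n)^a(\log\log n)^b}{n}\,\mathbb P\big\{M_n\ge\sigma\phi(n)(\epsilon+a_n(\epsilon))\big\}=2\sqrt{\tfrac{1}{\pi(a+1)}}\,e^{-2\tau\sqrt{1+a}}\,\Gamma(b+1/2)$$ or $$\lim_{\epsilon\searrow\sqrt{1+a}}(\epsilon^2-a-1)^{b+1/2}\sum_{n=1}^\infty\frac{(\log n)^a(\log\log n)^b}{n}\,\mathbb P\big\{|S_n|\ge\sigma\phi(n)(\epsilon+a_n(\epsilon))\big\}=\sqrt{\tfrac{1}{\pi(a+1)}}\,e^{-2\tau\sqrt{1+a}}\,\Gamma(b+1/2).$$ Then $\mathbb E X=0$, $\mathbb E X^2=\sigma^2$, $\mathbb E\big[X^2(\log|X|)^a(\log\log|X|)^{b-1}\big]<\infty$, and $$\liminf_{t\to\infty}(\log\log t)\,\mathbb E\big[X^2I\{|X|\ge t\}\big]=0.$$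
   Context: Conventions: $\log x=\ln(x\vee e)$, $\log\log x=\log(\log x)$, $\phi(x)=\sqrt{2x\log\log x}$. For i.i.d. $X_1,X_2,\dots$, $S_n=X_1+\dots+X_n$ and $M_n=\max_{k\le n}|S_k|$. $\Gamma$ is the Gamma function. The joint limit condition on $a_n(\epsilon)$ means: for every $\eta>0$ there exist $n_0$ and $\delta>0$ such that $|a_n(\epsilon)\log\log n-\tau|<\eta$ for all $n\ge n_0$ and all $\epsilon\in(\sqrt{1+a},\sqrt{1+a}+\delta)$. *)

theory Defs
  imports "HOL-Analysis.Analysis" "HOL-Probability.Probability"
begin

definition logl :: "real \<Rightarrow> real" where
  "logl x = ln (max x (exp 1))"

definition loglogl :: "real \<Rightarrow> real" where
  "loglogl x = logl (logl x)"

definition phi :: "real \<Rightarrow> real" where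
  "phi x = sqrt (2 * x * loglogl x)"

definition psum :: "(nat \<Rightarrow> 'a \<Rightarrow> real) \<Rightarrow> nat \<Rightarrow> 'a \<Rightarrow> real" where
  "psum X n \<omega> = (\<Sum>i\<in>{1..n}. X i \<omega>)"

definition pmax :: "(nat \<Rightarrow> 'a \<Rightarrow> real) \<Rightarrow> nat \<Rightarrow> 'a \<Rightarrow> real" where
  "pmax X n \<omega> = Max ((\<lambda>k. \<bar>psum X k \<omega>\<bar>) ` {..n})"

end

theory Submission
  imports Defs "HOL-Real_Asymp.Real_Asymp"
begin

text \<open>
  Finiteness of the series at every level above the critical one already yields the moments. If
  \<open>X\<close> had no second moment, then, by a characteristic function argument, \<open>S\<^sub>k\<close> would exceed
  \<open>y \<surd>k\<close> with probability bounded away from \<open>0\<close> for every \<open>y\<close>; a product of about \<open>log log n\<close>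
  such block events has probability at least a small negative power of \<open>log n\<close>, so the series
  diverges. The same block estimate together with the central limit theorem gives mean zero and
  variance at most \<open>\<sigma>\<^sup>2\<close>, and a single big jump followed by a typical sum gives the weighted
  second moment.

  With these moments, truncation at \<open>\<kappa> \<surd>(n / log log n)\<close> costs only a summable remainder, and
  exponential tilting, Gaussian smoothing and Fourier inversion bound the tail of the truncated sum
  by the Gaussian tail with the truncated variance, up to a factor \<open>1 + o(1)\<close>. If
  \<open>(log log t) E[X\<^sup>2; |X| \<ge> t] \<ge> c > 0\<close> for all large \<open>t\<close>, the truncated variances are at most
  \<open>\<sigma>\<^sup>2 - c / log log n\<close>, so that the Gaussian exponent \<open>u\<^sup>2 / (2 n \<sigma>\<^sup>2)\<close> at
  \<open>u \<approx> \<sigma> \<phi>(n) \<surd>(1 + a)\<close> gains a positive constant and the limit is smaller than the assumed one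
  by a fixed factor. A variance below \<open>\<sigma>\<^sup>2\<close> makes the series converge at the critical level, so the
  limit would be \<open>0\<close>. An Ottaviani inequality with a central limit lower bound transfers both
  arguments from \<open>|S\<^sub>n|\<close> to \<open>M\<^sub>n\<close>, with the factor \<open>2\<close>.
\<close>

subsection \<open>Iterated logarithms and the weights of the series\<close>

text \<open>This dictates the truncation level: Chernoff exponents are of order sqrt (log log n /
  n), so exponent times level stays bounded, and a small \<kappa> loses arbitrarily little on the
  exponential scale. The sharp Gaussian bound also needs the removed mean and the truncated third
  moment to be small up to powers of log log n, which may fail for some n. At these n the crude
  Chernoff bound brings the weight down to (log n)^(-1/2) / n, and a negative power of log n is all
  it takes to make their contribution summable from E X^2 alone. Whatever is summable uniformly in
  \<epsilon> disappears under the normalization, because b + 1/2 is positive. The exponential tilt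
  uses the full variance, so that a deficit c / log log n of the truncated variance is multiplied by
  u^2 / n, of order log log n, and becomes a constant.\<close>

lemma logl_ge_1: "1 \<le> logl x"
  unfolding logl_def by (subst ln_ge_iff) (auto simp: less_max_iff_disj)

lemma logl_pos [simp]: "0 < logl x" using logl_ge_1[of x] by linarith

lemma loglogl_ge_1: "1 \<le> loglogl x"
  unfolding loglogl_def by (rule logl_ge_1)

lemma loglogl_pos [simp]: "0 < loglogl x" using loglogl_ge_1[of x] by linarith

lemma logl_mono: "x \<le> y \<Longrightarrow> logl x \<le> logl y"
  unfolding logl_def by (subst ln_le_cancel_iff) (auto simp: less_max_iff_disj)

lemma loglogl_mono: "x \<le> y \<Longrightarrow> loglogl x \<le> loglogl y"
  unfolding loglogl_def by (intro logl_mono)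

lemma logl_eq: "exp 1 \<le> x \<Longrightarrow> logl x = ln x"
  unfolding logl_def by (simp add: max_def)

lemma loglogl_eq: "exp (exp 1) \<le> x \<Longrightarrow> loglogl x = ln (ln x)"
proof -
  assume *: "exp (exp 1) \<le> x"
  have "exp 1 \<le> exp (exp (1::real))" by simp
  then have "exp 1 \<le> x" using * by linarith
  moreover have "exp 1 \<le> ln x"
    using * by (subst ln_ge_iff) (auto intro: less_le_trans[OF exp_gt_zero])
  ultimately show ?thesis unfolding loglogl_def by (simp add: logl_eq)
qed

lemma logl_measurable [measurable]: "logl \<in> borel_measurable borel"
  unfolding logl_def by measurable

lemma loglogl_measurable [measurable]: "loglogl \<in> borel_measurable borel"
  unfolding loglogl_def by measurable

text \<open>Since \<open>logl x\<close> is at least 1, the additive \<open>ln K\<close> can be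
  absorbed into a multiplicative constant. Together with \<open>logl_power_le\<close> this is how
  weights at comparable arguments are compared.\<close>

lemma logl_mult_le:
  assumes "1 \<le> K" shows "logl (K * x) \<le> (1 + ln K) * logl x"
proof -
  have "logl (K * x) \<le> ln (K * max x (exp 1))"
  proof -
    have "exp 1 * 1 \<le> max x (exp 1) * K" using assms by (intro mult_mono) (auto simp: le_max_iff_disj)
    moreover have "K * x \<le> K * max x (exp 1)" using assms by (intro mult_left_mono) auto
    ultimately have "max (K * x) (exp 1) \<le> K * max x (exp 1)" by (simp add: mult.commute)
    then show ?thesis unfolding logl_def
      by (intro ln_mono) (auto simp: less_max_iff_disj)
  qed
  also have "\<dots> = ln K + logl x"
  proof -
    have "0 < max x (exp 1)" by (simp add: less_max_iff_disj)
    then show ?thesis unfolding logl_def using assms by (subst ln_mult_pos) auto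
  qed
  also have "\<dots> \<le> (1 + ln K) * logl x"
    using assms logl_ge_1[of x] mult_left_mono[of 1 "logl x" "ln K"] by (simp add: algebra_simps)
  finally show ?thesis .
qed

lemma loglogl_mult_le:
  assumes "1 \<le> K" shows "loglogl (K * x) \<le> (1 + ln (1 + ln K)) * loglogl x"
proof -
  have "loglogl (K * x) \<le> logl ((1 + ln K) * logl x)"
    unfolding loglogl_def by (intro logl_mono logl_mult_le assms)
  also have "\<dots> \<le> (1 + ln (1 + ln K)) * logl (logl x)"
    using assms by (intro logl_mult_le) auto
  finally show ?thesis unfolding loglogl_def .
qed

lemma logl_power_le:
  assumes "0 \<le> x" "1 \<le> k" shows "logl (x ^ k) \<le> real k * logl x"
proof -
  have "max (x ^ k) (exp 1) \<le> (max x (exp 1)) ^ k"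
  proof (intro max.boundedI)
    show "x ^ k \<le> max x (exp 1) ^ k" using assms by (intro power_mono) auto
    have "exp 1 \<le> exp (1::real) ^ k" using assms by (intro self_le_power) (auto simp: one_le_exp_iff)
    also have "\<dots> \<le> max x (exp 1) ^ k" by (intro power_mono) auto
    finally show "exp 1 \<le> max x (exp 1) ^ k" .
  qed
  then have "logl (x ^ k) \<le> ln (max x (exp 1) ^ k)"
    unfolding logl_def by (subst ln_le_cancel_iff) (auto simp: less_max_iff_disj)
  also have "\<dots> = real k * logl x" unfolding logl_def by (subst ln_realpow) (auto simp: less_max_iff_disj)
  finally show ?thesis .
qed

lemma loglogl_power_le:
  assumes "0 \<le> x" "1 \<le> k" shows "loglogl (x ^ k) \<le> (1 + ln (real k)) * loglogl x"
  unfolding loglogl_def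
  using order_trans[OF logl_mono[OF logl_power_le[OF assms]] logl_mult_le[of "real k" "logl x"]] assms
  by simp

lemma eventually_logl: "\<forall>\<^sub>F x in at_top. logl x = ln x"
  using eventually_ge_at_top[of "exp 1"] by eventually_elim (rule logl_eq)

lemma eventually_loglogl: "\<forall>\<^sub>F x in at_top. loglogl x = ln (ln x)"
  using eventually_ge_at_top[of "exp (exp 1)"] by eventually_elim (rule loglogl_eq)

text \<open>The exponents \<open>a\<close> and \<open>b\<close> may have either sign; comparing the
  bases in both directions gives one constant for all exponents.\<close>

lemma powr_two_sided:
  fixes x y K \<alpha> :: real
  assumes "0 < x" "0 < y" "1 \<le> K" "x \<le> K * y" "y \<le> K * x"
  shows "x powr \<alpha> \<le> K powr \<bar>\<alpha>\<bar> * y powr \<alpha>"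
proof (cases "0 \<le> \<alpha>")
  case True
  have "x powr \<alpha> \<le> (K * y) powr \<alpha>" using assms True by (intro powr_mono2) auto
  then show ?thesis using assms True by (simp add: powr_mult)
next
  case False
  have "(K * x) powr \<alpha> \<le> y powr \<alpha>" using assms False by (intro powr_mono2') auto
  then have "K powr \<alpha> * x powr \<alpha> \<le> y powr \<alpha>" using assms by (simp add: powr_mult)
  moreover have "K powr (-\<alpha>) * K powr \<alpha> = 1" using assms by (simp add: powr_add[symmetric])
  ultimately show ?thesis using False assms
    mult_left_mono[of "K powr \<alpha> * x powr \<alpha>" "y powr \<alpha>" "K powr (-\<alpha>)"]
    by (simp add: mult.assoc[symmetric])
qed

text \<open>The value at 0 is 0 because division by 0 gives 0, so a series over all naturals agrees
  with the series from 1 on.\<close>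

definition wt :: "real \<Rightarrow> real \<Rightarrow> nat \<Rightarrow> real" where
  "wt a b n = logl (real n) powr a * loglogl (real n) powr b / real n"

lemma wt_nonneg [simp]: "0 \<le> wt a b n" unfolding wt_def by simp

lemma wt_0 [simp]: "wt a b 0 = 0" unfolding wt_def by simp

text \<open>The increments of ln (ln n) are at most 1 / (n ln n), by ln z \<le> z - 1 applied at
  both logarithms, and ln (ln n) is unbounded.\<close>

lemma not_summable_inverse_n_ln: "\<not> summable (\<lambda>n. 1 / (real n * ln (real n)))"
proof
  let ?f = "\<lambda>n. 1 / (real n * ln (real n))" and ?g = "\<lambda>n. ln (ln (real n))"
  assume s: "summable ?f"
  have *: "ln y - ln x \<le> (y - x) / x" if "0 < x" "0 < y" for x y :: real
  proof -
    have "ln y - ln x = ln (y / x)" using that by (simp add: ln_div)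
    also have "\<dots> \<le> y / x - 1" using that by (intro ln_le_minus_one) auto
    finally show ?thesis using that by (simp add: field_simps)
  qed
  have step: "?g (Suc n) - ?g n \<le> ?f n" if "n \<ge> 2" for n
  proof -
    have "?g (Suc n) - ?g n \<le> (ln (real (Suc n)) - ln (real n)) / ln (real n)"
      using that by (intro *) auto
    also have "\<dots> \<le> ((real (Suc n) - real n) / real n) / ln (real n)"
      using that by (intro divide_right_mono *) auto
    finally show ?thesis by simp
  qed
  have bd: "?g (n + 2) \<le> ?g 2 + suminf ?f" for n
  proof -
    have "?g (n + 2) - ?g 2 \<le> (\<Sum>i<n. ?f (i + 2))"
    proof (induction n)
      case (Suc n) then show ?case using step[of "n + 2"] by simp
    qed simp
    also have "\<dots> = (\<Sum>i\<in>{2..<n+2}. ?f i)"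
      by (rule sum.reindex_bij_witness[of _ "\<lambda>i. i - 2" "\<lambda>i. i + 2"]) auto
    also have "\<dots> \<le> suminf ?f"
    proof (intro sum_le_suminf s ballI)
      show "0 \<le> ?f k" for k by (cases k) auto
    qed auto
    finally show ?thesis by simp
  qed
  have "filterlim (\<lambda>n. ?g (n + 2)) at_top sequentially" by real_asymp
  then have "\<forall>\<^sub>F n in sequentially. ?g (n + 2) > ?g 2 + suminf ?f"
    by (simp add: filterlim_at_top_dense)
  then show False using bd by (auto simp: eventually_sequentially not_less[symmetric])
qed

text \<open>Comparison with 1 / (n ln n): the surplus factor (ln n)^(1 + \<alpha>) outweighs (ln ln
  n)^\<beta> for every \<beta>.\<close>

lemma wt_not_summable:
  assumes "-1 < \<alpha>" shows "\<not> summable (wt \<alpha> \<beta>)"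
proof
  assume s: "summable (wt \<alpha> \<beta>)"
  have "(\<lambda>x. ln x powr (1 + \<alpha>) * ln (ln x) powr \<beta>) \<in> \<omega>[at_top](\<lambda>x::real. 1)"
    using assms by real_asymp
  then have "\<forall>\<^sub>F x in at_top. ln x powr (1 + \<alpha>) * ln (ln x) powr \<beta> \<ge> 1"
    by (auto dest!: landau_omega.smallD[of _ _ _ 1] elim!: eventually_mono)
  then have "\<forall>\<^sub>F x in at_top. logl x powr \<alpha> * loglogl x powr \<beta> / x \<ge> 1 / (x * ln x)"
    using eventually_logl eventually_loglogl eventually_gt_at_top[of 1]
  proof eventually_elim
    case (elim x)
    then show ?case by (simp add: powr_add field_simps)
  qed
  then have "\<forall>\<^sub>F n in sequentially. wt \<alpha> \<beta> n \<ge> 1 / (real n * ln (real n))"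
    unfolding wt_def using filterlim_real_sequentially by (rule eventually_compose_filterlim)
  moreover have "\<forall>\<^sub>F n in sequentially. n \<ge> 2" by (rule eventually_ge_at_top)
  ultimately have "\<forall>\<^sub>F n in sequentially. norm (1 / (real n * ln (real n))) \<le> wt \<alpha> \<beta> n"
    by eventually_elim auto
  then have "summable (\<lambda>n. 1 / (real n * ln (real n)))"
    by (rule summable_comparison_test_ev[OF _ s])
  then show False using not_summable_inverse_n_ln by simp
qed

text \<open>The bound holds on all of [1, \<infinity>) and not only eventually, because the
  logarithms are capped below by 1. It is also applied with \<open>logl x\<close> in place of
  \<open>x\<close>, where it says that a power of log beats every power of log log.\<close>

lemma bounded_powr_log:
  assumes "q < 0" shows "\<exists>C>0. \<forall>x\<ge>1. x powr q * logl x powr \<alpha> * loglogl x powr \<beta> \<le> C"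
proof -
  have "((\<lambda>x. x powr q * ln x powr \<alpha> * ln (ln x) powr \<beta>) \<longlongrightarrow> 0) at_top"
    using assms by real_asymp
  then have "\<forall>\<^sub>F x in at_top. x powr q * ln x powr \<alpha> * ln (ln x) powr \<beta> < 1"
    by (rule order_tendstoD) simp
  then have "\<forall>\<^sub>F x in at_top. x powr q * logl x powr \<alpha> * loglogl x powr \<beta> \<le> 1"
    using eventually_logl eventually_loglogl by eventually_elim simp
  then obtain N where N: "\<And>x. x \<ge> N \<Longrightarrow> x powr q * logl x powr \<alpha> * loglogl x powr \<beta> \<le> 1"
    by (auto simp: eventually_at_top_linorder)
  define C where "C = max 1 (logl N powr \<bar>\<alpha>\<bar> * loglogl N powr \<bar>\<beta>\<bar>)"
  have "x powr q * logl x powr \<alpha> * loglogl x powr \<beta> \<le> C" if "x \<ge> 1" for x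
  proof (cases "x \<ge> N")
    case True then show ?thesis using N[of x] by (auto simp: C_def)
  next
    case False
    have "x powr q \<le> 1" using that assms using powr_mono2'[of q 1 x] by simp
    moreover have "logl x powr \<alpha> \<le> logl N powr \<bar>\<alpha>\<bar>"
      using False logl_mono[of x N] logl_ge_1[of x]
      by (intro order_trans[OF powr_mono[of \<alpha> "\<bar>\<alpha>\<bar>"] powr_mono2]) auto
    moreover have "loglogl x powr \<beta> \<le> loglogl N powr \<bar>\<beta>\<bar>"
      using False loglogl_mono[of x N] loglogl_ge_1[of x]
      by (intro order_trans[OF powr_mono[of \<beta> "\<bar>\<beta>\<bar>"] powr_mono2]) auto
    ultimately have "x powr q * logl x powr \<alpha> * loglogl x powr \<beta> \<le> 1 * logl N powr \<bar>\<alpha>\<bar> * loglogl N powr \<bar>\<beta>\<bar>"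
      by (intro mult_mono) auto
    then show ?thesis by (auto simp: C_def)
  qed
  moreover have "C > 0" by (auto simp: C_def)
  ultimately show ?thesis by blast
qed

subsection \<open>Sums of i.i.d. random variables\<close>

text \<open>A locale, so that upper tail statements transfer to lower tails by interpreting it for
  \<open>- X\<close>, and to centered variables by interpreting it for \<open>X - c\<close>. Indices
  start at 1, as in \<open>psum\<close>.\<close>

locale iid_real = prob_space M for M :: "'a measure" +
  fixes X :: "nat \<Rightarrow> 'a \<Rightarrow> real"
  assumes rv: "\<And>n. n \<ge> 1 \<Longrightarrow> X n \<in> borel_measurable M"
    and indep: "indep_vars (\<lambda>_. borel) X {1..}"
    and ident: "\<And>n. n \<ge> 1 \<Longrightarrow> distr M borel (X n) = distr M borel (X 1)"
begin

lemma rv_1 [measurable]: "X 1 \<in> borel_measurable M" "X (Suc 0) \<in> borel_measurable M"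
  using rv[of 1] by auto

lemma rv_sum: "A \<subseteq> {1..} \<Longrightarrow> (\<lambda>\<omega>. \<Sum>i\<in>A. X i \<omega>) \<in> borel_measurable M"
  by (intro borel_measurable_sum rv) auto

lemma rv_block [measurable]: "(\<lambda>\<omega>. \<Sum>l\<in>{i<..j::nat}. X l \<omega>) \<in> borel_measurable M"
  by (intro rv_sum) auto

lemma rv_psum [measurable]: "psum X n \<in> borel_measurable M"
  unfolding psum_def by (intro rv_sum) auto

lemma expectation_ident:
  fixes g :: "real \<Rightarrow> 'b::{banach, second_countable_topology}"
  assumes "n \<ge> 1" and [measurable]: "g \<in> borel_measurable borel"
  shows "expectation (\<lambda>\<omega>. g (X n \<omega>)) = expectation (\<lambda>\<omega>. g (X 1 \<omega>))"
proof -
  have "expectation (\<lambda>\<omega>. g (X n \<omega>)) = (\<integral>x. g x \<partial>distr M borel (X n))"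
    using rv[OF assms(1)] by (intro integral_distr[symmetric]) auto
  also have "\<dots> = (\<integral>x. g x \<partial>distr M borel (X 1))" using ident[OF assms(1)] by simp
  also have "\<dots> = expectation (\<lambda>\<omega>. g (X 1 \<omega>))" by (intro integral_distr) auto
  finally show ?thesis .
qed

lemma integrable_ident:
  fixes g :: "real \<Rightarrow> 'b::{banach, second_countable_topology}"
  assumes "n \<ge> 1" and [measurable]: "g \<in> borel_measurable borel" and "integrable M (\<lambda>\<omega>. g (X 1 \<omega>))"
  shows "integrable M (\<lambda>\<omega>. g (X n \<omega>))"
proof -
  have "integrable (distr M borel (X 1)) g" using assms by (subst integrable_distr_eq) auto
  then have "integrable (distr M borel (X n)) g" using ident[OF assms(1)] by simp
  then show ?thesis using rv[OF assms(1)] by (subst (asm) integrable_distr_eq) auto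
qed

lemma prob_ident:
  assumes "n \<ge> 1" and [measurable]: "Measurable.pred borel P"
  shows "prob {\<omega> \<in> space M. P (X n \<omega>)} = prob {\<omega> \<in> space M. P (X 1 \<omega>)}"
proof -
  have *: "prob {\<omega> \<in> space M. P (X n \<omega>)} = measure (distr M borel (X n)) {x. P x}" if "n \<ge> 1" for n
    using rv[OF that] by (subst measure_distr) (auto intro!: arg_cong[where f = prob])
  show ?thesis using *[OF assms(1)] *[of 1] ident[OF assms(1)] by simp
qed

lemma
  fixes g :: "nat \<Rightarrow> real \<Rightarrow> 'b::{real_normed_field, banach, second_countable_topology}"
  assumes I: "finite I" "I \<subseteq> {1..}"
    and [measurable]: "\<And>i. i \<in> I \<Longrightarrow> g i \<in> borel_measurable borel"
    and int: "\<And>i. i \<in> I \<Longrightarrow> integrable M (\<lambda>\<omega>. g i (X 1 \<omega>))"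
  shows expectation_prod: "expectation (\<lambda>\<omega>. \<Prod>i\<in>I. g i (X i \<omega>)) = (\<Prod>i\<in>I. expectation (\<lambda>\<omega>. g i (X 1 \<omega>)))"
    and integrable_prod: "integrable M (\<lambda>\<omega>. \<Prod>i\<in>I. g i (X i \<omega>))"
proof -
  have ind: "indep_vars (\<lambda>_. borel) (\<lambda>i \<omega>. g i (X i \<omega>)) I"
    using I by (intro indep_vars_compose2[OF indep_vars_subset[OF indep I(2)]]) auto
  have int': "integrable M (\<lambda>\<omega>. g i (X i \<omega>))" if "i \<in> I" for i
  proof (rule integrable_ident[OF _ _ int[OF that]])
    show "1 \<le> i" using subsetD[OF I(2) that] by simp
    show "g i \<in> borel_measurable borel" using that by simp
  qed
  show "integrable M (\<lambda>\<omega>. \<Prod>i\<in>I. g i (X i \<omega>))"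
    by (rule indep_vars_integrable[OF I(1) ind int'])
  have "expectation (\<lambda>\<omega>. \<Prod>i\<in>I. g i (X i \<omega>)) = (\<Prod>i\<in>I. expectation (\<lambda>\<omega>. g i (X i \<omega>)))"
    by (rule indep_vars_lebesgue_integral[OF I(1) ind int'])
  also have "\<dots> = (\<Prod>i\<in>I. expectation (\<lambda>\<omega>. g i (X 1 \<omega>)))"
  proof (intro prod.cong refl expectation_ident)
    show "1 \<le> i" if "i \<in> I" for i using that I(2) by auto
  qed simp
  finally show "expectation (\<lambda>\<omega>. \<Prod>i\<in>I. g i (X i \<omega>)) = \<dots>" .
qed

text \<open>Stated for arbitrary measurable functions of two disjoint sets of coordinates, because
  the first-passage event in \<open>Ottaviani_one_sided\<close> is not a function of a single
  sum.\<close>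

lemma indep_functions:
  assumes "A \<inter> B = {}" "A \<subseteq> {1..}" "B \<subseteq> {1..}"
    and "f \<in> measurable (PiM A (\<lambda>_. borel)) N" "g \<in> measurable (PiM B (\<lambda>_. borel)) L"
  shows "indep_var N (\<lambda>\<omega>. f (\<lambda>i\<in>A. X i \<omega>)) L (\<lambda>\<omega>. g (\<lambda>i\<in>B. X i \<omega>))"
  using indep_var_compose[OF indep_var_restrict[OF indep assms(1-3)] assms(4,5)]
  by (simp add: comp_def)

lemma indep_sums:
  assumes "A \<inter> B = {}" "A \<subseteq> {1..}" "B \<subseteq> {1..}" "finite A" "finite B"
  shows "indep_var borel (\<lambda>\<omega>. \<Sum>i\<in>A. X i \<omega>) borel (\<lambda>\<omega>. \<Sum>i\<in>B. X i \<omega>)"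
proof -
  have "indep_var borel (\<lambda>\<omega>. (\<lambda>h. \<Sum>i\<in>A. h i) (\<lambda>i\<in>A. X i \<omega>)) borel (\<lambda>\<omega>. (\<lambda>h. \<Sum>i\<in>B. h i) (\<lambda>i\<in>B. X i \<omega>))"
    using assms by (intro indep_functions borel_measurable_sum measurable_component_singleton) auto
  then show ?thesis by (simp cong: sum.cong)
qed

text \<open>Each additional term convolves the law with that of \<open>X 1\<close>, whatever the
  starting index, so both sides satisfy the same recursion.\<close>

lemma distr_block_sum:
  "distr M borel (\<lambda>\<omega>. \<Sum>l\<in>{i<..i+j}. X l \<omega>) = distr M borel (psum X j)"
proof (induction j)
  case 0 then show ?case by (simp add: psum_def)
next
  case (Suc j)
  have *: "distr M borel (\<lambda>\<omega>. \<Sum>l\<in>{i<..i+Suc j}. X l \<omega>) =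
      convolution (distr M borel (\<lambda>\<omega>. \<Sum>l\<in>{i<..i+j}. X l \<omega>)) (distr M borel (X 1))" for i
  proof -
    have "{i<..i+Suc j} = insert (Suc (i+j)) {i<..i+j}" by auto
    then have "distr M borel (\<lambda>\<omega>. \<Sum>l\<in>{i<..i+Suc j}. X l \<omega>) =
       distr M borel (\<lambda>\<omega>. (\<Sum>l\<in>{i<..i+j}. X l \<omega>) + X (Suc (i+j)) \<omega>)"
      by (simp add: add.commute)
    also have "\<dots> = convolution (distr M borel (\<lambda>\<omega>. \<Sum>l\<in>{i<..i+j}. X l \<omega>)) (distr M borel (X (Suc (i+j))))"
    proof (intro sum_indep_random_variable rv_block rv)
      have "indep_var borel (\<lambda>\<omega>. \<Sum>l\<in>{i<..i+j}. X l \<omega>) borel (\<lambda>\<omega>. \<Sum>l\<in>{Suc (i+j)}. X l \<omega>)"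
        by (intro indep_sums) (simp_all add: subset_iff)
      then show "indep_var borel (\<lambda>\<omega>. \<Sum>l\<in>{i<..i+j}. X l \<omega>) borel (X (Suc (i+j)))" by simp
    qed simp
    finally show ?thesis using ident[of "Suc (i+j)"] by simp
  qed
  have psum_eq: "psum X n = (\<lambda>\<omega>. \<Sum>l\<in>{0<..0+n}. X l \<omega>)" for n
    by (rule ext) (auto simp: psum_def intro!: sum.cong)
  show ?case using *[of i] *[of 0] Suc psum_eq[of j] psum_eq[of "Suc j"] by simp
qed

lemma prob_block_sum:
  assumes [measurable]: "Measurable.pred borel P"
  shows "prob {\<omega> \<in> space M. P (\<Sum>l\<in>{i<..i+j}. X l \<omega>)} = prob {\<omega> \<in> space M. P (psum X j \<omega>)}"
proof -
  have "prob {\<omega> \<in> space M. P (\<Sum>l\<in>{i<..i+j}. X l \<omega>)} = measure (distr M borel (\<lambda>\<omega>. \<Sum>l\<in>{i<..i+j}. X l \<omega>)) {x. P x}"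
    by (subst measure_distr) (auto intro!: arg_cong[where f = prob] rv_sum)
  also have "\<dots> = measure (distr M borel (psum X j)) {x. P x}" by (simp add: distr_block_sum)
  also have "\<dots> = prob {\<omega> \<in> space M. P (psum X j \<omega>)}"
    by (subst measure_distr) (auto intro!: arg_cong[where f = prob])
  finally show ?thesis .
qed

lemma psum_add: "psum X (i + j) \<omega> = psum X i \<omega> + (\<Sum>l\<in>{i<..i+j}. X l \<omega>)"
proof -
  have "{1..i+j} = {1..i} \<union> {i<..i+j}" by auto
  then show ?thesis unfolding psum_def by (subst sum.union_disjoint[symmetric]) auto
qed

lemma indep_psum_block:
  "indep_var borel (psum X i) borel (\<lambda>\<omega>. \<Sum>l\<in>{i<..i+j}. X l \<omega>)"
  unfolding psum_def[abs_def] by (intro indep_sums) (auto simp: subset_iff)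

lemma prob_psum_block:
  assumes [measurable]: "Measurable.pred borel P" "Measurable.pred borel Q"
  shows "prob {\<omega> \<in> space M. P (psum X i \<omega>) \<and> Q (\<Sum>l\<in>{i<..i+j}. X l \<omega>)}
     = prob {\<omega> \<in> space M. P (psum X i \<omega>)} * prob {\<omega> \<in> space M. Q (psum X j \<omega>)}"
proof -
  have "{x. P x} \<in> sets borel" "{x. Q x} \<in> sets borel" by measurable
  from indep_varD[OF indep_psum_block this, of i j]
  have "prob {\<omega> \<in> space M. P (psum X i \<omega>) \<and> Q (\<Sum>l\<in>{i<..i+j}. X l \<omega>)}
     = prob {\<omega> \<in> space M. P (psum X i \<omega>)} * prob {\<omega> \<in> space M. Q (\<Sum>l\<in>{i<..i+j}. X l \<omega>)}"
    by (simp add: vimage_def Int_def conj_commute conj_left_commute)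
  then show ?thesis by (simp add: prob_block_sum)
qed

text \<open>By independence of the first \<open>i\<close> terms and the \<open>j\<close> terms after
  them: two large consecutive blocks make a large sum.\<close>

lemma prob_psum_ge_add:
  "prob {\<omega> \<in> space M. psum X i \<omega> \<ge> x} * prob {\<omega> \<in> space M. psum X j \<omega> \<ge> y}
    \<le> prob {\<omega> \<in> space M. psum X (i + j) \<omega> \<ge> x + y}"
proof -
  have "prob {\<omega> \<in> space M. psum X i \<omega> \<ge> x \<and> (\<Sum>l\<in>{i<..i+j}. X l \<omega>) \<ge> y}
     \<le> prob {\<omega> \<in> space M. psum X (i + j) \<omega> \<ge> x + y}"
    by (intro finite_measure_mono) (auto simp: psum_add)
  then show ?thesis by (subst (asm) prob_psum_block) auto
qed

lemma prob_psum_ge_mult: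
  "prob {\<omega> \<in> space M. psum X k \<omega> \<ge> s} ^ m \<le> prob {\<omega> \<in> space M. psum X (m * k) \<omega> \<ge> real m * s}"
proof (induction m)
  case 0 then show ?case by (simp add: psum_def prob_space)
next
  case (Suc m)
  have "prob {\<omega> \<in> space M. psum X k \<omega> \<ge> s} ^ Suc m
     \<le> prob {\<omega> \<in> space M. psum X k \<omega> \<ge> s} * prob {\<omega> \<in> space M. psum X (m * k) \<omega> \<ge> real m * s}"
    using Suc by (simp add: mult_left_mono)
  also have "\<dots> \<le> prob {\<omega> \<in> space M. psum X (k + m * k) \<omega> \<ge> s + real m * s}"
    by (rule prob_psum_ge_add)
  finally show ?case by (simp add: algebra_simps)
qed

text \<open>The \<open>r\<close> leftover terms are bounded below one at a time, at the price of one
  factor per term and without any moment.\<close>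

lemma prob_psum_blocks:
  "prob {\<omega> \<in> space M. psum X k \<omega> \<ge> s} ^ m * prob {\<omega> \<in> space M. X 1 \<omega> \<ge> - C} ^ r
    \<le> prob {\<omega> \<in> space M. psum X (m * k + r) \<omega> \<ge> real m * s - real r * C}"
proof -
  have "prob {\<omega> \<in> space M. X 1 \<omega> \<ge> - C} ^ r \<le> prob {\<omega> \<in> space M. psum X r \<omega> \<ge> real r * - C}"
    using prob_psum_ge_mult[of "- C" 1 r] by (simp add: psum_def)
  then have "prob {\<omega> \<in> space M. psum X k \<omega> \<ge> s} ^ m * prob {\<omega> \<in> space M. X 1 \<omega> \<ge> - C} ^ r
    \<le> prob {\<omega> \<in> space M. psum X (m * k) \<omega> \<ge> real m * s} * prob {\<omega> \<in> space M. psum X r \<omega> \<ge> real r * - C}"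
    by (intro mult_mono prob_psum_ge_mult) auto
  also have "\<dots> \<le> prob {\<omega> \<in> space M. psum X (m * k + r) \<omega> \<ge> real m * s + real r * - C}"
    by (rule prob_psum_ge_add)
  finally show ?thesis by simp
qed

lemma iid_uminus: "iid_real M (\<lambda>n \<omega>. - X n \<omega>)"
proof unfold_locales
  show "indep_vars (\<lambda>_. borel) (\<lambda>n \<omega>. - X n \<omega>) {1..}"
    by (rule indep_vars_compose2[OF indep]) auto
  show "distr M borel (\<lambda>\<omega>. - X n \<omega>) = distr M borel (\<lambda>\<omega>. - X 1 \<omega>)" if "n \<ge> 1" for n
  proof -
    have *: "distr M borel (\<lambda>\<omega>. - X n \<omega>) = distr (distr M borel (X n)) borel uminus" if "n \<ge> 1" for n
      using rv[OF that] by (subst distr_distr) (auto simp: comp_def)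
    show ?thesis using *[OF that] *[of 1] ident[OF that] by simp
  qed
  show "(\<lambda>\<omega>. - X n \<omega>) \<in> borel_measurable M" if "n \<ge> 1" for n
    using rv[OF that] by simp
qed

lemma psum_uminus: "psum (\<lambda>n \<omega>. - X n \<omega>) n \<omega> = - psum X n \<omega>"
  unfolding psum_def by (simp add: sum_negf)

end

subsection \<open>Second moment, mean and variance bound\<close>

lemma std_normal_singleton: "measure std_normal_distribution {y} = 0"
proof -
  have "emeasure std_normal_distribution {y} = (\<integral>\<^sup>+x. ennreal (std_normal_density x) * indicator {y} x \<partial>lborel)"
    by (subst emeasure_density) auto
  also have "\<dots> = 0"
    using AE_lborel_singleton[of y] by (subst nn_integral_0_iff_AE) (auto elim: eventually_mono)
  finally show ?thesis by (simp add: measure_def)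
qed

context iid_real begin

lemma exists_median_bound:
  "\<exists>C. prob {\<omega> \<in> space M. X 1 \<omega> \<ge> - C} \<ge> 1/2 \<and> prob {\<omega> \<in> space M. X 1 \<omega> \<le> C} \<ge> 1/2"
proof -
  interpret D: real_distribution "distr M borel (X 1)" by (intro real_distribution_distr) simp
  have cdf: "cdf (distr M borel (X 1)) x = prob {\<omega> \<in> space M. X 1 \<omega> \<le> x}" for x
    unfolding cdf_def by (subst measure_distr) (auto intro!: arg_cong[where f = prob])
  have "\<forall>\<^sub>F x in at_top. cdf (distr M borel (X 1)) x > 1/2"
    by (rule order_tendstoD(1)[OF D.cdf_lim_at_top_prob]) simp
  moreover have "\<forall>\<^sub>F x in at_top. cdf (distr M borel (X 1)) (-x) < 1/2"
    using order_tendstoD(2)[OF D.cdf_lim_at_bot, of "1/2"]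
    by (auto simp: at_bot_mirror eventually_filtermap)
  ultimately have "\<forall>\<^sub>F x in at_top. 1/2 < prob {\<omega> \<in> space M. X 1 \<omega> \<le> x} \<and> prob {\<omega> \<in> space M. X 1 \<omega> \<le> -x} < 1/2"
    unfolding cdf by eventually_elim simp
  then obtain C where C: "1/2 < prob {\<omega> \<in> space M. X 1 \<omega> \<le> C}" "prob {\<omega> \<in> space M. X 1 \<omega> \<le> -C} < 1/2"
    by (auto simp: eventually_at_top_linorder)
  have "1 - prob {\<omega> \<in> space M. X 1 \<omega> \<le> -C} = prob (space M - {\<omega> \<in> space M. X 1 \<omega> \<le> -C})"
    by (subst prob_compl) auto
  also have "\<dots> \<le> prob {\<omega> \<in> space M. X 1 \<omega> \<ge> - C}"
    by (intro finite_measure_mono) auto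
  finally show ?thesis using C by (intro exI[of _ C]) auto
qed

text \<open>Split \<open>{1..n}\<close> into \<open>m \<approx> \<beta> log log n\<close> blocks, where \<open>\<beta>\<close> is slightly larger than
  \<open>2 x\<^sup>2 / y\<^sup>2\<close>. If all block sums are large, then \<open>|S\<^sub>n| \<ge> x \<phi>(n)\<close>; the probability of this is at
  least about \<open>p\<close> to the power \<open>m\<close>. The \<open>n mod m\<close> remaining terms are bounded by the median; they
  turn \<open>p\<close> into \<open>p / 2\<close>.\<close>

lemma diverges_of_block_bound:
  assumes y: "0 < y" and p: "0 < p" "p \<le> 1" and x: "0 < x" and a: "- 1 < a"
    and ev: "\<forall>\<^sub>F k in sequentially. p \<le> max (prob {\<omega> \<in> space M. psum X k \<omega> \<ge> y * sqrt (real k)})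
        (prob {\<omega> \<in> space M. psum X k \<omega> \<le> - (y * sqrt (real k))})"
    and slack: "ln (2 / p) * (2 * x\<^sup>2 / y\<^sup>2) < 1 + a"
  shows "\<not> summable (\<lambda>n. wt a b n * prob {\<omega> \<in> space M. \<bar>psum X n \<omega>\<bar> \<ge> x * phi (real n)})"
proof
  assume sm: "summable (\<lambda>n. wt a b n * prob {\<omega> \<in> space M. \<bar>psum X n \<omega>\<bar> \<ge> x * phi (real n)})"
  obtain C where C: "prob {\<omega> \<in> space M. X 1 \<omega> \<ge> - C} \<ge> 1/2" "prob {\<omega> \<in> space M. X 1 \<omega> \<le> C} \<ge> 1/2"
    using exists_median_bound by blast
  define C' where "C' = \<bar>C\<bar>"
  have C': "C' \<ge> 0" "prob {\<omega> \<in> space M. X 1 \<omega> \<ge> - C'} \<ge> 1/2" "prob {\<omega> \<in> space M. X 1 \<omega> \<le> C'} \<ge> 1/2"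
  proof -
    have "prob {\<omega> \<in> space M. X 1 \<omega> \<ge> - C} \<le> prob {\<omega> \<in> space M. X 1 \<omega> \<ge> - C'}"
         "prob {\<omega> \<in> space M. X 1 \<omega> \<le> C} \<le> prob {\<omega> \<in> space M. X 1 \<omega> \<le> C'}"
      by (intro finite_measure_mono; auto simp: C'_def)+
    then show "prob {\<omega> \<in> space M. X 1 \<omega> \<ge> - C'} \<ge> 1/2" "prob {\<omega> \<in> space M. X 1 \<omega> \<le> C'} \<ge> 1/2"
      using C by linarith+
  qed (simp add: C'_def)
  have lp: "ln (2 / p) > 0" using p by (intro ln_gt_zero) auto
  \<comment> \<open>There are two constraints on the number \<beta> log log n of blocks: \<beta> > 2
    x^2 / y^2 makes the blocks together exceed the level, and \<beta> < d keeps the price (p / 2)^m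
    above a constant times (log n)^(-c) with c < 1 + a.\<close>
  define d where "d = (1 + a) / ln (2 / p)"
  have "2 * x\<^sup>2 / y\<^sup>2 < d" using slack lp by (simp add: d_def field_simps)
  then obtain \<beta> where \<beta>: "2 * x\<^sup>2 / y\<^sup>2 < \<beta>" "\<beta> < d" using dense by blast
  have \<beta>_pos: "\<beta> > 0" using \<beta>(1) x y by (auto intro: less_trans[rotated])
  have \<beta>_d: "\<beta> * ln (2/p) < 1 + a" using \<beta>(2) lp by (simp add: d_def field_simps)
  \<comment> \<open>Being below 1, \<rho> leaves a gap of order sqrt q between sqrt (\<rho> q) and
    sqrt q. The gap absorbs the rounding of the block length and the constant \<open>C'\<close> of
    the leftover terms.\<close>
  define \<rho> where "\<rho> = 2 * x\<^sup>2 / (y\<^sup>2 * \<beta>)"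
  have \<rho>: "0 < \<rho>" "\<rho> < 1" using \<beta> \<beta>_pos x y by (auto simp: \<rho>_def field_simps)
  define m where "m n = nat \<lceil>\<beta> * loglogl (real n)\<rceil>" for n :: nat
  have m_ge: "\<beta> * loglogl (real n) \<le> real (m n)" for n unfolding m_def by linarith
  have m_le: "real (m n) \<le> \<beta> * loglogl (real n) + 1" for n
    unfolding m_def using mult_pos_pos[OF \<beta>_pos loglogl_pos[of "real n"]] by linarith
  have m_pos: "0 < m n" for n
    using m_ge[of n] mult_pos_pos[OF \<beta>_pos loglogl_pos[of "real n"]] by linarith
  define q where "q n = real n / real (m n)" for n
  have q_top: "filterlim q at_top sequentially"
  proof (rule filterlim_at_top_mono)
    show "filterlim (\<lambda>n. real n / (\<beta> * ln (ln (real n)) + 1)) at_top sequentially"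
      using \<beta>_pos by real_asymp
    have "\<forall>\<^sub>F n in sequentially. loglogl (real n) = ln (ln (real n))"
      using eventually_compose_filterlim[OF eventually_loglogl filterlim_real_sequentially] .
    then show "\<forall>\<^sub>F n in sequentially. real n / (\<beta> * ln (ln (real n)) + 1) \<le> q n"
    proof eventually_elim
      case (elim n)
      then show ?case unfolding q_def using m_le[of n] m_pos[of n] by (intro divide_left_mono) auto
    qed
  qed
  define k where "k n = n div m n" for n
  define r where "r n = n mod m n" for n
  have n_eq: "n = m n * k n + r n" for n by (simp add: k_def r_def)
  have r_le: "r n \<le> m n" for n using m_pos[of n] by (simp add: r_def less_imp_le)
  have k_ge: "q n - 1 \<le> real (k n)" for n
  proof -
    have "real n = real (m n) * real (k n) + real (r n)"
      using arg_cong[OF n_eq[of n], of real] by simp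
    then show ?thesis using r_le[of n] m_pos[of n] by (simp add: q_def field_simps)
  qed
  have k_top: "filterlim k at_top sequentially"
  proof -
    have "filterlim (\<lambda>n. q n - 1) at_top sequentially"
      using filterlim_tendsto_add_at_top[OF tendsto_const[of "-1"] q_top] by simp
    then have "filterlim (\<lambda>n. real (k n)) at_top sequentially"
      by (rule filterlim_at_top_mono) (simp add: k_ge)
    then show ?thesis by (simp add: filterlim_sequentially_iff_filterlim_real)
  qed
  have "\<forall>\<^sub>F z in at_top. y * sqrt (\<rho> * z) \<le> y * sqrt (z - 1) - C'"
  proof -
    have "1 - sqrt \<rho> > 0" using \<rho> by auto
    then have "filterlim (\<lambda>z. y * sqrt (z - 1) - C' - y * sqrt \<rho> * sqrt z) at_top at_top" using y by real_asymp
    then have "\<forall>\<^sub>F z in at_top. y * sqrt (z - 1) - C' - y * sqrt \<rho> * sqrt z \<ge> 0"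
      unfolding filterlim_at_top by blast
    then show ?thesis by eventually_elim (simp add: real_sqrt_mult algebra_simps)
  qed
  from eventually_compose_filterlim[OF this q_top]
  have E1: "\<forall>\<^sub>F n in sequentially. y * sqrt (\<rho> * q n) \<le> y * sqrt (q n - 1) - C'" .
  have E2: "\<forall>\<^sub>F n in sequentially. p \<le> max (prob {\<omega> \<in> space M. psum X (k n) \<omega> \<ge> y * sqrt (real (k n))})
        (prob {\<omega> \<in> space M. psum X (k n) \<omega> \<le> - (y * sqrt (real (k n)))})"
    using eventually_compose_filterlim[OF ev k_top] .
  define c where "c = \<beta> * ln (2 / p)"
  have E3: "\<forall>\<^sub>F n in sequentially. loglogl (real n) = ln (ln (real n))" "\<forall>\<^sub>F n in sequentially. logl (real n) = ln (real n)"
    using eventually_compose_filterlim[OF eventually_loglogl filterlim_real_sequentially]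
      eventually_compose_filterlim[OF eventually_logl filterlim_real_sequentially] .
  have key: "\<forall>\<^sub>F n in sequentially. (p / 2) * logl (real n) powr (- c) \<le> prob {\<omega> \<in> space M. \<bar>psum X n \<omega>\<bar> \<ge> x * phi (real n)}"
    using E1 E2 E3
  proof eventually_elim
    case (elim n)
    let ?P = "prob {\<omega> \<in> space M. \<bar>psum X n \<omega>\<bar> \<ge> x * phi (real n)}"
    let ?s = "y * sqrt (real (k n))"
    have "x * phi (real n) = sqrt (x\<^sup>2 * (2 * real n * loglogl (real n)))"
      using x by (simp add: phi_def real_sqrt_mult)
    also have "\<dots> \<le> sqrt ((real (m n))\<^sup>2 * (y\<^sup>2 * (\<rho> * q n)))"
    proof (rule real_sqrt_le_mono)
      have "(real (m n))\<^sup>2 * (y\<^sup>2 * (\<rho> * q n)) = (2 * x\<^sup>2 / \<beta>) * real n * real (m n)"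
        using m_pos[of n] y \<beta>_pos by (simp add: q_def \<rho>_def power2_eq_square)
      also have "\<dots> \<ge> (2 * x\<^sup>2 / \<beta>) * real n * (\<beta> * loglogl (real n))"
        using \<beta>_pos by (intro mult_left_mono m_ge) auto
      finally show "x\<^sup>2 * (2 * real n * loglogl (real n)) \<le> (real (m n))\<^sup>2 * (y\<^sup>2 * (\<rho> * q n))"
        using \<beta>_pos by simp
    qed
    also have "\<dots> = real (m n) * (y * sqrt (\<rho> * q n))" using y by (simp add: real_sqrt_mult)
    also have "\<dots> \<le> real (m n) * (y * sqrt (q n - 1) - C')" using elim(1) by (intro mult_left_mono) auto
    also have "\<dots> \<le> real (m n) * (?s - C')"
      using k_ge[of n] y by (intro mult_left_mono diff_right_mono) auto
    also have "\<dots> \<le> real (m n) * ?s - real (r n) * C'"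
      using r_le[of n] C' by (simp add: right_diff_distrib mult_right_mono)
    finally have th: "x * phi (real n) \<le> real (m n) * ?s - real (r n) * C'" .
    have half: "(1/2::real) ^ m n \<le> z ^ r n" if "1/2 \<le> z" for z :: real
    proof -
      have "(1/2::real) ^ m n \<le> (1/2) ^ r n" using r_le[of n] by (intro power_decreasing) auto
      also have "\<dots> \<le> z ^ r n" using that by (intro power_mono) auto
      finally show ?thesis .
    qed
    have "p ^ m n * (1/2) ^ m n \<le> ?P"
    proof (cases "p \<le> prob {\<omega> \<in> space M. psum X (k n) \<omega> \<ge> ?s}")
      case True
      have "p ^ m n * (1/2) ^ m n \<le> prob {\<omega> \<in> space M. psum X (k n) \<omega> \<ge> ?s} ^ m n * prob {\<omega> \<in> space M. X 1 \<omega> \<ge> - C'} ^ r n"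
        using True p C' by (intro mult_mono power_mono half) auto
      also have "\<dots> \<le> prob {\<omega> \<in> space M. psum X (m n * k n + r n) \<omega> \<ge> real (m n) * ?s - real (r n) * C'}"
        by (rule prob_psum_blocks)
      also have "\<dots> \<le> ?P" unfolding n_eq[of n, symmetric] using th by (intro finite_measure_mono) auto
      finally show ?thesis .
    next
      \<comment> \<open>Which of the two tails is heavy may depend on the block length, so the sign
        is chosen separately for every n and the lower tail is treated through
        \<open>- X\<close>.\<close>
      case False
      interpret N: iid_real M "\<lambda>n \<omega>. - X n \<omega>" by (rule iid_uminus)
      have T: "p \<le> prob {\<omega> \<in> space M. psum X (k n) \<omega> \<le> - ?s}" using False elim(2) by auto
      have T2: "{\<omega> \<in> space M. - psum X (k n) \<omega> \<ge> ?s} = {\<omega> \<in> space M. psum X (k n) \<omega> \<le> - ?s}"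
        "{\<omega> \<in> space M. - X 1 \<omega> \<ge> - C'} = {\<omega> \<in> space M. X 1 \<omega> \<le> C'}" by auto
      have "p ^ m n * (1/2) ^ m n \<le> prob {\<omega> \<in> space M. - psum X (k n) \<omega> \<ge> ?s} ^ m n * prob {\<omega> \<in> space M. - X 1 \<omega> \<ge> - C'} ^ r n"
        unfolding T2 using T p C' by (intro mult_mono power_mono half) auto
      also have "\<dots> \<le> prob {\<omega> \<in> space M. - psum X (m n * k n + r n) \<omega> \<ge> real (m n) * ?s - real (r n) * C'}"
        using N.prob_psum_blocks[where k = "k n" and s = ?s and m = "m n" and C = C' and r = "r n"]
        by (simp only: psum_uminus)
      also have "\<dots> \<le> ?P" unfolding n_eq[of n, symmetric] using th by (intro finite_measure_mono) auto
      finally show ?thesis .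
    qed
    moreover have "(p / 2) * logl (real n) powr (- c) \<le> p ^ m n * (1/2) ^ m n"
    proof -
      have "loglogl (real n) = ln (logl (real n))" using elim by simp
      then have "logl (real n) powr (- c) = exp (- c * loglogl (real n))"
        using less_imp_neq[OF logl_pos[of "real n"]] by (simp add: powr_def)
      also have "\<dots> = (p / 2) powr (\<beta> * loglogl (real n))"
        using p by (simp add: powr_def c_def ln_div algebra_simps)
      finally have "(p / 2) * logl (real n) powr (- c) = (p / 2) powr (\<beta> * loglogl (real n) + 1)"
        using p by (simp add: powr_add)
      also have "\<dots> \<le> (p / 2) powr real (m n)" using m_le[of n] p by (intro powr_mono') auto
      also have "\<dots> = (p / 2) ^ m n" using p by (simp add: powr_realpow)
      finally show ?thesis by (simp add: power_mult_distrib[symmetric])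
    qed
    ultimately show ?case by linarith
  qed
  have "summable (\<lambda>n. (p / 2) * wt (a - c) b n)"
  proof (rule summable_comparison_test_ev[OF _ sm])
    show "\<forall>\<^sub>F n in sequentially. norm ((p / 2) * wt (a - c) b n) \<le> wt a b n * prob {\<omega> \<in> space M. \<bar>psum X n \<omega>\<bar> \<ge> x * phi (real n)}"
      using key
    proof eventually_elim
      case (elim n)
      have "norm ((p / 2) * wt (a - c) b n) = wt a b n * ((p / 2) * logl (real n) powr (- c))"
        using p by (simp add: wt_def powr_diff powr_minus field_simps)
      also have "\<dots> \<le> wt a b n * prob {\<omega> \<in> space M. \<bar>psum X n \<omega>\<bar> \<ge> x * phi (real n)}"
        using elim by (intro mult_left_mono) auto
      finally show ?case .
    qed
  qed
  then have "summable (wt (a - c) b)" using p by (subst (asm) summable_cmult_iff) auto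
  then show False using wt_not_summable[of "a - c" b] \<beta>_d by (simp add: c_def)
qed

text \<open>Tightness of \<open>S\<^sub>k / \<surd>k\<close> keeps the \<open>k\<close>-th power of the characteristic function at
  \<open>t \<approx> 1 / \<surd>k\<close> away from \<open>0\<close>, so the symmetrization satisfies \<open>k E (1 - cos (t (X - X'))) \<le> ln 4\<close>, and
  Fatou's lemma bounds \<open>E (X - X')\<^sup>2\<close>.\<close>

lemma second_moment_of_frequently_tight:
  assumes y: "0 < y"
    and fr: "\<exists>\<^sub>F k in sequentially. 7/8 \<le> prob {\<omega> \<in> space M. \<bar>psum X k \<omega>\<bar> < y * sqrt (real k)}"
  shows "integrable M (\<lambda>\<omega>. (X 1 \<omega>)\<^sup>2)"
proof -
  define \<mu> where "\<mu> = distr M borel (X 1)"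
  interpret D: real_distribution \<mu> unfolding \<mu>_def by (intro real_distribution_distr) simp
  interpret DD: pair_prob_space \<mu> \<mu> ..
  \<comment> \<open>Chosen so that |t S| \<le> 1/4 on the tight event. The complement has
    probability at most 1/8 and contributes at most 2/8, which gives the 1/2 in
    \<open>close\<close>.\<close>
  define t where "t k = 1 / (4 * y * sqrt (real k))" for k :: nat
  have char_sum: "char (distr M borel (psum X k)) s = char \<mu> s ^ k" for k s
  proof -
    have "char (distr M borel (psum X k)) s = (\<Prod>i\<in>{1..k}. char (distr M borel (X i)) s)"
      unfolding psum_def[abs_def] by (intro char_distr_sum indep_vars_subset[OF indep]) auto
    also have "\<dots> = (\<Prod>i\<in>{1..k}. char \<mu> s)"
      unfolding \<mu>_def by (intro prod.cong refl arg_cong2[where f = char] ident) auto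
    finally show ?thesis by simp
  qed
  have close: "norm (char \<mu> (t k)) ^ k \<ge> 1/2"
    if k: "k > 0" "7/8 \<le> prob {\<omega> \<in> space M. \<bar>psum X k \<omega>\<bar> < y * sqrt (real k)}" for k
  proof -
    let ?A = "{\<omega> \<in> space M. \<bar>psum X k \<omega>\<bar> < y * sqrt (real k)}"
    have bound: "norm (1 - iexp (t k * psum X k \<omega>)) \<le> 1/4 + 2 * indicator (space M - ?A) \<omega>" if "\<omega> \<in> space M" for \<omega>
    proof (cases "\<omega> \<in> ?A")
      case True
      have "norm (iexp (t k * psum X k \<omega>) - 1) \<le> \<bar>t k * psum X k \<omega>\<bar>"
        using iexp_approx1[of "t k * psum X k \<omega>" 0] by simp
      also have "\<dots> \<le> t k * (y * sqrt (real k))" using True k y by (auto simp: abs_mult t_def intro!: mult_left_mono)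
      also have "\<dots> = 1/4" using k y by (simp add: t_def)
      finally show ?thesis using True by (simp add: norm_minus_commute)
    next
      case False
      then show ?thesis using norm_triangle_ineq4[of 1 "iexp (t k * psum X k \<omega>)"] that by (simp add: indicator_def)
    qed
    have int1: "integrable M (\<lambda>\<omega>. iexp (t k * psum X k \<omega>))"
      by (rule integrable_iexp) auto
    have "norm (1 - char (distr M borel (psum X k)) (t k)) = norm (expectation (\<lambda>\<omega>. 1 - iexp (t k * psum X k \<omega>)))"
      using int1 by (simp add: char_def integral_distr prob_space)
    also have "\<dots> \<le> expectation (\<lambda>\<omega>. norm (1 - iexp (t k * psum X k \<omega>)))" by (rule integral_norm_bound)
    also have "\<dots> \<le> expectation (\<lambda>\<omega>. 1/4 + 2 * indicator (space M - ?A) \<omega>)"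
      by (intro integral_mono_AE AE_I2 bound integrable_norm Bochner_Integration.integrable_diff int1
          Bochner_Integration.integrable_add integrable_mult_right) (auto simp: less_top[symmetric])
    also have "\<dots> = 1/4 + 2 * prob (space M - ?A)" by (simp add: prob_space less_top[symmetric])
    also have "prob (space M - ?A) = 1 - prob ?A" by (intro prob_compl) simp
    finally have "norm (1 - char (distr M borel (psum X k)) (t k)) \<le> 1/2" using k by simp
    then have "1/2 \<le> norm (char (distr M borel (psum X k)) (t k))"
      using norm_triangle_ineq2[of 1 "1 - char (distr M borel (psum X k)) (t k)"] by simp
    then show ?thesis by (simp add: char_sum norm_power)
  qed
  have int_cs: "integrable \<mu> (\<lambda>x. cos (s * x))" "integrable \<mu> (\<lambda>x. sin (s * x))" for s
    by (auto intro!: D.integrable_const_bound[of _ 1])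
  \<comment> \<open>The squared modulus is the characteristic function of the symmetrization X - X',
    written as a double integral of cosines.\<close>
  have sq: "(\<integral>x. (\<integral>x'. cos (s * (x - x')) \<partial>\<mu>) \<partial>\<mu>) = (norm (char \<mu> s))\<^sup>2" for s
  proof -
    have "(\<integral>x. (\<integral>x'. cos (s * (x - x')) \<partial>\<mu>) \<partial>\<mu>)
      = (\<integral>x. cos (s * x) * (\<integral>x'. cos (s * x') \<partial>\<mu>) + sin (s * x) * (\<integral>x'. sin (s * x') \<partial>\<mu>) \<partial>\<mu>)"
      using int_cs by (simp add: right_diff_distrib cos_diff)
    also have "\<dots> = (\<integral>x'. cos (s * x') \<partial>\<mu>)\<^sup>2 + (\<integral>x'. sin (s * x') \<partial>\<mu>)\<^sup>2"
      using int_cs by (simp add: power2_eq_square)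
    also have "\<dots> = (norm (char \<mu> s))\<^sup>2"
    proof -
      have "integrable \<mu> (\<lambda>x. iexp (s * x))" by (rule D.integrable_iexp) auto
      then have "Re (char \<mu> s) = (\<integral>x'. cos (s * x') \<partial>\<mu>)" "Im (char \<mu> s) = (\<integral>x'. sin (s * x') \<partial>\<mu>)"
        unfolding char_def by (simp_all add: Re_exp Im_exp flip: integral_Re integral_Im)
      then show ?thesis by (simp add: cmod_power2)
    qed
    finally show ?thesis .
  qed
  have Dk: "(\<integral>\<^sup>+z. ennreal (real k * (1 - cos (t k * (fst z - snd z)))) \<partial>(\<mu> \<Otimes>\<^sub>M \<mu>)) \<le> ennreal (ln 4)"
    if k: "k > 0" "7/8 \<le> prob {\<omega> \<in> space M. \<bar>psum X k \<omega>\<bar> < y * sqrt (real k)}" for k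
  proof -
    let ?h = "\<lambda>z. cos (t k * (fst z - snd z))"
    have int: "integrable (\<mu> \<Otimes>\<^sub>M \<mu>) ?h"
      by (rule DD.integrable_const_bound[of _ 1]) auto
    have "(\<integral>z. ?h z \<partial>(\<mu> \<Otimes>\<^sub>M \<mu>)) = (norm (char \<mu> (t k)))\<^sup>2"
      unfolding sq[symmetric] by (subst DD.integral_fst'[symmetric, OF int]) simp
    then have "(\<integral>z. real k * (1 - ?h z) \<partial>(\<mu> \<Otimes>\<^sub>M \<mu>)) = real k * (1 - (norm (char \<mu> (t k)))\<^sup>2)"
      using int by (simp add: DD.prob_space)
    \<comment> \<open>The 2k-th power of the modulus is at least 1/4; taking logarithms and using ln
      z \<le> z - 1 turns this into a bound on k (1 - |char|^2).\<close>
    also have "\<dots> \<le> ln 4"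
    proof -
      let ?c = "norm (char \<mu> (t k))"
      have pos: "0 < ?c" using close[OF k] k(1) by (cases "?c = 0") (auto simp: power_0_left)
      have "(1/2)\<^sup>2 \<le> (?c ^ k)\<^sup>2" using close[OF k] by (intro power_mono) auto
      then have "1/4 \<le> (?c\<^sup>2) ^ k" by (simp add: power2_eq_square power_mult_distrib)
      then have "ln (1/4) \<le> ln ((?c\<^sup>2) ^ k)" using pos by (intro ln_mono) auto
      then have "- ln 4 \<le> real k * ln (?c\<^sup>2)" using pos by (simp add: ln_div ln_realpow)
      also have "\<dots> \<le> real k * (?c\<^sup>2 - 1)" using pos by (intro mult_left_mono ln_le_minus_one) auto
      finally show ?thesis by (simp add: algebra_simps)
    qed
    finally have "(\<integral>z. real k * (1 - ?h z) \<partial>(\<mu> \<Otimes>\<^sub>M \<mu>)) \<le> ln 4" .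
    moreover have "integrable (\<mu> \<Otimes>\<^sub>M \<mu>) (\<lambda>z. real k * (1 - ?h z))"
      using int by simp
    ultimately show ?thesis
      by (subst nn_integral_eq_integral) (auto intro!: ennreal_leI)
  qed
  have "infinite {k. 7/8 \<le> prob {\<omega> \<in> space M. \<bar>psum X k \<omega>\<bar> < y * sqrt (real k)}}"
    using fr unfolding frequently_cofinite[symmetric] cofinite_eq_sequentially .
  then obtain r :: "nat \<Rightarrow> nat" where r: "strict_mono r"
      "\<And>n. r n \<in> {k. 7/8 \<le> prob {\<omega> \<in> space M. \<bar>psum X k \<omega>\<bar> < y * sqrt (real k)}}"
    using infinite_enumerate by blast
  \<comment> \<open>Shifting the enumeration by one makes every index positive.\<close>
  define r' where "r' n = r (Suc n)" for n
  have r': "r' n > 0" "7/8 \<le> prob {\<omega> \<in> space M. \<bar>psum X (r' n) \<omega>\<bar> < y * sqrt (real (r' n))}" for n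
    using r(2)[of "Suc n"] strict_mono_imp_increasing[OF r(1), of "Suc n"] by (auto simp: r'_def)
  have r'_top: "filterlim r' at_top sequentially"
    unfolding r'_def using filterlim_compose[OF filterlim_subseq[OF r(1)] filterlim_Suc] .
  have lim: "(\<lambda>n. real (r' n) * (1 - cos (t (r' n) * w))) \<longlonglongrightarrow> w\<^sup>2 / (32 * y\<^sup>2)" for w
  proof -
    have "((\<lambda>u. u * (1 - cos (1 / (4 * y * sqrt u) * w))) \<longlongrightarrow> w\<^sup>2 / (32 * y\<^sup>2)) at_top"
    proof -
      have "((\<lambda>h. (1 - cos h) / h\<^sup>2) \<longlongrightarrow> 1/2) (at (0::real))" by real_asymp
      moreover have "filterlim (\<lambda>u. 1 / (4 * y * sqrt u) * w) (at 0) at_top" if "w \<noteq> 0"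
        unfolding filterlim_at using that y
        by (auto intro!: eventually_mono[OF eventually_gt_at_top[of 0]]) real_asymp
      ultimately have *: "((\<lambda>u. (1 - cos (1 / (4 * y * sqrt u) * w)) / (1 / (4 * y * sqrt u) * w)\<^sup>2) \<longlongrightarrow> 1/2) at_top" if "w \<noteq> 0"
        using that filterlim_compose by blast
      show ?thesis
      proof (cases "w = 0")
        case False
        have "((\<lambda>u. (1 - cos (1 / (4 * y * sqrt u) * w)) / (1 / (4 * y * sqrt u) * w)\<^sup>2 * (w\<^sup>2 / (16 * y\<^sup>2))) \<longlongrightarrow> 1/2 * (w\<^sup>2 / (16 * y\<^sup>2))) at_top"
          by (intro tendsto_mult tendsto_const *[OF False])
        moreover have "\<forall>\<^sub>F u in at_top. (1 - cos (1 / (4 * y * sqrt u) * w)) / (1 / (4 * y * sqrt u) * w)\<^sup>2 * (w\<^sup>2 / (16 * y\<^sup>2)) =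
            u * (1 - cos (1 / (4 * y * sqrt u) * w))"
          using eventually_gt_at_top[of 0] by eventually_elim (use False y in \<open>simp add: power_mult_distrib power_divide field_simps\<close>)
        ultimately show ?thesis by (subst (asm) tendsto_cong) (auto simp: mult.commute)
      qed simp
    qed
    from filterlim_compose[OF this filterlim_compose[OF filterlim_real_sequentially r'_top]]
    show ?thesis by (simp add: t_def)
  qed
  have "(\<integral>\<^sup>+z. ennreal ((fst z - snd z)\<^sup>2 / (32 * y\<^sup>2)) \<partial>(\<mu> \<Otimes>\<^sub>M \<mu>))
     = (\<integral>\<^sup>+z. liminf (\<lambda>n. ennreal (real (r' n) * (1 - cos (t (r' n) * (fst z - snd z))))) \<partial>(\<mu> \<Otimes>\<^sub>M \<mu>))"
    by (intro nn_integral_cong lim_imp_Liminf[symmetric] tendsto_ennrealI lim) simp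
  also have "\<dots> \<le> liminf (\<lambda>n. (\<integral>\<^sup>+z. ennreal (real (r' n) * (1 - cos (t (r' n) * (fst z - snd z)))) \<partial>(\<mu> \<Otimes>\<^sub>M \<mu>)))"
    by (intro nn_integral_liminf) auto
  also have "\<dots> \<le> liminf (\<lambda>n::nat. ennreal (ln 4))"
    by (intro Liminf_mono always_eventually allI Dk r')
  finally have fin: "(\<integral>\<^sup>+z. ennreal ((fst z - snd z)\<^sup>2 / (32 * y\<^sup>2)) \<partial>(\<mu> \<Otimes>\<^sub>M \<mu>)) < \<infinity>"
    by (simp add: Liminf_const le_less_trans ennreal_less_top)
  also have "(\<integral>\<^sup>+z. ennreal ((fst z - snd z)\<^sup>2 / (32 * y\<^sup>2)) \<partial>(\<mu> \<Otimes>\<^sub>M \<mu>))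
     = (\<integral>\<^sup>+x'. (\<integral>\<^sup>+x. ennreal ((x - x')\<^sup>2 / (32 * y\<^sup>2)) \<partial>\<mu>) \<partial>\<mu>)"
    by (subst DD.nn_integral_snd[symmetric]) auto
  \<comment> \<open>A single x' with finite inner integral is enough, because x^2 \<le> 2 (x - x')^2
    + 2 x'^2.\<close>
  finally have "AE x' in \<mu>. (\<integral>\<^sup>+x. ennreal ((x - x')\<^sup>2 / (32 * y\<^sup>2)) \<partial>\<mu>) \<noteq> \<infinity>"
    by (intro nn_integral_noteq_infinite) auto
  then obtain x' where x': "(\<integral>\<^sup>+x. ennreal ((x - x')\<^sup>2 / (32 * y\<^sup>2)) \<partial>\<mu>) \<noteq> \<infinity>"
    using D.ae_filter_bot eventually_happens by blast
  have "integrable \<mu> (\<lambda>x. (x - x')\<^sup>2 / (32 * y\<^sup>2))"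
    using x' by (intro integrableI_nonneg) (auto simp: less_top[symmetric])
  then have "integrable \<mu> (\<lambda>x. 2 * (32 * y\<^sup>2) * ((x - x')\<^sup>2 / (32 * y\<^sup>2)) + 2 * x'\<^sup>2)"
    by (intro Bochner_Integration.integrable_add integrable_mult_right) auto
  then have "integrable \<mu> (\<lambda>x. x\<^sup>2)"
  proof (rule Bochner_Integration.integrable_bound)
    show "AE x in \<mu>. norm (x\<^sup>2) \<le> norm (2 * (32 * y\<^sup>2) * ((x - x')\<^sup>2 / (32 * y\<^sup>2)) + 2 * x'\<^sup>2)"
    proof (intro AE_I2)
      fix x
      have "0 \<le> (x - 2 * x')\<^sup>2" by simp
      then have "x\<^sup>2 \<le> 2 * (x - x')\<^sup>2 + 2 * x'\<^sup>2" by (simp add: power2_eq_square algebra_simps)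
      then show "norm (x\<^sup>2) \<le> norm (2 * (32 * y\<^sup>2) * ((x - x')\<^sup>2 / (32 * y\<^sup>2)) + 2 * x'\<^sup>2)" using y by simp
    qed
  qed auto
  then show ?thesis unfolding \<mu>_def by (subst (asm) integrable_distr_eq) auto
qed

section \<open>Chebyshev's inequality and the central limit theorem for partial sums\<close>

lemma psum_moments:
  assumes "integrable M (\<lambda>\<omega>. (X 1 \<omega>)\<^sup>2)" and "expectation (X 1) = 0"
  shows "integrable M (\<lambda>\<omega>. (psum X n \<omega>)\<^sup>2)"
    and "expectation (\<lambda>\<omega>. (psum X n \<omega>)\<^sup>2) = real n * expectation (\<lambda>\<omega>. (X 1 \<omega>)\<^sup>2)"
proof -
  have int1: "integrable M (X 1)"
    by (rule square_integrable_imp_integrable[OF _ assms(1)]) simp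
  have "integrable M (psum X n) \<and> integrable M (\<lambda>\<omega>. (psum X n \<omega>)\<^sup>2) \<and> expectation (psum X n) = 0 \<and>
     expectation (\<lambda>\<omega>. (psum X n \<omega>)\<^sup>2) = real n * expectation (\<lambda>\<omega>. (X 1 \<omega>)\<^sup>2)"
  proof (induction n)
    case 0 then show ?case by (simp add: psum_def[abs_def])
  next
    case (Suc n)
    have eq: "psum X (Suc n) \<omega> = psum X n \<omega> + X (Suc n) \<omega>" for \<omega> by (simp add: psum_def)
    have i1: "integrable M (X (Suc n))" "integrable M (\<lambda>\<omega>. (X (Suc n) \<omega>)\<^sup>2)"
      using integrable_ident[of "Suc n" "\<lambda>x. x"] integrable_ident[of "Suc n" "\<lambda>x. x\<^sup>2"] int1 assms by auto
    have e1: "expectation (X (Suc n)) = 0" "expectation (\<lambda>\<omega>. (X (Suc n) \<omega>)\<^sup>2) = expectation (\<lambda>\<omega>. (X 1 \<omega>)\<^sup>2)"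
      using expectation_ident[of "Suc n" "\<lambda>x. x"] expectation_ident[of "Suc n" "\<lambda>x. x\<^sup>2"] assms by auto
    have "indep_var borel (psum X n) borel (\<lambda>\<omega>. \<Sum>l\<in>{n<..n+1}. X l \<omega>)" by (rule indep_psum_block)
    moreover have "{n<..Suc n} = {Suc n}" by auto
    ultimately have ind: "indep_var borel (psum X n) borel (X (Suc n))" by simp
    have cross: "integrable M (\<lambda>\<omega>. psum X n \<omega> * X (Suc n) \<omega>)" "expectation (\<lambda>\<omega>. psum X n \<omega> * X (Suc n) \<omega>) = 0"
      using indep_var_integrable[OF ind] indep_var_lebesgue_integral[OF ind] Suc i1 e1 by auto
    show ?case using Suc i1 e1 cross
      by (simp add: eq[abs_def] power2_sum algebra_simps)
  qed
  then show "integrable M (\<lambda>\<omega>. (psum X n \<omega>)\<^sup>2)"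
    and "expectation (\<lambda>\<omega>. (psum X n \<omega>)\<^sup>2) = real n * expectation (\<lambda>\<omega>. (X 1 \<omega>)\<^sup>2)" by auto
qed

lemma psum_Chebyshev:
  assumes "integrable M (\<lambda>\<omega>. (X 1 \<omega>)\<^sup>2)" and "expectation (X 1) = 0" and "0 < s"
  shows "prob {\<omega> \<in> space M. \<bar>psum X n \<omega>\<bar> \<ge> s} \<le> real n * expectation (\<lambda>\<omega>. (X 1 \<omega>)\<^sup>2) / s\<^sup>2"
  using second_moment_method[of "psum X n" s] psum_moments[OF assms(1,2), of n] assms(3)
  by (simp add: second_moment_method)

lemma iid_centered: "iid_real M (\<lambda>n \<omega>. X n \<omega> - c)"
proof unfold_locales
  show "indep_vars (\<lambda>_. borel) (\<lambda>n \<omega>. X n \<omega> - c) {1..}"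
    by (rule indep_vars_compose2[OF indep]) auto
  show "distr M borel (\<lambda>\<omega>. X n \<omega> - c) = distr M borel (\<lambda>\<omega>. X 1 \<omega> - c)" if "n \<ge> 1" for n
  proof -
    have *: "distr M borel (\<lambda>\<omega>. X n \<omega> - c) = distr (distr M borel (X n)) borel (\<lambda>x. x - c)" if "n \<ge> 1" for n
      using rv[OF that] by (subst distr_distr) (auto simp: comp_def)
    show ?thesis using *[OF that] *[of 1] ident[OF that] by simp
  qed
  show "(\<lambda>\<omega>. X n \<omega> - c) \<in> borel_measurable M" if "n \<ge> 1" for n
    using rv[OF that] by simp
qed

lemma psum_centered: "psum (\<lambda>n \<omega>. X n \<omega> - c) n \<omega> = psum X n \<omega> - real n * c"
  unfolding psum_def by (simp add: sum_subtractf)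

text \<open>Weak convergence gives convergence of the distribution functions at every
  \<open>y\<close>, because the normal law has no atoms. The sequence is shifted by one so that it
  is indexed by all naturals.\<close>

lemma CLT_tail:
  assumes int: "integrable M (\<lambda>\<omega>. (X 1 \<omega>)\<^sup>2)" and mean: "expectation (X 1) = 0"
    and v: "expectation (\<lambda>\<omega>. (X 1 \<omega>)\<^sup>2) = v" "0 < v"
  shows "(\<lambda>k. prob {\<omega> \<in> space M. psum X k \<omega> \<le> y * sqrt v * sqrt (real k)}) \<longlonglongrightarrow> cdf std_normal_distribution y"
proof -
  have ind: "indep_vars (\<lambda>i. borel) (\<lambda>i. X (Suc i)) UNIV"
  proof -
    have "indep_vars (\<lambda>_. borel) (\<lambda>j \<omega>. (\<lambda>f. f (Suc j)) (\<lambda>i\<in>{Suc j}. X i \<omega>)) UNIV"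
      by (rule indep_vars_compose2[OF indep_vars_restrict[OF indep]]) (auto simp: disjoint_family_on_def)
    then show ?thesis by simp
  qed
  have "weak_conv_m (\<lambda>n. distr M borel (\<lambda>x. (\<Sum>i<n. X (Suc i) x) / sqrt (n * (sqrt v)\<^sup>2))) std_normal_distribution"
  proof (rule central_limit_theorem_zero_mean[OF ind])
    show "expectation (X (Suc n)) = 0" for n
      using expectation_ident[of "Suc n" "\<lambda>x. x"] mean by simp
    then show "variance (X (Suc n)) = (sqrt v)\<^sup>2" for n
      using expectation_ident[of "Suc n" "\<lambda>x. x\<^sup>2"] v by simp
    show "integrable M (\<lambda>x. (X (Suc n) x)\<^sup>2)" for n
      using integrable_ident[of "Suc n" "\<lambda>x. x\<^sup>2"] int by simp
    show "distr M borel (X (Suc n)) = distr M borel (X 1)" for n by (rule ident) simp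
  qed (use v in auto)
  moreover have "isCont (cdf std_normal_distribution) y"
  proof -
    interpret R: real_distribution std_normal_distribution by (rule real_dist_normal_dist)
    show ?thesis by (simp add: R.isCont_cdf std_normal_singleton)
  qed
  ultimately have "(\<lambda>n. cdf (distr M borel (\<lambda>x. (\<Sum>i<n. X (Suc i) x) / sqrt (n * (sqrt v)\<^sup>2))) y) \<longlonglongrightarrow> cdf std_normal_distribution y"
    unfolding weak_conv_m_def weak_conv_def by blast
  moreover have "\<forall>\<^sub>F n in sequentially. cdf (distr M borel (\<lambda>x. (\<Sum>i<n. X (Suc i) x) / sqrt (n * (sqrt v)\<^sup>2))) y
     = prob {\<omega> \<in> space M. psum X n \<omega> \<le> y * sqrt v * sqrt (real n)}"
    using eventually_gt_at_top[of 0]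
  proof eventually_elim
    case (elim n)
    have eq: "(\<Sum>i<n. X (Suc i) x) = psum X n x" for x
      unfolding psum_def by (rule sum.reindex_bij_witness[of _ "\<lambda>i. i - 1" Suc]) auto
    have "cdf (distr M borel (\<lambda>x. (\<Sum>i<n. X (Suc i) x) / sqrt (n * (sqrt v)\<^sup>2))) y
      = prob {x \<in> space M. psum X n x / sqrt (n * (sqrt v)\<^sup>2) \<le> y}"
      unfolding cdf_def eq by (subst measure_distr) (auto intro!: arg_cong[where f = prob])
    also have "{x \<in> space M. psum X n x / sqrt (n * (sqrt v)\<^sup>2) \<le> y} = {\<omega> \<in> space M. psum X n \<omega> \<le> y * sqrt v * sqrt (real n)}"
      using elim v by (auto simp: real_sqrt_mult field_simps)
    finally show ?case .
  qed
  ultimately show ?thesis by (rule Lim_transform_eventually)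
qed

end

lemma std_normal_cdf_0: "cdf std_normal_distribution 0 = 1 / 2"
proof -
  interpret R: real_distribution std_normal_distribution by (rule real_dist_normal_dist)
  have "emeasure std_normal_distribution {0..} = (\<integral>\<^sup>+x. ennreal (std_normal_density x) * indicator {0..} x \<partial>lborel)"
    by (subst emeasure_density) auto
  also have "\<dots> = (\<integral>\<^sup>+x. ennreal (std_normal_density x) * indicator {..0} x \<partial>lborel)"
    by (subst nn_integral_real_affine[where c = "-1" and t = 0])
       (auto intro!: nn_integral_cong simp: indicator_def normal_density_def)
  also have "\<dots> = emeasure std_normal_distribution {..0}" by (subst emeasure_density) auto
  finally have eq: "measure std_normal_distribution {0..} = measure std_normal_distribution {..0}"
    by (simp add: measure_def)
  note null = std_normal_singleton[of 0]
  have "1 = measure std_normal_distribution ({0..} \<union> {..<0})"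
  proof -
    have "{0..} \<union> {..<0::real} = UNIV" by auto
    then show ?thesis using R.prob_space by simp
  qed
  also have "\<dots> = measure std_normal_distribution {0..} + measure std_normal_distribution {..<0}"
    by (intro R.finite_measure_Union) auto
  also have "measure std_normal_distribution {..0} = measure std_normal_distribution ({..<0} \<union> {0})"
    by (intro arg_cong[where f = "measure std_normal_distribution"]) auto
  then have "measure std_normal_distribution {..<0} = measure std_normal_distribution {..0}"
    using R.finite_measure_Union[of "{..<0}" "{0}"] null by simp
  finally show ?thesis using eq by (simp add: cdf_def)
qed

text \<open>On (y, y + 1] the density is at least its value at the right end. This is crude, but
  \<open>moments_of_summable\<close> needs only the leading order y^2 / 2 of the negative
  logarithm.\<close>

lemma std_normal_tail_ge:
  assumes "0 \<le> y"
  shows "exp (- (y + 1)\<^sup>2 / 2) / sqrt (2 * pi) \<le> 1 - cdf std_normal_distribution y"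
proof -
  interpret R: real_distribution std_normal_distribution by (rule real_dist_normal_dist)
  have "ennreal (exp (- (y + 1)\<^sup>2 / 2) / sqrt (2 * pi)) = (\<integral>\<^sup>+x. ennreal (exp (- (y + 1)\<^sup>2 / 2) / sqrt (2 * pi)) * indicator {y<..y+1} x \<partial>lborel)"
    by (subst nn_integral_cmult_indicator) auto
  also have "\<dots> \<le> (\<integral>\<^sup>+x. ennreal (std_normal_density x) * indicator {y<..y+1} x \<partial>lborel)"
    using assms by (intro nn_integral_mono)
      (auto simp: indicator_def normal_density_def divide_right_mono power_mono intro!: ennreal_leI)
  also have "\<dots> = emeasure std_normal_distribution {y<..y+1}" by (subst emeasure_density) auto
  finally have "exp (- (y + 1)\<^sup>2 / 2) / sqrt (2 * pi) \<le> measure std_normal_distribution {y<..y+1}"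
    by (simp add: R.emeasure_eq_measure)
  also have "\<dots> \<le> measure std_normal_distribution (UNIV - {..y})"
    by (intro R.finite_measure_mono) auto
  also have "\<dots> = 1 - cdf std_normal_distribution y"
    using R.prob_compl[of "{..y}"] by (simp add: cdf_def)
  finally show ?thesis .
qed

context iid_real begin

text \<open>Three uses of \<open>diverges_of_block_bound\<close>. Without a second moment, or with a
  nonzero mean, |S_k| exceeds y sqrt k with a fixed probability for every y, so y can be as large as
  the slack condition demands. For the variance, y is Y sqrt v and p is a Gaussian tail bound at Y;
  the slack quantity then tends to x^2 / v as Y grows.\<close>

lemma moments_of_summable:
  assumes s: "0 < s" and a: "- 1 < a"
    and sm: "\<And>x. s * sqrt (1 + a) < x \<Longrightarrow> summable (\<lambda>n. wt a b n * prob {\<omega> \<in> space M. \<bar>psum X n \<omega>\<bar> \<ge> x * phi (real n)})"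
  shows "integrable M (\<lambda>\<omega>. (X 1 \<omega>)\<^sup>2)" "expectation (X 1) = 0" "expectation (\<lambda>\<omega>. (X 1 \<omega>)\<^sup>2) \<le> s\<^sup>2"
proof -
  define x where "x = s * sqrt (1 + a) + 1"
  have x: "x > 0" "s * sqrt (1 + a) < x" using s a by (auto simp: x_def intro: add_nonneg_pos)
  have ex_y: "\<exists>y>0. ln (2 / p) * (2 * x\<^sup>2 / y\<^sup>2) < 1 + a" for p :: real
  proof -
    have "((\<lambda>y. ln (2 / p) * (2 * x\<^sup>2 / y\<^sup>2)) \<longlongrightarrow> 0) at_top" by real_asymp
    then have "\<forall>\<^sub>F y in at_top. ln (2 / p) * (2 * x\<^sup>2 / y\<^sup>2) < 1 + a" using a by (intro order_tendstoD) auto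
    then have "\<forall>\<^sub>F y in at_top. ln (2 / p) * (2 * x\<^sup>2 / y\<^sup>2) < 1 + a \<and> y > 0"
      by (intro eventually_conj eventually_gt_at_top)
    then show ?thesis by (auto simp: eventually_at_top_linorder)
  qed
  have split: "prob {\<omega> \<in> space M. \<bar>psum X k \<omega>\<bar> \<ge> u} \<le> prob {\<omega> \<in> space M. psum X k \<omega> \<ge> u} + prob {\<omega> \<in> space M. psum X k \<omega> \<le> - u}" for k u
  proof -
    have "prob {\<omega> \<in> space M. \<bar>psum X k \<omega>\<bar> \<ge> u} \<le> prob ({\<omega> \<in> space M. psum X k \<omega> \<ge> u} \<union> {\<omega> \<in> space M. psum X k \<omega> \<le> - u})"
      by (intro finite_measure_mono) auto
    also have "\<dots> \<le> prob {\<omega> \<in> space M. psum X k \<omega> \<ge> u} + prob {\<omega> \<in> space M. psum X k \<omega> \<le> - u}"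
      by (intro measure_Un_le) auto
    finally show ?thesis .
  qed
  show int: "integrable M (\<lambda>\<omega>. (X 1 \<omega>)\<^sup>2)"
  proof (rule ccontr)
    assume ni: "\<not> integrable M (\<lambda>\<omega>. (X 1 \<omega>)\<^sup>2)"
    obtain y where y: "y > 0" "ln (2 / (1/16)) * (2 * x\<^sup>2 / y\<^sup>2) < 1 + a" using ex_y by blast
    have "\<forall>\<^sub>F k in sequentially. \<not> (7/8 \<le> prob {\<omega> \<in> space M. \<bar>psum X k \<omega>\<bar> < y * sqrt (real k)})"
      using second_moment_of_frequently_tight[OF y(1)] ni by (auto simp: not_frequently[symmetric])
    \<comment> \<open>The mass 1/8 outside the interval is shared by two tails, so one of them
      carries at least 1/16.\<close>
    then have "\<forall>\<^sub>F k in sequentially. 1/16 \<le> max (prob {\<omega> \<in> space M. psum X k \<omega> \<ge> y * sqrt (real k)})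
        (prob {\<omega> \<in> space M. psum X k \<omega> \<le> - (y * sqrt (real k))})"
    proof eventually_elim
      case (elim k)
      have "prob {\<omega> \<in> space M. \<bar>psum X k \<omega>\<bar> \<ge> y * sqrt (real k)} = prob (space M - {\<omega> \<in> space M. \<bar>psum X k \<omega>\<bar> < y * sqrt (real k)})"
        by (intro arg_cong[where f = prob]) auto
      also have "\<dots> = 1 - prob {\<omega> \<in> space M. \<bar>psum X k \<omega>\<bar> < y * sqrt (real k)}" by (intro prob_compl) simp
      finally show ?case using elim split[of "y * sqrt (real k)" k] by linarith
    qed
    from diverges_of_block_bound[OF y(1) _ _ x(1) a this y(2)] sm[OF x(2)] show False by simp
  qed
  have int1: "integrable M (X 1)"
    by (rule square_integrable_imp_integrable[OF _ int]) simp
  show mean: "expectation (X 1) = 0"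
  proof (rule ccontr)
    define c where "c = expectation (X 1)"
    assume "expectation (X 1) \<noteq> 0"
    then have c: "\<bar>c\<bar> > 0" by (simp add: c_def)
    interpret C: iid_real M "\<lambda>n \<omega>. X n \<omega> - c" by (rule iid_centered)
    define v where "v = expectation (\<lambda>\<omega>. (X 1 \<omega> - c)\<^sup>2)"
    have intc: "integrable M (\<lambda>\<omega>. (X 1 \<omega> - c)\<^sup>2)" using int int1 by (simp add: power2_diff)
    have meanc: "expectation (\<lambda>\<omega>. X 1 \<omega> - c) = 0" using int1 by (simp add: c_def prob_space)
    obtain y where y: "y > 0" "ln (2 / (1/4)) * (2 * x\<^sup>2 / y\<^sup>2) < 1 + a" using ex_y by blast
    have "(\<lambda>k. real k * v / (real k * \<bar>c\<bar> / 2)\<^sup>2) \<longlonglongrightarrow> 0" using c by real_asymp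
    then have "\<forall>\<^sub>F k in sequentially. real k * v / (real k * \<bar>c\<bar> / 2)\<^sup>2 < 1/2" by (rule order_tendstoD) simp
    moreover have "filterlim (\<lambda>k. real k * \<bar>c\<bar> / 2 - y * sqrt (real k)) at_top sequentially" using c y by real_asymp
    then have "\<forall>\<^sub>F k in sequentially. real k * \<bar>c\<bar> / 2 - y * sqrt (real k) \<ge> 0"
      unfolding filterlim_at_top by blast
    ultimately have "\<forall>\<^sub>F k in sequentially. 1/4 \<le> max (prob {\<omega> \<in> space M. psum X k \<omega> \<ge> y * sqrt (real k)})
        (prob {\<omega> \<in> space M. psum X k \<omega> \<le> - (y * sqrt (real k))})"
      using eventually_gt_at_top[of 0]
    proof eventually_elim
      case (elim k)
      have "prob {\<omega> \<in> space M. \<bar>psum X k \<omega> - real k * c\<bar> \<ge> real k * \<bar>c\<bar> / 2} \<le> real k * v / (real k * \<bar>c\<bar> / 2)\<^sup>2"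
        using C.psum_Chebyshev[OF intc meanc, of "real k * \<bar>c\<bar> / 2" k] c elim by (simp add: psum_centered v_def)
      also note elim(1)
      finally have 1: "prob {\<omega> \<in> space M. \<bar>psum X k \<omega> - real k * c\<bar> \<ge> real k * \<bar>c\<bar> / 2} < 1/2" .
      have "1 - prob {\<omega> \<in> space M. \<bar>psum X k \<omega> - real k * c\<bar> \<ge> real k * \<bar>c\<bar> / 2}
        = prob (space M - {\<omega> \<in> space M. \<bar>psum X k \<omega> - real k * c\<bar> \<ge> real k * \<bar>c\<bar> / 2})"
        by (intro prob_compl[symmetric]) simp
      also have "\<dots> \<le> prob {\<omega> \<in> space M. \<bar>psum X k \<omega>\<bar> \<ge> y * sqrt (real k)}"
      proof (intro finite_measure_mono subsetI)
        fix \<omega> assume "\<omega> \<in> space M - {\<omega> \<in> space M. \<bar>psum X k \<omega> - real k * c\<bar> \<ge> real k * \<bar>c\<bar> / 2}"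
        moreover have "\<bar>real k * c\<bar> = real k * \<bar>c\<bar>" by (simp add: abs_mult)
        ultimately have "\<bar>psum X k \<omega> - real k * c\<bar> < real k * \<bar>c\<bar> / 2" "\<bar>real k * c\<bar> = real k * \<bar>c\<bar>" "\<omega> \<in> space M"
          by auto
        moreover have "\<bar>real k * c\<bar> \<le> \<bar>psum X k \<omega>\<bar> + \<bar>psum X k \<omega> - real k * c\<bar>" by arith
        ultimately show "\<omega> \<in> {\<omega> \<in> space M. \<bar>psum X k \<omega>\<bar> \<ge> y * sqrt (real k)}" using elim(2) by simp
      qed simp
      finally show ?case using 1 split[of "y * sqrt (real k)" k] by linarith
    qed
    from diverges_of_block_bound[OF y(1) _ _ x(1) a this y(2)] sm[OF x(2)] show False by simp
  qed
  show "expectation (\<lambda>\<omega>. (X 1 \<omega>)\<^sup>2) \<le> s\<^sup>2"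
  proof (rule ccontr)
    define v where "v = expectation (\<lambda>\<omega>. (X 1 \<omega>)\<^sup>2)"
    assume "\<not> expectation (\<lambda>\<omega>. (X 1 \<omega>)\<^sup>2) \<le> s\<^sup>2"
    then have v: "s\<^sup>2 < v" by (simp add: v_def)
    then have "s < sqrt v" using s by (intro real_less_rsqrt) auto
    then have "s * sqrt (1 + a) < sqrt v * sqrt (1 + a)" using a by (intro mult_strict_right_mono) auto
    then obtain x where x: "s * sqrt (1 + a) < x" "x < sqrt v * sqrt (1 + a)" using dense by blast
    have v0: "v > 0" using v s by (meson less_trans zero_less_power)
    have x0: "x > 0" using x(1) s a by (intro le_less_trans[OF _ x(1)]) auto
    have "x\<^sup>2 < (sqrt v * sqrt (1 + a))\<^sup>2" using x x0 by (intro power_strict_mono) auto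
    then have xv: "x\<^sup>2 / v < 1 + a" using v0 a by (simp add: power_mult_distrib field_simps)
    \<comment> \<open>Half of the lower bound in \<open>std_normal_tail_ge\<close>, so that the
      comparison with the normal tail is strict and survives the passage from the limit to finite
      k.\<close>
    define p where "p Y = exp (- (Y + 1)\<^sup>2 / 2) / sqrt (2 * pi) / 2" for Y :: real
    have "((\<lambda>Y. ln (2 / p Y) * (2 * x\<^sup>2 / (Y * sqrt v)\<^sup>2)) \<longlongrightarrow> x\<^sup>2 / v) at_top"
    proof -
      have "((\<lambda>Y. ((Y + 1)\<^sup>2 / 2 + ln (4 * sqrt (2 * pi))) * (2 * x\<^sup>2 / (Y\<^sup>2 * v))) \<longlongrightarrow> x\<^sup>2 / v) at_top"
        using v0 x0 by real_asymp (simp add: field_simps)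
      moreover have "ln (2 / p Y) = (Y + 1)\<^sup>2 / 2 + ln (4 * sqrt (2 * pi))" for Y
        by (simp add: p_def ln_div ln_mult)
      ultimately show ?thesis using v0 by (simp add: power_mult_distrib)
    qed
    then have "\<forall>\<^sub>F Y in at_top. ln (2 / p Y) * (2 * x\<^sup>2 / (Y * sqrt v)\<^sup>2) < 1 + a" using xv by (rule order_tendstoD)
    then have "\<forall>\<^sub>F Y in at_top. ln (2 / p Y) * (2 * x\<^sup>2 / (Y * sqrt v)\<^sup>2) < 1 + a \<and> Y > 0"
      by (intro eventually_conj eventually_gt_at_top)
    then obtain Y where Y: "ln (2 / p Y) * (2 * x\<^sup>2 / (Y * sqrt v)\<^sup>2) < 1 + a" "Y > 0"
      by (auto simp: eventually_at_top_linorder)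
    have pY: "0 < p Y" "p Y < 1 - cdf std_normal_distribution Y"
    proof -
      show *: "0 < p Y" by (simp add: p_def)
      have "2 * p Y \<le> 1 - cdf std_normal_distribution Y"
        using std_normal_tail_ge[of Y] Y(2) by (simp add: p_def)
      with * show "p Y < 1 - cdf std_normal_distribution Y" by linarith
    qed
    have "p Y \<le> 1"
    proof -
      have "0 \<le> cdf std_normal_distribution Y" by (simp add: cdf_def)
      then show ?thesis using pY by linarith
    qed
    have "\<forall>\<^sub>F k in sequentially. prob {\<omega> \<in> space M. psum X k \<omega> \<le> Y * sqrt v * sqrt (real k)} < 1 - p Y"
      using pY by (intro order_tendstoD(2)[OF CLT_tail[OF int mean v_def[symmetric] v0]]) auto
    then have ev: "\<forall>\<^sub>F k in sequentially. p Y \<le> max (prob {\<omega> \<in> space M. psum X k \<omega> \<ge> (Y * sqrt v) * sqrt (real k)})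
        (prob {\<omega> \<in> space M. psum X k \<omega> \<le> - ((Y * sqrt v) * sqrt (real k))})"
    proof eventually_elim
      case (elim k)
      have "1 - prob {\<omega> \<in> space M. psum X k \<omega> \<le> Y * sqrt v * sqrt (real k)}
        = prob (space M - {\<omega> \<in> space M. psum X k \<omega> \<le> Y * sqrt v * sqrt (real k)})"
        by (intro prob_compl[symmetric]) simp
      also have "\<dots> \<le> prob {\<omega> \<in> space M. psum X k \<omega> \<ge> (Y * sqrt v) * sqrt (real k)}"
        by (intro finite_measure_mono) auto
      finally show ?case using elim by linarith
    qed
    have "0 < Y * sqrt v" using Y v0 by simp
    from diverges_of_block_bound[OF this pY(1) \<open>p Y \<le> 1\<close> x0 a ev Y(1)] sm[OF x(1)] show False by simp
  qed
qed

end

subsection \<open>Maximal inequality and the weighted second moment\<close>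

lemma pmax_ge_iff: "u \<le> pmax X n \<omega> \<longleftrightarrow> (\<exists>k\<le>n. u \<le> \<bar>psum X k \<omega>\<bar>)"
  unfolding pmax_def by (subst Max_ge_iff) auto

context iid_real begin

lemma rv_pmax [measurable]: "pmax X n \<in> borel_measurable M"
  unfolding pmax_def by (intro borel_measurable_Max) auto

text \<open>Decompose by the first index k at which the sum reaches \<open>u\<close>. The sum of the
  remaining terms is independent of that event and is at least \<open>- w\<close> with probability
  at least \<open>q\<close>, and then the total is still at least \<open>u - w\<close>.\<close>

lemma Ottaviani_one_sided:
  assumes q: "\<And>j. j \<le> n \<Longrightarrow> q \<le> prob {\<omega> \<in> space M. psum X j \<omega> \<ge> - w}"
  shows "q * prob {\<omega> \<in> space M. \<exists>k\<le>n. psum X k \<omega> \<ge> u} \<le> prob {\<omega> \<in> space M. psum X n \<omega> \<ge> u - w}"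
proof -
  define A where "A k = {\<omega> \<in> space M. (\<forall>j<k. psum X j \<omega> < u) \<and> psum X k \<omega> \<ge> u}" for k
  have A [measurable]: "A k \<in> events" for k unfolding A_def by measurable
  let ?E = "{\<omega> \<in> space M. psum X n \<omega> \<ge> u - w}"
  have disj: "disjoint_family A"
    unfolding disjoint_family_on_def A_def
  proof (safe, goal_cases)
    case (1 i j \<omega>)
    then show ?case by (cases i j rule: linorder_cases) (auto simp: not_le[symmetric])
  qed
  have union: "{\<omega> \<in> space M. \<exists>k\<le>n. psum X k \<omega> \<ge> u} = (\<Union>k\<in>{..n}. A k)"
  proof (intro set_eqI iffI)
    fix \<omega> assume "\<omega> \<in> {\<omega> \<in> space M. \<exists>k\<le>n. psum X k \<omega> \<ge> u}"
    then obtain k where k: "k \<le> n" "psum X k \<omega> \<ge> u" and sp: "\<omega> \<in> space M" by auto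
    define l where "l = (LEAST k. psum X k \<omega> \<ge> u)"
    have "psum X l \<omega> \<ge> u" unfolding l_def by (rule LeastI[of _ k]) (rule k)
    moreover have "l \<le> k" unfolding l_def by (rule Least_le) (rule k)
    moreover have "\<forall>j<l. psum X j \<omega> < u" unfolding l_def using not_less_Least not_le by blast
    ultimately show "\<omega> \<in> (\<Union>k\<in>{..n}. A k)" using k sp by (auto simp: A_def intro!: bexI[of _ l])
  qed (auto simp: A_def)
  have each: "q * prob (A k) \<le> prob (A k \<inter> ?E)" if k: "k \<le> n" for k
  proof -
    \<comment> \<open>The first-passage event expressed through the first \<open>k\<close>
      coordinates alone, which makes it independent of the later block.\<close>
    define f where "f h = ((\<forall>j<k. (\<Sum>i\<in>{1..j}. h i) < u) \<and> (\<Sum>i\<in>{1..k}. h i) \<ge> u)" for h :: "nat \<Rightarrow> real"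
    have f: "f (\<lambda>i\<in>{1..k}. X i \<omega>) \<longleftrightarrow> (\<forall>j<k. psum X j \<omega> < u) \<and> psum X k \<omega> \<ge> u" for \<omega>
      unfolding f_def psum_def by (intro conj_cong all_cong1 imp_cong arg_cong2[where f = "(<)"] arg_cong2[where f = "(\<le>)"] sum.cong) auto
    have sumM: "(\<lambda>h::nat \<Rightarrow> real. \<Sum>i\<in>{1..j}. h i) \<in> borel_measurable (PiM {1..k} (\<lambda>_. borel))" if "j \<le> k" for j
      by (rule borel_measurable_sum[where f = "\<lambda>i h. h i"], rule measurable_component_singleton) (use that in auto)
    have *: "Measurable.pred (PiM {1..k} (\<lambda>_. borel)) (\<lambda>h. \<forall>j\<in>{..<k}. (\<Sum>i\<in>{1..j}. h i) < u)"
    proof (intro pred_intros_finite)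
      show "Measurable.pred (PiM {1..k} (\<lambda>_. borel)) (\<lambda>h. (\<Sum>i\<in>{1..j}. h i) < u)" if "j \<in> {..<k}" for j
        using sumM[of j] that by simp
    qed auto
    have "Measurable.pred (PiM {1..k} (\<lambda>_. borel)) (\<lambda>h. u \<le> (\<Sum>i\<in>{1..k}. h i))"
      using sumM[of k] by simp
    from pred_intros_logic(3)[OF * this] have "Measurable.pred (PiM {1..k} (\<lambda>_. borel)) f"
      unfolding f_def Ball_def lessThan_iff .
    note [measurable] = this
    have "(\<lambda>h. of_bool (f h) :: real) \<in> borel_measurable (PiM {1..k} (\<lambda>_. borel))" by measurable
    then have "indep_var borel (\<lambda>\<omega>. of_bool (f (\<lambda>i\<in>{1..k}. X i \<omega>)) :: real) borel (\<lambda>\<omega>. (\<lambda>h. \<Sum>i\<in>{k<..n}. h i) (\<lambda>i\<in>{k<..n}. X i \<omega>))"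
      by (intro indep_functions borel_measurable_sum measurable_component_singleton) (auto simp: subset_iff)
    from indep_varD[OF this, of "{1}" "{- w..}"]
    have "prob {\<omega> \<in> space M. f (\<lambda>i\<in>{1..k}. X i \<omega>) \<and> - w \<le> (\<Sum>i\<in>{k<..n}. X i \<omega>)}
       = prob {\<omega> \<in> space M. f (\<lambda>i\<in>{1..k}. X i \<omega>)} * prob {\<omega> \<in> space M. - w \<le> (\<Sum>i\<in>{k<..n}. X i \<omega>)}"
      by (simp add: vimage_def Int_def conj_commute conj_left_commute)
    also have "{\<omega> \<in> space M. f (\<lambda>i\<in>{1..k}. X i \<omega>)} = A k" by (simp only: f A_def)
    also have "{\<omega> \<in> space M. f (\<lambda>i\<in>{1..k}. X i \<omega>) \<and> - w \<le> (\<Sum>i\<in>{k<..n}. X i \<omega>)} = {\<omega> \<in> A k. - w \<le> (\<Sum>i\<in>{k<..n}. X i \<omega>)}"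
      by (auto simp only: f A_def mem_Collect_eq)
    also have "prob {\<omega> \<in> space M. - w \<le> (\<Sum>i\<in>{k<..n}. X i \<omega>)} = prob {\<omega> \<in> space M. - w \<le> psum X (n - k) \<omega>}"
      using prob_block_sum[of "\<lambda>x. - w \<le> x" k "n - k"] k by simp
    finally have eq: "prob {\<omega> \<in> A k. - w \<le> (\<Sum>i\<in>{k<..n}. X i \<omega>)} = prob (A k) * prob {\<omega> \<in> space M. - w \<le> psum X (n - k) \<omega>}" .
    have "q * prob (A k) \<le> prob {\<omega> \<in> space M. - w \<le> psum X (n - k) \<omega>} * prob (A k)"
      using q[of "n - k"] by (intro mult_right_mono) auto
    also have "\<dots> = prob {\<omega> \<in> A k. - w \<le> (\<Sum>i\<in>{k<..n}. X i \<omega>)}" by (simp add: eq mult.commute)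
    also have "\<dots> \<le> prob (A k \<inter> ?E)"
    proof (intro finite_measure_mono subsetI)
      fix \<omega> assume "\<omega> \<in> {\<omega> \<in> A k. - w \<le> (\<Sum>i\<in>{k<..n}. X i \<omega>)}"
      moreover have "psum X n \<omega> = psum X k \<omega> + (\<Sum>i\<in>{k<..n}. X i \<omega>)"
        using psum_add[of k "n - k" \<omega>] k by simp
      ultimately show "\<omega> \<in> A k \<inter> ?E" by (auto simp: A_def)
    qed auto
    finally show ?thesis .
  qed
  have "q * prob {\<omega> \<in> space M. \<exists>k\<le>n. psum X k \<omega> \<ge> u} = (\<Sum>k\<in>{..n}. q * prob (A k))"
    unfolding union using disj
    by (subst finite_measure_finite_Union) (auto simp: sum_distrib_left disjoint_family_on_def)
  also have "\<dots> \<le> (\<Sum>k\<in>{..n}. prob (A k \<inter> ?E))" by (intro sum_mono each) auto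
  also have "\<dots> = prob (\<Union>k\<in>{..n}. A k \<inter> ?E)"
    using disj by (intro finite_measure_finite_Union[symmetric]) (auto simp: disjoint_family_on_def)
  also have "\<dots> \<le> prob ?E" by (intro finite_measure_mono) auto
  finally show ?thesis .
qed

text \<open>Because \<open>w < u\<close>, the events S_n \<ge> u - w and - S_n \<ge> u - w are
  disjoint. Their probabilities add up to that of |S_n| \<ge> u - w, and no factor 2 is
  lost.\<close>

lemma Ottaviani:
  assumes q: "\<And>j. j \<le> n \<Longrightarrow> q \<le> prob {\<omega> \<in> space M. psum X j \<omega> \<ge> - w}"
      "\<And>j. j \<le> n \<Longrightarrow> q \<le> prob {\<omega> \<in> space M. psum X j \<omega> \<le> w}"
    and "w < u" "0 \<le> q"
  shows "q * prob {\<omega> \<in> space M. pmax X n \<omega> \<ge> u} \<le> prob {\<omega> \<in> space M. \<bar>psum X n \<omega>\<bar> \<ge> u - w}"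
proof -
  interpret N: iid_real M "\<lambda>n \<omega>. - X n \<omega>" by (rule iid_uminus)
  let ?A = "{\<omega> \<in> space M. \<exists>k\<le>n. psum X k \<omega> \<ge> u}" and ?B = "{\<omega> \<in> space M. \<exists>k\<le>n. - psum X k \<omega> \<ge> u}"
  have "q * prob ?B \<le> prob {\<omega> \<in> space M. - psum X n \<omega> \<ge> u - w}"
    using N.Ottaviani_one_sided[of n q w u] q(2) by (simp add: psum_uminus)
  moreover have "q * prob ?A \<le> prob {\<omega> \<in> space M. psum X n \<omega> \<ge> u - w}"
    by (rule Ottaviani_one_sided) (rule q)
  moreover have "prob {\<omega> \<in> space M. pmax X n \<omega> \<ge> u} \<le> prob ?A + prob ?B"
  proof -
    have "prob {\<omega> \<in> space M. pmax X n \<omega> \<ge> u} \<le> prob (?A \<union> ?B)"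
      by (intro finite_measure_mono) (auto simp: pmax_ge_iff abs_if split: if_splits)
    also have "\<dots> \<le> prob ?A + prob ?B" by (intro measure_Un_le) auto
    finally show ?thesis .
  qed
  then have "q * prob {\<omega> \<in> space M. pmax X n \<omega> \<ge> u} \<le> q * prob ?A + q * prob ?B"
    using assms(4) by (simp add: distrib_left[symmetric] mult_left_mono)
  moreover have "prob {\<omega> \<in> space M. psum X n \<omega> \<ge> u - w} + prob {\<omega> \<in> space M. - psum X n \<omega> \<ge> u - w}
     = prob {\<omega> \<in> space M. \<bar>psum X n \<omega>\<bar> \<ge> u - w}"
    using assms(3)
    by (subst finite_measure_Union[symmetric]) (auto intro!: arg_cong[where f = prob] simp: abs_if)
  ultimately show ?thesis by linarith
qed

lemma prob_exists_jump:
  "prob {\<omega> \<in> space M. \<exists>i\<in>{1..n}. \<bar>X i \<omega>\<bar> \<ge> t} = 1 - (1 - prob {\<omega> \<in> space M. \<bar>X 1 \<omega>\<bar> \<ge> t}) ^ n"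
proof -
  have [measurable]: "{\<omega> \<in> space M. \<bar>X i \<omega>\<bar> \<ge> t} \<in> events" if "i \<ge> 1" for i using rv[OF that] by measurable
  have ev: "{\<omega> \<in> space M. \<exists>i\<in>{1..n}. \<bar>X i \<omega>\<bar> \<ge> t} \<in> events"
    by (intro sets.sets_Collect_finite_Ex) auto
  have "(\<lambda>\<omega>. \<Prod>i\<in>{1..n}. indicator {x. \<bar>x\<bar> < t} (X i \<omega>) :: real) =
      (\<lambda>\<omega>. indicator {\<omega>. \<forall>i\<in>{1..n}. \<bar>X i \<omega>\<bar> < t} \<omega>)"
    by (auto simp: fun_eq_iff indicator_def prod_zero_iff)
  note fun_eq = this
  have "expectation (\<lambda>\<omega>. \<Prod>i\<in>{1..n}. indicator {x. \<bar>x\<bar> < t} (X i \<omega>) :: real) =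
     (\<Prod>i\<in>{1..n}. expectation (\<lambda>\<omega>. indicator {x. \<bar>x\<bar> < t} (X 1 \<omega>)))"
  proof (rule expectation_prod[where g = "\<lambda>_. indicator {x. \<bar>x\<bar> < t}"])
    show "integrable M (\<lambda>\<omega>. indicator {x. \<bar>x\<bar> < t} (X 1 \<omega>) :: real)"
      by (intro integrable_const_bound[of _ 1]) auto
  qed auto
  then have "expectation (\<lambda>\<omega>. indicator {\<omega>. \<forall>i\<in>{1..n}. \<bar>X i \<omega>\<bar> < t} \<omega> :: real) =
     (\<Prod>i\<in>{1..n}. expectation (\<lambda>\<omega>. indicator {x. \<bar>x\<bar> < t} (X 1 \<omega>)))"
    unfolding fun_eq .
  also have "expectation (\<lambda>\<omega>. indicator {x. \<bar>x\<bar> < t} (X 1 \<omega>)) = expectation (indicator (space M - {\<omega> \<in> space M. \<bar>X 1 \<omega>\<bar> \<ge> t}))"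
    by (intro Bochner_Integration.integral_cong) (auto simp: indicator_def)
  also have "\<dots> = 1 - prob {\<omega> \<in> space M. \<bar>X 1 \<omega>\<bar> \<ge> t}"
    by (subst prob_compl[symmetric]) auto
  also have "expectation (\<lambda>\<omega>. indicator {\<omega>. \<forall>i\<in>{1..n}. \<bar>X i \<omega>\<bar> < t} \<omega>)
     = expectation (indicator (space M - {\<omega> \<in> space M. \<exists>i\<in>{1..n}. \<bar>X i \<omega>\<bar> \<ge> t}) :: 'a \<Rightarrow> real)"
    by (intro Bochner_Integration.integral_cong) (auto simp: indicator_def not_le)
  also have "\<dots> = 1 - prob {\<omega> \<in> space M. \<exists>i\<in>{1..n}. \<bar>X i \<omega>\<bar> \<ge> t}"
    using ev by (subst prob_compl[symmetric]) auto
  finally show ?thesis by simp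
qed

end

text \<open>With z = n p in [0, 1] one has (1 - p)^n \<le> exp (- z) \<le> 1 / (1 + z) \<le> 1 - z /
  2. This turns the probability of some jump into n times that of a single one.\<close>

lemma one_minus_power_ge:
  assumes "0 \<le> p" "p \<le> 1" "real n * p \<le> 1" shows "real n * p / 2 \<le> 1 - (1 - p) ^ n"
proof -
  have "(1 - p) ^ n \<le> exp (- p) ^ n"
    using assms exp_ge_add_one_self[of "- p"] by (intro power_mono) auto
  also have "\<dots> = exp (- (real n * p))" by (simp add: exp_of_nat_mult[symmetric])
  also have "\<dots> \<le> 1 - real n * p / 2"
  proof -
    define z where "z = real n * p"
    have z: "0 \<le> z" "z \<le> 1" using assms by (auto simp: z_def)
    have "1 + z \<le> exp z" by (rule exp_ge_add_one_self)
    then have "exp (- z) \<le> 1 / (1 + z)" using z by (simp add: exp_minus field_simps)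
    also have "\<dots> \<le> 1 - z / 2" using z by (simp add: field_simps) (metis mult_left_le)
    finally show ?thesis by (simp add: z_def)
  qed
  finally show ?thesis by linarith
qed

section \<open>Big jumps and the weighted second moment\<close>

context iid_real begin

text \<open>Supplies the hypotheses of \<open>Ottaviani\<close> with q = 1/2, uniformly in
  \<open>j\<close>, for a shift \<open>w\<close> of order sqrt n.\<close>

lemma psum_Chebyshev_half:
  assumes "integrable M (\<lambda>\<omega>. (X 1 \<omega>)\<^sup>2)" "expectation (X 1) = 0" "0 < w"
    and "2 * (real n * expectation (\<lambda>\<omega>. (X 1 \<omega>)\<^sup>2)) \<le> w\<^sup>2" "j \<le> n"
  shows "1/2 \<le> prob {\<omega> \<in> space M. psum X j \<omega> \<ge> - w}" "1/2 \<le> prob {\<omega> \<in> space M. psum X j \<omega> \<le> w}"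
proof -
  have "real j * expectation (\<lambda>\<omega>. (X 1 \<omega>)\<^sup>2) \<le> real n * expectation (\<lambda>\<omega>. (X 1 \<omega>)\<^sup>2)"
    using assms(5) by (intro mult_right_mono) auto
  then have "real j * expectation (\<lambda>\<omega>. (X 1 \<omega>)\<^sup>2) / w\<^sup>2 \<le> 1 / 2" using assms(3,4) by (simp add: field_simps)
  then have "prob {\<omega> \<in> space M. \<bar>psum X j \<omega>\<bar> \<ge> w} \<le> 1 / 2"
    using psum_Chebyshev[OF assms(1-3), of j] by linarith
  moreover have "prob (space M - {\<omega> \<in> space M. \<bar>psum X j \<omega>\<bar> \<ge> w}) = 1 - prob {\<omega> \<in> space M. \<bar>psum X j \<omega>\<bar> \<ge> w}"
    by (intro prob_compl) simp
  moreover have "prob (space M - {\<omega> \<in> space M. \<bar>psum X j \<omega>\<bar> \<ge> w}) \<le> prob {\<omega> \<in> space M. psum X j \<omega> \<ge> - w}"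
    "prob (space M - {\<omega> \<in> space M. \<bar>psum X j \<omega>\<bar> \<ge> w}) \<le> prob {\<omega> \<in> space M. psum X j \<omega> \<le> w}"
    by (intro finite_measure_mono; auto)+
  ultimately show "1/2 \<le> prob {\<omega> \<in> space M. psum X j \<omega> \<ge> - w}" "1/2 \<le> prob {\<omega> \<in> space M. psum X j \<omega> \<le> w}"
    by linarith+
qed

text \<open>A jump of size 4 u forces the partial sum just before or just after it to have absolute
  value at least 2 u, hence M_n \<ge> 2 u, and \<open>Ottaviani\<close> with shift u returns to
  |S_n| \<ge> u. The constant 4 is the product of the two losses by 2, in
  \<open>one_minus_power_ge\<close> and in q = 1/2.\<close>

lemma prob_jump_le_psum:
  assumes int: "integrable M (\<lambda>\<omega>. (X 1 \<omega>)\<^sup>2)" and mean: "expectation (X 1) = 0" and x: "0 < x"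
  shows "\<forall>\<^sub>F n in sequentially. real n * prob {\<omega> \<in> space M. \<bar>X 1 \<omega>\<bar> \<ge> 4 * x * phi (real n)}
     \<le> 4 * prob {\<omega> \<in> space M. \<bar>psum X n \<omega>\<bar> \<ge> x * phi (real n)}"
proof -
  define v where "v = expectation (\<lambda>\<omega>. (X 1 \<omega>)\<^sup>2)"
  have v0: "0 \<le> v" by (simp add: v_def)
  have "filterlim (\<lambda>n. ln (ln (real n))) at_top sequentially" by real_asymp
  then have "\<forall>\<^sub>F n in sequentially. v / x\<^sup>2 \<le> ln (ln (real n))" unfolding filterlim_at_top by blast
  moreover have "\<forall>\<^sub>F n in sequentially. loglogl (real n) = ln (ln (real n))"
    by (rule eventually_compose_filterlim[OF eventually_loglogl filterlim_real_sequentially])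
  ultimately show ?thesis using eventually_gt_at_top[of 0]
  proof eventually_elim
    case (elim n)
    define u where "u = x * phi (real n)"
    have phi0: "phi (real n) > 0" using elim(3) by (simp add: phi_def del: loglogl_eq)
    then have u: "u > 0" using x by (simp add: u_def)
    have u2: "u\<^sup>2 = x\<^sup>2 * (2 * real n * loglogl (real n))"
      using elim loglogl_pos[of "real n"] by (simp add: u_def phi_def power_mult_distrib less_imp_le)
    have "v \<le> x\<^sup>2 * loglogl (real n)" using elim x by (simp add: field_simps)
    then have nv: "2 * (real n * v) \<le> u\<^sup>2" using mult_left_mono[of v "x\<^sup>2 * loglogl (real n)" "2 * real n"] by (simp add: u2 algebra_simps)
    let ?p = "prob {\<omega> \<in> space M. \<bar>X 1 \<omega>\<bar> \<ge> 4 * u}"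
    have "?p \<le> v / (4 * u)\<^sup>2" unfolding v_def using int u by (intro second_moment_method) auto
    then have "real n * ?p \<le> real n * (v / (4 * u)\<^sup>2)" by (intro mult_left_mono) auto
    also have "\<dots> \<le> 1"
    proof -
      have "real n * v \<le> 16 * u\<^sup>2" using nv zero_le_power2[of u] by linarith
      then show ?thesis using u by (simp add: power_mult_distrib field_simps)
    qed
    finally have np: "real n * ?p \<le> 1" .
    have "real n * ?p / 2 \<le> 1 - (1 - ?p) ^ n" by (rule one_minus_power_ge) (use np in auto)
    also have "\<dots> = prob {\<omega> \<in> space M. \<exists>i\<in>{1..n}. \<bar>X i \<omega>\<bar> \<ge> 4 * u}" by (rule prob_exists_jump[symmetric])
    also have "\<dots> \<le> prob {\<omega> \<in> space M. pmax X n \<omega> \<ge> 2 * u}"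
    proof (intro finite_measure_mono subsetI)
      fix \<omega> assume "\<omega> \<in> {\<omega> \<in> space M. \<exists>i\<in>{1..n}. \<bar>X i \<omega>\<bar> \<ge> 4 * u}"
      then obtain i where i: "i \<ge> 1" "i \<le> n" "\<bar>X i \<omega>\<bar> \<ge> 4 * u" "\<omega> \<in> space M" by auto
      then obtain j where j: "i = Suc j" by (cases i) auto
      have "psum X i \<omega> = psum X j \<omega> + X i \<omega>" by (simp add: psum_def j)
      then have "2 * u \<le> \<bar>psum X i \<omega>\<bar> \<or> 2 * u \<le> \<bar>psum X j \<omega>\<bar>" using i by linarith
      then show "\<omega> \<in> {\<omega> \<in> space M. pmax X n \<omega> \<ge> 2 * u}" using i j unfolding pmax_ge_iff
        by (auto intro: exI[of _ i] exI[of _ j])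
    qed auto
    also have "\<dots> \<le> 2 * prob {\<omega> \<in> space M. \<bar>psum X n \<omega>\<bar> \<ge> 2 * u - u}"
      using Ottaviani[OF psum_Chebyshev_half(1)[OF int mean u nv[unfolded v_def]] psum_Chebyshev_half(2)[OF int mean u nv[unfolded v_def]], of n "2 * u"] u
      by simp
    finally show ?case by (simp add: u_def mult.assoc)
  qed
qed

end

text \<open>Take the integers from t to a multiple of t^2 / log log t. Their number is of that
  order, they satisfy the constraint, and since they lie between t and t^2 their logarithms are
  comparable with those of t. The sum is therefore of the order of count times weight, which lowers
  the exponent \<open>b\<close> to \<open>b - 1\<close>.\<close>

lemma weighted_count_lower:
  assumes y: "0 < y"
  shows "\<exists>c>0. \<exists>t0\<ge>1. \<forall>t\<ge>t0. \<exists>A. finite A \<and> (\<forall>n\<in>A. n \<ge> 1 \<and> y * phi (real n) \<le> t) \<and>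
     c * (t\<^sup>2 * logl t powr a * loglogl t powr (b - 1)) \<le> (\<Sum>n\<in>A. logl (real n) powr a * loglogl (real n) powr b)"
proof -
  \<comment> \<open>As log log n \<le> 2 log log t on the chosen range, the constraint reduces to 4
    y^2 c0 \<le> 1; the bound c0 \<le> 1 gives n \<le> t^2.\<close>
  define c0 where "c0 = min 1 (1 / (4 * y\<^sup>2))"
  have c0: "0 < c0" "c0 \<le> 1" "c0 * (4 * y\<^sup>2) \<le> 1"
  proof -
    show "0 < c0" "c0 \<le> 1" using y by (auto simp: c0_def)
    have "c0 * (4 * y\<^sup>2) \<le> (1 / (4 * y\<^sup>2)) * (4 * y\<^sup>2)" by (intro mult_right_mono) (auto simp: c0_def)
    then show "c0 * (4 * y\<^sup>2) \<le> 1" using y by simp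
  qed
  define K where "K = 2 powr (\<bar>a\<bar> + \<bar>b\<bar>)"
  have K: "K > 0" by (simp add: K_def)
  have "filterlim (\<lambda>t. c0 / 2 * t\<^sup>2 / ln (ln t) - t - 1) at_top at_top" using c0 by real_asymp
  then have "\<forall>\<^sub>F t in at_top. c0 / 2 * t\<^sup>2 / ln (ln t) - t - 1 \<ge> 0" unfolding filterlim_at_top by blast
  then have "\<forall>\<^sub>F t in at_top. c0 / 2 * t\<^sup>2 / loglogl t \<ge> t + 1 \<and> t \<ge> 1"
    using eventually_loglogl eventually_ge_at_top[of 1] by eventually_elim auto
  then obtain t0 where t0: "\<And>t. t \<ge> t0 \<Longrightarrow> c0 / 2 * t\<^sup>2 / loglogl t \<ge> t + 1 \<and> t \<ge> 1"
    by (auto simp: eventually_at_top_linorder)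
  have "\<exists>A. finite A \<and> (\<forall>n\<in>A. n \<ge> 1 \<and> y * phi (real n) \<le> t) \<and>
     c0 / 2 / K * (t\<^sup>2 * logl t powr a * loglogl t powr (b - 1)) \<le> (\<Sum>n\<in>A. logl (real n) powr a * loglogl (real n) powr b)"
    if t: "t \<ge> t0" for t
  proof -
    have t1: "t \<ge> 1" and tb: "c0 / 2 * t\<^sup>2 / loglogl t \<ge> t + 1" using t0[OF t] by auto
    define N where "N = nat \<lfloor>c0 * t\<^sup>2 / loglogl t\<rfloor>"
    define m where "m = nat \<lceil>t\<rceil>"
    have Nle: "real N \<le> c0 * t\<^sup>2 / loglogl t" unfolding N_def
      by (intro of_nat_floor divide_nonneg_nonneg mult_nonneg_nonneg) (use c0 in \<open>auto simp: less_imp_le\<close>)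
    have Nge: "c0 * t\<^sup>2 / loglogl t - 1 \<le> real N" unfolding N_def by linarith
    have mle: "real m \<le> t + 1" "t \<le> real m" using t1 unfolding m_def by linarith+
    have bounds: "logl t \<le> logl (real n)" "logl (real n) \<le> 2 * logl t" "loglogl t \<le> loglogl (real n)" "loglogl (real n) \<le> 2 * loglogl t"
      if n: "m \<le> n" "n \<le> N" for n
    proof -
      have "t \<le> real n" using n(1) mle(2) by linarith
      then show "logl t \<le> logl (real n)" "loglogl t \<le> loglogl (real n)" by (auto intro: logl_mono loglogl_mono)
      have "real n \<le> c0 * t\<^sup>2 / loglogl t" using n(2) Nle by linarith
      also have "\<dots> \<le> 1 * t\<^sup>2 / 1" using c0 loglogl_ge_1[of t] by (intro frac_le mult_right_mono) auto
      finally have n2: "real n \<le> t\<^sup>2" by simp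
      show "logl (real n) \<le> 2 * logl t"
        using order_trans[OF logl_mono[OF n2] logl_power_le[of t 2]] t1 by simp
      have "loglogl (real n) \<le> (1 + ln (real 2)) * loglogl t"
        using order_trans[OF loglogl_mono[OF n2] loglogl_power_le[of t 2]] t1 by simp
      also have "\<dots> \<le> 2 * loglogl t" using ln_2_less_1 by (intro mult_right_mono) (auto simp: less_imp_le)
      finally show "loglogl (real n) \<le> 2 * loglogl t" .
    qed
    have th: "y * phi (real n) \<le> t" if n: "m \<le> n" "n \<le> N" for n
    proof -
      have "real n \<le> c0 * t\<^sup>2 / loglogl t" using n(2) Nle by linarith
      then have "2 * real n * loglogl (real n) \<le> 2 * (c0 * t\<^sup>2 / loglogl t) * (2 * loglogl t)"
        using bounds(4)[OF n] c0 by (intro mult_mono) (auto simp: less_imp_le)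
      also have "\<dots> = 4 * c0 * t\<^sup>2" using less_imp_neq[OF loglogl_pos[of t]] by simp
      finally have "y\<^sup>2 * (2 * real n * loglogl (real n)) \<le> y\<^sup>2 * (4 * c0 * t\<^sup>2)" by (intro mult_left_mono) auto
      also have "\<dots> \<le> 1 * t\<^sup>2"
        using mult_right_mono[OF c0(3), of "t\<^sup>2"] by (simp add: algebra_simps)
      finally have "sqrt (y\<^sup>2 * (2 * real n * loglogl (real n))) \<le> sqrt (t\<^sup>2)" by (intro real_sqrt_le_mono) simp
      then show ?thesis using y t1 by (simp add: phi_def real_sqrt_mult)
    qed
    have trm: "logl t powr a * loglogl t powr b / K \<le> logl (real n) powr a * loglogl (real n) powr b"
      if n: "n \<in> {m..N}" for n
    proof -
      have "logl t powr a * loglogl t powr b \<le> (2 powr \<bar>a\<bar> * logl (real n) powr a) * (2 powr \<bar>b\<bar> * loglogl (real n) powr b)"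
        using bounds[of n] n
        by (intro mult_mono powr_two_sided) (auto intro: order_trans[OF _ mult_right_mono[of 1 2]] simp: less_imp_le)
      then show ?thesis using K by (simp add: K_def powr_add field_simps)
    qed
    have card: "c0 / 2 * t\<^sup>2 / loglogl t \<le> real (card {m..N})"
    proof -
      have "real N + 1 - real m \<le> real (card {m..N})" by auto
      then show ?thesis using Nge mle tb by simp
    qed
    have "c0 / 2 / K * (t\<^sup>2 * logl t powr a * loglogl t powr (b - 1)) = (c0 / 2 * t\<^sup>2 / loglogl t) * (logl t powr a * loglogl t powr b / K)"
      using K less_imp_le[OF loglogl_pos[of t]] by (simp add: powr_diff field_simps)
    also have "\<dots> \<le> real (card {m..N}) * (logl t powr a * loglogl t powr b / K)"
      using K by (intro mult_right_mono card) auto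
    also have "\<dots> \<le> (\<Sum>n\<in>{m..N}. logl (real n) powr a * loglogl (real n) powr b)"
      by (rule sum_bounded_below) (rule trm)
    finally show ?thesis
      using th mle t1 by (intro exI[of _ "{m..N}"]) auto
  qed
  moreover have "t0 \<ge> 1" using t0[of t0] by simp
  moreover have "0 < c0 / 2 / K" using c0 K by simp
  ultimately show ?thesis by blast
qed

context iid_real begin

text \<open>Tonelli: the series is the expectation of the sum of n \<open>wt a b n\<close> over
  those n with y \<open>phi\<close> n \<le> |X|, and \<open>weighted_count_lower\<close> bounds this
  sum below by a multiple of the weighted square when |X| is large.\<close>

lemma integrable_of_jump_summable:
  assumes y: "0 < y"
    and sm: "summable (\<lambda>n. wt a b n * (real n * prob {\<omega> \<in> space M. \<bar>X 1 \<omega>\<bar> \<ge> y * phi (real n)}))"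
  shows "integrable M (\<lambda>\<omega>. (X 1 \<omega>)\<^sup>2 * logl \<bar>X 1 \<omega>\<bar> powr a * loglogl \<bar>X 1 \<omega>\<bar> powr (b - 1))"
proof -
  obtain c t0 where c: "c > 0" and t0: "t0 \<ge> 1" and low: "\<And>t. t \<ge> t0 \<Longrightarrow> \<exists>A. finite A \<and> (\<forall>n\<in>A. n \<ge> 1 \<and> y * phi (real n) \<le> t) \<and>
     c * (t\<^sup>2 * logl t powr a * loglogl t powr (b - 1)) \<le> (\<Sum>n\<in>A. logl (real n) powr a * loglogl (real n) powr b)"
    using weighted_count_lower[OF y, of a b] by blast
  define g where "g n = logl (real n) powr a * loglogl (real n) powr b" for n :: nat
  define G where "G n \<omega> = ennreal (wt a b n * real n) * indicator {\<omega> \<in> space M. \<bar>X 1 \<omega>\<bar> \<ge> y * phi (real n)} \<omega>" for n \<omega>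
  have G [measurable]: "G n \<in> borel_measurable M" for n unfolding G_def by measurable
  have "(\<integral>\<^sup>+\<omega>. (\<Sum>n. G n \<omega>) \<partial>M) = (\<Sum>n. (\<integral>\<^sup>+\<omega>. G n \<omega> \<partial>M))" by (intro nn_integral_suminf) simp
  also have "\<dots> = (\<Sum>n. ennreal (wt a b n * (real n * prob {\<omega> \<in> space M. \<bar>X 1 \<omega>\<bar> \<ge> y * phi (real n)})))"
    unfolding G_def by (subst nn_integral_cmult_indicator) (auto simp: emeasure_eq_measure ennreal_mult' mult.assoc)
  also have "\<dots> < \<infinity>" using sm by (subst suminf_ennreal2) auto
  finally have fin: "(\<integral>\<^sup>+\<omega>. (\<Sum>n. G n \<omega>) \<partial>M) < \<infinity>" .
  \<comment> \<open>Covers the values of |X| below \<open>t0\<close>. Absolute values of the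
    exponents give upper bounds because the logarithms are at least 1.\<close>
  define D where "D = t0\<^sup>2 * logl t0 powr \<bar>a\<bar> * loglogl t0 powr \<bar>b - 1\<bar>"
  define h where "h t = t\<^sup>2 * logl t powr a * loglogl t powr (b - 1)" for t :: real
  have pt: "ennreal (h \<bar>X 1 \<omega>\<bar>) \<le> ennreal (1 / c) * (\<Sum>n. G n \<omega>) + ennreal D" if sp: "\<omega> \<in> space M" for \<omega>
  proof (cases "\<bar>X 1 \<omega>\<bar> \<ge> t0")
    case True
    define t where "t = \<bar>X 1 \<omega>\<bar>"
    obtain A where A: "finite A" "\<forall>n\<in>A. n \<ge> 1 \<and> y * phi (real n) \<le> t" "c * h t \<le> (\<Sum>n\<in>A. g n)"
      using low[of t] True unfolding t_def h_def g_def by blast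
    have "ennreal (c * h t) \<le> ennreal (\<Sum>n\<in>A. g n)" by (intro ennreal_leI A)
    also have "\<dots> = (\<Sum>n\<in>A. ennreal (g n))" by (intro sum_ennreal[symmetric]) (simp add: g_def)
    also have "\<dots> \<le> (\<Sum>n\<in>A. G n \<omega>)"
    proof (intro sum_mono)
      fix n assume "n \<in> A"
      then show "ennreal (g n) \<le> G n \<omega>" using A(2) sp by (auto simp: G_def g_def wt_def t_def indicator_def)
    qed
    also have "\<dots> \<le> (\<Sum>n. G n \<omega>)" using A(1) by (intro sum_le_suminf) auto
    finally have "ennreal (1 / c) * ennreal (c * h t) \<le> ennreal (1 / c) * (\<Sum>n. G n \<omega>)" by (intro mult_left_mono) auto
    moreover have "ennreal (1 / c) * ennreal (c * h t) = ennreal (h t)"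
      using c by (subst ennreal_mult'[symmetric]) auto
    ultimately show ?thesis unfolding t_def by (simp add: add_increasing2)
  next
    case False
    define t where "t = \<bar>X 1 \<omega>\<bar>"
    have t: "0 \<le> t" "t \<le> t0" using False by (auto simp: t_def)
    have 1: "t\<^sup>2 \<le> t0\<^sup>2" using t by (intro power_mono) auto
    have 2: "logl t powr a \<le> logl t0 powr \<bar>a\<bar>"
      using t logl_ge_1[of t] logl_mono[OF t(2)] by (intro order_trans[OF powr_mono[of a "\<bar>a\<bar>"] powr_mono2]) auto
    have 3: "loglogl t powr (b - 1) \<le> loglogl t0 powr \<bar>b - 1\<bar>"
      using t loglogl_ge_1[of t] loglogl_mono[OF t(2)] by (intro order_trans[OF powr_mono[of "b - 1" "\<bar>b - 1\<bar>"] powr_mono2]) auto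
    have "h t \<le> D" unfolding h_def D_def using 1 2 3 by (intro mult_mono) auto
    then show ?thesis unfolding t_def[symmetric] by (simp add: add_increasing ennreal_leI)
  qed
  have "integrable M (\<lambda>\<omega>. h \<bar>X 1 \<omega>\<bar>)"
  proof (rule integrableI_nonneg)
    show "(\<lambda>\<omega>. h \<bar>X 1 \<omega>\<bar>) \<in> borel_measurable M" unfolding h_def by measurable
    show "AE \<omega> in M. 0 \<le> h \<bar>X 1 \<omega>\<bar>" by (simp add: h_def)
    have "(\<integral>\<^sup>+\<omega>. ennreal (h \<bar>X 1 \<omega>\<bar>) \<partial>M) \<le> (\<integral>\<^sup>+\<omega>. ennreal (1 / c) * (\<Sum>n. G n \<omega>) + ennreal D \<partial>M)"
      by (intro nn_integral_mono pt)
    also have "\<dots> = ennreal (1 / c) * (\<integral>\<^sup>+\<omega>. (\<Sum>n. G n \<omega>) \<partial>M) + ennreal D"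
      by (subst nn_integral_add) (auto simp: nn_integral_cmult emeasure_space_1)
    also have "\<dots> < \<infinity>" using fin by (simp add: ennreal_mult_less_top)
    finally show "(\<integral>\<^sup>+\<omega>. ennreal (h \<bar>X 1 \<omega>\<bar>) \<partial>M) < \<infinity>" .
  qed
  then show ?thesis by (simp add: h_def)
qed

lemma integrable_of_summable:
  assumes int: "integrable M (\<lambda>\<omega>. (X 1 \<omega>)\<^sup>2)" and mean: "expectation (X 1) = 0" and x: "0 < x"
    and sm: "summable (\<lambda>n. wt a b n * prob {\<omega> \<in> space M. \<bar>psum X n \<omega>\<bar> \<ge> x * phi (real n)})"
  shows "integrable M (\<lambda>\<omega>. (X 1 \<omega>)\<^sup>2 * logl \<bar>X 1 \<omega>\<bar> powr a * loglogl \<bar>X 1 \<omega>\<bar> powr (b - 1))"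
proof (rule integrable_of_jump_summable)
  show "0 < 4 * x" using x by simp
  show "summable (\<lambda>n. wt a b n * (real n * prob {\<omega> \<in> space M. \<bar>X 1 \<omega>\<bar> \<ge> 4 * x * phi (real n)}))"
  proof (rule summable_comparison_test_ev)
    show "summable (\<lambda>n. 4 * (wt a b n * prob {\<omega> \<in> space M. \<bar>psum X n \<omega>\<bar> \<ge> x * phi (real n)}))"
      using sm by (intro summable_mult)
    show "\<forall>\<^sub>F n in sequentially. norm (wt a b n * (real n * prob {\<omega> \<in> space M. \<bar>X 1 \<omega>\<bar> \<ge> 4 * x * phi (real n)}))
      \<le> 4 * (wt a b n * prob {\<omega> \<in> space M. \<bar>psum X n \<omega>\<bar> \<ge> x * phi (real n)})"
      using prob_jump_le_psum[OF int mean x]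
    proof eventually_elim
      case (elim n)
      then show ?case using mult_left_mono[OF elim wt_nonneg[of a b n]] by simp
    qed
  qed
qed

end

subsection \<open>Truncation\<close>

text \<open>Large values become 0 rather than the level itself: a jump then contributes the factor 1
  to an exponential of the truncated sum, which \<open>tsum_exp_moment_jump\<close>
  exploits.\<close>

definition trunc :: "real \<Rightarrow> real \<Rightarrow> real" where
  "trunc k x = (if \<bar>x\<bar> \<le> k then x else 0)"

text \<open>The size of what truncation removes, see \<open>abs_diff_trunc\<close>. It is the whole
  of |x| and not only the part above the level.\<close>

definition excess :: "real \<Rightarrow> real \<Rightarrow> real" where
  "excess k x = (if \<bar>x\<bar> \<le> k then 0 else \<bar>x\<bar>)"

lemma trunc_measurable [measurable]: "trunc k \<in> borel_measurable borel"
  unfolding trunc_def by measurable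

lemma excess_measurable [measurable]: "excess k \<in> borel_measurable borel"
  unfolding excess_def by measurable

lemma excess_nonneg [simp]: "0 \<le> excess k x"
  by (simp add: excess_def)

lemma excess_le: "excess k x \<le> \<bar>x\<bar>"
  by (simp add: excess_def)

lemma sum_inverse_sqrt_le:
  assumes "finite A" "\<And>n. n \<in> A \<Longrightarrow> real n \<le> N" "0 \<le> N"
  shows "(\<Sum>n\<in>A. 1 / sqrt (real n)) \<le> 2 * sqrt N"
proof (cases "A \<subseteq> {0}")
  case True
  then have "(\<Sum>n\<in>A. 1 / sqrt (real n)) = 0" by (intro sum.neutral) auto
  then show ?thesis using assms(3) by simp
next
  case False
  define m where "m = Max A"
  have "A \<noteq> {}" using False by auto
  then have m: "m \<in> A" "A \<subseteq> {..m}" using assms(1) by (auto simp: m_def)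
  have step: "1 / sqrt (real (Suc n)) \<le> 2 * (sqrt (real (Suc n)) - sqrt (real n))" for n
  proof -
    define u w where "u = sqrt (real (Suc n))" and "w = sqrt (real n)"
    have uw: "0 \<le> w" "w \<le> u" "0 < u" "u * u = w * w + 1" by (auto simp: u_def w_def)
    have "(u - w) * (u + w) = 1" using uw by (simp add: algebra_simps)
    moreover have "(u - w) * (u + w) \<le> (u - w) * (2 * u)" using uw by (intro mult_left_mono) auto
    ultimately have "1 \<le> (2 * (u - w)) * u" by (simp add: algebra_simps)
    then show ?thesis using uw unfolding u_def[symmetric] w_def[symmetric] by (simp add: pos_divide_le_eq)
  qed
  have "(\<Sum>n\<in>A. 1 / sqrt (real n)) \<le> (\<Sum>n\<in>{..m}. 1 / sqrt (real n))"
    using m by (intro sum_mono2) auto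
  also have "\<dots> \<le> 2 * sqrt (real m)"
  proof (induction m)
    case (Suc m) then show ?case using step[of m] by simp
  qed simp
  also have "\<dots> \<le> 2 * sqrt N" using assms(2)[OF m(1)] by simp
  finally show ?thesis .
qed

text \<open>Indices below t^(1/4) contribute O(t^(1/4)), which is negligible. For the others all
  logarithms are comparable with those of t, so the weights come out of the sum, and the constraint
  gives sqrt n = O(t (log log t)^(-p)); what remains is a sum of n^(-1/2).\<close>

lemma weighted_sum_upper:
  fixes c p \<alpha> \<beta> :: real
  assumes c: "0 < c"
  shows "\<exists>C>0. \<forall>t\<ge>1. \<forall>A. finite A \<longrightarrow> (\<forall>n\<in>A. c * sqrt (real n) * loglogl (real n) powr p < t) \<longrightarrow>
    (\<Sum>n\<in>A. logl (real n) powr \<alpha> * loglogl (real n) powr \<beta> / sqrt (real n))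
      \<le> C * (t * logl t powr \<alpha> * loglogl t powr (\<beta> - p))"
proof -
  obtain C1 where C1: "C1 > 0" "\<And>x. x \<ge> 1 \<Longrightarrow> x powr (-1/6) * logl x powr 0 * loglogl x powr (-p) \<le> C1"
    using bounded_powr_log[of "-1/6" 0 "-p"] by auto
  obtain C2 where C2: "C2 > 0" "\<And>x. x \<ge> 1 \<Longrightarrow> x powr (-1/2) * logl x powr \<alpha> * loglogl x powr \<beta> \<le> C2"
    using bounded_powr_log[of "-1/2" \<alpha> \<beta>] by auto
  obtain C3 where C3: "C3 > 0" "\<And>x. x \<ge> 1 \<Longrightarrow> x powr (-3/4) * logl x powr (-\<alpha>) * loglogl x powr (p-\<beta>) \<le> C3"
    using bounded_powr_log[of "-3/4" "-\<alpha>" "p-\<beta>"] by auto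
  define D where "D = max 1 (C1 / c)"
  have D: "D \<ge> 1" "C1 / c \<le> D" by (auto simp: D_def)
  \<comment> \<open>One constant for all four comparisons of log and log log between n and t. They
    rest on t \<le> n^4 and n \<le> (D t)^3.\<close>
  define K where "K = 4 * (1 + ln D) * (1 + ln (1 + ln D))"
  have lnD: "ln D \<ge> 0" using D by simp
  have ll: "ln (1 + ln D) \<ge> 0" using lnD by simp
  have K: "K \<ge> 1" "4 * (1 + ln D) \<le> K" "4 * (1 + ln (1 + ln D)) \<le> K" "4 \<le> K"
  proof -
    have a: "1 * 1 \<le> (1 + ln D) * (1 + ln (1 + ln D))" using lnD ll by (intro mult_mono) auto
    have b: "(1 + ln D) * 1 \<le> (1 + ln D) * (1 + ln (1 + ln D))" using lnD ll by (intro mult_left_mono) auto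
    have c: "1 * (1 + ln (1 + ln D)) \<le> (1 + ln D) * (1 + ln (1 + ln D))" using lnD ll by (intro mult_right_mono) auto
    show "4 \<le> K" "4 * (1 + ln D) \<le> K" "4 * (1 + ln (1 + ln D)) \<le> K" using a b c by (auto simp: K_def algebra_simps)
    then show "K \<ge> 1" by linarith
  qed
  define Q where "Q = K powr (\<bar>\<alpha>\<bar> + \<bar>\<beta>\<bar> + \<bar>p\<bar>)"
  define C where "C = 2 * C2 * C3 + Q * (2 / c)"
  have "(\<Sum>n\<in>A. logl (real n) powr \<alpha> * loglogl (real n) powr \<beta> / sqrt (real n)) \<le> C * (t * logl t powr \<alpha> * loglogl t powr (\<beta> - p))"
    if t: "t \<ge> 1" and fA: "finite A" and A: "\<And>n. n \<in> A \<Longrightarrow> c * sqrt (real n) * loglogl (real n) powr p < t" for t A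
  proof -
    let ?g = "\<lambda>n. logl (real n) powr \<alpha> * loglogl (real n) powr \<beta> / sqrt (real n)"
    let ?R = "t * logl t powr \<alpha> * loglogl t powr (\<beta> - p)"
    define A1 where "A1 = {n \<in> A. real n < t powr (1/4)}"
    define A2 where "A2 = {n \<in> A. t powr (1/4) \<le> real n}"
    have split: "(\<Sum>n\<in>A. ?g n) = (\<Sum>n\<in>A1. ?g n) + (\<Sum>n\<in>A2. ?g n)"
      unfolding A1_def A2_def using fA
      by (subst sum.union_disjoint[symmetric]) (auto intro!: sum.cong)
    have "(\<Sum>n\<in>A1. ?g n) \<le> (\<Sum>n\<in>{..nat \<lfloor>t powr (1/4)\<rfloor>}. C2)"
    proof (rule order_trans[OF sum_mono2 sum_mono])
      show "A1 \<subseteq> {..nat \<lfloor>t powr (1/4)\<rfloor>}" unfolding A1_def by (auto simp: le_nat_floor)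
      show "?g n \<le> C2" for n
        using C2(2)[of "real n"] C2(1) by (cases "n = 0") (auto simp: powr_minus powr_half_sqrt field_simps)
    qed auto
    also have "\<dots> \<le> 2 * t powr (1/4) * C2"
    proof -
      have "real (nat \<lfloor>t powr (1/4)\<rfloor>) \<le> t powr (1/4)" by (intro of_nat_floor) simp
      moreover have "1 \<le> t powr (1/4)" using t by (simp add: ge_one_powr_ge_zero)
      ultimately have "real (Suc (nat \<lfloor>t powr (1/4)\<rfloor>)) \<le> 2 * t powr (1/4)"
        unfolding of_nat_Suc by linarith
      then show ?thesis using C2(1) by (simp add: mult_right_mono)
    qed
    also have "t powr (1/4) = (t powr (-3/4) * logl t powr (-\<alpha>) * loglogl t powr (p-\<beta>)) * ?R"
    proof -
      have "t powr (1/4) = t powr (-3/4) * t" using t powr_add[of t "-3/4" 1] by simp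
      moreover have "logl t powr (-\<alpha>) * logl t powr \<alpha> = 1" "loglogl t powr (p-\<beta>) * loglogl t powr (\<beta>-p) = 1"
        using less_imp_neq[OF logl_pos[of t]] less_imp_neq[OF loglogl_pos[of t]] by (auto simp: powr_add[symmetric])
      ultimately show ?thesis by (simp add: mult_ac)
    qed
    also have "2 * \<dots> * C2 \<le> 2 * (C3 * ?R) * C2"
      using C3(2)[OF t] C2(1) t by (intro mult_right_mono mult_left_mono) auto
    finally have S1: "(\<Sum>n\<in>A1. ?g n) \<le> 2 * C2 * C3 * ?R" by (simp add: mult_ac)
    have comp: "logl (real n) \<le> K * logl t" "logl t \<le> K * logl (real n)" "loglogl (real n) \<le> K * loglogl t" "loglogl t \<le> K * loglogl (real n)" "n \<noteq> 0"
      if n: "n \<in> A2" for n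
    proof -
      have n4: "t powr (1/4) \<le> real n" and nA: "n \<in> A" using n by (auto simp: A2_def)
      have "1 \<le> t powr (1/4)" using t by (simp add: ge_one_powr_ge_zero)
      then have n1: "real n \<ge> 1" using n4 by linarith
      then show "n \<noteq> 0" by auto
      have "t = (t powr (1/4)) ^ 4" using t by (simp add: powr_realpow[symmetric] powr_powr)
      also have "\<dots> \<le> real n ^ 4" using n4 by (intro power_mono) auto
      finally have tn: "t \<le> real n ^ 4" .
      have "logl t \<le> 4 * logl (real n)"
        using order_trans[OF logl_mono[OF tn] logl_power_le[of "real n" 4]] by simp
      also have "\<dots> \<le> K * logl (real n)" using K by (intro mult_right_mono) (auto simp: less_imp_le)
      finally show "logl t \<le> K * logl (real n)" .
      have "loglogl t \<le> (1 + ln (real 4)) * loglogl (real n)"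
        using order_trans[OF loglogl_mono[OF tn] loglogl_power_le[of "real n" 4]] by simp
      also have "\<dots> \<le> K * loglogl (real n)" using K ln_le_minus_one[of 4] by (intro mult_right_mono) (auto simp: less_imp_le)
      finally show "loglogl t \<le> K * loglogl (real n)" .
      \<comment> \<open>A crude bound that works for either sign of \<open>p\<close>: since n^(1/6)
        dominates every power of log log n, n^(1/3) is at most a constant times sqrt n (log log
        n)^p.\<close>
      have "real n powr (1/3) = sqrt (real n) * loglogl (real n) powr p * (real n powr (-1/6) * logl (real n) powr 0 * loglogl (real n) powr (-p))"
      proof -
        have "real n powr (1/3) = real n powr (1/2) * real n powr (-1/6)" by (simp add: powr_add[symmetric])
        moreover have "loglogl (real n) powr p * loglogl (real n) powr (-p) = 1"
          using less_imp_neq[OF loglogl_pos[of "real n"]] by (auto simp: powr_add[symmetric])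
        ultimately show ?thesis using n1 less_imp_neq[OF logl_pos[of "real n"]] by (simp add: powr_half_sqrt mult_ac)
      qed
      also have "\<dots> \<le> sqrt (real n) * loglogl (real n) powr p * C1" by (intro mult_left_mono C1(2) n1) auto
      also have "\<dots> \<le> (t / c) * C1" using A[OF nA] c C1(1) by (intro mult_right_mono) (auto simp: field_simps)
      also have "\<dots> \<le> D * t" using mult_right_mono[OF D(2), of t] t by (simp add: field_simps)
      finally have "(real n powr (1/3)) ^ 3 \<le> (D * t) ^ 3" by (intro power_mono) auto
      moreover have "(real n powr (1/3)) ^ 3 = real n" using n1 by (simp add: powr_realpow[symmetric] powr_powr)
      ultimately have nt: "real n \<le> (D * t) ^ 3" by simp
      have Dt: "0 \<le> D * t" using D t by auto
      have "logl (real n) \<le> 3 * logl (D * t)"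
        using order_trans[OF logl_mono[OF nt] logl_power_le[of "D * t" 3]] Dt by simp
      also have "\<dots> \<le> 3 * ((1 + ln D) * logl t)" using logl_mult_le[OF D(1), of t] by simp
      also have "\<dots> = (3 * (1 + ln D)) * logl t" by simp
      also have "\<dots> \<le> K * logl t" using K lnD by (intro mult_right_mono) (auto simp: less_imp_le)
      finally show "logl (real n) \<le> K * logl t" .
      have "loglogl (real n) \<le> (1 + ln (real 3)) * loglogl (D * t)"
        using order_trans[OF loglogl_mono[OF nt] loglogl_power_le[of "D * t" 3]] Dt by simp
      also have "\<dots> \<le> 4 * ((1 + ln (1 + ln D)) * loglogl t)"
        using loglogl_mult_le[OF D(1), of t] ln_le_minus_one[of 3] by (intro mult_mono) (auto simp: less_imp_le)
      also have "\<dots> = (4 * (1 + ln (1 + ln D))) * loglogl t" by simp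
      also have "\<dots> \<le> K * loglogl t" using K by (intro mult_right_mono) (auto simp: less_imp_le)
      finally show "loglogl (real n) \<le> K * loglogl t" .
    qed
    define V where "V = (t / c) * (K powr \<bar>p\<bar> * loglogl t powr (-p))"
    have V0: "V \<ge> 0" using t c by (simp add: V_def)
    have nV: "real n \<le> V\<^sup>2" if n: "n \<in> A2" for n
    proof -
      have "c * sqrt (real n) * loglogl (real n) powr p < t" using A n by (auto simp: A2_def)
      then have "sqrt (real n) * loglogl (real n) powr p \<le> t / c" using c by (simp add: field_simps)
      then have "sqrt (real n) * loglogl (real n) powr p * loglogl (real n) powr (-p) \<le> t / c * loglogl (real n) powr (-p)"
        by (intro mult_right_mono) auto
      moreover have "loglogl (real n) powr p * loglogl (real n) powr (-p) = 1"
        using less_imp_neq[OF loglogl_pos[of "real n"]] by (auto simp: powr_add[symmetric])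
      ultimately have "sqrt (real n) \<le> t / c * loglogl (real n) powr (-p)" by (simp add: mult.assoc)
      also have "\<dots> \<le> V" unfolding V_def
        using powr_two_sided[of "loglogl (real n)" "loglogl t" K "-p"] comp[OF n] K t c by (intro mult_left_mono) auto
      finally have "(sqrt (real n))\<^sup>2 \<le> V\<^sup>2" by (intro power_mono) auto
      then show ?thesis by simp
    qed
    have "(\<Sum>n\<in>A2. ?g n) \<le> (\<Sum>n\<in>A2. (K powr \<bar>\<alpha>\<bar> * logl t powr \<alpha>) * (K powr \<bar>\<beta>\<bar> * loglogl t powr \<beta>) * (1 / sqrt (real n)))"
    proof (intro sum_mono)
      fix n assume n: "n \<in> A2"
      have "logl (real n) powr \<alpha> * loglogl (real n) powr \<beta> \<le> (K powr \<bar>\<alpha>\<bar> * logl t powr \<alpha>) * (K powr \<bar>\<beta>\<bar> * loglogl t powr \<beta>)"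
        using comp[OF n] K by (intro mult_mono powr_two_sided) auto
      from mult_right_mono[OF this, of "1 / sqrt (real n)"]
      show "?g n \<le> (K powr \<bar>\<alpha>\<bar> * logl t powr \<alpha>) * (K powr \<bar>\<beta>\<bar> * loglogl t powr \<beta>) * (1 / sqrt (real n))" by simp
    qed
    also have "\<dots> = (K powr \<bar>\<alpha>\<bar> * logl t powr \<alpha>) * (K powr \<bar>\<beta>\<bar> * loglogl t powr \<beta>) * (\<Sum>n\<in>A2. 1 / sqrt (real n))"
      by (simp only: sum_distrib_left)
    also have "\<dots> \<le> (K powr \<bar>\<alpha>\<bar> * logl t powr \<alpha>) * (K powr \<bar>\<beta>\<bar> * loglogl t powr \<beta>) * (2 * sqrt (V\<^sup>2))"
      using fA nV by (intro mult_left_mono sum_inverse_sqrt_le) (auto simp: A2_def)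
    also have "\<dots> = Q * (2 / c) * ?R"
    proof -
      have "sqrt (V\<^sup>2) = V" using V0 by simp
      moreover have "Q = K powr \<bar>\<alpha>\<bar> * K powr \<bar>\<beta>\<bar> * K powr \<bar>p\<bar>" by (simp add: Q_def powr_add)
      moreover have "loglogl t powr (\<beta> - p) = loglogl t powr \<beta> * loglogl t powr (- p)"
        using powr_add[of "loglogl t" \<beta> "- p"] by simp
      ultimately show ?thesis by (simp only: V_def times_divide_eq_left times_divide_eq_right mult_ac)
    qed
    finally have S2: "(\<Sum>n\<in>A2. ?g n) \<le> Q * (2 / c) * ?R" .
    show ?thesis using S1 S2 unfolding split C_def by (simp add: distrib_right)
  qed
  moreover have "C > 0" using C2 C3 c unfolding C_def Q_def by (intro add_pos_nonneg) auto
  ultimately show ?thesis by blast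
qed

text \<open>Telescoping against 4 / sqrt n. For consecutive square roots w \<le> u one has u \<le> 3
  w / 2, hence u (u + w) \<le> 15 w^2 / 4, and 4 covers this.\<close>

lemma sum_inverse_three_halves_le:
  assumes "finite A" "\<And>n. n \<in> A \<Longrightarrow> N \<le> real n" "0 < N"
  shows "(\<Sum>n\<in>A. 1 / (real n * sqrt (real n))) \<le> 4 / sqrt N"
proof (cases "A = {}")
  case True then show ?thesis using assms by simp
next
  case False
  define m where "m = Min A"
  have m: "m \<in> A" "\<And>n. n \<in> A \<Longrightarrow> m \<le> n" using assms(1) False by (auto simp: m_def)
  have m0: "m > 0" using assms(2)[OF m(1)] assms(3) by (cases m) auto
  have step: "1 / (real n * sqrt (real n)) \<le> 4 / sqrt (real n) - 4 / sqrt (real (Suc n))" if "n > 0" for n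
  proof -
    define u w where "u = sqrt (real (Suc n))" and "w = sqrt (real n)"
    have uw: "0 < w" "w \<le> u" "u * u = w * w + 1" "w * w = real n" using that by (auto simp: u_def w_def)
    have w1: "1 \<le> w" using that by (simp add: w_def)
    have u2: "u \<le> 3/2 * w"
    proof (rule power2_le_imp_le)
      have "u\<^sup>2 = w * w + 1" using uw by (simp add: power2_eq_square)
      also have "\<dots> \<le> (3/2 * w)\<^sup>2" using mult_mono[OF w1 w1] uw by (simp add: power2_eq_square)
      finally show "u\<^sup>2 \<le> (3/2 * w)\<^sup>2" .
    qed (use uw in auto)
    have "u * (u + w) \<le> (3/2 * w) * (5/2 * w)" using u2 uw by (intro mult_mono) auto
    then have "u * (u + w) \<le> 4 * (w * w)" using uw by (auto intro: order_trans)
    moreover have "(u - w) * (u + w) = 1" using uw by (simp add: algebra_simps)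
    ultimately have "u * ((u - w) * (u + w)) \<le> 4 * (w * w) * (u - w)" 
      using uw mult_right_mono[of "u * (u + w)" "4 * (w * w)" "u - w"] by (simp add: mult_ac)
    then have "u \<le> 4 * (w * w) * (u - w)" using \<open>(u - w) * (u + w) = 1\<close> by simp
    then have le: "u / (w * w * (u * w)) \<le> 4 * (w * w) * (u - w) / (w * w * (u * w))"
      using uw(1,2) by (intro divide_right_mono) auto
    have "u > 0" using uw(1,2) by linarith
    then have "u / (w * w * (u * w)) = 1 / (w * w * w)" "4 * (w * w) * (u - w) / (w * w * (u * w)) = 4 / w - 4 / u"
      using uw(1) by (simp_all add: field_simps)
    with le have "1 / (w * w * w) \<le> 4 / w - 4 / u" by simp
    then show ?thesis using uw(4) by (simp add: u_def w_def mult_ac)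
  qed
  have "(\<Sum>n\<in>A. 1 / (real n * sqrt (real n))) \<le> (\<Sum>n\<in>{m..<Suc (Max A)}. 1 / (real n * sqrt (real n)))"
    using assms(1) m by (intro sum_mono2) (auto simp: less_Suc_eq_le)
  also have "\<dots> \<le> (\<Sum>n\<in>{m..<Suc (Max A)}. 4 / sqrt (real n) - 4 / sqrt (real (Suc n)))"
    using m0 by (intro sum_mono step) auto
  also have "\<dots> = 4 / sqrt (real m) - 4 / sqrt (real (Suc (Max A)))"
  proof -
    have "m \<le> Suc (Max A)" using m assms(1) by (simp add: le_SucI)
    then show ?thesis using sum_Suc_diff'[of m "Suc (Max A)" "\<lambda>n. - 4 / sqrt (real n)"] by simp
  qed
  also have "\<dots> \<le> 4 / sqrt (real m)" by simp
  also have "\<dots> \<le> 4 / sqrt N" using assms(2)[OF m(1)] assms(3) by (intro divide_left_mono) (auto simp: m0)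
  finally show ?thesis .
qed

text \<open>Exchange of sum and expectation: it is enough to bound the partial sums pointwise by one
  integrable variable.\<close>

lemma summable_of_pointwise:
  fixes F :: "nat \<Rightarrow> 'a \<Rightarrow> real"
  assumes F: "\<And>n. integrable M (F n)" "\<And>n \<omega>. 0 \<le> F n \<omega>"
    and H: "integrable M H" "\<And>N \<omega>. (\<Sum>n<N. F n \<omega>) \<le> H \<omega>"
  shows "summable (\<lambda>n. \<integral>\<omega>. F n \<omega> \<partial>M)"
proof (rule bounded_imp_summable)
  show "0 \<le> (\<integral>\<omega>. F n \<omega> \<partial>M)" for n using F by simp
  show "(\<Sum>k\<le>n. \<integral>\<omega>. F k \<omega> \<partial>M) \<le> (\<integral>\<omega>. H \<omega> \<partial>M)" for n
  proof -
    have "(\<Sum>k\<le>n. \<integral>\<omega>. F k \<omega> \<partial>M) = (\<integral>\<omega>. (\<Sum>k\<le>n. F k \<omega>) \<partial>M)" using F by simp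
    also have "\<dots> \<le> (\<integral>\<omega>. H \<omega> \<partial>M)"
      using F H H(2)[where N = "Suc n"] by (intro integral_mono) (auto simp: lessThan_Suc_atMost)
    finally show ?thesis .
  qed
qed

context iid_real begin

text \<open>At |X| = t only the indices whose level is below t contribute, each with a multiple of
  t, and \<open>weighted_sum_upper\<close> supplies a second factor t together with the logarithms.
  It is used with p = -1/2 at the truncation level and with p = 1/2 for large jumps.\<close>

lemma summable_tail_moment:
  fixes c p \<alpha> \<beta> :: real
  assumes c: "0 < c" and int: "integrable M (\<lambda>\<omega>. (X 1 \<omega>)\<^sup>2)"
    and intG: "integrable M (\<lambda>\<omega>. (X 1 \<omega>)\<^sup>2 * logl \<bar>X 1 \<omega>\<bar> powr \<alpha> * loglogl \<bar>X 1 \<omega>\<bar> powr (\<beta> - p))"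
  shows "summable (\<lambda>n. wt \<alpha> \<beta> n * (sqrt (real n) *
     expectation (\<lambda>\<omega>. excess (c * sqrt (real n) * loglogl (real n) powr p) (X 1 \<omega>))))"
proof -
  from weighted_sum_upper[OF c, of p \<alpha> \<beta>]
  obtain C where C: "C > 0" "\<forall>t\<ge>1. \<forall>A. finite A \<longrightarrow> (\<forall>n\<in>A. c * sqrt (real n) * loglogl (real n) powr p < t) \<longrightarrow>
    (\<Sum>n\<in>A. logl (real n) powr \<alpha> * loglogl (real n) powr \<beta> / sqrt (real n))
      \<le> C * (t * logl t powr \<alpha> * loglogl t powr (\<beta> - p))"
    by (elim exE conjE)
  define g where "g n = logl (real n) powr \<alpha> * loglogl (real n) powr \<beta> / sqrt (real n)" for n
  have g: "g n \<ge> 0" for n by (simp add: g_def)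
  have int1: "integrable M (\<lambda>\<omega>. \<bar>X 1 \<omega>\<bar>)"
    by (intro integrable_abs square_integrable_imp_integrable[OF _ int]) simp
  define F where "F n \<omega> = g n * excess (c * sqrt (real n) * loglogl (real n) powr p) (X 1 \<omega>)" for n \<omega>
  define G where "G t = t\<^sup>2 * logl t powr \<alpha> * loglogl t powr (\<beta> - p)" for t :: real
  have low: "logl t = 1" "loglogl t = 1" if "t \<le> 1" for t
  proof -
    have "t \<le> exp 1" using that by (meson order_trans one_le_exp_iff zero_le_one)
    then show "logl t = 1" by (simp add: logl_def max_def)
    then show "loglogl t = 1" unfolding loglogl_def by (simp add: logl_def max_def)
  qed
  have "summable (\<lambda>n. expectation (F n))"
  proof (rule summable_of_pointwise)
    show "integrable M (F n)" for n unfolding F_def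
    proof (intro integrable_mult_right)
      show "integrable M (\<lambda>\<omega>. excess (c * sqrt (real n) * loglogl (real n) powr p) (X 1 \<omega>))"
        by (rule Bochner_Integration.integrable_bound[OF int1]) (auto simp: excess_le)
    qed
    show "0 \<le> F n \<omega>" for n \<omega> using g by (simp add: F_def)
    show "integrable M (\<lambda>\<omega>. C * (1 + G \<bar>X 1 \<omega>\<bar>))"
      using intG by (simp add: G_def)
    show "(\<Sum>n<N. F n \<omega>) \<le> C * (1 + G \<bar>X 1 \<omega>\<bar>)" for N \<omega>
    proof -
      define t where "t = \<bar>X 1 \<omega>\<bar>"
      define A where "A = {n. n < N \<and> c * sqrt (real n) * loglogl (real n) powr p < t}"
      have t0: "t \<ge> 0" by (simp add: t_def)
      have "(\<Sum>n<N. F n \<omega>) = (\<Sum>n\<in>A. g n * t)"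
        unfolding F_def A_def t_def by (rule sum.mono_neutral_cong_right) (auto simp: excess_def)
      also have "\<dots> = t * (\<Sum>n\<in>A. g n)" by (simp add: sum_distrib_left mult.commute)
      \<comment> \<open>\<open>weighted_sum_upper\<close> needs an argument of at least 1; enlarging
        \<open>t\<close> to \<open>max 1 t\<close> only weakens the constraint on n.\<close>
      also have "\<dots> \<le> t * (C * (max 1 t * logl (max 1 t) powr \<alpha> * loglogl (max 1 t) powr (\<beta> - p)))"
        unfolding g_def using t0 by (intro mult_left_mono C(2)[rule_format]) (auto simp: A_def)
      also have "\<dots> \<le> C * (1 + G t)"
      proof (cases "t \<le> 1")
        case True
        have "G t \<ge> 0" by (simp add: G_def)
        then have "0 \<le> C * G t" using C(1) by simp
        moreover have "t * C \<le> 1 * C" using True C(1) by (intro mult_right_mono) auto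
        moreover have "max 1 t = 1" using True by simp
        ultimately show ?thesis using low[of 1] by (simp add: distrib_left)
      next
        case False
        then show ?thesis using C(1) by (simp add: max_def G_def power2_eq_square distrib_left mult_ac)
      qed
      finally show ?thesis by (simp add: t_def)
    qed
  qed
  moreover have "g n = wt \<alpha> \<beta> n * sqrt (real n)" for n
  proof -
    have "wt \<alpha> \<beta> n * sqrt (real n) = logl (real n) powr \<alpha> * loglogl (real n) powr \<beta> * (sqrt (real n) / real n)"
      by (simp add: wt_def)
    also have "sqrt (real n) / real n = 1 / sqrt (real n)" by (simp add: sqrt_divide_self_eq inverse_eq_divide)
    finally show ?thesis by (simp add: g_def)
  qed
  moreover have "expectation (F n) = g n * expectation (\<lambda>\<omega>. excess (c * sqrt (real n) * loglogl (real n) powr p) (X 1 \<omega>))" for n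
    unfolding F_def by simp
  ultimately show ?thesis by (simp only: mult.assoc)
qed

text \<open>At |X| = t only the n with t \<le> c sqrt n contribute. The sum of n^(-3/2) over them is
  at most 4 c / t, and multiplied by t^3 this is 4 c t^2.\<close>

lemma summable_truncated_third_moment:
  fixes c :: real and k :: "nat \<Rightarrow> real"
  assumes c: "0 < c" and int: "integrable M (\<lambda>\<omega>. (X 1 \<omega>)\<^sup>2)" and k: "\<And>n. k n \<le> c * sqrt (real n)"
  shows "summable (\<lambda>n. 1 / (real n * sqrt (real n)) * expectation (\<lambda>\<omega>. \<bar>trunc (k n) (X 1 \<omega>)\<bar> ^ 3))"
proof -
  define F where "F n \<omega> = 1 / (real n * sqrt (real n)) * \<bar>trunc (k n) (X 1 \<omega>)\<bar> ^ 3" for n \<omega>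
  have "summable (\<lambda>n. expectation (F n))"
  proof (rule summable_of_pointwise)
    show "integrable M (F n)" for n unfolding F_def
    proof (intro integrable_mult_right integrable_const_bound[where B = "\<bar>k n\<bar> ^ 3"] AE_I2)
      show "norm (\<bar>trunc (k n) (X 1 \<omega>)\<bar> ^ 3) \<le> \<bar>k n\<bar> ^ 3" for \<omega>
        by (auto simp: trunc_def intro!: power_mono)
    qed auto
    show "0 \<le> F n \<omega>" for n \<omega> by (simp add: F_def)
    show "integrable M (\<lambda>\<omega>. 4 * c * (X 1 \<omega>)\<^sup>2)" using int by simp
    show "(\<Sum>n<N. F n \<omega>) \<le> 4 * c * (X 1 \<omega>)\<^sup>2" for N \<omega>
    proof -
      define t where "t = \<bar>X 1 \<omega>\<bar>"
      define A where "A = {n. n < N \<and> t \<le> k n}"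
      have "(\<Sum>n<N. F n \<omega>) = (\<Sum>n\<in>A. 1 / (real n * sqrt (real n)) * t ^ 3)"
        unfolding F_def A_def t_def by (rule sum.mono_neutral_cong_right) (auto simp: trunc_def)
      also have "\<dots> = t ^ 3 * (\<Sum>n\<in>A. 1 / (real n * sqrt (real n)))" by (simp add: sum_distrib_left mult.commute)
      also have "\<dots> \<le> 4 * c * t\<^sup>2"
      proof (cases "t = 0")
        case False
        then have t: "t > 0" by (simp add: t_def)
        have "(t / c)\<^sup>2 \<le> real n" if "n \<in> A" for n
        proof -
          have "t \<le> c * sqrt (real n)" using that k[of n] by (auto simp: A_def)
          then have "t / c \<le> sqrt (real n)" using c by (simp add: field_simps)
          then have "(t / c)\<^sup>2 \<le> (sqrt (real n))\<^sup>2" using t c by (intro power_mono) auto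
          then show ?thesis by simp
        qed
        then have "(\<Sum>n\<in>A. 1 / (real n * sqrt (real n))) \<le> 4 / sqrt ((t / c)\<^sup>2)"
          using t c by (intro sum_inverse_three_halves_le) (auto simp: A_def)
        then have "t ^ 3 * (\<Sum>n\<in>A. 1 / (real n * sqrt (real n))) \<le> t ^ 3 * (4 / (t / c))"
          using t c by (intro mult_left_mono) auto
        also have "\<dots> = 4 * c * t\<^sup>2" using t c by (simp add: power3_eq_cube power2_eq_square)
        finally show ?thesis .
      qed simp
      finally show ?thesis by (simp add: t_def)
    qed
  qed
  then show ?thesis by (simp add: F_def[abs_def])
qed

end

section \<open>Exponential moments and tails of truncated sums\<close>

lemma exp_le_quadratic: "exp (y::real) \<le> 1 + y + y\<^sup>2 / 2 * exp \<bar>y\<bar>"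
proof -
  obtain t where t: "\<bar>t\<bar> \<le> \<bar>y\<bar>" "exp y = (\<Sum>m<2. y ^ m / fact m) + exp t / fact 2 * y ^ 2"
    using Maclaurin_exp_le[of y 2] by blast
  have "exp t \<le> exp \<bar>y\<bar>" using t(1) by simp
  then have "exp t / 2 * y\<^sup>2 \<le> exp \<bar>y\<bar> / 2 * y\<^sup>2" by (intro mult_right_mono divide_right_mono) auto
  then show ?thesis using t(2) by (simp add: numeral_2_eq_2 mult.commute)
qed

lemma exp_minus_one_le: "0 \<le> (y::real) \<Longrightarrow> exp y - 1 \<le> y * exp y"
  using exp_ge_add_one_self[of "- y"] mult_right_mono[of "1 - y" "exp (- y)" "exp y"]
  by (simp add: exp_minus algebra_simps)

lemma abs_trunc_le: "\<bar>trunc k x\<bar> \<le> \<bar>x\<bar>" "0 \<le> k \<Longrightarrow> \<bar>trunc k x\<bar> \<le> k" "(trunc k x)\<^sup>2 \<le> x\<^sup>2"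
  by (auto simp: trunc_def)

lemma abs_diff_trunc: "\<bar>x - trunc k x\<bar> = excess k x"
  by (simp add: trunc_def excess_def)

lemma excess_le_square: "0 < k \<Longrightarrow> k * excess k x \<le> x\<^sup>2 - (trunc k x)\<^sup>2"
proof (cases "\<bar>x\<bar> \<le> k")
  case False
  then have "k * \<bar>x\<bar> \<le> \<bar>x\<bar> * \<bar>x\<bar>" by (intro mult_right_mono) auto
  also have "\<dots> = x\<^sup>2" by (simp add: power2_eq_square)
  finally show ?thesis using False by (simp add: trunc_def excess_def)
qed (simp add: trunc_def excess_def)

context iid_real begin

lemma Markov_bound:
  assumes "integrable M f" "\<And>\<omega>. 0 \<le> f \<omega>" "A \<in> events" "\<And>\<omega>. \<omega> \<in> A \<Longrightarrow> c \<le> f \<omega>"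
  shows "c * prob A \<le> expectation f"
proof -
  have "c * prob A = expectation (\<lambda>\<omega>. c * indicator A \<omega>)" using assms(3) by simp
  also have "\<dots> \<le> expectation f"
  proof (intro integral_mono integrable_mult_right assms(1))
    show "integrable M (indicator A :: 'a \<Rightarrow> real)"
      using assms(3) by (intro integrable_real_indicator) (auto simp: less_top[symmetric])
    show "c * indicator A \<omega> \<le> f \<omega>" for \<omega> using assms(2,4)[of \<omega>] by (cases "\<omega> \<in> A") auto
  qed
  finally show ?thesis .
qed

lemma integrable_trunc [simp, intro]: "0 \<le> k \<Longrightarrow> integrable M (\<lambda>\<omega>. trunc k (X 1 \<omega>))"
  by (rule integrable_const_bound[of _ k]) (auto simp: abs_trunc_le)

lemma integrable_exp_trunc:
  assumes "0 \<le> k" shows "integrable M (\<lambda>\<omega>. exp (s * trunc k (X 1 \<omega>)))"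
proof (rule integrable_const_bound[of _ "exp (\<bar>s\<bar> * k)"])
  show "AE \<omega> in M. norm (exp (s * trunc k (X 1 \<omega>))) \<le> exp (\<bar>s\<bar> * k)"
  proof (intro AE_I2)
    fix \<omega>
    have "s * trunc k (X 1 \<omega>) \<le> \<bar>s\<bar> * \<bar>trunc k (X 1 \<omega>)\<bar>" by (simp add: abs_mult[symmetric])
    also have "\<dots> \<le> \<bar>s\<bar> * k" using assms by (intro mult_left_mono abs_trunc_le) auto
    finally show "norm (exp (s * trunc k (X 1 \<omega>))) \<le> exp (\<bar>s\<bar> * k)" by simp
  qed
qed measurable

end

locale iid_centered_l2 = iid_real +
  assumes int2: "integrable M (\<lambda>\<omega>. (X 1 \<omega>)\<^sup>2)" and mean: "expectation (X 1) = 0"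
begin

lemma int1: "integrable M (X 1)"
  by (rule square_integrable_imp_integrable[OF _ int2]) simp

lemma integrable_excess [simp, intro]: "integrable M (\<lambda>\<omega>. excess k (X 1 \<omega>))"
  by (rule Bochner_Integration.integrable_bound[OF int1]) (auto simp: excess_le)

lemma integrable_trunc_square [simp, intro]: "integrable M (\<lambda>\<omega>. (trunc k (X 1 \<omega>))\<^sup>2)"
  by (rule Bochner_Integration.integrable_bound[OF int2]) (auto simp: abs_trunc_le)

text \<open>Since X has mean zero, the truncated mean is minus the mean of the removed part.\<close>

lemma mean_trunc_le:
  assumes "0 \<le> k" shows "\<bar>expectation (\<lambda>\<omega>. trunc k (X 1 \<omega>))\<bar> \<le> expectation (\<lambda>\<omega>. excess k (X 1 \<omega>))"
proof -
  have "expectation (\<lambda>\<omega>. X 1 \<omega> - trunc k (X 1 \<omega>)) = - expectation (\<lambda>\<omega>. trunc k (X 1 \<omega>))"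
    using Bochner_Integration.integral_diff[OF int1 integrable_trunc[OF assms]] mean by simp
  then have "\<bar>expectation (\<lambda>\<omega>. trunc k (X 1 \<omega>))\<bar> = \<bar>expectation (\<lambda>\<omega>. X 1 \<omega> - trunc k (X 1 \<omega>))\<bar>" by simp
  also have "\<dots> \<le> expectation (\<lambda>\<omega>. \<bar>X 1 \<omega> - trunc k (X 1 \<omega>)\<bar>)" by (rule integral_abs_bound)
  finally show ?thesis by (simp add: abs_diff_trunc)
qed

text \<open>The quadratic bound for exp costs the factor exp (r k), so the estimate is useful as
  long as exponent times level stays bounded. The first term pays for the bias of the truncated
  mean.\<close>

lemma exp_moment_trunc_le:
  assumes "0 \<le> k" "\<bar>s\<bar> = r"
  shows "expectation (\<lambda>\<omega>. exp (s * trunc k (X 1 \<omega>)))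
    \<le> exp (r * expectation (\<lambda>\<omega>. excess k (X 1 \<omega>)) + r\<^sup>2 / 2 * expectation (\<lambda>\<omega>. (X 1 \<omega>)\<^sup>2) * exp (r * k))"
proof -
  let ?T = "\<lambda>\<omega>. trunc k (X 1 \<omega>)"
  have "expectation (\<lambda>\<omega>. exp (s * ?T \<omega>)) \<le> expectation (\<lambda>\<omega>. 1 + s * ?T \<omega> + s\<^sup>2 / 2 * exp (r * k) * (X 1 \<omega>)\<^sup>2)"
  proof (intro integral_mono integrable_exp_trunc assms(1))
    show "integrable M (\<lambda>\<omega>. 1 + s * ?T \<omega> + s\<^sup>2 / 2 * exp (r * k) * (X 1 \<omega>)\<^sup>2)"
      using assms(1) int2 by (intro Bochner_Integration.integrable_add integrable_mult_right integrable_trunc) auto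
    fix \<omega>
    have "(s * ?T \<omega>)\<^sup>2 / 2 * exp \<bar>s * ?T \<omega>\<bar> \<le> (s\<^sup>2 * (X 1 \<omega>)\<^sup>2) / 2 * exp (r * k)"
    proof (intro mult_mono divide_right_mono)
      show "(s * ?T \<omega>)\<^sup>2 \<le> s\<^sup>2 * (X 1 \<omega>)\<^sup>2"
        unfolding power_mult_distrib by (intro mult_left_mono abs_trunc_le) auto
      have "\<bar>s * ?T \<omega>\<bar> \<le> r * k" unfolding abs_mult assms(2) using assms by (intro mult_left_mono abs_trunc_le) auto
      then show "exp \<bar>s * ?T \<omega>\<bar> \<le> exp (r * k)" by simp
    qed auto
    then show "exp (s * ?T \<omega>) \<le> 1 + s * ?T \<omega> + s\<^sup>2 / 2 * exp (r * k) * (X 1 \<omega>)\<^sup>2"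
      using exp_le_quadratic[of "s * ?T \<omega>"] by (simp add: mult_ac)
  qed
  also have "\<dots> = 1 + (s * expectation ?T + s\<^sup>2 / 2 * exp (r * k) * expectation (\<lambda>\<omega>. (X 1 \<omega>)\<^sup>2))"
    using int2 integrable_trunc[OF assms(1)] by (simp add: prob_space)
  also have "\<dots> \<le> exp (s * expectation ?T + s\<^sup>2 / 2 * exp (r * k) * expectation (\<lambda>\<omega>. (X 1 \<omega>)\<^sup>2))"
    by (rule exp_ge_add_one_self)
  also have "\<dots> \<le> exp (r * expectation (\<lambda>\<omega>. excess k (X 1 \<omega>)) + r\<^sup>2 / 2 * expectation (\<lambda>\<omega>. (X 1 \<omega>)\<^sup>2) * exp (r * k))"
  proof -
    have "s * expectation ?T \<le> \<bar>s\<bar> * \<bar>expectation ?T\<bar>" by (simp add: abs_mult[symmetric])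
    also have "\<dots> \<le> r * expectation (\<lambda>\<omega>. excess k (X 1 \<omega>))" unfolding assms(2)
      using assms by (intro mult_left_mono mean_trunc_le) auto
    finally have "s * expectation ?T \<le> r * expectation (\<lambda>\<omega>. excess k (X 1 \<omega>))" .
    moreover have "s\<^sup>2 = r\<^sup>2" using assms(2) by auto
    ultimately show ?thesis by (simp add: mult_ac)
  qed
  finally show ?thesis .
qed

text \<open>For nonnegative \<open>s\<close> an upper bound for the logarithm of the moment
  generating function of the truncated variable, both at \<open>s\<close> and at
  \<open>- s\<close>.\<close>

definition cgf_bound :: "real \<Rightarrow> real \<Rightarrow> real" where
  "cgf_bound k s = s * expectation (\<lambda>\<omega>. excess k (X 1 \<omega>)) + s\<^sup>2 / 2 * expectation (\<lambda>\<omega>. (X 1 \<omega>)\<^sup>2) * exp (s * k)"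

definition tsum :: "real \<Rightarrow> nat \<Rightarrow> 'a \<Rightarrow> real" where
  "tsum k n \<omega> = (\<Sum>i\<in>{1..n}. trunc k (X i \<omega>))"

definition esum :: "real \<Rightarrow> nat \<Rightarrow> 'a \<Rightarrow> real" where
  "esum k n \<omega> = (\<Sum>i\<in>{1..n}. excess k (X i \<omega>))"

lemma rv_fun_sum: "f \<in> borel_measurable borel \<Longrightarrow> (\<lambda>\<omega>. \<Sum>i\<in>{1..n}. f (X i \<omega>) :: real) \<in> borel_measurable M"
  by (intro borel_measurable_sum measurable_compose[OF rv]) auto

lemma rv_tsum [measurable]: "tsum k n \<in> borel_measurable M"
  unfolding tsum_def by (intro rv_fun_sum) simp

lemma rv_esum [measurable]: "esum k n \<in> borel_measurable M"
  unfolding esum_def by (intro rv_fun_sum) simp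

lemma abs_psum_diff_tsum: "\<bar>psum X n \<omega> - tsum k n \<omega>\<bar> \<le> esum k n \<omega>"
  unfolding psum_def tsum_def esum_def sum_subtractf[symmetric]
  by (rule order_trans[OF sum_abs]) (simp add: abs_diff_trunc)

lemma jump_event [measurable]: "{\<omega> \<in> space M. \<exists>i\<in>{1..n}. k < \<bar>X i \<omega>\<bar>} \<in> events"
proof (intro sets.sets_Collect_finite_Ex)
  fix i assume "i \<in> {1..n}"
  then have [measurable]: "X i \<in> borel_measurable M" using rv[of i] by simp
  show "{\<omega> \<in> space M. k < \<bar>X i \<omega>\<bar>} \<in> events" by measurable
qed simp

lemma tsum_exp_moment:
  assumes "0 \<le> k" "\<bar>s\<bar> = r"
  shows "integrable M (\<lambda>\<omega>. exp (s * tsum k n \<omega>))"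
    and "expectation (\<lambda>\<omega>. exp (s * tsum k n \<omega>)) \<le> exp (real n * cgf_bound k r)"
proof -
  have eq: "exp (s * tsum k n \<omega>) = (\<Prod>i\<in>{1..n}. exp (s * trunc k (X i \<omega>)))" for \<omega>
    by (simp add: tsum_def sum_distrib_left exp_sum)
  show "integrable M (\<lambda>\<omega>. exp (s * tsum k n \<omega>))"
    unfolding eq by (rule integrable_prod[where g = "\<lambda>_ x. exp (s * trunc k x)"])
      (auto intro: integrable_exp_trunc[OF assms(1), simplified])
  have "expectation (\<lambda>\<omega>. exp (s * tsum k n \<omega>)) = (\<Prod>i\<in>{1..n}. expectation (\<lambda>\<omega>. exp (s * trunc k (X 1 \<omega>))))"
    unfolding eq by (rule expectation_prod[where g = "\<lambda>_ x. exp (s * trunc k x)"])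
      (auto intro: integrable_exp_trunc[OF assms(1), simplified])
  also have "\<dots> = expectation (\<lambda>\<omega>. exp (s * trunc k (X 1 \<omega>))) ^ n" by simp
  also have "\<dots> \<le> exp (cgf_bound k r) ^ n"
    unfolding cgf_bound_def by (intro power_mono exp_moment_trunc_le assms) auto
  finally show "expectation (\<lambda>\<omega>. exp (s * tsum k n \<omega>)) \<le> exp (real n * cgf_bound k r)"
    by (simp add: exp_of_nat_mult)
qed

text \<open>Truncated sums on the event of at least one jump: the extra factor \<open>n P(|X| > k)\<close> makes the
  contribution of this event summable.\<close>

lemma tsum_exp_moment_jump:
  assumes k: "0 \<le> k" and r: "\<bar>s\<bar> = r"
  shows "integrable M (\<lambda>\<omega>. exp (s * tsum k n \<omega>) * (\<Sum>j\<in>{1..n}. of_bool (k < \<bar>X j \<omega>\<bar>)))"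
    and "expectation (\<lambda>\<omega>. exp (s * tsum k n \<omega>) * (\<Sum>j\<in>{1..n}. of_bool (k < \<bar>X j \<omega>\<bar>)))
      \<le> real n * prob {\<omega> \<in> space M. k < \<bar>X 1 \<omega>\<bar>} * exp (real n * cgf_bound k r)"
proof -
  define g where "g j i x = (if i = j then of_bool (k < \<bar>x\<bar>) else exp (s * trunc k x))" for j i :: nat and x :: real
  have gm [measurable]: "g j i \<in> borel_measurable borel" for j i
    unfolding g_def by measurable
  have gint: "integrable M (\<lambda>\<omega>. g j i (X 1 \<omega>))" for j i
    using integrable_exp_trunc[OF k, of s] unfolding g_def
    by (cases "i = j") (auto intro!: integrable_const_bound[of _ 1])
  have eq: "exp (s * tsum k n \<omega>) * of_bool (k < \<bar>X j \<omega>\<bar>) = (\<Prod>i\<in>{1..n}. g j i (X i \<omega>))" if j: "j \<in> {1..n}" for j \<omega>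
  proof -
    have "exp (s * tsum k n \<omega>) = (\<Prod>i\<in>{1..n}. exp (s * trunc k (X i \<omega>)))"
      by (simp add: tsum_def sum_distrib_left exp_sum)
    also have "\<dots> = exp (s * trunc k (X j \<omega>)) * (\<Prod>i\<in>{1..n} - {j}. exp (s * trunc k (X i \<omega>)))"
      using j by (intro prod.remove) auto
    finally have "exp (s * tsum k n \<omega>) * of_bool (k < \<bar>X j \<omega>\<bar>) = of_bool (k < \<bar>X j \<omega>\<bar>) * (\<Prod>i\<in>{1..n} - {j}. exp (s * trunc k (X i \<omega>)))"
      by (cases "k < \<bar>X j \<omega>\<bar>") (auto simp: trunc_def)
    also have "\<dots> = g j j (X j \<omega>) * (\<Prod>i\<in>{1..n} - {j}. g j i (X i \<omega>))"
      by (auto simp: g_def intro!: prod.cong)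
    also have "\<dots> = (\<Prod>i\<in>{1..n}. g j i (X i \<omega>))" using j by (intro prod.remove[symmetric]) auto
    finally show ?thesis .
  qed
  have each_int: "integrable M (\<lambda>\<omega>. exp (s * tsum k n \<omega>) * of_bool (k < \<bar>X j \<omega>\<bar>))" if "j \<in> {1..n}" for j
    unfolding eq[OF that] by (rule integrable_prod[where g = "g j"]) (use gint gm in auto)
  have cb: "0 \<le> cgf_bound k r"
    using r unfolding cgf_bound_def by (intro add_nonneg_nonneg mult_nonneg_nonneg) auto
  have each: "expectation (\<lambda>\<omega>. exp (s * tsum k n \<omega>) * of_bool (k < \<bar>X j \<omega>\<bar>))
     \<le> prob {\<omega> \<in> space M. k < \<bar>X 1 \<omega>\<bar>} * exp (real n * cgf_bound k r)" if j: "j \<in> {1..n}" for j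
  proof -
    have "expectation (\<lambda>\<omega>. exp (s * tsum k n \<omega>) * of_bool (k < \<bar>X j \<omega>\<bar>)) = (\<Prod>i\<in>{1..n}. expectation (\<lambda>\<omega>. g j i (X 1 \<omega>)))"
      unfolding eq[OF j] by (rule expectation_prod[where g = "g j"]) (use gint gm in auto)
    also have "\<dots> = expectation (\<lambda>\<omega>. g j j (X 1 \<omega>)) * (\<Prod>i\<in>{1..n} - {j}. expectation (\<lambda>\<omega>. g j i (X 1 \<omega>)))"
      using j by (intro prod.remove) auto
    also have "expectation (\<lambda>\<omega>. g j j (X 1 \<omega>)) = expectation (indicator {\<omega> \<in> space M. k < \<bar>X 1 \<omega>\<bar>})"
      by (intro Bochner_Integration.integral_cong) (auto simp: g_def indicator_def)
    also have "\<dots> = prob {\<omega> \<in> space M. k < \<bar>X 1 \<omega>\<bar>}" by simp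
    also have "(\<Prod>i\<in>{1..n} - {j}. expectation (\<lambda>\<omega>. g j i (X 1 \<omega>))) \<le> (\<Prod>i\<in>{1..n} - {j}. exp (cgf_bound k r))"
    proof (intro prod_mono conjI)
      fix i assume i: "i \<in> {1..n} - {j}"
      show "0 \<le> expectation (\<lambda>\<omega>. g j i (X 1 \<omega>))" by (intro integral_nonneg_AE) (auto simp: g_def)
      show "expectation (\<lambda>\<omega>. g j i (X 1 \<omega>)) \<le> exp (cgf_bound k r)"
        using i exp_moment_trunc_le[OF k r] by (simp add: g_def cgf_bound_def)
    qed
    also have "\<dots> = exp (cgf_bound k r) ^ (n - 1)" using j by simp
    also have "\<dots> = exp (real (n - 1) * cgf_bound k r)" by (simp only: exp_of_nat_mult)
    also have "\<dots> \<le> exp (real n * cgf_bound k r)" using cb by (simp add: mult_right_mono)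
    finally show ?thesis by (simp add: mult_left_mono)
  qed
  show "integrable M (\<lambda>\<omega>. exp (s * tsum k n \<omega>) * (\<Sum>j\<in>{1..n}. of_bool (k < \<bar>X j \<omega>\<bar>)))"
    unfolding sum_distrib_left by (intro Bochner_Integration.integrable_sum each_int) auto
  have "expectation (\<lambda>\<omega>. exp (s * tsum k n \<omega>) * (\<Sum>j\<in>{1..n}. of_bool (k < \<bar>X j \<omega>\<bar>)))
     = (\<Sum>j\<in>{1..n}. expectation (\<lambda>\<omega>. exp (s * tsum k n \<omega>) * of_bool (k < \<bar>X j \<omega>\<bar>)))"
    unfolding sum_distrib_left by (intro Bochner_Integration.integral_sum each_int) auto
  also have "\<dots> \<le> (\<Sum>j\<in>{1..n}. prob {\<omega> \<in> space M. k < \<bar>X 1 \<omega>\<bar>} * exp (real n * cgf_bound k r))"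
    by (intro sum_mono each) auto
  finally show "expectation (\<lambda>\<omega>. exp (s * tsum k n \<omega>) * (\<Sum>j\<in>{1..n}. of_bool (k < \<bar>X j \<omega>\<bar>)))
      \<le> real n * prob {\<omega> \<in> space M. k < \<bar>X 1 \<omega>\<bar>} * exp (real n * cgf_bound k r)"
    by (simp add: mult.assoc)
qed

text \<open>Chernoff for both signs, with the indicator of a jump bounded by the number of
  jumps.\<close>

lemma tsum_tail_jump:
  assumes k: "0 \<le> k" and s: "0 < s"
  shows "prob {\<omega> \<in> space M. \<bar>tsum k n \<omega>\<bar> \<ge> u \<and> (\<exists>i\<in>{1..n}. k < \<bar>X i \<omega>\<bar>)}
     \<le> 2 * (real n * prob {\<omega> \<in> space M. k < \<bar>X 1 \<omega>\<bar>}) * exp (real n * cgf_bound k s - s * u)"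
proof -
  let ?J = "\<lambda>\<omega>. \<Sum>j\<in>{1..n}. of_bool (k < \<bar>X j \<omega>\<bar>) :: real"
  let ?A = "{\<omega> \<in> space M. \<bar>tsum k n \<omega>\<bar> \<ge> u \<and> (\<exists>i\<in>{1..n}. k < \<bar>X i \<omega>\<bar>)}"
  let ?f = "\<lambda>\<omega>. exp (s * tsum k n \<omega>) * ?J \<omega> + exp (- s * tsum k n \<omega>) * ?J \<omega>"
  have A: "?A \<in> events"
  proof -
    have eq: "?A = {\<omega> \<in> space M. \<bar>tsum k n \<omega>\<bar> \<ge> u} \<inter> {\<omega> \<in> space M. \<exists>i\<in>{1..n}. k < \<bar>X i \<omega>\<bar>}" by auto
    show ?thesis unfolding eq by (rule sets.Int[OF _ jump_event]) measurable
  qed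
  have J0: "?J \<omega> \<ge> 0" for \<omega> by (intro sum_nonneg) auto
  have "exp (s * u) * prob ?A \<le> expectation ?f"
  proof (rule Markov_bound[OF _ _ A])
    show "integrable M ?f"
      using tsum_exp_moment_jump(1)[OF k, of s s n] tsum_exp_moment_jump(1)[OF k, of "- s" s n] s
      by (intro Bochner_Integration.integrable_add) auto
    show "0 \<le> ?f \<omega>" for \<omega> using J0 by (intro add_nonneg_nonneg mult_nonneg_nonneg) auto
    fix \<omega> assume \<omega>: "\<omega> \<in> ?A"
    then obtain i where i: "i \<in> {1..n}" "k < \<bar>X i \<omega>\<bar>" by auto
    have "of_bool (k < \<bar>X i \<omega>\<bar>) \<le> ?J \<omega>" by (rule member_le_sum) (use i in auto)
    then have J1: "1 \<le> ?J \<omega>" using i by simp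
    have "s * u \<le> s * tsum k n \<omega> \<or> s * u \<le> - s * tsum k n \<omega>"
    proof -
      have "u \<le> tsum k n \<omega> \<or> u \<le> - tsum k n \<omega>" using \<omega> by auto
      then show ?thesis
        using s mult_left_mono[of u "tsum k n \<omega>" s] mult_left_mono[of u "- tsum k n \<omega>" s] by auto
    qed
    then have "exp (s * u) \<le> exp (s * tsum k n \<omega>) + exp (- s * tsum k n \<omega>)"
      by (auto intro: add_increasing add_increasing2)
    also have "\<dots> \<le> (exp (s * tsum k n \<omega>) + exp (- s * tsum k n \<omega>)) * ?J \<omega>"
      using mult_left_mono[OF J1, of "exp (s * tsum k n \<omega>) + exp (- s * tsum k n \<omega>)"] by (simp add: add_nonneg_nonneg)
    finally show "exp (s * u) \<le> ?f \<omega>" by (simp only: distrib_right)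
  qed
  also have "\<dots> \<le> 2 * (real n * prob {\<omega> \<in> space M. k < \<bar>X 1 \<omega>\<bar>}) * exp (real n * cgf_bound k s)"
    using tsum_exp_moment_jump[OF k, of s s n] tsum_exp_moment_jump[OF k, of "- s" s n] s
    by (subst Bochner_Integration.integral_add) auto
  finally have "exp (s * u) * prob ?A \<le> 2 * (real n * prob {\<omega> \<in> space M. k < \<bar>X 1 \<omega>\<bar>}) * exp (real n * cgf_bound k s)" .
  then show ?thesis by (simp add: exp_diff field_simps)
qed

lemma tsum_tail:
  assumes k: "0 \<le> k" and s: "0 < s"
  shows "prob {\<omega> \<in> space M. \<bar>tsum k n \<omega>\<bar> \<ge> u} \<le> 2 * exp (real n * cgf_bound k s - s * u)"
proof -
  let ?A = "{\<omega> \<in> space M. \<bar>tsum k n \<omega>\<bar> \<ge> u}"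
  let ?f = "\<lambda>\<omega>. exp (s * tsum k n \<omega>) + exp (- s * tsum k n \<omega>)"
  have "exp (s * u) * prob ?A \<le> expectation ?f"
  proof (rule Markov_bound)
    show "integrable M ?f"
      using tsum_exp_moment(1)[OF k, of s s n] tsum_exp_moment(1)[OF k, of "- s" s n] s
      by (intro Bochner_Integration.integrable_add) auto
    fix \<omega> assume \<omega>: "\<omega> \<in> ?A"
    have "s * u \<le> s * tsum k n \<omega> \<or> s * u \<le> - s * tsum k n \<omega>"
    proof -
      have "u \<le> tsum k n \<omega> \<or> u \<le> - tsum k n \<omega>" using \<omega> by auto
      then show ?thesis
        using s mult_left_mono[of u "tsum k n \<omega>" s] mult_left_mono[of u "- tsum k n \<omega>" s] by auto
    qed
    then show "exp (s * u) \<le> ?f \<omega>"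
      by (auto intro: add_increasing add_increasing2)
  qed (auto intro: add_nonneg_nonneg)
  also have "\<dots> \<le> 2 * exp (real n * cgf_bound k s)"
    using tsum_exp_moment[OF k, of s s n] tsum_exp_moment[OF k, of "- s" s n] s
    by (subst Bochner_Integration.integral_add) auto
  finally have "exp (s * u) * prob ?A \<le> 2 * exp (real n * cgf_bound k s)" .
  then show ?thesis by (simp add: exp_diff field_simps)
qed

end

text \<open>Chernoff exponents below have the form \<theta> sqrt (log log n / n), so exponent times
  level is the constant \<theta> \<kappa>. The form with \<open>powr\<close> matches p = -1/2 in
  \<open>summable_tail_moment\<close>.\<close>

definition level :: "real \<Rightarrow> nat \<Rightarrow> real" where
  "level \<kappa> n = \<kappa> * sqrt (real n) * loglogl (real n) powr (- 1/2)"

lemma level_eq: "level \<kappa> n = \<kappa> * sqrt (real n) / sqrt (loglogl (real n))"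
proof -
  have "loglogl (real n) powr (- 1/2) = 1 / sqrt (loglogl (real n))"
    using powr_minus[of "loglogl (real n)" "1/2"] loglogl_ge_1[of "real n"]
    by (simp add: powr_half_sqrt inverse_eq_divide)
  then show ?thesis by (simp add: level_def)
qed

lemma level_nonneg: "0 \<le> \<kappa> \<Longrightarrow> 0 \<le> level \<kappa> n"
  by (simp add: level_def)

lemma eventually_log_seq:
  "\<forall>\<^sub>F n in sequentially. logl (real n) = ln (real n)"
  "\<forall>\<^sub>F n in sequentially. loglogl (real n) = ln (ln (real n))"
  using eventually_compose_filterlim[OF eventually_logl filterlim_real_sequentially]
    eventually_compose_filterlim[OF eventually_loglogl filterlim_real_sequentially] .

text \<open>Along n the capped logarithms are eventually the iterated ln. The function
  \<open>f\<close> receives n, log n and log log n as separate arguments, so that a limit computed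
  for ln carries over.\<close>

lemma filterlim_seq_cong:
  fixes f :: "real \<Rightarrow> real \<Rightarrow> real \<Rightarrow> real"
  assumes "filterlim (\<lambda>n. f (real n) (ln (real n)) (ln (ln (real n)))) F sequentially"
  shows "filterlim (\<lambda>n. f (real n) (logl (real n)) (loglogl (real n))) F sequentially"
proof -
  have "\<forall>\<^sub>F n in sequentially. f (real n) (ln (real n)) (ln (ln (real n))) = f (real n) (logl (real n)) (loglogl (real n))"
    using eventually_log_seq by eventually_elim simp
  from filterlim_cong[OF refl refl this] assms show ?thesis by blast
qed

lemma level_top: "0 < \<kappa> \<Longrightarrow> filterlim (level \<kappa>) at_top sequentially"
  unfolding level_def by (rule filterlim_seq_cong[of "\<lambda>n l L. \<kappa> * sqrt n * L powr (- 1/2)"]) real_asymp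

lemma loglogl_top: "filterlim (\<lambda>n. loglogl (real n)) at_top sequentially"
  by (rule filterlim_seq_cong[of "\<lambda>n l L. L"]) real_asymp

text \<open>Here \<open>q\<close> stands for sqrt n and \<open>r\<close> for sqrt (log log n); the
  three cancellations occur in \<open>summable_esum_tail\<close>.\<close>

lemma scale_cancel:
  fixes q r x c e :: real
  assumes "0 < q" "0 < r"
  shows "(q * q) * (x / (q * r)) / (c * q / r) = x / c"
    and "(q * q) * (x / (q * r) * r * e) = x * q * e"
    and "(q * q) / (c * q * r) = 1 / c * (1 / r * q)"
  using assms by (simp_all add: field_simps)

section \<open>Estimates at the truncation level\<close>

context iid_centered_l2 begin

lemma trunc_variance_tendsto:
  "((\<lambda>k. expectation (\<lambda>\<omega>. (trunc k (X 1 \<omega>))\<^sup>2)) \<longlongrightarrow> expectation (\<lambda>\<omega>. (X 1 \<omega>)\<^sup>2)) at_top"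
proof (rule integral_dominated_convergence_at_top[where w = "\<lambda>\<omega>. (X 1 \<omega>)\<^sup>2"])
  show "AE \<omega> in M. ((\<lambda>k. (trunc k (X 1 \<omega>))\<^sup>2) \<longlongrightarrow> (X 1 \<omega>)\<^sup>2) at_top"
  proof (intro AE_I2 tendsto_eventually)
    fix \<omega> show "\<forall>\<^sub>F k in at_top. (trunc k (X 1 \<omega>))\<^sup>2 = (X 1 \<omega>)\<^sup>2"
      using eventually_ge_at_top[of "\<bar>X 1 \<omega>\<bar>"] by eventually_elim (simp add: trunc_def)
  qed
qed (use int2 in \<open>auto simp: abs_trunc_le\<close>)

text \<open>Equal to E[X^2; |X| > k]. Its convergence to 0, without a rate, is what controls the
  bias terms.\<close>

definition tail_var :: "real \<Rightarrow> real" where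
  "tail_var k = expectation (\<lambda>\<omega>. (X 1 \<omega>)\<^sup>2) - expectation (\<lambda>\<omega>. (trunc k (X 1 \<omega>))\<^sup>2)"

lemma tail_var_tendsto: "(tail_var \<longlongrightarrow> 0) at_top"
  unfolding tail_var_def[abs_def] using tendsto_diff[OF tendsto_const[of "expectation (\<lambda>\<omega>. (X 1 \<omega>)\<^sup>2)"] trunc_variance_tendsto]
  by (simp only: diff_self)

text \<open>The mean excess is o(1 / k). At the truncation level this makes the bias term of
  \<open>cgf_bound\<close>, multiplied by n, of smaller order than log log n.\<close>

lemma expectation_excess_le:
  assumes "0 < k" shows "expectation (\<lambda>\<omega>. excess k (X 1 \<omega>)) \<le> tail_var k / k"
proof -
  have "k * expectation (\<lambda>\<omega>. excess k (X 1 \<omega>)) = expectation (\<lambda>\<omega>. k * excess k (X 1 \<omega>))" by simp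
  also have "\<dots> \<le> expectation (\<lambda>\<omega>. (X 1 \<omega>)\<^sup>2 - (trunc k (X 1 \<omega>))\<^sup>2)"
    using assms int2 integrable_excess[of k] integrable_trunc_square[of k]
    by (intro integral_mono excess_le_square integrable_mult_right Bochner_Integration.integrable_diff) auto
  also have "\<dots> = tail_var k"
    unfolding tail_var_def using int2 integrable_trunc_square[of k] by (intro Bochner_Integration.integral_diff) auto
  finally show ?thesis using assms by (simp add: field_simps)
qed

text \<open>With L = log log n, s = \<theta> sqrt (L / n) and k the level: s k = \<theta> \<kappa>,
  n s^2 = \<theta>^2 L and n s / k = \<theta> L / \<kappa>. The bias is thus L times a multiple of
  \<open>tail_var\<close>, absorbed into \<eta> L.\<close>

lemma cgf_bound_eventually:
  assumes \<kappa>: "0 < \<kappa>" and \<theta>: "0 < \<theta>" and \<eta>: "0 < \<eta>"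
  shows "\<forall>\<^sub>F n in sequentially. real n * cgf_bound (level \<kappa> n) (\<theta> * sqrt (loglogl (real n) / real n))
     \<le> (\<theta>\<^sup>2 * expectation (\<lambda>\<omega>. (X 1 \<omega>)\<^sup>2) / 2 * exp (\<theta> * \<kappa>) + \<eta>) * loglogl (real n)"
proof -
  have "(\<lambda>n. \<theta> / \<kappa> * tail_var (level \<kappa> n)) \<longlonglongrightarrow> \<theta> / \<kappa> * 0"
    by (intro tendsto_mult tendsto_const filterlim_compose[OF tail_var_tendsto level_top[OF \<kappa>]])
  then have "\<forall>\<^sub>F n in sequentially. \<theta> / \<kappa> * tail_var (level \<kappa> n) < \<eta>" using \<eta> by (intro order_tendstoD) auto
  then show ?thesis using eventually_gt_at_top[of 0]
  proof eventually_elim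
    case (elim n)
    define L where "L = loglogl (real n)"
    define s where "s = \<theta> * sqrt (L / real n)"
    define k where "k = level \<kappa> n"
    have L: "L > 0" by (simp add: L_def)
    have rn: "sqrt (real n) > 0" using elim by simp
    have k: "k = \<kappa> * sqrt (real n) / sqrt L" by (simp only: k_def level_eq L_def)
    have k0: "k > 0" using \<kappa> rn L by (simp add: k)
    have s: "s = \<theta> * sqrt L / sqrt (real n)" by (simp add: s_def real_sqrt_divide)
    have sk: "s * k = \<theta> * \<kappa>" using rn L by (simp add: s k)
    have "real n * (s * expectation (\<lambda>\<omega>. excess k (X 1 \<omega>))) \<le> real n * (s * (tail_var k / k))"
      using \<theta> L by (intro mult_left_mono expectation_excess_le k0) (auto simp: s)
    also have "\<dots> = (\<theta> / \<kappa> * tail_var k) * L"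
    proof -
      have "real n * (s / k) = \<theta> / \<kappa> * L"
        using rn L \<kappa> by (simp add: s k field_simps flip: real_sqrt_mult) (simp add: real_sqrt_mult)?
      moreover have "real n * (s * (tail_var k / k)) = (real n * (s / k)) * tail_var k" by simp
      ultimately show ?thesis by simp
    qed
    also have "\<dots> \<le> \<eta> * L" using elim(1) L by (intro mult_right_mono) (auto simp: k_def)
    finally have 1: "real n * (s * expectation (\<lambda>\<omega>. excess k (X 1 \<omega>))) \<le> \<eta> * L" .
    have "real n * s\<^sup>2 = \<theta>\<^sup>2 * L" using elim L by (simp add: s_def power_mult_distrib)
    then have 2: "real n * (s\<^sup>2 / 2 * expectation (\<lambda>\<omega>. (X 1 \<omega>)\<^sup>2) * exp (s * k)) = \<theta>\<^sup>2 * expectation (\<lambda>\<omega>. (X 1 \<omega>)\<^sup>2) / 2 * exp (\<theta> * \<kappa>) * L"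
      unfolding sk by (simp add: field_simps)
    show ?case unfolding cgf_bound_def k_def[symmetric] L_def[symmetric] s_def[symmetric]
      unfolding distrib_left distrib_right 2 using 1 by linarith
  qed
qed

text \<open>Chernoff at logarithmic precision. With v = E X^2, the quantity \<theta> g - \<theta>^2
  v / 2 is maximal at \<theta> = g / v, with value g^2 / (2 v), and a small \<kappa> brings exp
  (\<theta> \<kappa>) close to 1. The second bound keeps the jump probability as a factor.\<close>

lemma crude_bound:
  assumes \<kappa>: "0 < \<kappa>" and \<theta>: "0 < \<theta>"
    and \<rho>: "\<rho> < \<theta> * g - \<theta>\<^sup>2 * expectation (\<lambda>\<omega>. (X 1 \<omega>)\<^sup>2) / 2 * exp (\<theta> * \<kappa>)"
  shows "\<forall>\<^sub>F n in sequentially. \<forall>u \<ge> g * sqrt (real n * loglogl (real n)).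
     prob {\<omega> \<in> space M. \<bar>tsum (level \<kappa> n) n \<omega>\<bar> \<ge> u} \<le> 2 * logl (real n) powr (- \<rho>) \<and>
     prob {\<omega> \<in> space M. \<bar>tsum (level \<kappa> n) n \<omega>\<bar> \<ge> u \<and> (\<exists>i\<in>{1..n}. level \<kappa> n < \<bar>X i \<omega>\<bar>)}
       \<le> 2 * (real n * prob {\<omega> \<in> space M. level \<kappa> n < \<bar>X 1 \<omega>\<bar>}) * logl (real n) powr (- \<rho>)"
proof -
  define e where "e = \<theta>\<^sup>2 * expectation (\<lambda>\<omega>. (X 1 \<omega>)\<^sup>2) / 2 * exp (\<theta> * \<kappa>)"
  define \<eta> where "\<eta> = \<theta> * g - e - \<rho>"
  have \<eta>: "\<eta> > 0" using \<rho> by (simp add: \<eta>_def e_def)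
  show ?thesis using cgf_bound_eventually[OF \<kappa> \<theta> \<eta>] eventually_log_seq eventually_gt_at_top[of 0]
  proof eventually_elim
    case (elim n)
    show ?case
    proof (intro allI impI)
    fix u assume u: "u \<ge> g * sqrt (real n * loglogl (real n))"
    define L where "L = loglogl (real n)"
    define s where "s = \<theta> * sqrt (L / real n)"
    have L: "L > 0" "L = ln (logl (real n))"
      unfolding L_def by (rule loglogl_pos) (use elim(2,3) in simp)
    have s0: "s > 0" using elim L \<theta> by (simp add: s_def)
    have "s * (g * sqrt (real n * L)) = \<theta> * g * L"
      using elim(4) L by (simp add: s_def real_sqrt_divide real_sqrt_mult)
    then have "\<theta> * g * L = s * (g * sqrt (real n * L))" by (rule sym)
    also have "\<dots> \<le> s * u" using u s0 unfolding L_def by (intro mult_left_mono) auto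
    finally have "\<theta> * g * L \<le> s * u" .
    moreover have "real n * cgf_bound (level \<kappa> n) s \<le> (e + \<eta>) * L" using elim(1) by (simp add: e_def L_def s_def)
    ultimately have "real n * cgf_bound (level \<kappa> n) s - s * u \<le> - \<rho> * L" by (simp add: \<eta>_def algebra_simps)
    then have "exp (real n * cgf_bound (level \<kappa> n) s - s * u) \<le> exp (- \<rho> * L)" by simp
    also have "\<dots> = logl (real n) powr (- \<rho>)" using L(2) less_imp_neq[OF logl_pos[of "real n"]] by (simp add: powr_def)
    finally have ex: "exp (real n * cgf_bound (level \<kappa> n) s - s * u) \<le> logl (real n) powr (- \<rho>)" .
    have k0: "0 \<le> level \<kappa> n" using \<kappa> by (intro level_nonneg) simp
    show "prob {\<omega> \<in> space M. \<bar>tsum (level \<kappa> n) n \<omega>\<bar> \<ge> u} \<le> 2 * logl (real n) powr (- \<rho>) \<and>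
     prob {\<omega> \<in> space M. \<bar>tsum (level \<kappa> n) n \<omega>\<bar> \<ge> u \<and> (\<exists>i\<in>{1..n}. level \<kappa> n < \<bar>X i \<omega>\<bar>)}
       \<le> 2 * (real n * prob {\<omega> \<in> space M. level \<kappa> n < \<bar>X 1 \<omega>\<bar>}) * logl (real n) powr (- \<rho>)"
      by (intro conjI order_trans[OF tsum_tail[OF k0 s0] mult_left_mono[OF ex]]
        order_trans[OF tsum_tail_jump[OF k0 s0] mult_left_mono[OF ex]]) auto
    qed
  qed
qed

text \<open>Jumps above \<open>\<delta> \<surd>(n log log n)\<close> are controlled by the probability of a single one. For the
  excess \<open>Z\<close> of the others use Chernoff in the form \<open>(e\<^sup>s\<^sup>h - 1) P(Z \<ge> h) \<le> E e\<^sup>s\<^sup>Z - 1\<close>: the right side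
  keeps a factor of the mean excess, and an exponent \<open>s\<close> with \<open>s h = 5 ln (log log n)\<close> gains the power of \<open>log log n\<close> needed for
  summability.\<close>

lemma summable_esum_tail:
  assumes \<kappa>: "0 < \<kappa>" and h: "0 < h"
    and intG: "integrable M (\<lambda>\<omega>. (X 1 \<omega>)\<^sup>2 * logl \<bar>X 1 \<omega>\<bar> powr a * loglogl \<bar>X 1 \<omega>\<bar> powr (b - 1))"
  shows "summable (\<lambda>n. wt a b n * prob {\<omega> \<in> space M. esum (level \<kappa> n) n \<omega> \<ge> h * sqrt (real n * loglogl (real n))})"
proof -
  define v where "v = expectation (\<lambda>\<omega>. (X 1 \<omega>)\<^sup>2)"
  \<comment> \<open>With L = log log n and the exponent \<open>s\<close> below, K h = 5 makes exp (s
    h sqrt (n L)) equal to L^5, and K \<delta> = 1/2 makes exp (s E) equal to sqrt L at the upper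
    cutoff. The outcome L^(-5) L L^(5/2) = L^(-3/2) is the power that the weighted moment can pay
    for.\<close>
  define K where "K = 5 / h"
  define \<delta> where "\<delta> = h / 10"
  have K: "K > 0" "K * h = 5" "K * \<delta> = 1/2" using h by (auto simp: K_def \<delta>_def)
  have \<delta>: "\<delta> > 0" using h by (simp add: \<delta>_def)
  define hi where "hi n = \<delta> * sqrt (real n) * loglogl (real n) powr (1/2)" for n :: nat
  have v0: "v \<ge> 0" by (simp add: v_def)
  \<comment> \<open>The powers of log log n are lowered so that both tail sums require the same
    moment: (b - 1/2) - 1/2 and (b - 3/2) + 1/2 both equal b - 1.\<close>
  have s1: "summable (\<lambda>n. wt a (b - 1/2) n * (sqrt (real n) * expectation (\<lambda>\<omega>. excess (hi n) (X 1 \<omega>))))"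
    unfolding hi_def by (rule summable_tail_moment[OF \<delta> int2]) (use intG in simp)
  have s2: "summable (\<lambda>n. wt a (b - 3/2) n * (sqrt (real n) * expectation (\<lambda>\<omega>. excess (level \<kappa> n) (X 1 \<omega>))))"
    unfolding level_def by (rule summable_tail_moment[OF \<kappa> int2]) (use intG in simp)
  have "(\<lambda>n. K / \<kappa> * tail_var (level \<kappa> n)) \<longlonglongrightarrow> K / \<kappa> * 0"
    by (intro tendsto_mult tendsto_const filterlim_compose[OF tail_var_tendsto level_top[OF \<kappa>]])
  then have e1: "\<forall>\<^sub>F n in sequentially. K / \<kappa> * tail_var (level \<kappa> n) < 5/2" by (intro order_tendstoD) auto
  have "(\<lambda>n. K\<^sup>2 * v / 2 * (ln (loglogl (real n)))\<^sup>2 / sqrt (loglogl (real n))) \<longlonglongrightarrow> 0"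
    by (rule filterlim_seq_cong[of "\<lambda>n l L. K\<^sup>2 * v / 2 * (ln L)\<^sup>2 / sqrt L"]) real_asymp
  then have e2: "\<forall>\<^sub>F n in sequentially. K\<^sup>2 * v / 2 * (ln (loglogl (real n)))\<^sup>2 / sqrt (loglogl (real n)) < 1" by (intro order_tendstoD) auto
  have e3: "\<forall>\<^sub>F n in sequentially. 2 \<le> loglogl (real n)"
    using loglogl_top unfolding filterlim_at_top by blast
  show ?thesis
  proof (rule summable_comparison_test_ev)
    show "summable (\<lambda>n. 1 / \<delta> * (wt a (b - 1/2) n * (sqrt (real n) * expectation (\<lambda>\<omega>. excess (hi n) (X 1 \<omega>)))) +
        2 * exp 1 * K * (wt a (b - 3/2) n * (sqrt (real n) * expectation (\<lambda>\<omega>. excess (level \<kappa> n) (X 1 \<omega>)))))"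
      by (intro summable_add summable_mult s1 s2)
    show "\<forall>\<^sub>F n in sequentially. norm (wt a b n * prob {\<omega> \<in> space M. esum (level \<kappa> n) n \<omega> \<ge> h * sqrt (real n * loglogl (real n))})
      \<le> 1 / \<delta> * (wt a (b - 1/2) n * (sqrt (real n) * expectation (\<lambda>\<omega>. excess (hi n) (X 1 \<omega>)))) +
        2 * exp 1 * K * (wt a (b - 3/2) n * (sqrt (real n) * expectation (\<lambda>\<omega>. excess (level \<kappa> n) (X 1 \<omega>))))"
      using e1 e2 e3 eventually_gt_at_top[of 0]
    proof eventually_elim
      case (elim n)
      define L where "L = loglogl (real n)"
      define k where "k = level \<kappa> n"
      define E where "E = hi n"
      define s where "s = K * ln L / sqrt (real n * L)"
      \<comment> \<open>The excess of jumps between \<open>k\<close> and \<open>E\<close>; jumps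
        beyond \<open>E\<close> form the event \<open>J\<close>.\<close>
      define mid where "mid x = (if \<bar>x\<bar> \<le> E then excess k x else 0)" for x :: real
      define exc where "exc = expectation (\<lambda>\<omega>. excess k (X 1 \<omega>))"
      have mid_m [measurable]: "mid \<in> borel_measurable borel" unfolding mid_def by measurable
      have L: "L \<ge> 2" using elim(3) by (simp add: L_def)
      have L0: "L > 0" "ln L \<ge> 0" using L by auto
      have rn: "sqrt (real n) > 0" using elim(4) by simp
      have k: "k = \<kappa> * sqrt (real n) / sqrt L" by (simp only: k_def level_eq L_def)
      have k0: "k > 0" using \<kappa> rn L by (simp add: k)
      have E: "E = \<delta> * sqrt (real n) * sqrt L" using L by (simp add: E_def hi_def L_def powr_half_sqrt)
      have E0: "E > 0" using \<delta> rn L by (simp add: E)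
      have s0: "s \<ge> 0" using K L0 by (simp add: s_def)
      have sE: "s * E = ln L / 2"
      proof -
        have "s * E = K * \<delta> * ln L" using rn L0 by (simp add: s_def E real_sqrt_mult)
        then show ?thesis by (simp add: K(3))
      qed
      have eE: "exp (s * E) = sqrt L" unfolding sE using L0 by (simp add: powr_half_sqrt[symmetric] powr_def)
      have mid: "0 \<le> mid x" "mid x \<le> excess k x" "mid x \<le> E" "(mid x)\<^sup>2 \<le> x\<^sup>2" for x
      proof -
        show "0 \<le> mid x" "mid x \<le> excess k x" by (auto simp: mid_def)
        show "mid x \<le> E" using E0 excess_le[of k x] by (auto simp: mid_def)
        have "mid x \<le> \<bar>x\<bar>" using excess_le[of k x] by (auto simp: mid_def)
        then have "(mid x)\<^sup>2 \<le> \<bar>x\<bar>\<^sup>2" using \<open>0 \<le> mid x\<close> by (intro power_mono) auto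
        then show "(mid x)\<^sup>2 \<le> x\<^sup>2" by simp
      qed
      have eb: "exp (s * mid x) \<le> sqrt L" for x
        unfolding eE[symmetric] using mid(3)[of x] s0 by (simp add: mult_left_mono)
      have int_e: "integrable M (\<lambda>\<omega>. exp (s * mid (X 1 \<omega>)))"
        by (rule integrable_const_bound[of _ "sqrt L"]) (use eb in auto)
      define \<mu> where "\<mu> = expectation (\<lambda>\<omega>. exp (s * mid (X 1 \<omega>))) - 1"
      \<comment> \<open>Two bounds on the same quantity. This one shows n \<mu> \<le> (5/2) ln L + 1
        and so controls exp (n \<mu>); the next one keeps the mean excess as a factor.\<close>
      have \<mu>1: "\<mu> \<le> s * exc + s\<^sup>2 / 2 * sqrt L * v"
      proof -
        have "expectation (\<lambda>\<omega>. exp (s * mid (X 1 \<omega>))) \<le> expectation (\<lambda>\<omega>. 1 + s * excess k (X 1 \<omega>) + s\<^sup>2 / 2 * sqrt L * (X 1 \<omega>)\<^sup>2)"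
        proof (intro integral_mono int_e)
          show "integrable M (\<lambda>\<omega>. 1 + s * excess k (X 1 \<omega>) + s\<^sup>2 / 2 * sqrt L * (X 1 \<omega>)\<^sup>2)"
            using int2 integrable_excess by (intro Bochner_Integration.integrable_add integrable_mult_right) auto
          fix \<omega>
          let ?y = "s * mid (X 1 \<omega>)"
          have y0: "0 \<le> ?y" using s0 mid by simp
          have "?y\<^sup>2 / 2 * exp \<bar>?y\<bar> \<le> s\<^sup>2 * (X 1 \<omega>)\<^sup>2 / 2 * sqrt L"
            using y0 eb mid(4)[of "X 1 \<omega>"] by (intro mult_mono divide_right_mono) (auto simp: power_mult_distrib mult_left_mono)
          moreover have "?y \<le> s * excess k (X 1 \<omega>)" using s0 mid by (intro mult_left_mono) auto
          ultimately show "exp ?y \<le> 1 + s * excess k (X 1 \<omega>) + s\<^sup>2 / 2 * sqrt L * (X 1 \<omega>)\<^sup>2"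
            using exp_le_quadratic[of ?y] by (simp add: mult_ac)
        qed
        also have "\<dots> = 1 + s * exc + s\<^sup>2 / 2 * sqrt L * v"
          using int2 integrable_excess[of k] by (simp add: prob_space exc_def v_def)
        finally show ?thesis by (simp add: \<mu>_def)
      qed
      have \<mu>2: "\<mu> \<le> s * sqrt L * exc"
      proof -
        have "expectation (\<lambda>\<omega>. exp (s * mid (X 1 \<omega>))) \<le> expectation (\<lambda>\<omega>. 1 + s * sqrt L * excess k (X 1 \<omega>))"
        proof (intro integral_mono int_e)
          show "integrable M (\<lambda>\<omega>. 1 + s * sqrt L * excess k (X 1 \<omega>))"
            using integrable_excess by (intro Bochner_Integration.integrable_add integrable_mult_right) auto
          fix \<omega>
          let ?y = "s * mid (X 1 \<omega>)"
          have y0: "0 \<le> ?y" using s0 mid by simp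
          have "exp ?y - 1 \<le> ?y * exp ?y" using y0 by (rule exp_minus_one_le)
          also have "\<dots> \<le> (s * excess k (X 1 \<omega>)) * sqrt L"
            using y0 s0 mid eb by (intro mult_mono) auto
          finally show "exp ?y \<le> 1 + s * sqrt L * excess k (X 1 \<omega>)" by (simp add: mult_ac)
        qed
        also have "\<dots> = 1 + s * sqrt L * exc"
          using integrable_excess[of k] by (simp add: prob_space exc_def)
        finally show ?thesis by (simp add: \<mu>_def)
      qed
      have \<mu>0: "\<mu> \<ge> 0"
      proof -
        have "1 \<le> expectation (\<lambda>\<omega>. exp (s * mid (X 1 \<omega>)))"
          using integral_mono[of M "\<lambda>_. 1" "\<lambda>\<omega>. exp (s * mid (X 1 \<omega>))"] int_e s0 mid by (simp add: prob_space)
        then show ?thesis by (simp add: \<mu>_def)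
      qed
      have exc0: "exc \<ge> 0" unfolding exc_def by (intro integral_nonneg_AE) auto
      have n\<mu>1: "real n * \<mu> \<le> 5/2 * ln L + 1"
      proof -
        have "real n * \<mu> \<le> real n * (s * exc + s\<^sup>2 / 2 * sqrt L * v)" using \<mu>1 by (intro mult_left_mono) auto
        also have "\<dots> = real n * s * exc + real n * s\<^sup>2 / 2 * sqrt L * v" by (simp add: algebra_simps)
        also have "real n * s * exc \<le> real n * s * (tail_var k / k)"
          unfolding exc_def using s0 by (intro mult_left_mono expectation_excess_le k0) auto
        also have "real n * s * (tail_var k / k) = K / \<kappa> * tail_var k * ln L"
        proof -
          have "real n * s / k = K / \<kappa> * ln L"
          proof -
            have "real n * s / k = (sqrt (real n) * sqrt (real n)) * (K * ln L / (sqrt (real n) * sqrt L)) / (\<kappa> * sqrt (real n) / sqrt L)"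
              by (simp only: s_def k real_sqrt_mult real_sqrt_mult_self abs_of_nat)
            also have "\<dots> = K * ln L / \<kappa>" by (rule scale_cancel) (use rn L0 in auto)
            finally show ?thesis by simp
          qed
          moreover have "real n * s * (tail_var k / k) = (real n * s / k) * tail_var k" by simp
          ultimately show ?thesis by simp
        qed
        also have "\<dots> \<le> 5/2 * ln L" using elim(1) L0 by (intro mult_right_mono) (auto simp: k_def)
        also have "real n * s\<^sup>2 / 2 * sqrt L * v = K\<^sup>2 * v / 2 * (ln L)\<^sup>2 / sqrt L"
        proof -
          have f1: "real n * s\<^sup>2 = K\<^sup>2 * (ln L)\<^sup>2 / L" using elim(4) L0 by (simp add: s_def power_mult_distrib power_divide)
          have f2: "sqrt L / L = 1 / sqrt L" using L0 by (simp add: sqrt_divide_self_eq inverse_eq_divide)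
          have "real n * s\<^sup>2 / 2 * sqrt L * v = (real n * s\<^sup>2) * (sqrt L * v / 2)" by simp
          also have "\<dots> = (K\<^sup>2 * (ln L)\<^sup>2 / L) * (sqrt L * v / 2)" by (simp only: f1)
          also have "\<dots> = (K\<^sup>2 * (ln L)\<^sup>2 * v / 2) * (sqrt L / L)" by (simp add: mult_ac)
          also have "\<dots> = (K\<^sup>2 * (ln L)\<^sup>2 * v / 2) * (1 / sqrt L)" by (simp only: f2)
          finally show ?thesis by (simp add: mult_ac)
        qed
        also have "\<dots> \<le> 1" using elim(2) by (simp add: L_def)
        finally show ?thesis by simp
      qed
      have n\<mu>2: "real n * \<mu> \<le> K * L * sqrt (real n) * exc"
      proof -
        have "real n * \<mu> \<le> real n * (s * sqrt L * exc)" using \<mu>2 by (intro mult_left_mono) auto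
        also have "\<dots> = K * ln L * sqrt (real n) * exc"
        proof -
          have "real n * (s * sqrt L * exc) = (sqrt (real n) * sqrt (real n)) * (K * ln L / (sqrt (real n) * sqrt L) * sqrt L * exc)"
            by (simp only: s_def real_sqrt_mult real_sqrt_mult_self abs_of_nat)
          also have "\<dots> = K * ln L * sqrt (real n) * exc" by (rule scale_cancel) (use rn L0 in auto)
          finally show ?thesis .
        qed
        also have "\<dots> \<le> K * L * sqrt (real n) * exc"
          using K L0 exc0 ln_le_minus_one[of L] by (intro mult_right_mono mult_left_mono) auto
        finally show ?thesis .
      qed
      define Y where "Y \<omega> = (\<Sum>i\<in>{1..n}. mid (X i \<omega>))" for \<omega>
      have Y_m [measurable]: "Y \<in> borel_measurable M" unfolding Y_def by (rule rv_fun_sum) simp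
      have Y0: "Y \<omega> \<ge> 0" for \<omega> unfolding Y_def using mid by (intro sum_nonneg) auto
      have Ye: "exp (s * Y \<omega>) = (\<Prod>i\<in>{1..n}. exp (s * mid (X i \<omega>)))" for \<omega>
        by (simp add: Y_def sum_distrib_left exp_sum)
      have Yint: "integrable M (\<lambda>\<omega>. exp (s * Y \<omega>))"
        unfolding Ye by (rule integrable_prod[where g = "\<lambda>_ x. exp (s * mid x)"]) (use int_e in auto)
      have Yexp: "expectation (\<lambda>\<omega>. exp (s * Y \<omega>)) = (1 + \<mu>) ^ n"
      proof -
        have "expectation (\<lambda>\<omega>. exp (s * Y \<omega>)) = (\<Prod>i\<in>{1..n}. expectation (\<lambda>\<omega>. exp (s * mid (X 1 \<omega>))))"
          unfolding Ye by (rule expectation_prod[where g = "\<lambda>_ x. exp (s * mid x)"]) (use int_e in auto)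
        then show ?thesis by (simp add: \<mu>_def)
      qed
      let ?y0 = "h * sqrt (real n * L)"
      have sy0: "exp (s * ?y0) = L ^ 5"
      proof -
        have "s * ?y0 = (K * h) * ln L" using rn L0 by (simp add: s_def)
        then have "s * ?y0 = real 5 * ln L" by (simp add: K(2))
        then have "exp (s * ?y0) = exp (ln L) ^ 5" by (simp only: exp_of_nat_mult)
        then show ?thesis using L0 by simp
      qed
      have "(L ^ 5 - 1) * prob {\<omega> \<in> space M. Y \<omega> \<ge> ?y0} \<le> expectation (\<lambda>\<omega>. exp (s * Y \<omega>) - 1)"
      proof (rule Markov_bound)
        show "integrable M (\<lambda>\<omega>. exp (s * Y \<omega>) - 1)" using Yint by simp
        show "0 \<le> exp (s * Y \<omega>) - 1" for \<omega> using Y0 s0 by simp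
        fix \<omega> assume "\<omega> \<in> {\<omega> \<in> space M. Y \<omega> \<ge> ?y0}"
        then have "s * ?y0 \<le> s * Y \<omega>" using s0 by (intro mult_left_mono) auto
        then have "exp (s * ?y0) \<le> exp (s * Y \<omega>)" by simp
        then show "L ^ 5 - 1 \<le> exp (s * Y \<omega>) - 1" unfolding sy0 by simp
      qed measurable
      also have "\<dots> = (1 + \<mu>) ^ n - 1" using Yint Yexp by (simp add: prob_space)
      also have "\<dots> \<le> exp (real n * \<mu>) - 1"
      proof -
        have "(1 + \<mu>) ^ n \<le> exp \<mu> ^ n" using \<mu>0 exp_ge_add_one_self[of \<mu>] by (intro power_mono) auto
        then show ?thesis by (simp add: exp_of_nat_mult)
      qed
      also have "\<dots> \<le> (real n * \<mu>) * exp (real n * \<mu>)" using \<mu>0 by (intro exp_minus_one_le) auto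
      also have "\<dots> \<le> (K * L * sqrt (real n) * exc) * exp (5/2 * ln L + 1)"
      proof (rule mult_mono[OF n\<mu>2])
        show "exp (real n * \<mu>) \<le> exp (5/2 * ln L + 1)" using n\<mu>1 by simp
        show "0 \<le> K * L * sqrt (real n) * exc" using K(1) L0 exc0 by simp
      qed simp
      also have "exp (5/2 * ln L + 1) = exp 1 * L powr (5/2)" using L0 by (simp add: powr_def exp_add)
      finally have m1: "(L ^ 5 - 1) * prob {\<omega> \<in> space M. Y \<omega> \<ge> ?y0} \<le> K * L * sqrt (real n) * exc * (exp 1 * L powr (5/2))" .
      have L5: "L ^ 5 / 2 \<le> L ^ 5 - 1"
      proof -
        have "2 ^ 5 \<le> L ^ 5" using L by (intro power_mono) auto
        then show ?thesis by simp
      qed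
      have "L ^ 5 / 2 * prob {\<omega> \<in> space M. Y \<omega> \<ge> ?y0} \<le> K * L * sqrt (real n) * exc * (exp 1 * L powr (5/2))"
        using m1 mult_right_mono[OF L5, of "prob {\<omega> \<in> space M. Y \<omega> \<ge> ?y0}"] by simp
      then have mid_prob: "prob {\<omega> \<in> space M. Y \<omega> \<ge> ?y0} \<le> 2 * exp 1 * K * (L powr (- 3/2) * (sqrt (real n) * exc))"
      proof -
        assume *: "L ^ 5 / 2 * prob {\<omega> \<in> space M. Y \<omega> \<ge> ?y0} \<le> K * L * sqrt (real n) * exc * (exp 1 * L powr (5/2))"
        have "L * L powr (5/2) = L ^ 5 * L powr (- 3/2)"
        proof -
          have "L * L powr (5/2) = L powr (1 + 5/2)" using L0 by (subst powr_add) simp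
          also have "\<dots> = L powr (5 + - 3/2)" by simp
          also have "\<dots> = L ^ 5 * L powr (- 3/2)" using L0 by (subst powr_add) (simp add: powr_numeral)
          finally show ?thesis .
        qed
        then have "K * L * sqrt (real n) * exc * (exp 1 * L powr (5/2)) = L ^ 5 / 2 * (2 * exp 1 * K * (L powr (- 3/2) * (sqrt (real n) * exc)))"
          by (simp add: mult_ac)
        with * show ?thesis using L0 by (simp add: mult_le_cancel_left)
      qed
      define J where "J = {\<omega> \<in> space M. \<exists>i\<in>{1..n}. E < \<bar>X i \<omega>\<bar>}"
      have J_m [measurable]: "J \<in> events" unfolding J_def by (rule jump_event)
      have "prob J \<le> (\<Sum>i\<in>{1..n}. prob {\<omega> \<in> space M. E < \<bar>X i \<omega>\<bar>})"
      proof -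
        have "J = (\<Union>i\<in>{1..n}. {\<omega> \<in> space M. E < \<bar>X i \<omega>\<bar>})" by (auto simp: J_def)
        moreover have "{\<omega> \<in> space M. E < \<bar>X i \<omega>\<bar>} \<in> events" if "i \<in> {1..n}" for i
        proof -
          have [measurable]: "X i \<in> borel_measurable M" using rv[of i] that by simp
          show ?thesis by measurable
        qed
        ultimately show ?thesis by (simp only:) (intro measure_UNION_le; simp)
      qed
      also have "\<dots> = (\<Sum>i\<in>{1..n}. prob {\<omega> \<in> space M. E < \<bar>X 1 \<omega>\<bar>})"
        by (intro sum.cong refl prob_ident) auto
      also have "\<dots> = real n * prob {\<omega> \<in> space M. E < \<bar>X 1 \<omega>\<bar>}" by simp
      also have "\<dots> \<le> real n * (expectation (\<lambda>\<omega>. excess E (X 1 \<omega>)) / E)"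
      proof -
        have "E * prob {\<omega> \<in> space M. E < \<bar>X 1 \<omega>\<bar>} \<le> expectation (\<lambda>\<omega>. excess E (X 1 \<omega>))"
          by (rule Markov_bound[OF integrable_excess]) (auto simp: excess_def)
        then have "prob {\<omega> \<in> space M. E < \<bar>X 1 \<omega>\<bar>} \<le> expectation (\<lambda>\<omega>. excess E (X 1 \<omega>)) / E" using E0 by (simp add: field_simps)
        then show ?thesis by (intro mult_left_mono) auto
      qed
      also have "\<dots> = 1 / \<delta> * (L powr (- 1/2) * (sqrt (real n) * expectation (\<lambda>\<omega>. excess E (X 1 \<omega>))))"
      proof -
        have "real n / E = 1 / \<delta> * (L powr (- 1/2) * sqrt (real n))"
        proof -
          have "real n / E = (sqrt (real n) * sqrt (real n)) / (\<delta> * sqrt (real n) * sqrt L)"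
            by (simp only: E real_sqrt_mult_self abs_of_nat)
          also have "\<dots> = 1 / \<delta> * (1 / sqrt L * sqrt (real n))" by (rule scale_cancel) (use rn L0 in auto)
          also have "1 / sqrt L = L powr (- 1/2)"
            using L0 powr_minus[of L "1/2"] by (simp add: powr_half_sqrt inverse_eq_divide)
          finally show ?thesis .
        qed
        moreover have "real n * (expectation (\<lambda>\<omega>. excess E (X 1 \<omega>)) / E) = (real n / E) * expectation (\<lambda>\<omega>. excess E (X 1 \<omega>))" by simp
        ultimately show ?thesis by (simp only: mult.assoc)
      qed
      finally have jump_prob: "prob J \<le> 1 / \<delta> * (L powr (- 1/2) * (sqrt (real n) * expectation (\<lambda>\<omega>. excess E (X 1 \<omega>))))" .
      have "prob {\<omega> \<in> space M. esum k n \<omega> \<ge> ?y0} \<le> prob (J \<union> {\<omega> \<in> space M. Y \<omega> \<ge> ?y0})"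
      proof (intro finite_measure_mono subsetI)
        fix \<omega> assume \<omega>: "\<omega> \<in> {\<omega> \<in> space M. esum k n \<omega> \<ge> ?y0}"
        show "\<omega> \<in> J \<union> {\<omega> \<in> space M. Y \<omega> \<ge> ?y0}"
        proof (cases "\<omega> \<in> J")
          case False
          then have "Y \<omega> = esum k n \<omega>" using \<omega> by (auto simp: J_def Y_def esum_def mid_def intro!: sum.cong)
          then show ?thesis using \<omega> by auto
        qed simp
      qed measurable
      also have "\<dots> \<le> prob J + prob {\<omega> \<in> space M. Y \<omega> \<ge> ?y0}" by (intro measure_Un_le) measurable
      finally have tot: "prob {\<omega> \<in> space M. esum k n \<omega> \<ge> ?y0} \<le>
          1 / \<delta> * (L powr (- 1/2) * (sqrt (real n) * expectation (\<lambda>\<omega>. excess E (X 1 \<omega>)))) + 2 * exp 1 * K * (L powr (- 3/2) * (sqrt (real n) * exc))"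
        using mid_prob jump_prob by linarith
      have w: "wt a b n * L powr (- 1/2) = wt a (b - 1/2) n" "wt a b n * L powr (- 3/2) = wt a (b - 3/2) n"
        using powr_add[of L b "- 1/2"] powr_add[of L b "- 3/2"] by (simp_all add: wt_def L_def)
      have "norm (wt a b n * prob {\<omega> \<in> space M. esum k n \<omega> \<ge> ?y0}) = wt a b n * prob {\<omega> \<in> space M. esum k n \<omega> \<ge> ?y0}" by simp
      also have "\<dots> \<le> wt a b n * (1 / \<delta> * (L powr (- 1/2) * (sqrt (real n) * expectation (\<lambda>\<omega>. excess E (X 1 \<omega>)))) + 2 * exp 1 * K * (L powr (- 3/2) * (sqrt (real n) * exc)))"
        by (intro mult_left_mono tot) simp
      also have "\<dots> = 1 / \<delta> * ((wt a b n * L powr (- 1/2)) * (sqrt (real n) * expectation (\<lambda>\<omega>. excess E (X 1 \<omega>)))) +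
          2 * exp 1 * K * ((wt a b n * L powr (- 3/2)) * (sqrt (real n) * exc))" by (simp add: algebra_simps)
      finally show ?case unfolding w by (simp only: k_def E_def L_def exc_def)
    qed
  qed
qed

end

subsection \<open>Sharp Gaussian upper bound for truncated sums\<close>

lemma normal_density_zero: "0 < w \<Longrightarrow> normal_density 0 w y = exp (- (y / w)\<^sup>2 / 2) / (sqrt (2 * pi) * w)"
  by (simp add: normal_density_def real_sqrt_mult power_divide)

context prob_space begin

text \<open>If u \<le> S, shifting the Gaussian kernel by r = m w puts the mass \<open>p\<close> of
  it into [S, S + 2 r], where z \<ge> u and exp (- t (z - u)) exp (t S) \<ge> exp (t u - 2 t r).
  After exchanging the integrals, exp (- t (z - u)) is integrated over z \<ge> u and produces 1 / t,
  the factor that Chernoff's inequality misses.\<close>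

lemma tail_le_smoothed:
  fixes S :: "'a \<Rightarrow> real"
  assumes S [measurable]: "S \<in> borel_measurable M"
    and t: "0 < t" and w: "0 < w" and m: "0 \<le> m"
    and p: "p = measure std_normal_distribution {-m..m}" "0 < p"
    and int: "\<And>z. integrable M (\<lambda>\<omega>. exp (t * S \<omega>) * normal_density 0 w (z - S \<omega>))"
    and H: "\<And>z. expectation (\<lambda>\<omega>. exp (t * S \<omega>) * normal_density 0 w (z - S \<omega>)) \<le> H"
  shows "prob {\<omega> \<in> space M. u \<le> S \<omega>} \<le> exp (2 * t * m * w - t * u) / (p * t) * H"
proof -
  interpret P: pair_sigma_finite M lborel ..
  interpret R: real_distribution std_normal_distribution by (rule real_dist_normal_dist)
  define r where "r = m * w"
  define C where "C = exp (2 * t * r - t * u) / p"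
  define F where "F \<omega> z = ennreal (exp (- (t * (z - u)))) * indicator {u..} z * ennreal (exp (t * S \<omega>) * normal_density 0 w (z - r - S \<omega>))" for \<omega> z
  have Fm [measurable]: "case_prod F \<in> borel_measurable (M \<Otimes>\<^sub>M lborel)" unfolding F_def normal_density_def by measurable
  have H0: "0 \<le> H" by (rule order_trans[OF _ H[of 0]]) (intro integral_nonneg_AE AE_I2 mult_nonneg_nonneg, auto simp: normal_density_nonneg w)
  have mass: "(\<integral>\<^sup>+z. ennreal (normal_density 0 w (z - r - x)) * indicator {x..x+2*r} z \<partial>lborel) = ennreal p" for x
  proof -
    have "(\<integral>\<^sup>+z. ennreal (normal_density 0 w (z - r - x)) * indicator {x..x+2*r} z \<partial>lborel)
       = ennreal \<bar>w\<bar> * (\<integral>\<^sup>+y. ennreal (normal_density 0 w ((x + r + w * y) - r - x)) * indicator {x..x+2*r} (x + r + w * y) \<partial>lborel)"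
      using w by (subst nn_integral_real_affine[where c = w and t = "x + r"]) (auto simp: normal_density_def)
    also have "\<dots> = (\<integral>\<^sup>+y. ennreal \<bar>w\<bar> * (ennreal (normal_density 0 w ((x + r + w * y) - r - x)) * indicator {x..x+2*r} (x + r + w * y)) \<partial>lborel)"
      by (subst nn_integral_cmult) (auto simp: normal_density_def)
    also have "\<dots> = (\<integral>\<^sup>+y. ennreal (std_normal_density y) * indicator {-m..m} y \<partial>lborel)"
    proof (intro nn_integral_cong)
      fix y
      have "x + r + w * y \<in> {x..x+2*r} \<longleftrightarrow> y \<in> {-m..m}"
      proof -
        have "x + r + w * y \<in> {x..x+2*r} \<longleftrightarrow> w * (- m) \<le> w * y \<and> w * y \<le> w * m" by (auto simp: r_def mult.commute)
        then show ?thesis using w by (simp only: mult_le_cancel_left_pos atLeastAtMost_iff)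
      qed
      then have "indicator {x..x+2*r} (x + r + w * y) = (indicator {-m..m} y :: ennreal)" by (simp add: indicator_def)
      moreover have "ennreal \<bar>w\<bar> * ennreal (normal_density 0 w ((x + r + w * y) - r - x)) = ennreal (std_normal_density y)"
        using w by (subst ennreal_mult'[symmetric]) (auto simp: normal_density_zero std_normal_density_def field_simps)
      ultimately show "ennreal \<bar>w\<bar> * (ennreal (normal_density 0 w ((x + r + w * y) - r - x)) * indicator {x..x+2*r} (x + r + w * y))
        = ennreal (std_normal_density y) * indicator {-m..m} y" by (simp add: mult.assoc[symmetric])
    qed
    also have "\<dots> = emeasure std_normal_distribution {-m..m}" by (subst emeasure_density) auto
    finally show ?thesis by (simp add: p(1) R.emeasure_eq_measure)
  qed
  have pt: "indicator {\<omega> \<in> space M. u \<le> S \<omega>} \<omega> \<le> ennreal C * (\<integral>\<^sup>+z. F \<omega> z \<partial>lborel)" if "\<omega> \<in> space M" for \<omega>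
  proof (cases "u \<le> S \<omega>")
    case True
    define x where "x = S \<omega>"
    have r0: "r \<ge> 0" using m w by (simp add: r_def)
    have "ennreal (exp (t * u - 2 * t * r)) * ennreal p
        = (\<integral>\<^sup>+z. ennreal (exp (t * u - 2 * t * r)) * (ennreal (normal_density 0 w (z - r - x)) * indicator {x..x+2*r} z) \<partial>lborel)"
      unfolding mass[symmetric, of x] by (subst nn_integral_cmult) (auto simp: normal_density_def)
    also have "\<dots> \<le> (\<integral>\<^sup>+z. F \<omega> z \<partial>lborel)"
    proof (intro nn_integral_mono)
      fix z
      show "ennreal (exp (t * u - 2 * t * r)) * (ennreal (normal_density 0 w (z - r - x)) * indicator {x..x+2*r} z) \<le> F \<omega> z"
      proof (cases "z \<in> {x..x+2*r}")
        case z: True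
        have "exp (t * u - 2 * t * r) \<le> exp (- (t * (z - u))) * exp (t * x)"
        proof -
          have "t * (z - x) \<le> t * (2 * r)" using z t by (intro mult_left_mono) auto
          then have "t * u - 2 * t * r \<le> - (t * (z - u)) + t * x" by (simp add: algebra_simps)
          then show ?thesis by (simp add: exp_add[symmetric])
        qed
        then have "exp (t * u - 2 * t * r) * normal_density 0 w (z - r - x) \<le> exp (- (t * (z - u))) * exp (t * x) * normal_density 0 w (z - r - x)"
          by (intro mult_right_mono) (auto simp: normal_density_nonneg w)
        then have "ennreal (exp (t * u - 2 * t * r) * normal_density 0 w (z - r - x)) \<le> ennreal (exp (- (t * (z - u))) * (exp (t * x) * normal_density 0 w (z - r - x)))"
          by (intro ennreal_leI) (simp add: mult.assoc)
        moreover have "z \<ge> u" using z True by (auto simp: x_def)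
        ultimately show ?thesis using z by (simp add: F_def x_def ennreal_mult' normal_density_nonneg w)
      qed simp
    qed
    finally have *: "ennreal (exp (t * u - 2 * t * r) * p) \<le> (\<integral>\<^sup>+z. F \<omega> z \<partial>lborel)" using p(2) by (simp add: ennreal_mult')
    have "C * (exp (t * u - 2 * t * r) * p) = 1"
      using p(2) by (simp add: C_def exp_diff field_simps)
    then have "ennreal C * ennreal (exp (t * u - 2 * t * r) * p) = 1"
      using p(2) by (subst ennreal_mult'[symmetric]) (auto simp: C_def)
    with mult_left_mono[OF *, of "ennreal C"] show ?thesis using True that by simp
  qed simp
  have "ennreal (prob {\<omega> \<in> space M. u \<le> S \<omega>}) = (\<integral>\<^sup>+\<omega>. indicator {\<omega> \<in> space M. u \<le> S \<omega>} \<omega> \<partial>M)"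
    by (simp add: emeasure_eq_measure)
  also have "\<dots> \<le> (\<integral>\<^sup>+\<omega>. ennreal C * (\<integral>\<^sup>+z. F \<omega> z \<partial>lborel) \<partial>M)" by (intro nn_integral_mono pt)
  also have "\<dots> = ennreal C * (\<integral>\<^sup>+\<omega>. (\<integral>\<^sup>+z. F \<omega> z \<partial>lborel) \<partial>M)" by (intro nn_integral_cmult) measurable
  also have "(\<integral>\<^sup>+\<omega>. (\<integral>\<^sup>+z. F \<omega> z \<partial>lborel) \<partial>M) = (\<integral>\<^sup>+z. (\<integral>\<^sup>+\<omega>. F \<omega> z \<partial>M) \<partial>lborel)"
    using P.Fubini[OF Fm] by simp
  also have "\<dots> \<le> (\<integral>\<^sup>+z. ennreal (exp (- (t * (z - u))) * H) * indicator {u..} z \<partial>lborel)"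
  proof (intro nn_integral_mono)
    fix z
    have "(\<integral>\<^sup>+\<omega>. F \<omega> z \<partial>M) = ennreal (exp (- (t * (z - u)))) * indicator {u..} z * (\<integral>\<^sup>+\<omega>. ennreal (exp (t * S \<omega>) * normal_density 0 w (z - r - S \<omega>)) \<partial>M)"
      unfolding F_def by (intro nn_integral_cmult) (simp add: normal_density_def)
    also have "(\<integral>\<^sup>+\<omega>. ennreal (exp (t * S \<omega>) * normal_density 0 w (z - r - S \<omega>)) \<partial>M) = ennreal (expectation (\<lambda>\<omega>. exp (t * S \<omega>) * normal_density 0 w (z - r - S \<omega>)))"
      by (intro nn_integral_eq_integral int) (auto simp: normal_density_nonneg w)
    also have "ennreal (exp (- (t * (z - u)))) * indicator {u..} z * \<dots> \<le> ennreal (exp (- (t * (z - u)))) * indicator {u..} z * ennreal H"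
      by (intro mult_left_mono ennreal_leI H) auto
    also have "\<dots> = ennreal (exp (- (t * (z - u))) * H) * indicator {u..} z"
      using H0 by (simp add: ennreal_mult' mult_ac)
    finally show "(\<integral>\<^sup>+\<omega>. F \<omega> z \<partial>M) \<le> ennreal (exp (- (t * (z - u))) * H) * indicator {u..} z" .
  qed
  also have "\<dots> = ennreal (0 - (- exp (- (t * (u - u))) / t * H))"
  proof (rule nn_integral_FTC_atLeast[where F = "\<lambda>z. - exp (- (t * (z - u))) / t * H" and T = 0])
    show "((\<lambda>z. - exp (- (t * (z - u))) / t * H) has_real_derivative exp (- (t * (z - u))) * H) (at z)" if "u \<le> z" for z
      using t by (auto intro!: derivative_eq_intros)
    show "((\<lambda>z. - exp (- (t * (z - u))) / t * H) \<longlongrightarrow> 0) at_top" using t by real_asymp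
    show "0 \<le> exp (- (t * (z - u))) * H" if "u \<le> z" for z using H0 by simp
  qed measurable
  also have "\<dots> = ennreal (H / t)" by simp
  finally have "ennreal (prob {\<omega> \<in> space M. u \<le> S \<omega>}) \<le> ennreal C * ennreal (H / t)"
    by (simp add: mult_left_mono)
  also have "\<dots> = ennreal (C * (H / t))" using p(2) by (subst ennreal_mult'[symmetric]) (auto simp: C_def)
  finally have "prob {\<omega> \<in> space M. u \<le> S \<omega>} \<le> C * (H / t)"
    using p(2) H0 t by (subst (asm) ennreal_le_iff) (auto simp: C_def)
  then show ?thesis by (simp add: C_def r_def field_simps)
qed

text \<open>The Gaussian kernel is a constant times the characteristic function of the standard
  normal law at (S - z) / w. After Fubini, z survives only in a factor of modulus 1, so the bound is
  uniform in z, as \<open>tail_le_smoothed\<close> requires.\<close>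

lemma smoothed_density_le_Fourier:
  fixes S :: "'a \<Rightarrow> real"
  assumes S [measurable]: "S \<in> borel_measurable M" and Sb: "\<And>\<omega>. \<bar>S \<omega>\<bar> \<le> B" and t: "0 < t" and w: "0 < w"
  shows "integrable M (\<lambda>\<omega>. exp (t * S \<omega>) * normal_density 0 w (z - S \<omega>))"
    and "expectation (\<lambda>\<omega>. exp (t * S \<omega>) * normal_density 0 w (z - S \<omega>))
       \<le> (\<integral>\<nu>. norm (expectation (\<lambda>\<omega>. exp (Complex t (\<nu> / w) * complex_of_real (S \<omega>)))) \<partial>std_normal_distribution) / (sqrt (2 * pi) * w)"
proof -
  interpret N: real_distribution std_normal_distribution by (rule real_dist_normal_dist)
  interpret P: pair_prob_space M std_normal_distribution ..
  have eb: "exp (t * S \<omega>) \<le> exp (t * B)" for \<omega>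
  proof -
    have "S \<omega> \<le> B" using Sb[of \<omega>] by simp
    then show ?thesis using t by simp
  qed
  show int: "integrable M (\<lambda>\<omega>. exp (t * S \<omega>) * normal_density 0 w (z - S \<omega>))"
  proof (rule integrable_const_bound[of _ "exp (t * B) * (1 / (sqrt (2 * pi) * w))"])
    show "AE \<omega> in M. norm (exp (t * S \<omega>) * normal_density 0 w (z - S \<omega>)) \<le> exp (t * B) * (1 / (sqrt (2 * pi) * w))"
    proof (intro AE_I2)
      fix \<omega>
      have "normal_density 0 w (z - S \<omega>) \<le> 1 / (sqrt (2 * pi) * w)"
        unfolding normal_density_zero[OF w] using w by (intro divide_right_mono) auto
      then have "exp (t * S \<omega>) * normal_density 0 w (z - S \<omega>) \<le> exp (t * B) * (1 / (sqrt (2 * pi) * w))"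
        by (intro mult_mono eb) (auto simp: normal_density_nonneg w)
      moreover have "0 \<le> exp (t * S \<omega>) * normal_density 0 w (z - S \<omega>)" by (simp add: normal_density_nonneg w)
      ultimately show "norm (exp (t * S \<omega>) * normal_density 0 w (z - S \<omega>)) \<le> exp (t * B) * (1 / (sqrt (2 * pi) * w))"
        by (simp only: real_norm_def abs_of_nonneg)
    qed
  qed (simp add: normal_density_def)
  define c where "c = 1 / (sqrt (2 * pi) * w)"
  define f where "f \<omega> \<nu> = exp (t * S \<omega>) * iexp ((S \<omega> - z) / w * \<nu>)" for \<omega> \<nu>
  have fm [measurable]: "case_prod f \<in> borel_measurable (M \<Otimes>\<^sub>M std_normal_distribution)"
    unfolding f_def by measurable
  have fint: "integrable (M \<Otimes>\<^sub>M std_normal_distribution) (case_prod f)"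
  proof (rule P.integrable_const_bound[of _ "exp (t * B)"])
    have "cmod (f \<omega> \<nu>) \<le> exp (t * B)" for \<omega> \<nu>
      using eb[of \<omega>] unfolding f_def norm_mult norm_exp_i_times by simp
    then show "AE x in M \<Otimes>\<^sub>M std_normal_distribution. cmod (case_prod f x) \<le> exp (t * B)" by (intro AE_I2) auto
  qed measurable
  have inner: "complex_of_real (normal_density 0 w (z - S \<omega>)) = complex_of_real c * (\<integral>\<nu>. iexp ((S \<omega> - z) / w * \<nu>) \<partial>std_normal_distribution)" for \<omega>
  proof -
    have "(\<integral>\<nu>. iexp ((S \<omega> - z) / w * \<nu>) \<partial>std_normal_distribution) = char std_normal_distribution ((S \<omega> - z) / w)"
      by (simp add: char_def)
    also have "\<dots> = complex_of_real (exp (- ((S \<omega> - z) / w)\<^sup>2 / 2))" by (simp add: char_std_normal_distribution)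
    also have "((S \<omega> - z) / w)\<^sup>2 = ((z - S \<omega>) / w)\<^sup>2" by (simp add: power_divide power2_commute)
    finally show ?thesis by (simp add: normal_density_zero[OF w] c_def)
  qed
  have "complex_of_real (expectation (\<lambda>\<omega>. exp (t * S \<omega>) * normal_density 0 w (z - S \<omega>)))
     = expectation (\<lambda>\<omega>. complex_of_real (exp (t * S \<omega>) * normal_density 0 w (z - S \<omega>)))"
    by (rule integral_complex_of_real[symmetric])
  also have "\<dots> = expectation (\<lambda>\<omega>. complex_of_real c * (\<integral>\<nu>. f \<omega> \<nu> \<partial>std_normal_distribution))"
    unfolding f_def by (intro Bochner_Integration.integral_cong refl) (simp add: inner mult_ac)
  also have "\<dots> = complex_of_real c * expectation (\<lambda>\<omega>. (\<integral>\<nu>. f \<omega> \<nu> \<partial>std_normal_distribution))" by simp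
  also have "expectation (\<lambda>\<omega>. (\<integral>\<nu>. f \<omega> \<nu> \<partial>std_normal_distribution)) = (\<integral>\<nu>. expectation (\<lambda>\<omega>. f \<omega> \<nu>) \<partial>std_normal_distribution)"
    using P.Fubini_integral[OF fint] by simp
  finally have eq: "complex_of_real (expectation (\<lambda>\<omega>. exp (t * S \<omega>) * normal_density 0 w (z - S \<omega>)))
     = complex_of_real c * (\<integral>\<nu>. expectation (\<lambda>\<omega>. f \<omega> \<nu>) \<partial>std_normal_distribution)" .
  have c0: "c > 0" using w by (simp add: c_def)
  have "norm (complex_of_real (expectation (\<lambda>\<omega>. exp (t * S \<omega>) * normal_density 0 w (z - S \<omega>))))
     = c * norm (\<integral>\<nu>. expectation (\<lambda>\<omega>. f \<omega> \<nu>) \<partial>std_normal_distribution)"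
    unfolding eq norm_mult norm_of_real abs_of_pos[OF c0] ..
  then have "expectation (\<lambda>\<omega>. exp (t * S \<omega>) * normal_density 0 w (z - S \<omega>)) \<le> c * norm (\<integral>\<nu>. expectation (\<lambda>\<omega>. f \<omega> \<nu>) \<partial>std_normal_distribution)"
    by (metis abs_le_D1 norm_of_real order_refl)
  also have "\<dots> \<le> c * (\<integral>\<nu>. norm (expectation (\<lambda>\<omega>. f \<omega> \<nu>)) \<partial>std_normal_distribution)"
    using w by (intro mult_left_mono integral_norm_bound) (simp add: c_def)
  also have "(\<lambda>\<nu>. norm (expectation (\<lambda>\<omega>. f \<omega> \<nu>))) = (\<lambda>\<nu>. norm (expectation (\<lambda>\<omega>. exp (Complex t (\<nu> / w) * complex_of_real (S \<omega>)))))"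
  proof
    fix \<nu>
    have "f \<omega> \<nu> = iexp (- z / w * \<nu>) * exp (Complex t (\<nu> / w) * complex_of_real (S \<omega>))" for \<omega>
    proof -
      have "f \<omega> \<nu> = exp (complex_of_real (t * S \<omega>) + \<i> * complex_of_real ((S \<omega> - z) / w * \<nu>))"
        by (simp only: f_def exp_add exp_of_real)
      also have "complex_of_real (t * S \<omega>) + \<i> * complex_of_real ((S \<omega> - z) / w * \<nu>)
          = \<i> * complex_of_real (- z / w * \<nu>) + Complex t (\<nu> / w) * complex_of_real (S \<omega>)"
        using w by (auto simp: complex_eq_iff field_simps)
      finally show ?thesis by (simp only: exp_add)
    qed
    then have "expectation (\<lambda>\<omega>. f \<omega> \<nu>) = iexp (- z / w * \<nu>) * expectation (\<lambda>\<omega>. exp (Complex t (\<nu> / w) * complex_of_real (S \<omega>)))"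
      by (simp only: integral_mult_right_zero)
    then show "norm (expectation (\<lambda>\<omega>. f \<omega> \<nu>)) = norm (expectation (\<lambda>\<omega>. exp (Complex t (\<nu> / w) * complex_of_real (S \<omega>))))"
      by (simp add: norm_mult)
  qed
  finally show "expectation (\<lambda>\<omega>. exp (t * S \<omega>) * normal_density 0 w (z - S \<omega>))
       \<le> (\<integral>\<nu>. norm (expectation (\<lambda>\<omega>. exp (Complex t (\<nu> / w) * complex_of_real (S \<omega>)))) \<partial>std_normal_distribution) / (sqrt (2 * pi) * w)"
    by (simp add: c_def)
qed

text \<open>From |1 + \<alpha>|^2 = 1 + 2 Re \<alpha> + |\<alpha>|^2 and 1 + x \<le> exp x. Keeping
  the real part at first order, instead of the modulus, is what preserves Gaussian decay in the
  frequency.\<close>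

lemma norm_one_plus_le_exp: "norm (1 + \<alpha>) \<le> exp (Re \<alpha> + (norm \<alpha>)\<^sup>2 / 2)" for \<alpha> :: complex
proof (rule power2_le_imp_le)
  have "(norm (1 + \<alpha>))\<^sup>2 = 1 + (2 * Re \<alpha> + (norm \<alpha>)\<^sup>2)"
    unfolding cmod_power2 by (simp add: power2_eq_square algebra_simps)
  also have "\<dots> \<le> exp (2 * Re \<alpha> + (norm \<alpha>)\<^sup>2)" by (rule exp_ge_add_one_self)
  also have "\<dots> = (exp (Re \<alpha> + (norm \<alpha>)\<^sup>2 / 2))\<^sup>2" by (simp add: exp_double[symmetric] algebra_simps)
  finally show "(norm (1 + \<alpha>))\<^sup>2 \<le> (exp (Re \<alpha> + (norm \<alpha>)\<^sup>2 / 2))\<^sup>2" .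
qed simp

text \<open>Second order Taylor expansion with the third absolute moment as remainder; the decay
  comes from Re (t + i \<xi>)^2 = t^2 - \<xi>^2. The hypotheses carry the bounds \<open>m1\<close>,
  \<open>D\<close> and \<open>r\<close> so that one estimate serves all frequencies up to a
  cutoff.\<close>

lemma complex_mgf_le:
  fixes T :: "'a \<Rightarrow> real"
  assumes T [measurable]: "T \<in> borel_measurable M" and Tb: "\<And>\<omega>. \<bar>T \<omega>\<bar> \<le> k" and tk: "\<bar>t\<bar> * k \<le> e0"
    and m: "\<bar>expectation T\<bar> \<le> m1" and D: "norm (Complex t \<xi>) \<le> D"
    and V: "V = expectation (\<lambda>\<omega>. (T \<omega>)\<^sup>2)" and R: "exp e0 * D ^ 3 / 2 * expectation (\<lambda>\<omega>. \<bar>T \<omega>\<bar> ^ 3) \<le> r"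
  shows "norm (expectation (\<lambda>\<omega>. exp (Complex t \<xi> * complex_of_real (T \<omega>))))
     \<le> exp (\<bar>t\<bar> * m1 + (t\<^sup>2 - \<xi>\<^sup>2) * V / 2 + r + (D * m1 + D\<^sup>2 * V / 2 + r)\<^sup>2 / 2)"
proof -
  define \<zeta> where "\<zeta> = Complex t \<xi>"
  have k0: "0 \<le> k" using Tb[of undefined] by linarith
  have Tint: "integrable M (\<lambda>\<omega>. T \<omega> ^ j)" for j
    by (rule integrable_const_bound[of _ "k ^ j"]) (auto simp: power_abs intro!: power_mono Tb)
  have Tint1: "integrable M T" using Tint[of 1] by simp
  have Tint3: "integrable M (\<lambda>\<omega>. \<bar>T \<omega>\<bar> ^ 3)"
    by (rule integrable_const_bound[of _ "k ^ 3"]) (auto intro!: power_mono Tb)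
  have Eint: "integrable M (\<lambda>\<omega>. exp (\<zeta> * complex_of_real (T \<omega>)))"
  proof (rule integrable_const_bound[of _ "exp e0"])
    have "t * T \<omega> \<le> e0" for \<omega>
    proof -
      have "t * T \<omega> \<le> \<bar>t\<bar> * \<bar>T \<omega>\<bar>" by (simp add: abs_mult[symmetric])
      also have "\<dots> \<le> \<bar>t\<bar> * k" by (intro mult_left_mono Tb) simp
      finally show ?thesis using tk by linarith
    qed
    then show "AE \<omega> in M. norm (exp (\<zeta> * complex_of_real (T \<omega>))) \<le> exp e0"
      by (simp add: norm_exp_eq_Re \<zeta>_def)
  qed measurable
  have Tc: "integrable M (\<lambda>\<omega>. complex_of_real (T \<omega>))" "integrable M (\<lambda>\<omega>. complex_of_real ((T \<omega>)\<^sup>2))"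
    by (rule integrable_of_real, rule Tint1, rule integrable_of_real, rule Tint)
  have Qint: "integrable M (\<lambda>\<omega>. 1 + \<zeta> * complex_of_real (T \<omega>) + \<zeta>\<^sup>2 / 2 * complex_of_real ((T \<omega>)\<^sup>2))"
    by (intro Bochner_Integration.integrable_add integrable_mult_right Tc integrable_const)
  define rem where "rem = expectation (\<lambda>\<omega>. exp (\<zeta> * complex_of_real (T \<omega>)) - (1 + \<zeta> * complex_of_real (T \<omega>) + \<zeta>\<^sup>2 / 2 * complex_of_real ((T \<omega>)\<^sup>2)))"
  have D0: "D \<ge> 0" using D norm_ge_zero order_trans by blast
  have rem: "norm rem \<le> r"
  proof -
    have "norm rem \<le> expectation (\<lambda>\<omega>. norm (exp (\<zeta> * complex_of_real (T \<omega>)) - (1 + \<zeta> * complex_of_real (T \<omega>) + \<zeta>\<^sup>2 / 2 * complex_of_real ((T \<omega>)\<^sup>2))))"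
      unfolding rem_def by (rule integral_norm_bound)
    also have "\<dots> \<le> expectation (\<lambda>\<omega>. exp e0 * D ^ 3 / 2 * \<bar>T \<omega>\<bar> ^ 3)"
    proof (intro integral_mono integrable_norm Bochner_Integration.integrable_diff Eint Qint integrable_mult_right Tint3)
      fix \<omega>
      let ?z = "\<zeta> * complex_of_real (T \<omega>)"
      have "norm (exp ?z - (\<Sum>j\<le>2. ?z ^ j / fact j)) \<le> exp \<bar>Re ?z\<bar> * norm ?z ^ Suc 2 / fact 2" by (rule Taylor_exp)
      also have "(\<Sum>j\<le>2. ?z ^ j / fact j) = 1 + ?z + \<zeta>\<^sup>2 / 2 * complex_of_real ((T \<omega>)\<^sup>2)"
        by (simp add: numeral_2_eq_2 power2_eq_square mult_ac)
      also have "exp \<bar>Re ?z\<bar> * norm ?z ^ Suc 2 / fact 2 \<le> exp e0 * (D * \<bar>T \<omega>\<bar>) ^ 3 / 2"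
      proof -
        have "\<bar>Re ?z\<bar> \<le> \<bar>t\<bar> * k" by (simp add: \<zeta>_def abs_mult mult_left_mono Tb)
        then have "exp \<bar>Re ?z\<bar> \<le> exp e0" using tk by simp
        moreover have "norm ?z ^ 3 \<le> (D * \<bar>T \<omega>\<bar>) ^ 3"
          using D by (intro power_mono) (auto simp: norm_mult \<zeta>_def mult_right_mono)
        ultimately have "exp \<bar>Re ?z\<bar> * norm ?z ^ 3 \<le> exp e0 * (D * \<bar>T \<omega>\<bar>) ^ 3" by (intro mult_mono) auto
        then show ?thesis by (simp add: eval_nat_numeral)
      qed
      finally show "norm (exp ?z - (1 + ?z + \<zeta>\<^sup>2 / 2 * complex_of_real ((T \<omega>)\<^sup>2))) \<le> exp e0 * D ^ 3 / 2 * \<bar>T \<omega>\<bar> ^ 3"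
        by (simp add: power_mult_distrib mult_ac)
    qed
    also have "\<dots> = exp e0 * D ^ 3 / 2 * expectation (\<lambda>\<omega>. \<bar>T \<omega>\<bar> ^ 3)" by simp
    finally show ?thesis using R by linarith
  qed
  define \<alpha> where "\<alpha> = \<zeta> * complex_of_real (expectation T) + \<zeta>\<^sup>2 / 2 * complex_of_real V + rem"
  have "expectation (\<lambda>\<omega>. exp (\<zeta> * complex_of_real (T \<omega>))) = 1 + \<alpha>"
  proof -
    have "rem = expectation (\<lambda>\<omega>. exp (\<zeta> * complex_of_real (T \<omega>))) - expectation (\<lambda>\<omega>. 1 + \<zeta> * complex_of_real (T \<omega>) + \<zeta>\<^sup>2 / 2 * complex_of_real ((T \<omega>)\<^sup>2))"
      unfolding rem_def by (rule Bochner_Integration.integral_diff[OF Eint Qint])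
    also have "expectation (\<lambda>\<omega>. 1 + \<zeta> * complex_of_real (T \<omega>) + \<zeta>\<^sup>2 / 2 * complex_of_real ((T \<omega>)\<^sup>2))
       = expectation (\<lambda>\<omega>. 1 + \<zeta> * complex_of_real (T \<omega>)) + expectation (\<lambda>\<omega>. \<zeta>\<^sup>2 / 2 * complex_of_real ((T \<omega>)\<^sup>2))"
      by (intro Bochner_Integration.integral_add Bochner_Integration.integrable_add integrable_mult_right Tc integrable_const)
    also have "expectation (\<lambda>\<omega>. 1 + \<zeta> * complex_of_real (T \<omega>)) = 1 + \<zeta> * complex_of_real (expectation T)"
      using Tint1 by (subst Bochner_Integration.integral_add) (auto simp: prob_space integral_complex_of_real)
    also have "expectation (\<lambda>\<omega>. \<zeta>\<^sup>2 / 2 * complex_of_real ((T \<omega>)\<^sup>2)) = \<zeta>\<^sup>2 / 2 * complex_of_real V"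
      unfolding V integral_mult_right_zero integral_complex_of_real ..
    finally show ?thesis by (simp add: \<alpha>_def algebra_simps)
  qed
  then have "norm (expectation (\<lambda>\<omega>. exp (\<zeta> * complex_of_real (T \<omega>)))) \<le> exp (Re \<alpha> + (norm \<alpha>)\<^sup>2 / 2)"
    using norm_one_plus_le_exp[of \<alpha>] by simp
  also have "\<dots> \<le> exp (\<bar>t\<bar> * m1 + (t\<^sup>2 - \<xi>\<^sup>2) * V / 2 + r + (D * m1 + D\<^sup>2 * V / 2 + r)\<^sup>2 / 2)"
  proof -
    have V0: "V \<ge> 0" unfolding V by simp
    have "Re \<alpha> = t * expectation T + (t\<^sup>2 - \<xi>\<^sup>2) * V / 2 + Re rem"
      by (simp add: \<alpha>_def \<zeta>_def power2_eq_square)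
    also have "t * expectation T \<le> \<bar>t\<bar> * m1"
      using mult_left_mono[OF m, of "\<bar>t\<bar>"] abs_ge_self[of "t * expectation T"] by (simp add: abs_mult)
    also have "Re rem \<le> r" using rem complex_Re_le_cmod order_trans by blast
    finally have 1: "Re \<alpha> \<le> \<bar>t\<bar> * m1 + (t\<^sup>2 - \<xi>\<^sup>2) * V / 2 + r" by simp
    have "norm \<alpha> \<le> norm (\<zeta> * complex_of_real (expectation T)) + norm (\<zeta>\<^sup>2 / 2 * complex_of_real V) + norm rem"
      unfolding \<alpha>_def by (intro order_trans[OF norm_triangle_ineq] add_mono norm_triangle_ineq order_refl)
    also have "\<dots> \<le> D * m1 + D\<^sup>2 * V / 2 + r"
    proof (intro add_mono rem)
      show "norm (\<zeta> * complex_of_real (expectation T)) \<le> D * m1"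
        unfolding norm_mult using D m D0 by (intro mult_mono) (auto simp: \<zeta>_def)
      have "(norm \<zeta>)\<^sup>2 \<le> D\<^sup>2" using D by (intro power_mono) (auto simp: \<zeta>_def)
      then show "norm (\<zeta>\<^sup>2 / 2 * complex_of_real V) \<le> D\<^sup>2 * V / 2"
        using V0 by (simp add: norm_mult norm_divide norm_power mult_right_mono)
    qed
    finally have "(norm \<alpha>)\<^sup>2 \<le> (D * m1 + D\<^sup>2 * V / 2 + r)\<^sup>2" by (intro power_mono) auto
    then show ?thesis using 1 by simp
  qed
  finally show ?thesis by (simp add: \<zeta>_def)
qed

end

text \<open>The integrand times the standard normal density is s times the density of N(0, s^2) with
  s^2 = 1 / (1 + q).\<close>

lemma normal_Gaussian_integral:
  assumes "0 \<le> q"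
  shows "integrable std_normal_distribution (\<lambda>\<nu>. exp (- q * \<nu>\<^sup>2 / 2))"
    and "(\<integral>\<nu>. exp (- q * \<nu>\<^sup>2 / 2) \<partial>std_normal_distribution) = 1 / sqrt (1 + q)"
proof -
  interpret N: real_distribution std_normal_distribution by (rule real_dist_normal_dist)
  show "integrable std_normal_distribution (\<lambda>\<nu>. exp (- q * \<nu>\<^sup>2 / 2))"
    by (rule N.integrable_const_bound[of _ 1]) (use assms in auto)
  define s where "s = 1 / sqrt (1 + q)"
  have s: "s > 0" "s\<^sup>2 = 1 / (1 + q)" using assms by (auto simp: s_def power_divide)
  have "(\<integral>\<nu>. exp (- q * \<nu>\<^sup>2 / 2) \<partial>std_normal_distribution) = (\<integral>\<nu>. std_normal_density \<nu> * exp (- q * \<nu>\<^sup>2 / 2) \<partial>lborel)"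
    by (subst integral_density) (auto simp: normal_density_nonneg)
  also have "\<dots> = (\<integral>\<nu>. s * normal_density 0 s \<nu> \<partial>lborel)"
  proof (intro Bochner_Integration.integral_cong refl)
    fix \<nu>
    have "- (\<nu> / s)\<^sup>2 / 2 = - \<nu>\<^sup>2 / 2 + - q * \<nu>\<^sup>2 / 2"
      using assms by (simp add: power_divide s(2) field_simps)
    then have "exp (- (\<nu> / s)\<^sup>2 / 2) = exp (- \<nu>\<^sup>2 / 2) * exp (- q * \<nu>\<^sup>2 / 2)" by (simp only: exp_add)
    then show "std_normal_density \<nu> * exp (- q * \<nu>\<^sup>2 / 2) = s * normal_density 0 s \<nu>"
      using s(1) by (simp add: normal_density_zero std_normal_density_def)
  qed
  also have "\<dots> = s" using s(1) by (simp add: integral_normal_density)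
  finally show "(\<integral>\<nu>. exp (- q * \<nu>\<^sup>2 / 2) \<partial>std_normal_distribution) = 1 / sqrt (1 + q)" by (simp add: s_def)
qed

lemma std_normal_two_sided_tail:
  assumes "0 < m" shows "measure std_normal_distribution {\<nu>. m < \<bar>\<nu>\<bar>} \<le> 1 / m\<^sup>2"
proof -
  interpret N: real_distribution std_normal_distribution by (rule real_dist_normal_dist)
  have i: "integrable std_normal_distribution (\<lambda>x. x\<^sup>2)" by (rule integrable_std_normal_distribution_moment)
  have e: "N.expectation (\<lambda>x. x\<^sup>2) = 1" using std_normal_distribution_even_moments(1)[of 1] by simp
  have "measure std_normal_distribution {\<nu>. m < \<bar>\<nu>\<bar>} \<le> measure std_normal_distribution {x \<in> space std_normal_distribution. m \<le> \<bar>x\<bar>}"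
    by (intro N.finite_measure_mono) auto
  also have "\<dots> \<le> N.expectation (\<lambda>x. x\<^sup>2) / m\<^sup>2"
    by (rule N.second_moment_method) (use i assms in auto)
  finally show ?thesis by (simp add: e)
qed

lemma std_normal_center_ge:
  assumes "0 < m" shows "1 - 1 / m\<^sup>2 \<le> measure std_normal_distribution {-m..m}"
proof -
  interpret N: real_distribution std_normal_distribution by (rule real_dist_normal_dist)
  have "measure std_normal_distribution {-m..m} = measure std_normal_distribution (UNIV - {\<nu>. m < \<bar>\<nu>\<bar>})"
    by (intro arg_cong[where f = "measure std_normal_distribution"]) (auto simp: abs_le_iff not_less)
  also have "\<dots> = 1 - measure std_normal_distribution {\<nu>. m < \<bar>\<nu>\<bar>}"
    using N.prob_compl[of "{\<nu>. m < \<bar>\<nu>\<bar>}"] by simp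
  finally show ?thesis using std_normal_two_sided_tail[OF assms] by simp
qed

section \<open>The sharp Gaussian upper tail of truncated sums\<close>

context iid_centered_l2 begin

definition third_moment :: "real \<Rightarrow> real" where
  "third_moment k = expectation (\<lambda>\<omega>. \<bar>trunc k (X 1 \<omega>)\<bar> ^ 3)"

definition var_trunc :: "real \<Rightarrow> real" where
  "var_trunc k = expectation (\<lambda>\<omega>. (trunc k (X 1 \<omega>))\<^sup>2)"

lemma abs_tsum_le: "0 \<le> k \<Longrightarrow> \<bar>tsum k n \<omega>\<bar> \<le> real n * k"
proof -
  assume k: "0 \<le> k"
  have "\<bar>tsum k n \<omega>\<bar> \<le> (\<Sum>i\<in>{1..n}. \<bar>trunc k (X i \<omega>)\<bar>)" unfolding tsum_def by (rule sum_abs)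
  also have "\<dots> \<le> (\<Sum>i\<in>{1..n}. k)" using k by (intro sum_mono abs_trunc_le)
  finally show ?thesis by simp
qed

lemma tsum_mgf:
  assumes "0 \<le> k"
  shows "expectation (\<lambda>\<omega>. exp (\<zeta> * complex_of_real (tsum k n \<omega>))) = expectation (\<lambda>\<omega>. exp (\<zeta> * complex_of_real (trunc k (X 1 \<omega>)))) ^ n"
proof -
  have eq: "exp (\<zeta> * complex_of_real (tsum k n \<omega>)) = (\<Prod>i\<in>{1..n}. exp (\<zeta> * complex_of_real (trunc k (X i \<omega>))))" for \<omega>
    by (simp add: tsum_def sum_distrib_left exp_sum)
  have int: "integrable M (\<lambda>\<omega>. exp (\<zeta> * complex_of_real (trunc k (X 1 \<omega>))))"
  proof (rule integrable_const_bound[of _ "exp (\<bar>Re \<zeta>\<bar> * k)"])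
    have "Re \<zeta> * trunc k (X 1 \<omega>) \<le> \<bar>Re \<zeta>\<bar> * k" for \<omega>
    proof -
      have "Re \<zeta> * trunc k (X 1 \<omega>) \<le> \<bar>Re \<zeta>\<bar> * \<bar>trunc k (X 1 \<omega>)\<bar>" by (simp add: abs_mult[symmetric])
      also have "\<dots> \<le> \<bar>Re \<zeta>\<bar> * k" using assms by (intro mult_left_mono abs_trunc_le) auto
      finally show ?thesis .
    qed
    then show "AE \<omega> in M. norm (exp (\<zeta> * complex_of_real (trunc k (X 1 \<omega>)))) \<le> exp (\<bar>Re \<zeta>\<bar> * k)"
      by (intro AE_I2) (simp add: norm_exp_eq_Re)
  qed measurable
  have "expectation (\<lambda>\<omega>. exp (\<zeta> * complex_of_real (tsum k n \<omega>))) = (\<Prod>i\<in>{1..n}. expectation (\<lambda>\<omega>. exp (\<zeta> * complex_of_real (trunc k (X 1 \<omega>)))))"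
    unfolding eq by (rule expectation_prod[where g = "\<lambda>_ x. exp (\<zeta> * complex_of_real (trunc k x))"]) (use int in auto)
  then show ?thesis by simp
qed

text \<open>Up to the cutoff frequency \<Xi> the one-step estimate raised to the power n has
  Gaussian decay and integrates to 1 / sqrt (1 + n V / w^2). Beyond \<Xi> the modulus is at most its
  value at 0, and the smoothing law has mass at most 1 / (\<Xi> w)^2 there. \<open>err\<close>
  collects the bias, the third moment and the square of the one-step term.\<close>

lemma tsum_upper_tail:
  fixes n :: nat and k t w m D e0 \<delta> u q :: real
  defines "V \<equiv> var_trunc k" and "m1 \<equiv> expectation (\<lambda>\<omega>. excess k (X 1 \<omega>))"
  assumes k: "0 \<le> k" and t: "0 < t" and w: "0 < w" and m: "1 < m" and tk: "t * k \<le> e0" and \<Xi>: "0 < \<Xi>" and D: "t + \<Xi> \<le> D"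
  defines "r \<equiv> exp e0 * D ^ 3 / 2 * third_moment k"
  defines "err \<equiv> real n * (t * m1 + r + (D * m1 + D\<^sup>2 * V / 2 + r)\<^sup>2 / 2)"
  shows "prob {\<omega> \<in> space M. u \<le> tsum k n \<omega>}
    \<le> exp (2 * t * m * w + err) / (1 - 1 / m\<^sup>2) * exp (real n * t\<^sup>2 * V / 2 - t * u) / t *
       ((1 / sqrt (1 + real n * V / w\<^sup>2) + 1 / (\<Xi> * w)\<^sup>2) / (sqrt (2 * pi) * w))"
proof -
  interpret N: real_distribution std_normal_distribution by (rule real_dist_normal_dist)
  define mg where "mg \<xi> = norm (expectation (\<lambda>\<omega>. exp (Complex t \<xi> * complex_of_real (trunc k (X 1 \<omega>)))))" for \<xi>
  define A where "A = exp (real n * t\<^sup>2 * V / 2 + err)"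
  have V0: "0 \<le> V" by (simp add: V_def var_trunc_def)
  have mgf: "mg \<xi> \<le> exp (t * m1 + (t\<^sup>2 - \<xi>\<^sup>2) * V / 2 + r + (D * m1 + D\<^sup>2 * V / 2 + r)\<^sup>2 / 2)" if \<xi>: "\<bar>\<xi>\<bar> \<le> \<Xi>" for \<xi>
  proof -
    have "norm (Complex t \<xi>) \<le> t + \<bar>\<xi>\<bar>" using cmod_le[of "Complex t \<xi>"] t by simp
    then have D': "norm (Complex t \<xi>) \<le> D" using \<xi> D by linarith
    have "norm (expectation (\<lambda>\<omega>. exp (Complex t \<xi> * complex_of_real (trunc k (X 1 \<omega>)))))
       \<le> exp (\<bar>t\<bar> * m1 + (t\<^sup>2 - \<xi>\<^sup>2) * V / 2 + r + (D * m1 + D\<^sup>2 * V / 2 + r)\<^sup>2 / 2)"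
      by (rule complex_mgf_le[where k = k and ?e0.0 = e0])
         (use k t tk D' mean_trunc_le[OF k] in \<open>auto simp: abs_trunc_le V_def var_trunc_def m1_def r_def third_moment_def\<close>)
    then show ?thesis using t by (simp add: mg_def)
  qed
  have M0: "0 \<le> mg \<xi>" for \<xi> by (simp add: mg_def)
  have small: "mg \<xi> ^ n \<le> A * exp (- real n * V * \<xi>\<^sup>2 / 2)" if "\<bar>\<xi>\<bar> \<le> \<Xi>" for \<xi>
  proof -
    have "mg \<xi> ^ n \<le> exp (t * m1 + (t\<^sup>2 - \<xi>\<^sup>2) * V / 2 + r + (D * m1 + D\<^sup>2 * V / 2 + r)\<^sup>2 / 2) ^ n"
      by (intro power_mono mgf that M0)
    also have "\<dots> = A * exp (- real n * V * \<xi>\<^sup>2 / 2)"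
      unfolding A_def err_def exp_of_nat_mult[symmetric] exp_add[symmetric] by (simp add: algebra_simps diff_divide_distrib)
    finally show ?thesis .
  qed
  \<comment> \<open>The transform of a positive measure has its largest modulus at frequency 0. This
    replaces a smoothness condition on the law at high frequencies.\<close>
  have M_le: "mg \<xi> \<le> mg 0" for \<xi>
  proof -
    have "mg \<xi> \<le> expectation (\<lambda>\<omega>. norm (exp (Complex t \<xi> * complex_of_real (trunc k (X 1 \<omega>)))))"
      unfolding mg_def by (rule integral_norm_bound)
    also have "\<dots> = expectation (\<lambda>\<omega>. exp (t * trunc k (X 1 \<omega>)))" by (simp add: norm_exp_eq_Re)
    also have "\<dots> = norm (complex_of_real (expectation (\<lambda>\<omega>. exp (t * trunc k (X 1 \<omega>)))))"
      by (simp add: integral_nonneg_AE)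
    also have "\<dots> = mg 0"
    proof -
      have "Complex t 0 * complex_of_real x = complex_of_real (t * x)" for x by (simp add: complex_eq_iff)
      then show ?thesis unfolding mg_def by (simp only: exp_of_real integral_complex_of_real)
    qed
    finally show ?thesis .
  qed
  have all: "mg \<xi> ^ n \<le> A * exp (- real n * V * \<xi>\<^sup>2 / 2) + A * indicator {\<nu>. \<Xi> < \<bar>\<nu>\<bar>} \<xi>" for \<xi>
  proof (cases "\<bar>\<xi>\<bar> \<le> \<Xi>")
    case True then show ?thesis using small[OF True] by simp
  next
    case False
    have "mg \<xi> ^ n \<le> mg 0 ^ n" by (intro power_mono M_le M0)
    also have "\<dots> \<le> A" using small[of 0] \<Xi> by simp
    finally show ?thesis using False by (simp add: A_def add_increasing)
  qed
  have F: "(\<integral>\<nu>. norm (expectation (\<lambda>\<omega>. exp (Complex t (\<nu> / w) * complex_of_real (tsum k n \<omega>)))) \<partial>std_normal_distribution)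
      \<le> A * (1 / sqrt (1 + real n * V / w\<^sup>2) + 1 / (\<Xi> * w)\<^sup>2)"
  proof -
    define q where "q = real n * V / w\<^sup>2"
    have q0: "q \<ge> 0" using V0 by (simp add: q_def)
    have eq: "norm (expectation (\<lambda>\<omega>. exp (Complex t (\<nu> / w) * complex_of_real (tsum k n \<omega>)))) = mg (\<nu> / w) ^ n" for \<nu>
      unfolding tsum_mgf[OF k] mg_def norm_power ..
    have i1: "integrable std_normal_distribution (\<lambda>\<nu>. A * exp (- q * \<nu>\<^sup>2 / 2))"
      by (intro integrable_mult_right normal_Gaussian_integral q0)
    have i2: "integrable std_normal_distribution (\<lambda>\<nu>. A * indicator {\<nu>. \<Xi> * w < \<bar>\<nu>\<bar>} \<nu>)"
      by (intro integrable_mult_right N.integrable_const_bound[of _ 1]) auto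
    have "(\<integral>\<nu>. norm (expectation (\<lambda>\<omega>. exp (Complex t (\<nu> / w) * complex_of_real (tsum k n \<omega>)))) \<partial>std_normal_distribution)
       \<le> (\<integral>\<nu>. A * exp (- q * \<nu>\<^sup>2 / 2) + A * indicator {\<nu>. \<Xi> * w < \<bar>\<nu>\<bar>} \<nu> \<partial>std_normal_distribution)"
    proof (rule integral_mono')
      show "integrable std_normal_distribution (\<lambda>\<nu>. A * exp (- q * \<nu>\<^sup>2 / 2) + A * indicator {\<nu>. \<Xi> * w < \<bar>\<nu>\<bar>} \<nu>)"
        by (rule Bochner_Integration.integrable_add[OF i1 i2])
      fix \<nu>
      show "norm (expectation (\<lambda>\<omega>. exp (Complex t (\<nu> / w) * complex_of_real (tsum k n \<omega>)))) \<le> A * exp (- q * \<nu>\<^sup>2 / 2) + A * indicator {\<nu>. \<Xi> * w < \<bar>\<nu>\<bar>} \<nu>"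
        unfolding eq using all[of "\<nu> / w"] w by (simp add: q_def power_divide indicator_def field_simps)
    qed (auto simp: A_def)
    also have "\<dots> = A * (\<integral>\<nu>. exp (- q * \<nu>\<^sup>2 / 2) \<partial>std_normal_distribution) + A * measure std_normal_distribution {\<nu>. \<Xi> * w < \<bar>\<nu>\<bar>}"
      unfolding Bochner_Integration.integral_add[OF i1 i2] by simp
    also have "\<dots> \<le> A * (1 / sqrt (1 + q)) + A * (1 / (\<Xi> * w)\<^sup>2)"
      unfolding normal_Gaussian_integral(2)[OF q0]
      using \<Xi> w by (intro add_mono mult_left_mono std_normal_two_sided_tail order_refl) (auto simp: A_def)
    finally show ?thesis by (simp add: q_def distrib_left)
  qed
  define G where "G = A * (1 / sqrt (1 + real n * V / w\<^sup>2) + 1 / (\<Xi> * w)\<^sup>2) / (sqrt (2 * pi) * w)"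
  have G0: "0 \<le> G" using w V0 by (auto simp: G_def A_def intro!: divide_nonneg_pos mult_nonneg_nonneg add_nonneg_nonneg)
  note Fourier = smoothed_density_le_Fourier[OF rv_tsum abs_tsum_le[OF k] t w, of n]
  have H: "expectation (\<lambda>\<omega>. exp (t * tsum k n \<omega>) * normal_density 0 w (z - tsum k n \<omega>)) \<le> G" for z
    using order_trans[OF Fourier(2) divide_right_mono[OF F]] w by (simp add: G_def)
  define p where "p = measure std_normal_distribution {-m..m}"
  have p1: "1 - 1 / m\<^sup>2 \<le> p" unfolding p_def using m by (intro std_normal_center_ge) auto
  have m2: "0 < 1 - 1 / m\<^sup>2" using m by (simp add: one_less_power)
  have p0: "0 < p" using p1 m2 by linarith
  have "prob {\<omega> \<in> space M. u \<le> tsum k n \<omega>} \<le> exp (2 * t * m * w - t * u) / (p * t) * G"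
    by (rule tail_le_smoothed[OF rv_tsum t w _ p_def p0 Fourier(1) H]) (use m in auto)
  also have "\<dots> \<le> exp (2 * t * m * w - t * u) / ((1 - 1 / m\<^sup>2) * t) * G"
    using p1 m2 p0 t G0 by (intro mult_right_mono divide_left_mono mult_right_mono mult_pos_pos) auto
  also have "\<dots> = exp (2 * t * m * w + err) / (1 - 1 / m\<^sup>2) * exp (real n * t\<^sup>2 * V / 2 - t * u) / t *
       ((1 / sqrt (1 + real n * V / w\<^sup>2) + 1 / (\<Xi> * w)\<^sup>2) / (sqrt (2 * pi) * w))"
  proof -
    have "exp (2 * t * m * w - t * u) * A = exp (2 * t * m * w + err) * exp (real n * t\<^sup>2 * V / 2 - t * u)"
      unfolding A_def exp_add[symmetric] by (simp add: algebra_simps)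
    moreover have "exp (2 * t * m * w - t * u) / ((1 - 1 / m\<^sup>2) * t) * G = (exp (2 * t * m * w - t * u) * A) / ((1 - 1 / m\<^sup>2) * t) *
       ((1 / sqrt (1 + real n * V / w\<^sup>2) + 1 / (\<Xi> * w)\<^sup>2) / (sqrt (2 * pi) * w))" by (simp add: G_def)
    ultimately show ?thesis by simp
  qed
  finally show ?thesis .
qed

lemma var_trunc_eq: "var_trunc k = expectation (\<lambda>\<omega>. (X 1 \<omega>)\<^sup>2) - tail_var k"
  by (simp add: var_trunc_def tail_var_def)

text \<open>Thresholds that make the error term of \<open>tsum_upper_tail\<close> vanish. With L =
  log log n and \<open>D\<close> of order L^2 / sqrt n, the third moment enters with order L^6 /
  L^10 and the mean excess with order 1 / sqrt L.\<close>

definition negligible_moments :: "real \<Rightarrow> nat \<Rightarrow> bool" where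
  "negligible_moments \<kappa> n \<longleftrightarrow> expectation (\<lambda>\<omega>. excess (level \<kappa> n) (X 1 \<omega>)) \<le> 1 / (loglogl (real n) * sqrt (real n))
     \<and> third_moment (level \<kappa> n) \<le> sqrt (real n) / loglogl (real n) ^ 10"

text \<open>With L = log log n take the tilt u / (n s^2), the smoothing width sqrt n / L and the
  cutoff L^2 / sqrt n. Tilt times width is of order 1 / sqrt L, so smoothing costs nothing in the
  limit; cutoff times width is L, so the high frequencies contribute 1 / L^2 against the main term 1
  / (L sqrt V). The bound is uniform in the range of \<open>u\<close>.\<close>

lemma sharp_upper_tail:
  assumes \<kappa>: "0 < \<kappa>" and g: "0 < g1" "g1 \<le> g2" and s: "0 < s" and v: "expectation (\<lambda>\<omega>. (X 1 \<omega>)\<^sup>2) = s\<^sup>2"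
    and c: "0 < c" and \<delta>: "0 < \<delta>"
  shows "\<forall>\<^sub>F n in sequentially. \<forall>u. g1 * sqrt (real n * loglogl (real n)) \<le> u \<and> u \<le> g2 * sqrt (real n * loglogl (real n)) \<longrightarrow>
     negligible_moments \<kappa> n \<longrightarrow> var_trunc (level \<kappa> n) \<le> s\<^sup>2 - c / loglogl (real n) \<longrightarrow>
     prob {\<omega> \<in> space M. u \<le> tsum (level \<kappa> n) n \<omega>}
       \<le> (1 + \<delta>) * exp (- g1\<^sup>2 * c / (2 * s ^ 4)) * (exp (- u\<^sup>2 / (2 * real n * s\<^sup>2)) * (s * sqrt (real n) / (u * sqrt (2 * pi))))"
proof -
  define gs where "gs = g2 / s\<^sup>2"
  have gs: "gs > 0" using g s by (simp add: gs_def)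
  define e0 where "e0 = gs * \<kappa>"
  define c1 where "c1 = 4 * exp e0"
  define C1 where "C1 = 2 + 2 * s\<^sup>2 + c1"
  \<comment> \<open>A fixed kernel radius is enough: it brings the lost kernel mass within the
    factor 1 + \<delta>, and its cost 2 t m w still tends to 0.\<close>
  have "((\<lambda>m::real. 1 / (1 - 1 / m\<^sup>2)) \<longlongrightarrow> 1) at_top" by real_asymp
  then have "\<forall>\<^sub>F m in at_top. 1 / (1 - 1 / m\<^sup>2) < 1 + \<delta> \<and> m > (1::real)"
    using \<delta> by (intro eventually_conj eventually_gt_at_top order_tendstoD) auto
  then obtain m :: real where m: "1 / (1 - 1 / m\<^sup>2) < 1 + \<delta>" "m > 1" by (auto simp: eventually_at_top_linorder)
  define Vn where "Vn n = var_trunc (level \<kappa> n)" for n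
  define E where "E n L = 2 * m * gs / sqrt L + gs / sqrt L + c1 / L ^ 4 + C1\<^sup>2 * L ^ 8 / (2 * n)" for n L :: real
  have "(\<lambda>n. s\<^sup>2 - tail_var (level \<kappa> n)) \<longlonglongrightarrow> s\<^sup>2 - 0"
    by (intro tendsto_diff tendsto_const filterlim_compose[OF tail_var_tendsto level_top[OF \<kappa>]])
  then have Vlim: "Vn \<longlonglongrightarrow> s\<^sup>2" unfolding Vn_def[abs_def] var_trunc_eq v diff_zero .
  have Elim: "(\<lambda>n. E (real n) (loglogl (real n))) \<longlonglongrightarrow> 0"
    unfolding E_def
    by (rule filterlim_seq_cong[of "\<lambda>n l L. 2 * m * gs / sqrt L + gs / sqrt L + c1 / L ^ 4 + C1\<^sup>2 * L ^ 8 / (2 * n)"]) real_asymp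
  have L1: "(\<lambda>n. s / loglogl (real n)) \<longlonglongrightarrow> 0"
    by (rule filterlim_seq_cong[of "\<lambda>n l L. s / L"]) real_asymp
  define F where "F n = exp (E (real n) (loglogl (real n))) / (1 - 1 / m\<^sup>2) * (s / sqrt (Vn n) + s / loglogl (real n))" for n
  have "F \<longlonglongrightarrow> exp 0 / (1 - 1 / m\<^sup>2) * (s / sqrt (s\<^sup>2) + 0)"
    unfolding F_def using s m by (intro tendsto_intros Elim L1 Vlim) (auto simp: power2_eq_1_iff)
  then have "F \<longlonglongrightarrow> 1 / (1 - 1 / m\<^sup>2)" using s by simp
  then have ev1: "\<forall>\<^sub>F n in sequentially. F n < 1 + \<delta>" using m by (intro order_tendstoD) auto
  have "0 < s\<^sup>2" using s by simp
  then have ev2: "\<forall>\<^sub>F n in sequentially. 0 < Vn n" using Vlim by (intro order_tendstoD) auto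
  have "filterlim (\<lambda>n. (loglogl (real n))\<^sup>2 - gs * sqrt (loglogl (real n))) at_top sequentially"
    by (rule filterlim_seq_cong[of "\<lambda>n l L. L\<^sup>2 - gs * sqrt L"]) real_asymp
  then have ev3: "\<forall>\<^sub>F n in sequentially. 0 \<le> (loglogl (real n))\<^sup>2 - gs * sqrt (loglogl (real n))"
    unfolding filterlim_at_top by blast
  show ?thesis using ev1 ev2 ev3 eventually_gt_at_top[of 0]
  proof eventually_elim
    case (elim n)
    show ?case
    proof (intro allI impI, elim conjE)
      fix u assume u: "g1 * sqrt (real n * loglogl (real n)) \<le> u" "u \<le> g2 * sqrt (real n * loglogl (real n))"
        and gd: "negligible_moments \<kappa> n" and Vle: "var_trunc (level \<kappa> n) \<le> s\<^sup>2 - c / loglogl (real n)"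
      define L where "L = loglogl (real n)"
      define q where "q = sqrt (real n)"
      define k where "k = level \<kappa> n"
      define V where "V = Vn n"
      define t where "t = u / (real n * s\<^sup>2)"
      define w where "w = q / L"
      define \<Xi> where "\<Xi> = L\<^sup>2 / q"
      define D where "D = 2 * L\<^sup>2 / q"
      define m1 where "m1 = expectation (\<lambda>\<omega>. excess k (X 1 \<omega>))"
      have L: "L \<ge> 1" unfolding L_def by (rule loglogl_ge_1)
      have sL: "sqrt L > 0" "sqrt L * sqrt L = L" using L by auto
      have q: "q > 0" "q * q = real n" using elim(4) by (auto simp: q_def)
      have k: "k = \<kappa> * q / sqrt L" by (simp only: k_def level_eq q_def L_def)
      have k0: "0 \<le> k" using \<kappa> q sL by (simp add: k)
      have u': "g1 * (q * sqrt L) \<le> u" "u \<le> g2 * (q * sqrt L)" using u by (simp_all add: q_def L_def real_sqrt_mult)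
      have u0: "u > 0" using u'(1) g q sL by (intro less_le_trans[OF _ u'(1)]) simp
      have t0: "t > 0" using u0 elim(4) s by (simp add: t_def)
      have tle: "t \<le> gs * sqrt L / q"
      proof -
        have "t \<le> g2 * (q * sqrt L) / (real n * s\<^sup>2)" unfolding t_def using u' by (intro divide_right_mono) auto
        also have "\<dots> = gs * sqrt L / q" unfolding q(2)[symmetric] using q(1) s by (simp add: gs_def)
        finally show ?thesis .
      qed
      have tk: "t * k \<le> e0"
      proof -
        have "t * k \<le> (gs * sqrt L / q) * k" using tle k0 by (intro mult_right_mono)
        also have "\<dots> = e0" using q sL by (simp add: k e0_def)
        finally show ?thesis .
      qed
      have tD: "t + \<Xi> \<le> D"
      proof -
        have "gs * sqrt L / q \<le> L\<^sup>2 / q" using elim(3) q by (intro divide_right_mono) (auto simp: L_def)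
        then show ?thesis using tle by (simp add: \<Xi>_def D_def)
      qed
      have V: "V = var_trunc k" by (simp add: V_def Vn_def k_def)
      have V0: "V > 0" using elim(2) by (simp add: V_def)
      have Vs: "V \<le> s\<^sup>2 - c / L" using Vle by (simp add: V k_def L_def)
      have Vs2: "V \<le> s\<^sup>2"
      proof -
        have "0 \<le> c / L" using c L by simp
        then show ?thesis using Vs by linarith
      qed
      have m1: "m1 \<le> 1 / (L * q)" and th: "third_moment k \<le> q / L ^ 10"
        using gd by (auto simp: negligible_moments_def m1_def k_def L_def q_def)
      have m10: "0 \<le> m1" unfolding m1_def by (intro integral_nonneg_AE) auto
      define r where "r = exp e0 * D ^ 3 / 2 * third_moment k"
      have r0: "0 \<le> r" using q by (auto simp: r_def D_def third_moment_def intro!: mult_nonneg_nonneg)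
      have nr: "real n * r \<le> c1 / L ^ 4"
      proof -
        have "real n * r \<le> real n * (exp e0 * D ^ 3 / 2 * (q / L ^ 10))"
          unfolding r_def using th q by (intro mult_left_mono) (auto simp: D_def)
        also have "\<dots> = (q * q) * (exp e0 * D ^ 3 / 2 * (q / L ^ 10))" unfolding q(2) ..
        also have "\<dots> = c1 / L ^ 4" using q(1) L by (simp add: D_def c1_def field_simps eval_nat_numeral)
        finally show ?thesis .
      qed
      have sum_le: "real n * (D * m1 + D\<^sup>2 * V / 2 + r) \<le> C1 * L ^ 4"
      proof -
        have n1: "real n * (D * m1) \<le> 2 * L ^ 4"
        proof -
          have "real n * (D * m1) \<le> real n * (D * (1 / (L * q)))"
            using m1 q by (intro mult_left_mono) (auto simp: D_def)
          also have "\<dots> = (q * q) * (D * (1 / (L * q)))" unfolding q(2) ..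
          also have "\<dots> = 2 * L ^ 1" using q(1) L by (simp add: D_def field_simps power2_eq_square)
          also have "\<dots> \<le> 2 * L ^ 4" using L by (intro mult_left_mono power_increasing) auto
          finally show ?thesis .
        qed
        have n2: "real n * (D\<^sup>2 * V / 2) \<le> 2 * s\<^sup>2 * L ^ 4"
        proof -
          have "real n * (D\<^sup>2 * V / 2) \<le> real n * (D\<^sup>2 * s\<^sup>2 / 2)" using Vs2 by (intro mult_left_mono divide_right_mono) auto
          also have "\<dots> = (q * q) * (D\<^sup>2 * s\<^sup>2 / 2)" unfolding q(2) ..
          also have "\<dots> = 2 * s\<^sup>2 * L ^ 4" using q(1) L by (simp add: D_def field_simps eval_nat_numeral)
          finally show ?thesis .
        qed
        have n3: "real n * r \<le> c1 * L ^ 4"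
        proof -
          have "c1 / L ^ 4 \<le> c1 / 1" using L by (intro divide_left_mono) (auto simp: c1_def)
          also have "\<dots> \<le> c1 * L ^ 4" using L by (simp add: c1_def)
          finally show ?thesis using nr by linarith
        qed
        show ?thesis using n1 n2 n3 by (simp add: C1_def algebra_simps)
      qed
      define err where "err = real n * (t * m1 + r + (D * m1 + D\<^sup>2 * V / 2 + r)\<^sup>2 / 2)"
      have err: "err \<le> gs / sqrt L + c1 / L ^ 4 + C1\<^sup>2 * L ^ 8 / (2 * real n)"
      proof -
        have "real n * (t * m1) \<le> real n * ((gs * sqrt L / q) * (1 / (L * q)))"
          using tle m1 t0 m10 gs sL q by (intro mult_left_mono mult_mono) auto
        also have "\<dots> = (q * q) * ((gs * sqrt L / q) * (1 / ((sqrt L * sqrt L) * q)))" unfolding q(2) sL(2) ..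
        also have "\<dots> = gs / sqrt L" using q(1) sL(1) by (simp add: field_simps del: real_sqrt_mult_self)
        finally have a: "real n * (t * m1) \<le> gs / sqrt L" .
        define z where "z = D * m1 + D\<^sup>2 * V / 2 + r"
        have z0: "0 \<le> z" unfolding z_def using m10 r0 V0 q by (intro add_nonneg_nonneg mult_nonneg_nonneg divide_nonneg_nonneg) (auto simp: D_def)
        have "(real n * z)\<^sup>2 \<le> (C1 * L ^ 4)\<^sup>2" using sum_le z0 by (intro power_mono) (auto simp: z_def)
        then have "(real n * z)\<^sup>2 / (2 * real n) \<le> (C1 * L ^ 4)\<^sup>2 / (2 * real n)" by (intro divide_right_mono) auto
        moreover have "(real n * z)\<^sup>2 / (2 * real n) = real n * (z\<^sup>2 / 2)" using elim(4) by (simp add: power2_eq_square)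
        moreover have "(C1 * L ^ 4)\<^sup>2 = C1\<^sup>2 * L ^ 8" by (simp add: power_mult_distrib power_mult[symmetric])
        ultimately have b: "real n * (z\<^sup>2 / 2) \<le> C1\<^sup>2 * L ^ 8 / (2 * real n)" by simp
        show ?thesis unfolding err_def z_def[symmetric] distrib_left using a nr b by linarith
      qed
      have tw: "2 * t * m * w \<le> 2 * m * gs / sqrt L"
      proof -
        have "2 * t * m * w \<le> 2 * (gs * sqrt L / q) * m * w"
          using tle m q L by (intro mult_right_mono mult_left_mono) (auto simp: w_def)
        also have "\<dots> = 2 * (gs * sqrt L / q) * m * (q / (sqrt L * sqrt L))" unfolding w_def sL(2) ..
        also have "\<dots> = 2 * m * gs / sqrt L" using q(1) sL(1) by (simp add: field_simps del: real_sqrt_mult_self)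
        finally show ?thesis .
      qed
      have e1: "exp (2 * t * m * w + err) \<le> exp (E (real n) L)" using err tw by (simp add: E_def)
      have m2: "0 < 1 - 1 / m\<^sup>2" using m(2) by (simp add: one_less_power)
      have e2: "(1 / sqrt (1 + real n * V / w\<^sup>2) + 1 / (\<Xi> * w)\<^sup>2) / (sqrt (2 * pi) * w) \<le> (1 / sqrt V + 1 / L) / (sqrt (2 * pi) * q)"
      proof -
        have eq: "real n * V / w\<^sup>2 = L\<^sup>2 * V" unfolding q(2)[symmetric] w_def using q(1) L by (simp add: power2_eq_square)
        have p: "0 < L\<^sup>2 * V" using L V0 by simp
        then have "0 < sqrt (1 + L\<^sup>2 * V)" "0 < sqrt (L\<^sup>2 * V)" by (auto simp: add_pos_pos)
        then have "1 / sqrt (1 + real n * V / w\<^sup>2) \<le> 1 / sqrt (L\<^sup>2 * V)"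
          unfolding eq by (intro divide_left_mono mult_pos_pos) auto
        also have "\<dots> = 1 / (L * sqrt V)" using L by (simp add: real_sqrt_mult)
        finally have "1 / sqrt (1 + real n * V / w\<^sup>2) \<le> 1 / (L * sqrt V)" .
        moreover have "\<Xi> * w = L" using q L by (simp add: \<Xi>_def w_def power2_eq_square)
        ultimately have "(1 / sqrt (1 + real n * V / w\<^sup>2) + 1 / (\<Xi> * w)\<^sup>2) / (sqrt (2 * pi) * w) \<le> (1 / (L * sqrt V) + 1 / L\<^sup>2) / (sqrt (2 * pi) * w)"
          using q L by (intro divide_right_mono add_mono) (auto simp: w_def)
        also have "\<dots> = (1 / sqrt V + 1 / L) / (sqrt (2 * pi) * q)"
          using q(1) L V0 by (simp add: w_def field_simps power2_eq_square)
        finally show ?thesis .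
      qed
      \<comment> \<open>At this tilt the exponent is - u^2 / (2 n s^2) plus u^2 (V - s^2) / (2 n
        s^4). With V - s^2 \<le> - c / L and u^2 \<ge> g1^2 n L the second part is at most a
        negative constant.\<close>
      have e3: "exp (real n * t\<^sup>2 * V / 2 - t * u) \<le> exp (- g1\<^sup>2 * c / (2 * s ^ 4)) * exp (- u\<^sup>2 / (2 * real n * s\<^sup>2))"
      proof -
        have "real n * t\<^sup>2 * V / 2 - t * u = - (u\<^sup>2 / (2 * real n * s\<^sup>2)) + u\<^sup>2 / (2 * real n * s ^ 4) * (V - s\<^sup>2)"
          using elim(4) s unfolding t_def by (simp add: field_simps power2_eq_square eval_nat_numeral)
        also have "u\<^sup>2 / (2 * real n * s ^ 4) * (V - s\<^sup>2) \<le> u\<^sup>2 / (2 * real n * s ^ 4) * (- (c / L))"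
          using Vs s by (intro mult_left_mono) auto
        also have "\<dots> \<le> (g1 * (q * sqrt L))\<^sup>2 / (2 * real n * s ^ 4) * (- (c / L))"
          using u'(1) g q sL c L s by (intro mult_right_mono_neg divide_right_mono power_mono) auto
        also have "\<dots> = - g1\<^sup>2 * c / (2 * s ^ 4)"
        proof -
          have "(g1 * (q * sqrt L))\<^sup>2 = g1\<^sup>2 * (real n * L)"
            unfolding power2_eq_square q(2)[symmetric] using sL(2) by (simp add: mult_ac)
          then show ?thesis using elim(4) L s by (simp add: field_simps)
        qed
        finally have "real n * t\<^sup>2 * V / 2 - t * u \<le> - g1\<^sup>2 * c / (2 * s ^ 4) + - u\<^sup>2 / (2 * real n * s\<^sup>2)" by simp
        then show ?thesis unfolding exp_add[symmetric] by simp
      qed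
      have \<Xi>0: "0 < \<Xi>" and w0: "0 < w" using q L by (auto simp: \<Xi>_def w_def)
      have "prob {\<omega> \<in> space M. u \<le> tsum k n \<omega>}
        \<le> exp (2 * t * m * w + err) / (1 - 1 / m\<^sup>2) * exp (real n * t\<^sup>2 * V / 2 - t * u) / t *
         ((1 / sqrt (1 + real n * V / w\<^sup>2) + 1 / (\<Xi> * w)\<^sup>2) / (sqrt (2 * pi) * w))"
        using tsum_upper_tail[OF k0 t0 w0 m(2) tk \<Xi>0 tD, of u n] unfolding err_def r_def V m1_def .
      also have "\<dots> \<le> exp (E (real n) L) / (1 - 1 / m\<^sup>2) * (exp (- g1\<^sup>2 * c / (2 * s ^ 4)) * exp (- u\<^sup>2 / (2 * real n * s\<^sup>2))) / t *
         ((1 / sqrt V + 1 / L) / (sqrt (2 * pi) * q))"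
        using m2 t0 w0 V0 L q
        by (intro mult_mono[OF _ e2] divide_right_mono mult_mono[OF _ e3] e1) (auto intro!: divide_nonneg_nonneg add_nonneg_nonneg mult_nonneg_nonneg)
      also have "\<dots> = F n * exp (- g1\<^sup>2 * c / (2 * s ^ 4)) * (exp (- u\<^sup>2 / (2 * real n * s\<^sup>2)) * (s * q / (u * sqrt (2 * pi))))"
      proof -
        have it: "1 / t = (q * q) * s\<^sup>2 / u" unfolding t_def q(2) by simp
        have F: "F n = exp (E (real n) L) / (1 - 1 / m\<^sup>2) * (s * (1 / sqrt V + 1 / L))"
          by (simp add: F_def V_def L_def distrib_left)
        have key: "x / t * (y / (sqrt (2 * pi) * q)) = x * (s * y) * (s * q / (u * sqrt (2 * pi)))" for x y
        proof -
          have "x / t * (y / (sqrt (2 * pi) * q)) = x * (1 / t) * (y / (sqrt (2 * pi) * q))" by simp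
          also have "\<dots> = x * (s * y) * (s * q / (u * sqrt (2 * pi)))"
            unfolding it using q(1) u0 by (simp add: power2_eq_square)
          finally show ?thesis .
        qed
        show ?thesis unfolding key F by (simp only: mult_ac)
      qed
      also have "\<dots> \<le> (1 + \<delta>) * exp (- g1\<^sup>2 * c / (2 * s ^ 4)) * (exp (- u\<^sup>2 / (2 * real n * s\<^sup>2)) * (s * q / (u * sqrt (2 * pi))))"
        using elim(1) s q u0 by (intro mult_right_mono) auto
      finally show "prob {\<omega> \<in> space M. u \<le> tsum (level \<kappa> n) n \<omega>}
       \<le> (1 + \<delta>) * exp (- g1\<^sup>2 * c / (2 * s ^ 4)) * (exp (- u\<^sup>2 / (2 * real n * s\<^sup>2)) * (s * sqrt (real n) / (u * sqrt (2 * pi))))"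
        by (simp only: k_def q_def)
    qed
  qed
qed

end

subsection \<open>Asymptotics of the Gaussian series\<close>

text \<open>The logarithmic derivative is - 1/z - (1 + d) / (z ln z) + \<beta> / (z ln z ln ln z),
  which is nonpositive once ln z is large compared with |\<beta>|. The term with \<open>d\<close>
  only helps, so the threshold is the same for all \<open>d\<close>, which later tends to 0.\<close>

lemma wt_eventually_antimono:
  fixes \<beta> :: real
  shows "\<exists>x1\<ge>exp (exp 1). \<forall>d>0. \<forall>x y. x1 \<le> x \<longrightarrow> x \<le> y \<longrightarrow>
     ln y powr (-1-d) * ln (ln y) powr \<beta> / y \<le> ln x powr (-1-d) * ln (ln x) powr \<beta> / x"
proof -
  define x1 where "x1 = exp (max (exp 1) (\<bar>\<beta>\<bar> + 1))"
  have x1: "x1 \<ge> exp (exp 1)" by (simp add: x1_def)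
  have big: "x > 0" "ln x \<ge> exp 1" "ln x \<ge> \<bar>\<beta>\<bar> + 1" "ln (ln x) \<ge> 1" "ln x > 0" if "x \<ge> x1" for x
  proof -
    show x: "x > 0" using that x1 exp_gt_zero by (meson less_le_trans)
    have "max (exp 1) (\<bar>\<beta>\<bar> + 1) \<le> ln x" using that x by (subst ln_ge_iff) (auto simp: x1_def)
    then show l: "ln x \<ge> exp 1" "ln x \<ge> \<bar>\<beta>\<bar> + 1" by auto
    show "ln x > 0" using l(1) exp_gt_zero[of "1::real"] by linarith
    then show "ln (ln x) \<ge> 1" using l(1) by (subst ln_ge_iff) auto
  qed
  have "ln y powr (-1-d) * ln (ln y) powr \<beta> / y \<le> ln x powr (-1-d) * ln (ln x) powr \<beta> / x"
    if d: "d > 0" and x: "x1 \<le> x" "x \<le> y" for d x y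
  proof -
    define p where "p z = - ln z - (1 + d) * ln (ln z) + \<beta> * ln (ln (ln z))" for z :: real
    have eq: "ln z powr (-1-d) * ln (ln z) powr \<beta> / z = exp (p z)" if "z \<ge> x1" for z
    proof -
      have "ln (ln z) > 0" using big(4)[OF that] by linarith
      then show ?thesis using big[OF that]
        by (simp add: p_def powr_def exp_add exp_diff exp_minus field_simps)
    qed
    have "p y \<le> p x"
    proof (rule DERIV_nonpos_imp_nonincreasing[OF x(2)])
      fix z assume z: "x \<le> z" "z \<le> y"
      have z1: "z \<ge> x1" using z x by linarith
      note b = big[OF z1]
      have llz: "ln (ln z) > 0" using b(4) by linarith
      have D: "(p has_real_derivative (- (1/z) - (1 + d) * (1/z / ln z) + \<beta> * (1/z / ln z / ln (ln z)))) (at z)"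
        unfolding p_def using b llz by (auto intro!: derivative_eq_intros simp: field_simps)
      have "\<beta> * (1/z / ln z / ln (ln z)) \<le> 1/z"
      proof -
        have "ln z * 1 \<le> ln z * ln (ln z)" using b by (intro mult_left_mono) auto
        then have "\<beta> \<le> ln z * ln (ln z)" using b(3) by linarith
        then have "\<beta> / (ln z * ln (ln z)) \<le> 1" using b(5) llz by (simp add: divide_le_eq_1)
        then have "\<beta> / (ln z * ln (ln z)) * (1/z) \<le> 1 * (1/z)" using b(1) by (intro mult_right_mono) auto
        then show ?thesis by (simp add: field_simps)
      qed
      moreover have "0 \<le> (1 + d) * (1/z / ln z)" using d b by simp
      ultimately have "- (1/z) - (1 + d) * (1/z / ln z) + \<beta> * (1/z / ln z / ln (ln z)) \<le> 0" by linarith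
      then show "\<exists>D. (p has_real_derivative D) (at z) \<and> D \<le> 0" using D by blast
    qed
    then show ?thesis using eq[of x] eq[of y] x by simp
  qed
  then show ?thesis using x1 by blast
qed

text \<open>The lower end \<open>c\<close> is positive because s - 1 may be negative and the
  integrand then unbounded at 0. The part below \<open>c\<close> is nonnegative and dropped.\<close>

lemma incomplete_Gamma_le:
  assumes c: "0 < c" and s: "0 < (s::real)"
  shows "integral {c..y} (\<lambda>t. t powr (s - 1) / exp t) \<le> Gamma s"
    and "\<And>z. c < z \<Longrightarrow> ((\<lambda>y. integral {c..y} (\<lambda>t. t powr (s - 1) / exp t)) has_real_derivative z powr (s - 1) / exp z) (at z)"
proof -
  let ?f = "\<lambda>t::real. t powr (s - 1) / exp t"
  have hi: "(?f has_integral Gamma s) {0..}" by (rule Gamma_integral_real[OF s])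
  have cont: "continuous_on {c..u} ?f" for u using c by (intro continuous_intros) auto
  have "integral {c..y} ?f \<le> integral {0..} ?f"
    using c hi by (intro integral_subset_le integrable_continuous_real cont) (auto simp: has_integral_integrable)
  then show "integral {c..y} ?f \<le> Gamma s" using hi by (simp add: integral_unique)
  fix z assume z: "c < z"
  have "((\<lambda>y. integral {c..y} ?f) has_real_derivative ?f z) (at z within {c..z+1})"
    by (rule integral_has_real_derivative[OF cont]) (use z in auto)
  moreover have "at z within {c..z+1} = at z" using z by (intro at_within_interior) auto
  ultimately show "((\<lambda>y. integral {c..y} ?f) has_real_derivative ?f z) (at z)" by simp
qed

text \<open>The substitution t = d ln ln x turns the integral of (ln x)^(-1-d) (ln ln x)^(b - 1/2) /
  x into d^(-(b + 1/2)) times an incomplete Gamma integral. This is the origin of the Gamma function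
  and of the normalizing exponent; the starting index does not depend on \<open>d\<close>.\<close>

lemma wt_partial_sum_le:
  fixes b :: real
  assumes b: "- 1/2 < b"
  shows "\<exists>n1. \<forall>d>0. \<forall>N. (\<Sum>n\<in>{n1<..N}. wt (-1-d) (b - 1/2) n) \<le> Gamma (b + 1/2) * d powr (- (b + 1/2))"
proof -
  define s where "s = b + 1/2"
  have s: "s > 0" using b by (simp add: s_def)
  obtain x1 where x1: "x1 \<ge> exp (exp 1)" and anti: "\<And>d x y. d > 0 \<Longrightarrow> x1 \<le> x \<Longrightarrow> x \<le> y \<Longrightarrow>
     ln y powr (-1-d) * ln (ln y) powr (s - 1) / y \<le> ln x powr (-1-d) * ln (ln x) powr (s - 1) / x"
    using wt_eventually_antimono[of "s - 1"] by metis
  define n1 where "n1 = nat \<lceil>x1\<rceil> + 1"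
  have n1: "x1 < real n1" unfolding n1_def by linarith
  have "(\<Sum>n\<in>{n1<..N}. wt (-1-d) (b - 1/2) n) \<le> Gamma s * d powr (- s)" if d: "d > 0" for d N
  proof (cases "n1 \<le> N")
    case True
    have pos: "x > 0" "ln x \<ge> exp 1" "ln x > 0" "ln (ln x) \<ge> 1" "ln (ln x) > 0" if "x \<ge> x1" for x
    proof -
      have xe: "exp (exp 1) \<le> x" using that x1 by linarith
      then show x: "x > 0" using exp_gt_zero by (meson less_le_trans)
      show l: "ln x \<ge> exp 1" using xe x by (subst ln_ge_iff) auto
      then show l0: "ln x > 0" using exp_gt_zero[of "1::real"] by linarith
      show "ln (ln x) \<ge> 1" using l l0 by (subst ln_ge_iff) auto
      then show "ln (ln x) > 0" by linarith
    qed
    define c where "c = d * ln (ln x1)"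
    have c: "c > 0" using pos[of x1] d by (simp add: c_def)
    define Ig where "Ig y = integral {c..y} (\<lambda>t. t powr (s - 1) / exp t)" for y
    \<comment> \<open>An antiderivative of \<open>h\<close>. By the mean value theorem and
      monotonicity of \<open>h\<close> each term is at most an increment of \<Phi>, and the sum
      telescopes.\<close>
    define \<Phi> where "\<Phi> x = d powr (- s) * Ig (d * ln (ln x))" for x
    define h where "h x = ln x powr (-1-d) * ln (ln x) powr (s - 1) / x" for x
    have deriv: "(\<Phi> has_real_derivative h x) (at x)" if x: "x > x1" for x
    proof -
      note px = pos[OF less_imp_le[OF x]]
      have "ln x1 < ln x" using x pos(1)[of x1] px(1) by (subst ln_less_cancel_iff) auto
      then have "ln (ln x1) < ln (ln x)" using pos(3)[of x1] px(3) by (subst ln_less_cancel_iff) auto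
      then have cz: "c < d * ln (ln x)" using d by (simp add: c_def)
      have A: "(Ig has_real_derivative (d * ln (ln x)) powr (s - 1) / exp (d * ln (ln x))) (at (d * ln (ln x)))"
        unfolding Ig_def by (rule incomplete_Gamma_le(2)[OF c s cz])
      have B: "((\<lambda>x. d * ln (ln x)) has_real_derivative d * (1 / x / ln x)) (at x)"
        using px by (auto intro!: derivative_eq_intros simp: field_simps)
      have "((\<lambda>x. d powr (- s) * Ig (d * ln (ln x))) has_real_derivative
          d powr (- s) * ((d * ln (ln x)) powr (s - 1) / exp (d * ln (ln x)) * (d * (1 / x / ln x)))) (at x)"
        by (rule DERIV_cmult[OF DERIV_chain2[OF A B]])
      moreover have "d powr (- s) * ((d * ln (ln x)) powr (s - 1) / exp (d * ln (ln x)) * (d * (1 / x / ln x))) = h x"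
      proof -
        have 1: "(d * ln (ln x)) powr (s - 1) = d powr (s - 1) * ln (ln x) powr (s - 1)" using d px by (simp add: powr_mult)
        have 2: "d powr (- s) * d powr (s - 1) * d = 1"
        proof -
          have "d powr (- s) * d powr (s - 1) * d powr 1 = d powr 0" unfolding powr_add[symmetric] by simp
          then show ?thesis using d by simp
        qed
        have 3: "ln x powr (-1-d) = 1 / exp (d * ln (ln x)) * (1 / ln x)"
        proof -
          have "ln x powr (-1-d) = exp (- ln (ln x)) * exp (- (d * ln (ln x)))"
            using px(3) unfolding exp_add[symmetric] by (simp add: powr_def algebra_simps)
          then show ?thesis using px(3) by (simp add: exp_minus divide_inverse)
        qed
        have "d powr (- s) * ((d * ln (ln x)) powr (s - 1) / exp (d * ln (ln x)) * (d * (1 / x / ln x)))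
           = (d powr (- s) * d powr (s - 1) * d) * (ln (ln x) powr (s - 1) * (1 / exp (d * ln (ln x)) * (1 / ln x)) / x)"
          unfolding 1 by (simp add: mult_ac)
        also have "\<dots> = h x" unfolding 2 h_def 3 by (simp add: mult_ac)
        finally show ?thesis .
      qed
      ultimately show ?thesis unfolding \<Phi>_def by simp
    qed
    have step: "wt (-1-d) (b - 1/2) (Suc n) \<le> \<Phi> (real (Suc n)) - \<Phi> (real n)" if n: "n \<ge> n1" for n
    proof -
      have nx: "x1 < real n" using n n1 by linarith
      have "\<exists>z. real n < z \<and> z < real (Suc n) \<and> \<Phi> (real (Suc n)) - \<Phi> (real n) = (real (Suc n) - real n) * h z"
        using nx by (intro MVT2 deriv) auto
      then obtain z where z: "real n < z" "z < real (Suc n)" "\<Phi> (real (Suc n)) - \<Phi> (real n) = h z" by auto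
      have "h (real (Suc n)) \<le> h z" unfolding h_def using z nx d by (intro anti) auto
      moreover have "wt (-1-d) (b - 1/2) (Suc n) = h (real (Suc n))"
      proof -
        have "exp (exp 1) \<le> real (Suc n)" "exp 1 \<le> real (Suc n)"
        proof -
          show *: "exp (exp 1) \<le> real (Suc n)" using nx x1 by simp
          have "exp (1::real) \<le> exp (exp 1)" by simp
          then show "exp 1 \<le> real (Suc n)" using * by linarith
        qed
        then show ?thesis by (simp only: wt_def h_def logl_eq loglogl_eq s_def) simp
      qed
      ultimately show ?thesis using z by simp
    qed
    have "(\<Sum>n\<in>{n1<..N}. wt (-1-d) (b - 1/2) n) = (\<Sum>n\<in>{n1..<N}. wt (-1-d) (b - 1/2) (Suc n))"
      by (rule sum.reindex_bij_witness[of _ Suc "\<lambda>n. n - 1"]) auto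
    also have "\<dots> \<le> (\<Sum>n\<in>{n1..<N}. \<Phi> (real (Suc n)) - \<Phi> (real n))" by (intro sum_mono step) auto
    also have "\<dots> = \<Phi> (real N) - \<Phi> (real n1)" using True by (rule sum_Suc_diff')
    also have "\<dots> \<le> Gamma s * d powr (- s)"
    proof -
      have "0 \<le> Ig y" for y unfolding Ig_def
        using c by (intro integral_nonneg integrable_continuous_real continuous_intros) auto
      have "\<Phi> (real N) \<le> d powr (- s) * Gamma s"
        unfolding \<Phi>_def Ig_def by (intro mult_left_mono incomplete_Gamma_le c s) simp
      moreover have "0 \<le> \<Phi> (real n1)"
        unfolding \<Phi>_def using \<open>\<And>y. 0 \<le> Ig y\<close> by simp
      ultimately show ?thesis by (simp add: mult.commute)
    qed
    finally show ?thesis .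
  next
    case False
    then show ?thesis using s by (simp add: Gamma_real_pos less_imp_le)
  qed
  then show ?thesis by (auto simp: s_def)
qed

text \<open>The finitely many first terms are bounded, uniformly in \<open>d\<close>, by their
  values at d = 0. The resulting constant \<open>K\<close> disappears after multiplication by d^(b +
  1/2).\<close>

lemma wt_suminf_le:
  fixes b :: real
  assumes b: "- 1/2 < b"
  shows "\<exists>K. \<forall>d>0. summable (wt (-1-d) (b - 1/2)) \<and> suminf (wt (-1-d) (b - 1/2)) \<le> K + Gamma (b + 1/2) * d powr (- (b + 1/2))"
proof -
  obtain n1 where n1: "\<And>d N. d > 0 \<Longrightarrow> (\<Sum>n\<in>{n1<..N}. wt (-1-d) (b - 1/2) n) \<le> Gamma (b + 1/2) * d powr (- (b + 1/2))"
    using wt_partial_sum_le[OF b] by blast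
  define K where "K = (\<Sum>n\<in>{..n1}. wt (-1) (b - 1/2) n)"
  have "summable (wt (-1-d) (b - 1/2)) \<and> suminf (wt (-1-d) (b - 1/2)) \<le> K + Gamma (b + 1/2) * d powr (- (b + 1/2))" if d: "d > 0" for d
  proof -
    have le: "(\<Sum>n\<le>N. wt (-1-d) (b - 1/2) n) \<le> K + Gamma (b + 1/2) * d powr (- (b + 1/2))" for N
    proof -
      have "(\<Sum>n\<le>N. wt (-1-d) (b - 1/2) n) \<le> (\<Sum>n\<in>{..n1} \<union> {n1<..N}. wt (-1-d) (b - 1/2) n)"
        by (intro sum_mono2) auto
      also have "\<dots> = (\<Sum>n\<in>{..n1}. wt (-1-d) (b - 1/2) n) + (\<Sum>n\<in>{n1<..N}. wt (-1-d) (b - 1/2) n)"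
        by (intro sum.union_disjoint) auto
      also have "(\<Sum>n\<in>{..n1}. wt (-1-d) (b - 1/2) n) \<le> K" unfolding K_def
      proof (intro sum_mono)
        fix n
        have "logl (real n) powr (-1-d) \<le> logl (real n) powr (-1)" using d logl_ge_1 by (intro powr_mono) auto
        then show "wt (-1-d) (b - 1/2) n \<le> wt (-1) (b - 1/2) n"
          unfolding wt_def by (intro divide_right_mono mult_right_mono) auto
      qed
      finally show ?thesis using n1[OF d, of N] by linarith
    qed
    have "summable (wt (-1-d) (b - 1/2))" by (rule bounded_imp_summable[OF wt_nonneg le])
    moreover from this have "suminf (wt (-1-d) (b - 1/2)) \<le> K + Gamma (b + 1/2) * d powr (- (b + 1/2))"
    proof (rule suminf_le_const)
      fix n
      have "(\<Sum>i<n. wt (-1-d) (b - 1/2) i) \<le> (\<Sum>i\<le>n. wt (-1-d) (b - 1/2) i)" by (intro sum_mono2) auto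
      then show "(\<Sum>i<n. wt (-1-d) (b - 1/2) i) \<le> K + Gamma (b + 1/2) * d powr (- (b + 1/2))" using le[of n] by linarith
    qed
    ultimately show ?thesis by blast
  qed
  then show ?thesis by blast
qed

text \<open>Enlarging \<beta> only enlarges the weight, after which \<open>wt_suminf_le\<close>
  applies with d = - 1 - \<alpha>.\<close>

lemma wt_summable:
  assumes "\<alpha> < - 1" shows "summable (wt \<alpha> \<beta>)"
proof -
  define b where "b = max \<beta> 0 + 1/2"
  have "- 1/2 < b" by (simp add: b_def)
  from wt_suminf_le[OF this] have "summable (wt (-1-d) (b - 1/2))" if "d > 0" for d using that by blast
  from this[of "- 1 - \<alpha>"] have s: "summable (wt \<alpha> (b - 1/2))" using assms by simp
  show ?thesis
  proof (rule summable_comparison_test'[OF s])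
    fix n :: nat
    have "loglogl (real n) powr \<beta> \<le> loglogl (real n) powr (b - 1/2)"
      using loglogl_ge_1[of "real n"] by (intro powr_mono) (auto simp: b_def)
    then show "norm (wt \<alpha> \<beta> n) \<le> wt \<alpha> (b - 1/2) n"
      by (simp add: wt_def mult_left_mono divide_right_mono)
  qed
qed

section \<open>Splitting a partial sum into truncated sum and excess\<close>

lemma trunc_uminus: "trunc k (- x) = - trunc k x" by (simp add: trunc_def)

lemma excess_uminus: "excess k (- x) = excess k x" by (simp add: excess_def)

lemma phi_eq: "phi (real n) = sqrt 2 * sqrt (real n * loglogl (real n))"
  by (simp add: phi_def real_sqrt_mult)

context iid_centered_l2 begin

lemma centered_uminus: "iid_centered_l2 M (\<lambda>n \<omega>. - X n \<omega>)"
proof (rule iid_centered_l2.intro[OF iid_uminus], unfold_locales)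
  show "integrable M (\<lambda>\<omega>. (- X 1 \<omega>)\<^sup>2)" using int2 by simp
  show "expectation (\<lambda>\<omega>. - X 1 \<omega>) = 0" using mean by simp
qed

lemma prob_psum_le_split:
  "prob {\<omega> \<in> space M. \<bar>psum X n \<omega>\<bar> \<ge> u} \<le> prob {\<omega> \<in> space M. esum k n \<omega> \<ge> h} + prob {\<omega> \<in> space M. \<bar>tsum k n \<omega>\<bar> \<ge> u - h}"
proof -
  have "prob {\<omega> \<in> space M. \<bar>psum X n \<omega>\<bar> \<ge> u} \<le> prob ({\<omega> \<in> space M. esum k n \<omega> \<ge> h} \<union> {\<omega> \<in> space M. \<bar>tsum k n \<omega>\<bar> \<ge> u - h})"
  proof (intro finite_measure_mono subsetI)
    fix \<omega> assume "\<omega> \<in> {\<omega> \<in> space M. \<bar>psum X n \<omega>\<bar> \<ge> u}"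
    then show "\<omega> \<in> {\<omega> \<in> space M. esum k n \<omega> \<ge> h} \<union> {\<omega> \<in> space M. \<bar>tsum k n \<omega>\<bar> \<ge> u - h}"
      using abs_psum_diff_tsum[of n \<omega> k] by auto
  qed measurable
  also have "\<dots> \<le> prob {\<omega> \<in> space M. esum k n \<omega> \<ge> h} + prob {\<omega> \<in> space M. \<bar>tsum k n \<omega>\<bar> \<ge> u - h}"
    by (intro measure_Un_le) measurable
  finally show ?thesis .
qed

text \<open>Without a jump the truncated sum equals S_n, so the last term keeps the full level
  \<open>u\<close>, where the sharp bound is applied. Lowering the level by a multiple of sqrt (n
  log log n) changes the power of log n; it happens only together with a jump, whose probability
  supplies the missing smallness.\<close>

lemma prob_psum_le_split3:
  "prob {\<omega> \<in> space M. \<bar>psum X n \<omega>\<bar> \<ge> u} \<le> prob {\<omega> \<in> space M. esum k n \<omega> \<ge> h}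
     + prob {\<omega> \<in> space M. \<bar>tsum k n \<omega>\<bar> \<ge> u - h \<and> (\<exists>i\<in>{1..n}. k < \<bar>X i \<omega>\<bar>)} + prob {\<omega> \<in> space M. \<bar>tsum k n \<omega>\<bar> \<ge> u}"
proof -
  let ?A = "{\<omega> \<in> space M. esum k n \<omega> \<ge> h}" and ?C = "{\<omega> \<in> space M. \<bar>tsum k n \<omega>\<bar> \<ge> u}"
  let ?B = "{\<omega> \<in> space M. \<bar>tsum k n \<omega>\<bar> \<ge> u - h \<and> (\<exists>i\<in>{1..n}. k < \<bar>X i \<omega>\<bar>)}"
  have B [measurable]: "?B \<in> events"
  proof -
    have eq: "?B = {\<omega> \<in> space M. \<bar>tsum k n \<omega>\<bar> \<ge> u - h} \<inter> {\<omega> \<in> space M. \<exists>i\<in>{1..n}. k < \<bar>X i \<omega>\<bar>}" by auto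
    show ?thesis unfolding eq by (rule sets.Int[OF _ jump_event]) measurable
  qed
  have A [measurable]: "?A \<in> events" "?C \<in> events" by measurable
  have "prob {\<omega> \<in> space M. \<bar>psum X n \<omega>\<bar> \<ge> u} \<le> prob (?A \<union> ?B \<union> ?C)"
  proof (intro finite_measure_mono subsetI)
    fix \<omega> assume \<omega>: "\<omega> \<in> {\<omega> \<in> space M. \<bar>psum X n \<omega>\<bar> \<ge> u}"
    show "\<omega> \<in> ?A \<union> ?B \<union> ?C"
    proof (cases "\<exists>i\<in>{1..n}. k < \<bar>X i \<omega>\<bar>")
      case True
      then show ?thesis using \<omega> abs_psum_diff_tsum[of n \<omega> k] by auto
    next
      case False
      then have "tsum k n \<omega> = psum X n \<omega>"
        unfolding tsum_def psum_def trunc_def by (intro sum.cong) (auto simp: not_less)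
      then show ?thesis using \<omega> by auto
    qed
  next
    show "?A \<union> ?B \<union> ?C \<in> events" by (rule sets.Un[OF sets.Un[OF A(1) B] A(2)])
  qed
  also have "\<dots> \<le> prob (?A \<union> ?B) + prob ?C" using A B by (intro measure_Un_le sets.Un)
  also have "prob (?A \<union> ?B) \<le> prob ?A + prob ?B" using A B by (intro measure_Un_le)
  finally show ?thesis by simp
qed

lemma sharp_tail:
  assumes \<kappa>: "0 < \<kappa>" and g: "0 < g1" "g1 \<le> g2" and s: "0 < s" and v: "expectation (\<lambda>\<omega>. (X 1 \<omega>)\<^sup>2) = s\<^sup>2"
    and c: "0 < c" and \<delta>: "0 < \<delta>"
  shows "\<forall>\<^sub>F n in sequentially. \<forall>u. g1 * sqrt (real n * loglogl (real n)) \<le> u \<and> u \<le> g2 * sqrt (real n * loglogl (real n)) \<longrightarrow>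
     negligible_moments \<kappa> n \<longrightarrow> var_trunc (level \<kappa> n) \<le> s\<^sup>2 - c / loglogl (real n) \<longrightarrow>
     prob {\<omega> \<in> space M. \<bar>tsum (level \<kappa> n) n \<omega>\<bar> \<ge> u}
       \<le> 2 * ((1 + \<delta>) * exp (- g1\<^sup>2 * c / (2 * s ^ 4)) * (exp (- u\<^sup>2 / (2 * real n * s\<^sup>2)) * (s * sqrt (real n) / (u * sqrt (2 * pi)))))"
proof -
  interpret N: iid_centered_l2 M "\<lambda>n \<omega>. - X n \<omega>" by (rule centered_uminus)
  have N: "N.negligible_moments \<kappa> n \<longleftrightarrow> negligible_moments \<kappa> n" "N.var_trunc k = var_trunc k" "N.tsum k n \<omega> = - tsum k n \<omega>" for n k \<omega>
    by (simp_all add: N.negligible_moments_def negligible_moments_def N.third_moment_def third_moment_def N.var_trunc_def var_trunc_def N.tsum_def tsum_def trunc_uminus excess_uminus sum_negf)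
  have v': "expectation (\<lambda>\<omega>. (- X 1 \<omega>)\<^sup>2) = s\<^sup>2" using v by simp
  show ?thesis using sharp_upper_tail[OF \<kappa> g s v c \<delta>] N.sharp_upper_tail[OF \<kappa> g s v' c \<delta>, unfolded N]
  proof eventually_elim
    case (elim n)
    show ?case
    proof (intro allI impI)
      fix u assume u: "g1 * sqrt (real n * loglogl (real n)) \<le> u \<and> u \<le> g2 * sqrt (real n * loglogl (real n))"
        and gd: "negligible_moments \<kappa> n" and V: "var_trunc (level \<kappa> n) \<le> s\<^sup>2 - c / loglogl (real n)"
      let ?k = "level \<kappa> n"
      have "prob {\<omega> \<in> space M. \<bar>tsum ?k n \<omega>\<bar> \<ge> u} \<le> prob ({\<omega> \<in> space M. u \<le> tsum ?k n \<omega>} \<union> {\<omega> \<in> space M. u \<le> - tsum ?k n \<omega>})"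
        by (intro finite_measure_mono) (auto simp: abs_if split: if_splits)
      also have "\<dots> \<le> prob {\<omega> \<in> space M. u \<le> tsum ?k n \<omega>} + prob {\<omega> \<in> space M. u \<le> - tsum ?k n \<omega>}"
        by (intro measure_Un_le) measurable
      also have "\<dots> \<le> ((1 + \<delta>) * exp (- g1\<^sup>2 * c / (2 * s ^ 4)) * (exp (- u\<^sup>2 / (2 * real n * s\<^sup>2)) * (s * sqrt (real n) / (u * sqrt (2 * pi)))))
         + ((1 + \<delta>) * exp (- g1\<^sup>2 * c / (2 * s ^ 4)) * (exp (- u\<^sup>2 / (2 * real n * s\<^sup>2)) * (s * sqrt (real n) / (u * sqrt (2 * pi)))))"
        using elim u gd V by (intro add_mono) blast+
      finally show "prob {\<omega> \<in> space M. \<bar>tsum ?k n \<omega>\<bar> \<ge> u}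
       \<le> 2 * ((1 + \<delta>) * exp (- g1\<^sup>2 * c / (2 * s ^ 4)) * (exp (- u\<^sup>2 / (2 * real n * s\<^sup>2)) * (s * sqrt (real n) / (u * sqrt (2 * pi)))))"
        by (simp only: mult_2)
    qed
  qed
qed

end

subsection \<open>The limit under a variance deficit\<close>

locale lil_moments = iid_centered_l2 +
  fixes a b s :: real
  assumes a: "- 1 < a" and b: "- 1/2 < b" and s: "0 < s"
    and intG: "integrable M (\<lambda>\<omega>. (X 1 \<omega>)\<^sup>2 * logl \<bar>X 1 \<omega>\<bar> powr a * loglogl \<bar>X 1 \<omega>\<bar> powr (b - 1))"
begin

text \<open>\<open>g0\<close> is the critical level in units of \<open>\<surd>(n log log n)\<close>, and \<open>\<theta>\<close> the Chernoff exponent that is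
  optimal there for variance \<open>s\<^sup>2\<close>.\<close>

definition g0 :: real where "g0 = s * sqrt (1 + a) * sqrt 2"

lemma g0: "0 < g0" "g0\<^sup>2 = 2 * (1 + a) * s\<^sup>2"
  using a s by (auto simp: g0_def power_mult_distrib)

lemma g0_phi: "s * phi (real n) * (x * sqrt (1 + a)) = x * g0 * sqrt (real n * loglogl (real n))"
  by (simp add: g0_def phi_eq)

definition \<theta> :: real where "\<theta> = g0 / s\<^sup>2"

lemma \<theta>: "0 < \<theta>" "\<theta> * g0 = 2 * (1 + a)" "\<theta>\<^sup>2 * s\<^sup>2 = 2 * (1 + a)"
proof -
  show "0 < \<theta>" using g0 s by (simp add: \<theta>_def)
  have "\<theta> * g0 = g0\<^sup>2 / s\<^sup>2" by (simp add: \<theta>_def power2_eq_square)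
  then show "\<theta> * g0 = 2 * (1 + a)" using s by (simp add: g0)
  then have "\<theta> * (\<theta> * s\<^sup>2) = 2 * (1 + a)" using s by (simp add: \<theta>_def)
  then show "\<theta>\<^sup>2 * s\<^sup>2 = 2 * (1 + a)" by (simp add: power2_eq_square mult.assoc)
qed

text \<open>With variance v s^2 the exponent \<theta> yields about (1 + a) (2 - v), more than the 1
  + a required, so even a slightly subcritical level gives a convergent series. Of the slack (1 + a)
  (1 - v), the truncation through \<kappa> uses at most half and \<eta> = (1 - v) / 16 uses a
  quarter.\<close>

lemma strict_variance_summable:
  assumes v: "expectation (\<lambda>\<omega>. (X 1 \<omega>)\<^sup>2) < s\<^sup>2"
  shows "\<exists>\<eta>>0. \<eta> < 1 \<and> summable (\<lambda>n. wt a b n * prob {\<omega> \<in> space M. \<bar>psum X n \<omega>\<bar> \<ge> s * phi (real n) * ((1 - \<eta>) * sqrt (1 + a))})"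
proof -
  define v where "v = expectation (\<lambda>\<omega>. (X 1 \<omega>)\<^sup>2) / s\<^sup>2"
  have v01: "0 \<le> v" "v < 1" using assms s by (auto simp: v_def)
  have ex: "expectation (\<lambda>\<omega>. (X 1 \<omega>)\<^sup>2) = v * s\<^sup>2" using s by (simp add: v_def)
  define \<eta> where "\<eta> = (1 - v) / 16"
  have \<eta>: "0 < \<eta>" "\<eta> < 1" using v01 by (auto simp: \<eta>_def)
  have "((\<lambda>\<kappa>. v * exp (\<theta> * \<kappa>)) \<longlongrightarrow> v * exp (\<theta> * 0)) (at_right 0)" by (intro tendsto_intros)
  then have "\<forall>\<^sub>F \<kappa> in at_right 0. v * exp (\<theta> * \<kappa>) < (1 + v) / 2" using v01 by (intro order_tendstoD) auto
  then have "\<forall>\<^sub>F \<kappa> in at_right (0::real). v * exp (\<theta> * \<kappa>) < (1 + v) / 2 \<and> 0 < \<kappa>"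
    by (intro eventually_conj eventually_at_right_less)
  then obtain \<kappa> where \<kappa>: "v * exp (\<theta> * \<kappa>) < (1 + v) / 2" "0 < \<kappa>"
    using eventually_happens'[of "at_right (0::real)"] by auto
  define \<rho> where "\<rho> = (1 + a) * (1 + (1 - v) / 8)"
  have \<rho>: "1 + a < \<rho>" using a v01 by (simp add: \<rho>_def)
  have cr: "\<rho> < \<theta> * ((1 - 2 * \<eta>) * g0) - \<theta>\<^sup>2 * expectation (\<lambda>\<omega>. (X 1 \<omega>)\<^sup>2) / 2 * exp (\<theta> * \<kappa>)"
  proof -
    have "\<theta> * ((1 - 2 * \<eta>) * g0) = (1 - 2 * \<eta>) * (\<theta> * g0)" by simp
    also have "\<dots> = (1 + a) * (2 - 4 * \<eta>)" unfolding \<theta>(2) by (simp add: algebra_simps)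
    finally have 1: "\<theta> * ((1 - 2 * \<eta>) * g0) = (1 + a) * (2 - 4 * \<eta>)" .
    have "\<theta>\<^sup>2 * expectation (\<lambda>\<omega>. (X 1 \<omega>)\<^sup>2) / 2 * exp (\<theta> * \<kappa>) = (\<theta>\<^sup>2 * s\<^sup>2) / 2 * (v * exp (\<theta> * \<kappa>))"
      unfolding ex by simp
    also have "\<dots> = (1 + a) * (v * exp (\<theta> * \<kappa>))" unfolding \<theta>(3) by simp
    also have "\<dots> \<le> (1 + a) * ((1 + v) / 2)" using \<kappa>(1) a by (intro mult_left_mono) auto
    finally have "\<theta> * ((1 - 2 * \<eta>) * g0) - \<theta>\<^sup>2 * expectation (\<lambda>\<omega>. (X 1 \<omega>)\<^sup>2) / 2 * exp (\<theta> * \<kappa>) \<ge> (1 + a) * (2 - 4 * \<eta>) - (1 + a) * ((1 + v) / 2)"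
      using 1 by linarith
    moreover have "(1 + a) * (2 - 4 * \<eta>) - (1 + a) * ((1 + v) / 2) = (1 + a) * (1 + (1 - v) / 4)"
      by (simp add: \<eta>_def field_simps)
    moreover have "\<rho> < (1 + a) * (1 + (1 - v) / 4)" unfolding \<rho>_def using a v01 by (intro mult_strict_left_mono) auto
    ultimately show ?thesis by linarith
  qed
  have sm1: "summable (\<lambda>n. wt a b n * prob {\<omega> \<in> space M. esum (level \<kappa> n) n \<omega> \<ge> (\<eta> * g0) * sqrt (real n * loglogl (real n))})"
    using \<kappa> \<eta> g0 by (intro summable_esum_tail intG) auto
  have sm2: "summable (\<lambda>n. 2 * wt (a - \<rho>) b n)" using \<rho> by (intro summable_mult wt_summable) simp
  have "summable (\<lambda>n. wt a b n * prob {\<omega> \<in> space M. \<bar>psum X n \<omega>\<bar> \<ge> s * phi (real n) * ((1 - \<eta>) * sqrt (1 + a))})"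
  proof (rule summable_comparison_test_ev[OF _ summable_add[OF sm1 sm2]])
    show "\<forall>\<^sub>F n in sequentially. norm (wt a b n * prob {\<omega> \<in> space M. \<bar>psum X n \<omega>\<bar> \<ge> s * phi (real n) * ((1 - \<eta>) * sqrt (1 + a))})
       \<le> wt a b n * prob {\<omega> \<in> space M. esum (level \<kappa> n) n \<omega> \<ge> (\<eta> * g0) * sqrt (real n * loglogl (real n))} + 2 * wt (a - \<rho>) b n"
      using crude_bound[OF \<kappa>(2) \<theta>(1) cr]
    proof eventually_elim
      case (elim n)
      let ?r = "sqrt (real n * loglogl (real n))"
      let ?k = "level \<kappa> n"
      let ?P = "prob {\<omega> \<in> space M. \<bar>psum X n \<omega>\<bar> \<ge> s * phi (real n) * ((1 - \<eta>) * sqrt (1 + a))}"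
      have "?P \<le> prob {\<omega> \<in> space M. esum ?k n \<omega> \<ge> \<eta> * g0 * ?r} + prob {\<omega> \<in> space M. \<bar>tsum ?k n \<omega>\<bar> \<ge> s * phi (real n) * ((1 - \<eta>) * sqrt (1 + a)) - \<eta> * g0 * ?r}"
        by (rule prob_psum_le_split)
      also have "s * phi (real n) * ((1 - \<eta>) * sqrt (1 + a)) - \<eta> * g0 * ?r = (1 - 2 * \<eta>) * g0 * ?r"
        unfolding g0_phi by (simp add: algebra_simps)
      also have "prob {\<omega> \<in> space M. \<bar>tsum ?k n \<omega>\<bar> \<ge> (1 - 2 * \<eta>) * g0 * ?r} \<le> 2 * logl (real n) powr (- \<rho>)"
        using elim by (auto simp: mult.assoc)
      finally have "?P \<le> prob {\<omega> \<in> space M. esum ?k n \<omega> \<ge> \<eta> * g0 * ?r} + 2 * logl (real n) powr (- \<rho>)" by simp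
      then have "wt a b n * ?P \<le> wt a b n * (prob {\<omega> \<in> space M. esum ?k n \<omega> \<ge> \<eta> * g0 * ?r} + 2 * logl (real n) powr (- \<rho>))"
        by (intro mult_left_mono) auto
      also have "\<dots> = wt a b n * prob {\<omega> \<in> space M. esum ?k n \<omega> \<ge> \<eta> * g0 * ?r} + 2 * wt (a - \<rho>) b n"
        using powr_add[of "logl (real n)" a "- \<rho>"] by (simp add: wt_def algebra_simps)
      finally show ?case by simp
    qed
  qed
  then show ?thesis using \<eta> by blast
qed

end

section \<open>The joint limit condition and the dominating series\<close>

definition joint_limit :: "real \<Rightarrow> real \<Rightarrow> (nat \<Rightarrow> real \<Rightarrow> real) \<Rightarrow> bool" where
  "joint_limit r \<tau> \<alpha> \<longleftrightarrow> (\<forall>\<eta>>0. \<exists>n0 \<delta>. \<delta> > 0 \<and> (\<forall>n\<ge>n0. \<forall>\<epsilon>. r < \<epsilon> \<and> \<epsilon> < r + \<delta> \<longrightarrow> \<bar>\<alpha> n \<epsilon> * loglogl (real n) - \<tau>\<bar> < \<eta>))"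

text \<open>Expand L (\<epsilon> + \<alpha>)^2 with L = log log n. The cross term 2 \<epsilon>
  \<alpha> L tends to 2 r \<tau>, the source of the factor with \<tau> in the limit, and the
  nonnegative L \<alpha>^2 may be dropped because only upper bounds on tails are wanted.\<close>

lemma joint_limit_bounds:
  assumes j: "joint_limit r \<tau> \<alpha>" and r: "0 < r" and \<eta>: "0 < \<eta>" "\<eta> < 1" and \<zeta>: "0 < \<zeta>"
  shows "\<exists>n0 \<delta>. \<delta> > 0 \<and> (\<forall>n\<ge>n0. \<forall>\<epsilon>. r < \<epsilon> \<and> \<epsilon> < r + \<delta> \<longrightarrow>
     (1 - \<eta>) * r \<le> \<epsilon> + \<alpha> n \<epsilon> \<and> \<epsilon> + \<alpha> n \<epsilon> \<le> 2 * r \<and>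
     loglogl (real n) * \<epsilon>\<^sup>2 + 2 * r * \<tau> - \<zeta> \<le> loglogl (real n) * (\<epsilon> + \<alpha> n \<epsilon>)\<^sup>2)"
proof -
  define \<eta>3 where "\<eta>3 = min 1 (\<zeta> / (8 * r))"
  have \<eta>3: "0 < \<eta>3" "\<eta>3 \<le> 1" "4 * r * \<eta>3 \<le> \<zeta> / 2"
  proof -
    show "0 < \<eta>3" "\<eta>3 \<le> 1" using \<zeta> r by (auto simp: \<eta>3_def)
    have "4 * r * \<eta>3 \<le> 4 * r * (\<zeta> / (8 * r))" using r by (intro mult_left_mono) (auto simp: \<eta>3_def)
    then show "4 * r * \<eta>3 \<le> \<zeta> / 2" using r by simp
  qed
  obtain n0 \<delta>0 where n0: "\<delta>0 > 0" "\<And>n \<epsilon>. n \<ge> n0 \<Longrightarrow> r < \<epsilon> \<Longrightarrow> \<epsilon> < r + \<delta>0 \<Longrightarrow> \<bar>\<alpha> n \<epsilon> * loglogl (real n) - \<tau>\<bar> < \<eta>3"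
    using j \<eta>3(1) unfolding joint_limit_def by metis
  define \<delta> where "\<delta> = min \<delta>0 (min (r / 2) (\<zeta> / (4 * (\<bar>\<tau>\<bar> + 1))))"
  have \<delta>: "\<delta> > 0" "\<delta> \<le> \<delta>0" "\<delta> \<le> r / 2" "2 * \<delta> * \<bar>\<tau>\<bar> \<le> \<zeta> / 2"
  proof -
    show "\<delta> > 0" using n0(1) r \<zeta> by (auto simp: \<delta>_def intro!: divide_pos_pos)
    show "\<delta> \<le> \<delta>0" unfolding \<delta>_def by (rule min.cobounded1)
    show "\<delta> \<le> r / 2" unfolding \<delta>_def by (rule min.coboundedI2[OF min.cobounded1])
    have d: "\<delta> \<le> \<zeta> / (4 * (\<bar>\<tau>\<bar> + 1))" unfolding \<delta>_def by (rule min.coboundedI2[OF min.cobounded2])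
    have "2 * \<delta> * \<bar>\<tau>\<bar> \<le> 2 * (\<zeta> / (4 * (\<bar>\<tau>\<bar> + 1))) * (\<bar>\<tau>\<bar> + 1)"
      using d \<open>\<delta> > 0\<close> \<zeta> by (intro mult_mono) auto
    also have "\<dots> = \<zeta> / 2" by (simp add: field_simps)
    finally show "2 * \<delta> * \<bar>\<tau>\<bar> \<le> \<zeta> / 2" .
  qed
  define \<eta>4 where "\<eta>4 = min \<eta> (1/2) * r"
  have \<eta>4: "0 < \<eta>4" "\<eta>4 \<le> \<eta> * r" "\<eta>4 \<le> r / 2" using \<eta> r by (auto simp: \<eta>4_def mult_right_mono)
  have "\<forall>\<^sub>F n in sequentially. (\<bar>\<tau>\<bar> + 1) / \<eta>4 \<le> loglogl (real n)"
    using loglogl_top unfolding filterlim_at_top by blast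
  then obtain n1 where n1: "\<And>n. n \<ge> n1 \<Longrightarrow> (\<bar>\<tau>\<bar> + 1) / \<eta>4 \<le> loglogl (real n)"
    by (auto simp: eventually_sequentially)
  have "(1 - \<eta>) * r \<le> \<epsilon> + \<alpha> n \<epsilon> \<and> \<epsilon> + \<alpha> n \<epsilon> \<le> 2 * r \<and>
     loglogl (real n) * \<epsilon>\<^sup>2 + 2 * r * \<tau> - \<zeta> \<le> loglogl (real n) * (\<epsilon> + \<alpha> n \<epsilon>)\<^sup>2"
    if n: "n \<ge> max n0 n1" and \<epsilon>: "r < \<epsilon>" "\<epsilon> < r + \<delta>" for n \<epsilon>
  proof -
    define L where "L = loglogl (real n)"
    have L: "L > 0" by (simp add: L_def)
    have aL: "\<bar>\<alpha> n \<epsilon> * L - \<tau>\<bar> < \<eta>3" using n0(2)[of n \<epsilon>] n \<epsilon> \<delta> by (simp add: L_def)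
    have "\<bar>\<alpha> n \<epsilon>\<bar> * L = \<bar>\<alpha> n \<epsilon> * L\<bar>" using L by (simp add: abs_mult)
    also have "\<dots> \<le> \<bar>\<tau>\<bar> + 1" using aL \<eta>3(2) by linarith
    also have "\<dots> \<le> \<eta>4 * L" using n1[of n] n \<eta>4(1) by (simp add: L_def field_simps)
    finally have al: "\<bar>\<alpha> n \<epsilon>\<bar> \<le> \<eta>4" using L by simp
    have 1: "(1 - \<eta>) * r \<le> \<epsilon> + \<alpha> n \<epsilon>" using al \<eta>4(2) \<epsilon>(1) by (simp add: algebra_simps)
    have 2: "\<epsilon> + \<alpha> n \<epsilon> \<le> 2 * r" using al \<eta>4(3) \<epsilon>(2) \<delta>(3) by linarith
    have "2 * \<epsilon> * (\<tau> - \<eta>3) \<le> 2 * \<epsilon> * (\<alpha> n \<epsilon> * L)" using aL \<epsilon> r by (intro mult_left_mono) auto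
    moreover have "2 * r * \<tau> - \<zeta> \<le> 2 * \<epsilon> * (\<tau> - \<eta>3)"
    proof -
      have "\<bar>(\<epsilon> - r) * \<tau>\<bar> \<le> \<delta> * \<bar>\<tau>\<bar>" unfolding abs_mult using \<epsilon> by (intro mult_right_mono) auto
      then have "- (\<zeta> / 4) \<le> (\<epsilon> - r) * \<tau>" using \<delta>(4) by linarith
      moreover have "\<epsilon> * \<eta>3 \<le> (2 * r) * \<eta>3" using \<epsilon> \<delta>(3) r \<eta>3 by (intro mult_right_mono) auto
      then have "\<epsilon> * \<eta>3 \<le> \<zeta> / 4" using \<eta>3(3) by linarith
      ultimately show ?thesis by (simp add: algebra_simps)
    qed
    moreover have "L * (\<epsilon> + \<alpha> n \<epsilon>)\<^sup>2 = L * \<epsilon>\<^sup>2 + 2 * \<epsilon> * (\<alpha> n \<epsilon> * L) + L * (\<alpha> n \<epsilon>)\<^sup>2"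
      by (simp add: power2_eq_square algebra_simps)
    moreover have "0 \<le> L * (\<alpha> n \<epsilon>)\<^sup>2" using L by simp
    ultimately have 3: "L * \<epsilon>\<^sup>2 + 2 * r * \<tau> - \<zeta> \<le> L * (\<epsilon> + \<alpha> n \<epsilon>)\<^sup>2" by linarith
    show ?thesis using 1 2 3 by (simp add: L_def)
  qed
  then show ?thesis using \<delta>(1) by blast
qed

text \<open>In the application \<open>A\<close> is exp (c0 / 4) and \<open>B\<close> is exp (- c0),
  so the collected factor A B A A is exp (- c0 / 4).\<close>

lemma regroup:
  fixes A B P T x y z :: real
  shows "2 * (A * B * ((P * (T * A)) * (A * (1 / (2 * x * y * z))))) = (A * B * A * A) * (P * (T * (1 / (x * z) * (1 / y))))"
proof -
  define W where "W = 1 / (x * z) * (1 / y)"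
  have f1: "1 / (2 * x * y * z) = 1/2 * W" unfolding W_def times_divide_times_eq by (simp only: mult_1_left mult.assoc mult.commute mult.left_commute)
  have f2: "2 * (A * B * ((P * (T * A)) * (A * (1/2 * W)))) = (2 * (1/2)) * ((A * B * A * A) * (P * (T * W)))"
    by (simp only: mult_ac)
  have f3: "2 * (1/2) = (1::real)" by simp
  show ?thesis unfolding W_def[symmetric] f1 f2 f3 by (rule mult_1_left)
qed

context lil_moments begin

text \<open>The constant of the two-sided Gaussian tail at the critical level.\<close>

definition G0 :: "real \<Rightarrow> real" where
  "G0 \<tau> = sqrt (1 / (pi * (a + 1))) * exp (- 2 * \<tau> * sqrt (1 + a))"

text \<open>The factor (log |X|)^(-1/2) beats every power of log log |X|, so the second moment
  suffices whatever \<open>a\<close> and \<open>b\<close> are. This covers both the jump term and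
  the indices that violate the first condition of \<open>negligible_moments\<close>.\<close>

lemma summable_bad_excess:
  assumes "0 < \<kappa>"
  shows "summable (\<lambda>n. wt (-1/2) (b + 1) n * (sqrt (real n) * expectation (\<lambda>\<omega>. excess (level \<kappa> n) (X 1 \<omega>))))"
  unfolding level_def
proof (rule summable_tail_moment[OF assms int2])
  obtain C where C: "\<And>x. x \<ge> 1 \<Longrightarrow> x powr (-1/2) * logl x powr (b + 1 - (- 1/2)) * loglogl x powr 0 \<le> C"
    using bounded_powr_log[of "-1/2" "b + 1 - (- 1/2)" 0] by auto
  have le: "logl x powr (-1/2) * loglogl x powr (b + 1 - (- 1/2)) \<le> C" for x
    using C[OF logl_ge_1[of x]] less_imp_neq[OF loglogl_pos[of "logl x"]] by (simp add: loglogl_def)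
  show "integrable M (\<lambda>\<omega>. (X 1 \<omega>)\<^sup>2 * logl \<bar>X 1 \<omega>\<bar> powr (-1/2) * loglogl \<bar>X 1 \<omega>\<bar> powr (b + 1 - (- 1/2)))"
  proof (rule Bochner_Integration.integrable_bound)
    show "integrable M (\<lambda>\<omega>. C * (X 1 \<omega>)\<^sup>2)" using int2 by simp
    show "AE \<omega> in M. norm ((X 1 \<omega>)\<^sup>2 * logl \<bar>X 1 \<omega>\<bar> powr (-1/2) * loglogl \<bar>X 1 \<omega>\<bar> powr (b + 1 - (- 1/2))) \<le> norm (C * (X 1 \<omega>)\<^sup>2)"
    proof (intro AE_I2)
      fix \<omega>
      have "(X 1 \<omega>)\<^sup>2 * (logl \<bar>X 1 \<omega>\<bar> powr (-1/2) * loglogl \<bar>X 1 \<omega>\<bar> powr (b + 1 - (- 1/2))) \<le> (X 1 \<omega>)\<^sup>2 * C"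
        by (intro mult_left_mono le) simp
      also have "\<dots> \<le> norm (C * (X 1 \<omega>)\<^sup>2)" by (simp add: mult.commute)
      finally show "norm ((X 1 \<omega>)\<^sup>2 * logl \<bar>X 1 \<omega>\<bar> powr (-1/2) * loglogl \<bar>X 1 \<omega>\<bar> powr (b + 1 - (- 1/2))) \<le> norm (C * (X 1 \<omega>)\<^sup>2)"
        by (simp add: abs_mult mult.assoc)
    qed
  qed measurable
qed

lemma summable_bad_third:
  assumes "0 < \<kappa>"
  shows "summable (\<lambda>n. 1 / (real n * sqrt (real n)) * third_moment (level \<kappa> n))"
  unfolding third_moment_def
proof (rule summable_truncated_third_moment[OF assms int2])
  fix n
  have "level \<kappa> n = \<kappa> * sqrt (real n) / sqrt (loglogl (real n))" by (rule level_eq)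
  also have "\<dots> \<le> \<kappa> * sqrt (real n) / 1"
    using assms loglogl_ge_1[of "real n"] by (intro divide_left_mono) auto
  finally show "level \<kappa> n \<le> \<kappa> * sqrt (real n)" by simp
qed

text \<open>Dichotomy in n. If \<open>negligible_moments\<close> fails, the crude bound is
  multiplied by a quantity of at least 1 made from the violated condition. If it holds,
  \<open>prob_psum_le_split3\<close> separates excess, jumps and the sharp Gaussian term. Everything
  but the Gaussian term goes into \<rho>, which does not depend on \<epsilon>.\<close>

lemma main_domination:
  assumes v: "expectation (\<lambda>\<omega>. (X 1 \<omega>)\<^sup>2) = s\<^sup>2" and c: "0 < c"
    and deficit: "\<And>\<kappa>. 0 < \<kappa> \<Longrightarrow> \<forall>\<^sub>F n in sequentially. var_trunc (level \<kappa> n) \<le> s\<^sup>2 - c / loglogl (real n)"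
    and j: "joint_limit (sqrt (1 + a)) \<tau> \<alpha>"
  shows "\<exists>\<rho> n2 \<delta>2. summable \<rho> \<and> \<delta>2 > 0 \<and> (\<forall>n\<ge>n2. \<forall>\<epsilon>. sqrt (1 + a) < \<epsilon> \<and> \<epsilon> < sqrt (1 + a) + \<delta>2 \<longrightarrow>
     wt a b n * prob {\<omega> \<in> space M. \<bar>psum X n \<omega>\<bar> \<ge> s * phi (real n) * (\<epsilon> + \<alpha> n \<epsilon>)}
       \<le> \<rho> n + exp (- ((1 + a) * c / (4 * s\<^sup>2)) / 4) * G0 \<tau> * wt (a - \<epsilon>\<^sup>2) (b - 1/2) n)"
proof -
  define r where "r = sqrt (1 + a)"
  have r: "r > 0" "r\<^sup>2 = 1 + a" using a by (auto simp: r_def)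
  \<comment> \<open>A lower bound for the gain g1^2 c / (2 s^4) = (1 - \<eta>)^2 (1 + a) c / s^2
    when \<eta> \<le> 1/2. Of the factor exp (- c0), a factor exp (c0 / 4) is given away three
    times: to \<delta>, to the error in \<tau>, and to replacing \<epsilon> + \<alpha> by sqrt (1 +
    a) in the denominator.\<close>
  define c0 where "c0 = (1 + a) * c / (4 * s\<^sup>2)"
  have c0: "c0 > 0" using a c s by (simp add: c0_def)
  define \<eta> where "\<eta> = min (1/2) (min (1 / (12 * (1 + a))) (1 - exp (- c0 / 4)))"
  have \<eta>: "0 < \<eta>" "\<eta> \<le> 1/2" "6 * \<eta> * (1 + a) \<le> 1/2" "exp (- c0 / 4) \<le> 1 - \<eta>"
  proof -
    show "0 < \<eta>" using a c0 by (auto simp: \<eta>_def)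
    show "\<eta> \<le> 1/2" "exp (- c0 / 4) \<le> 1 - \<eta>" by (auto simp: \<eta>_def min_def)
    have "6 * \<eta> * (1 + a) \<le> 6 * (1 / (12 * (1 + a))) * (1 + a)" using a by (intro mult_right_mono mult_left_mono) (auto simp: \<eta>_def)
    also have "\<dots> = 1/2" using a by (simp add: field_simps)
    finally show "6 * \<eta> * (1 + a) \<le> 1/2" .
  qed
  have \<eta>1: "\<eta> < 1" using \<eta>(2) by linarith
  define \<delta> where "\<delta> = exp (c0 / 4) - 1"
  have \<delta>: "0 < \<delta>" using c0 by (simp add: \<delta>_def)
  define \<kappa> where "\<kappa> = ln (1 + \<eta>) / \<theta>"
  have \<kappa>: "0 < \<kappa>" "exp (\<theta> * \<kappa>) = 1 + \<eta>" using \<eta>(1) \<theta>(1) by (auto simp: \<kappa>_def)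
  \<comment> \<open>A loss of 4 \<eta> comes from lowering the level by 2 \<eta>, another \<eta>
    from \<kappa>, and the sixth makes the inequality strict. The condition 6 \<eta> (1 + a) \<le>
    1/2 then leaves a weight of at most (log n)^(-1/2) / n, up to powers of log log n.\<close>
  define \<rho>c where "\<rho>c = (1 + a) * (1 - 6 * \<eta>)"
  have \<rho>c: "a - \<rho>c \<le> - 1/2" using \<eta>(3) by (simp add: \<rho>c_def algebra_simps)
  have cr: "\<rho>c < \<theta> * ((1 - 2 * \<eta>) * g0) - \<theta>\<^sup>2 * expectation (\<lambda>\<omega>. (X 1 \<omega>)\<^sup>2) / 2 * exp (\<theta> * \<kappa>)"
  proof -
    have "\<theta> * ((1 - 2 * \<eta>) * g0) = (1 - 2 * \<eta>) * (\<theta> * g0)" by simp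
    also have "\<dots> = (1 + a) * (2 - 4 * \<eta>)" unfolding \<theta>(2) by (simp add: algebra_simps)
    finally have "\<theta> * ((1 - 2 * \<eta>) * g0) - \<theta>\<^sup>2 * expectation (\<lambda>\<omega>. (X 1 \<omega>)\<^sup>2) / 2 * exp (\<theta> * \<kappa>) = (1 + a) * (2 - 4 * \<eta>) - (1 + a) * (1 + \<eta>)"
      unfolding v \<theta>(3) \<kappa>(2) by simp
    also have "\<dots> = (1 + a) * (1 - 5 * \<eta>)" by (simp add: algebra_simps)
    finally have *: "\<theta> * ((1 - 2 * \<eta>) * g0) - \<theta>\<^sup>2 * expectation (\<lambda>\<omega>. (X 1 \<omega>)\<^sup>2) / 2 * exp (\<theta> * \<kappa>) = (1 + a) * (1 - 5 * \<eta>)" .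
    have "\<rho>c < (1 + a) * (1 - 5 * \<eta>)" unfolding \<rho>c_def using a \<eta>(1) by (intro mult_strict_left_mono) auto
    then show ?thesis using * by linarith
  qed
  define g1 where "g1 = (1 - \<eta>) * g0"
  have g1: "0 < g1" "g1 \<le> 2 * g0" using \<eta>1 \<eta>(1) g0(1) by (auto simp: g1_def intro: mult_right_mono)
  have c1: "c0 \<le> g1\<^sup>2 * c / (2 * s ^ 4)"
  proof -
    have "(1/2)\<^sup>2 \<le> (1 - \<eta>)\<^sup>2" using \<eta>(2) by (intro power_mono) auto
    then have "(1/2)\<^sup>2 * ((1 + a) * c / s\<^sup>2) \<le> (1 - \<eta>)\<^sup>2 * ((1 + a) * c / s\<^sup>2)" using a c by (intro mult_right_mono) auto
    moreover have "(1/2)\<^sup>2 * ((1 + a) * c / s\<^sup>2) = c0" by (simp add: c0_def power2_eq_square)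
    moreover have "(1 - \<eta>)\<^sup>2 * ((1 + a) * c / s\<^sup>2) = g1\<^sup>2 * c / (2 * s ^ 4)"
    proof -
      have s4: "s ^ 4 = s\<^sup>2 * s\<^sup>2" by (simp add: power_add[symmetric])
      have gsq: "g1\<^sup>2 = (1 - \<eta>)\<^sup>2 * (2 * (1 + a) * s\<^sup>2)" by (simp add: g1_def power_mult_distrib g0(2))
      have cancel: "x * y / z = x * (2 * y * z) / (2 * (z * z))" if "z \<noteq> 0" for x y z :: real using that by simp
      show ?thesis unfolding gsq s4 using s cancel[of "s\<^sup>2" "(1 - \<eta>)\<^sup>2" "(1 + a) * c"] by (simp add: mult_ac)
    qed
    ultimately show ?thesis by (simp only:)
  qed
  obtain n0 \<delta>2 where n0: "\<delta>2 > 0" "\<And>n \<epsilon>. n \<ge> n0 \<Longrightarrow> r < \<epsilon> \<and> \<epsilon> < r + \<delta>2 \<Longrightarrow>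
     (1 - \<eta>) * r \<le> \<epsilon> + \<alpha> n \<epsilon> \<and> \<epsilon> + \<alpha> n \<epsilon> \<le> 2 * r \<and>
     loglogl (real n) * \<epsilon>\<^sup>2 + 2 * r * \<tau> - c0 / 4 \<le> loglogl (real n) * (\<epsilon> + \<alpha> n \<epsilon>)\<^sup>2"
    using joint_limit_bounds[OF j[folded r_def] r(1) \<eta>(1) \<eta>1, of "c0 / 4"] c0 by auto
  obtain C where C: "C > 0" "\<And>x. x \<ge> 1 \<Longrightarrow> x powr (-1/2) * logl x powr (b + 10) * loglogl x powr 0 \<le> C"
    using bounded_powr_log[of "-1/2" "b + 10" 0] by auto
  have Cle: "logl x powr (-1/2) * loglogl x powr (b + 10) \<le> C" for x
    using C(2)[OF logl_ge_1[of x]] less_imp_neq[OF loglogl_pos[of "logl x"]] by (simp add: loglogl_def)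
  define R1 where "R1 n = wt a b n * prob {\<omega> \<in> space M. esum (level \<kappa> n) n \<omega> \<ge> (\<eta> * g0) * sqrt (real n * loglogl (real n))}" for n
  define R2 where "R2 n = wt (-1/2) (b + 1) n * (sqrt (real n) * expectation (\<lambda>\<omega>. excess (level \<kappa> n) (X 1 \<omega>)))" for n
  define R3 where "R3 n = 1 / (real n * sqrt (real n)) * third_moment (level \<kappa> n)" for n
  define \<rho> where "\<rho> n = R1 n + 2 * (1 + 1 / \<kappa>) * R2 n + 2 * C * R3 n" for n
  have "summable R1" unfolding R1_def using \<kappa> \<eta> g0 by (intro summable_esum_tail intG) auto
  moreover have "summable R2" unfolding R2_def by (rule summable_bad_excess[OF \<kappa>(1)])
  moreover have "summable R3" unfolding R3_def by (rule summable_bad_third[OF \<kappa>(1)])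
  ultimately have sm: "summable \<rho>" unfolding \<rho>_def[abs_def] by (intro summable_add summable_mult)
  have R0: "0 \<le> R1 n" "0 \<le> R2 n" "0 \<le> R3 n" for n
    by (auto simp: R1_def R2_def R3_def third_moment_def intro!: mult_nonneg_nonneg)
  have ev: "\<forall>\<^sub>F n in sequentially. \<forall>\<epsilon>. r < \<epsilon> \<and> \<epsilon> < r + \<delta>2 \<longrightarrow>
     wt a b n * prob {\<omega> \<in> space M. \<bar>psum X n \<omega>\<bar> \<ge> s * phi (real n) * (\<epsilon> + \<alpha> n \<epsilon>)}
       \<le> \<rho> n + exp (- c0 / 4) * G0 \<tau> * wt (a - \<epsilon>\<^sup>2) (b - 1/2) n"
    using crude_bound[OF \<kappa>(1) \<theta>(1) cr] sharp_tail[OF \<kappa>(1) g1 s v c \<delta>] deficit[OF \<kappa>(1)]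
      eventually_log_seq(1,2) eventually_gt_at_top[of 0] eventually_ge_at_top[of n0]
  proof eventually_elim
    case (elim n)
    show ?case
    proof (intro allI impI)
      fix \<epsilon> assume \<epsilon>: "r < \<epsilon> \<and> \<epsilon> < r + \<delta>2"
      define L where "L = loglogl (real n)"
      define k where "k = level \<kappa> n"
      define q where "q = sqrt (real n)"
      define Q where "Q = sqrt (real n * L)"
      define y where "y = \<epsilon> + \<alpha> n \<epsilon>"
      define u where "u = s * phi (real n) * y"
      define exc where "exc = expectation (\<lambda>\<omega>. excess k (X 1 \<omega>))"
      have L: "L \<ge> 1" unfolding L_def by (rule loglogl_ge_1)
      have l1: "logl (real n) \<ge> 1" by (rule logl_ge_1)
      have q: "q > 0" "q * q = real n" using elim(6) by (auto simp: q_def)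
      have Qq: "Q = q * sqrt L" by (simp add: Q_def q_def real_sqrt_mult)
      have Q0: "Q > 0" using q L by (simp add: Qq)
      have y: "(1 - \<eta>) * r \<le> y" "y \<le> 2 * r" "L * \<epsilon>\<^sup>2 + 2 * r * \<tau> - c0 / 4 \<le> L * y\<^sup>2"
        using n0(2)[OF elim(7) \<epsilon>] by (auto simp: y_def L_def)
      have y0: "y > 0" using y(1) \<eta>1 r(1) by (intro less_le_trans[OF _ y(1)]) simp
      have sphi: "s * phi (real n) * (x * r) = x * g0 * Q" for x using g0_phi[of n x] by (simp add: r_def Q_def L_def)
      have sp0: "s * phi (real n) \<ge> 0" using s L elim(6) by (simp add: phi_def L_def)
      have u1: "g1 * Q \<le> u"
        using mult_left_mono[OF y(1) sp0] unfolding u_def g1_def sphi[symmetric] .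
      have u2: "u \<le> 2 * g0 * Q"
        using mult_left_mono[OF y(2) sp0] unfolding u_def sphi[symmetric] .
      have uh: "(1 - 2 * \<eta>) * g0 * Q \<le> u - \<eta> * g0 * Q" using u1 by (simp add: g1_def algebra_simps)
      have crude1: "prob {\<omega> \<in> space M. \<bar>tsum k n \<omega>\<bar> \<ge> u - \<eta> * g0 * Q} \<le> 2 * logl (real n) powr (- \<rho>c)"
        and crude2: "prob {\<omega> \<in> space M. \<bar>tsum k n \<omega>\<bar> \<ge> u - \<eta> * g0 * Q \<and> (\<exists>i\<in>{1..n}. k < \<bar>X i \<omega>\<bar>)}
           \<le> 2 * (real n * prob {\<omega> \<in> space M. k < \<bar>X 1 \<omega>\<bar>}) * logl (real n) powr (- \<rho>c)"
        using elim(1)[rule_format, of "u - \<eta> * g0 * Q"] uh by (auto simp: k_def Q_def L_def)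
      have exc0: "0 \<le> exc" unfolding exc_def by (intro integral_nonneg_AE) auto
      have th0: "0 \<le> third_moment k" by (simp add: third_moment_def)
      have wc: "wt a b n * logl (real n) powr (- \<rho>c) \<le> wt (-1/2) b n"
      proof -
        have "logl (real n) powr a * logl (real n) powr (- \<rho>c) \<le> logl (real n) powr (-1/2)"
          unfolding powr_add[symmetric] using \<rho>c l1 by (intro powr_mono) auto
        then have "logl (real n) powr a * logl (real n) powr (- \<rho>c) * (loglogl (real n) powr b / real n) \<le> logl (real n) powr (-1/2) * (loglogl (real n) powr b / real n)"
          by (intro mult_right_mono) auto
        then show ?thesis by (simp add: wt_def mult_ac)
      qed
      have w1: "wt (-1/2) b n * L \<le> wt (-1/2) (b + 1) n"
        using L by (simp add: wt_def L_def powr_add)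
      have R1n: "R1 n = wt a b n * prob {\<omega> \<in> space M. esum k n \<omega> \<ge> \<eta> * g0 * Q}" by (simp add: R1_def k_def Q_def L_def)
      have R2n: "R2 n = wt (-1/2) (b + 1) n * (q * exc)" by (simp add: R2_def k_def q_def exc_def)
      have R3n: "R3 n = 1 / (real n * q) * third_moment k" by (simp add: R3_def k_def q_def)
      have G00: "0 \<le> exp (- c0 / 4) * G0 \<tau> * wt (a - \<epsilon>\<^sup>2) (b - 1/2) n"
        using a by (simp add: G0_def)
      show "wt a b n * prob {\<omega> \<in> space M. \<bar>psum X n \<omega>\<bar> \<ge> s * phi (real n) * (\<epsilon> + \<alpha> n \<epsilon>)}
       \<le> \<rho> n + exp (- c0 / 4) * G0 \<tau> * wt (a - \<epsilon>\<^sup>2) (b - 1/2) n"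
      proof (cases "negligible_moments \<kappa> n")
        case False
        \<comment> \<open>Whichever condition fails, the corresponding moment divided by its
          threshold is at least 1 and may multiply the crude bound.\<close>
        have one: "1 \<le> exc * L * q + third_moment k * L ^ 10 / q"
        proof -
          have "1 / (L * q) \<le> exc \<or> q / L ^ 10 \<le> third_moment k"
            using False by (auto simp: negligible_moments_def exc_def k_def L_def q_def not_le)
          then show ?thesis
          proof
            assume "1 / (L * q) \<le> exc"
            then have "1 \<le> exc * L * q" using L q by (simp add: field_simps)
            then show ?thesis using th0 L q by (simp add: add_increasing2)
          next
            assume "q / L ^ 10 \<le> third_moment k"
            then have "1 \<le> third_moment k * L ^ 10 / q" using L q by (simp add: field_simps)
            then show ?thesis using exc0 L q by (simp add: add_increasing)
          qed
        qed
        have "wt a b n * prob {\<omega> \<in> space M. \<bar>psum X n \<omega>\<bar> \<ge> u}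
          \<le> wt a b n * (prob {\<omega> \<in> space M. esum k n \<omega> \<ge> \<eta> * g0 * Q} + 2 * logl (real n) powr (- \<rho>c))"
          by (intro mult_left_mono order_trans[OF prob_psum_le_split[where k = k and h = "\<eta> * g0 * Q"]] add_mono order_refl crude1) simp
        also have "\<dots> = R1 n + 2 * (wt a b n * logl (real n) powr (- \<rho>c))" by (simp add: R1n distrib_left)
        also have "\<dots> \<le> R1 n + 2 * (wt (-1/2) b n * (exc * L * q + third_moment k * L ^ 10 / q))"
          using wc mult_left_mono[OF one wt_nonneg[of "-1/2" b n]] by simp
        also have "\<dots> \<le> R1 n + 2 * (R2 n + C * R3 n)"
        proof -
          have "wt (-1/2) b n * (exc * L * q) = (wt (-1/2) b n * L) * (q * exc)" by simp
          also have "\<dots> \<le> R2 n" unfolding R2n using exc0 q by (intro mult_right_mono w1) auto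
          finally have A: "wt (-1/2) b n * (exc * L * q) \<le> R2 n" .
          have "wt (-1/2) b n * (third_moment k * L ^ 10 / q) = (logl (real n) powr (-1/2) * loglogl (real n) powr (b + 10)) * R3 n"
            using L by (simp add: wt_def R3n L_def powr_add powr_numeral)
          also have "\<dots> \<le> C * R3 n" by (intro mult_right_mono Cle R0)
          finally have B: "wt (-1/2) b n * (third_moment k * L ^ 10 / q) \<le> C * R3 n" .
          show ?thesis using A B by (simp add: distrib_left)
        qed
        also have "\<dots> \<le> \<rho> n" using \<kappa>(1) R0(2)[of n] by (simp add: \<rho>_def algebra_simps)
        finally show ?thesis using G00 by (simp add: u_def y_def)
      next
        case True
        have k: "k = \<kappa> * q / sqrt L" by (simp only: k_def level_eq q_def L_def)
        have k0: "k > 0" using \<kappa>(1) q L by (simp add: k)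
        have "k * prob {\<omega> \<in> space M. k < \<bar>X 1 \<omega>\<bar>} \<le> exc"
          unfolding exc_def by (rule Markov_bound[OF integrable_excess]) (auto simp: excess_def)
        then have "real n * prob {\<omega> \<in> space M. k < \<bar>X 1 \<omega>\<bar>} \<le> real n * (exc / k)"
          using k0 by (intro mult_left_mono) (auto simp: field_simps)
        also have "\<dots> = (q * q) * (exc / (\<kappa> * q / sqrt L))" unfolding q(2) k ..
        also have "\<dots> = 1 / \<kappa> * (sqrt L * (q * exc))" using q(1) \<kappa>(1) L by simp
        also have "\<dots> \<le> 1 / \<kappa> * (L * (q * exc))"
        proof (intro mult_left_mono mult_right_mono)
          show "sqrt L \<le> L" using L by (intro real_le_lsqrt) (auto simp: power2_eq_square)
        qed (use q exc0 \<kappa>(1) in auto)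
        finally have jp: "real n * prob {\<omega> \<in> space M. k < \<bar>X 1 \<omega>\<bar>} \<le> 1 / \<kappa> * (L * (q * exc))" .
        have sharp: "prob {\<omega> \<in> space M. \<bar>tsum k n \<omega>\<bar> \<ge> u}
          \<le> 2 * ((1 + \<delta>) * exp (- g1\<^sup>2 * c / (2 * s ^ 4)) * (exp (- u\<^sup>2 / (2 * real n * s\<^sup>2)) * (s * q / (u * sqrt (2 * pi)))))"
          using elim(2)[rule_format, of u] u1 u2 True elim(3) by (simp add: k_def q_def Q_def L_def)
        have sharp2: "prob {\<omega> \<in> space M. \<bar>tsum k n \<omega>\<bar> \<ge> u} \<le> exp (- c0 / 4) * G0 \<tau> * (logl (real n) powr (- \<epsilon>\<^sup>2) * L powr (- 1/2))"
        proof -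
          have u2n: "u\<^sup>2 / (2 * real n * s\<^sup>2) = L * y\<^sup>2"
            using L elim(6) s by (simp add: u_def phi_def power_mult_distrib L_def[symmetric])
          have "exp (- u\<^sup>2 / (2 * real n * s\<^sup>2)) = exp (- (L * y\<^sup>2))" using u2n by simp
          also have "\<dots> \<le> exp (- (L * \<epsilon>\<^sup>2) + (- 2 * \<tau> * r + c0 / 4))" using y(3) by (simp add: mult_ac)
          also have "\<dots> = exp (- (L * \<epsilon>\<^sup>2)) * (exp (- 2 * \<tau> * r) * exp (c0 / 4))" by (simp only: exp_add)
          also have "exp (- (L * \<epsilon>\<^sup>2)) = logl (real n) powr (- \<epsilon>\<^sup>2)"
            using elim(4,5) less_imp_neq[OF logl_pos[of "real n"]] by (simp add: powr_def L_def)
          finally have E: "exp (- u\<^sup>2 / (2 * real n * s\<^sup>2)) \<le> logl (real n) powr (- \<epsilon>\<^sup>2) * (exp (- 2 * \<tau> * r) * exp (c0 / 4))" .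
          have "s * q / (u * sqrt (2 * pi)) = 1 / (2 * sqrt pi * sqrt L * y)"
            using s q(1) y0 L by (simp add: u_def phi_def L_def[symmetric] real_sqrt_mult q_def[symmetric] field_simps)
          also have "\<dots> \<le> 1 / (2 * sqrt pi * sqrt L * ((1 - \<eta>) * r))"
            using y(1) y0 r \<eta>1 L by (intro divide_left_mono mult_left_mono) auto
          also have "\<dots> \<le> 1 / (2 * sqrt pi * sqrt L * (exp (- c0 / 4) * r))"
            using \<eta>(4) r \<eta>1 L by (intro divide_left_mono mult_left_mono mult_right_mono) auto
          also have "\<dots> = exp (c0 / 4) * (1 / (2 * sqrt pi * sqrt L * r))" by (simp add: exp_minus field_simps)
          finally have Fq: "s * q / (u * sqrt (2 * pi)) \<le> exp (c0 / 4) * (1 / (2 * sqrt pi * sqrt L * r))" .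
          have ph0: "0 \<le> phi (real n)" using L by (simp add: phi_def L_def)
          have "exp (- g1\<^sup>2 * c / (2 * s ^ 4)) \<le> exp (- c0)" using c1 by simp
          then have "2 * ((1 + \<delta>) * exp (- g1\<^sup>2 * c / (2 * s ^ 4)) * (exp (- u\<^sup>2 / (2 * real n * s\<^sup>2)) * (s * q / (u * sqrt (2 * pi)))))
             \<le> 2 * (exp (c0 / 4) * exp (- c0) * ((logl (real n) powr (- \<epsilon>\<^sup>2) * (exp (- 2 * \<tau> * r) * exp (c0 / 4))) * (exp (c0 / 4) * (1 / (2 * sqrt pi * sqrt L * r)))))"
            using E Fq \<delta> s q y0 ph0
            by (intro mult_left_mono mult_mono) (auto simp: \<delta>_def u_def intro!: divide_nonneg_nonneg mult_nonneg_nonneg)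
          also have "\<dots> = (exp (c0 / 4) * exp (- c0) * exp (c0 / 4) * exp (c0 / 4)) * (logl (real n) powr (- \<epsilon>\<^sup>2) * (exp (- 2 * \<tau> * r) * (1 / (sqrt pi * r) * (1 / sqrt L))))"
            by (rule regroup)
          also have "exp (c0 / 4) * exp (- c0) * exp (c0 / 4) * exp (c0 / 4) = exp (- c0 / 4)"
            unfolding exp_add[symmetric] by simp
          also have "1 / sqrt L = L powr (- 1/2)"
            using L powr_minus[of L "1/2"] by (simp add: powr_half_sqrt inverse_eq_divide)
          also have "1 / (sqrt pi * r) = sqrt (1 / (pi * (a + 1)))"
            by (simp add: r_def real_sqrt_divide real_sqrt_mult add.commute)
          also have "exp (- c0 / 4) * (logl (real n) powr (- \<epsilon>\<^sup>2) * (exp (- 2 * \<tau> * r) * (sqrt (1 / (pi * (a + 1))) * L powr (- 1/2))))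
             = exp (- c0 / 4) * G0 \<tau> * (logl (real n) powr (- \<epsilon>\<^sup>2) * L powr (- 1/2))"
            by (simp only: G0_def r_def mult_ac)
          finally show ?thesis using sharp by linarith
        qed
        have w3: "wt a b n * (logl (real n) powr (- \<epsilon>\<^sup>2) * L powr (- 1/2)) = wt (a - \<epsilon>\<^sup>2) (b - 1/2) n"
          using powr_add[of "logl (real n)" a "- \<epsilon>\<^sup>2"] powr_add[of L b "- 1/2"] by (simp add: wt_def L_def)
        have "wt a b n * prob {\<omega> \<in> space M. \<bar>psum X n \<omega>\<bar> \<ge> u}
          \<le> wt a b n * (prob {\<omega> \<in> space M. esum k n \<omega> \<ge> \<eta> * g0 * Q}
             + 2 * (1 / \<kappa> * (L * (q * exc))) * logl (real n) powr (- \<rho>c)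
             + exp (- c0 / 4) * G0 \<tau> * (logl (real n) powr (- \<epsilon>\<^sup>2) * L powr (- 1/2)))"
        proof (intro mult_left_mono order_trans[OF prob_psum_le_split3[where k = k and h = "\<eta> * g0 * Q"]] add_mono order_refl sharp2)
          show "prob {\<omega> \<in> space M. \<bar>tsum k n \<omega>\<bar> \<ge> u - \<eta> * g0 * Q \<and> (\<exists>i\<in>{1..n}. k < \<bar>X i \<omega>\<bar>)}
             \<le> 2 * (1 / \<kappa> * (L * (q * exc))) * logl (real n) powr (- \<rho>c)"
            using jp by (intro order_trans[OF crude2] mult_right_mono mult_left_mono) auto
        qed simp
        also have "\<dots> = R1 n + 2 * (1 / \<kappa> * (L * (q * exc))) * (wt a b n * logl (real n) powr (- \<rho>c)) + exp (- c0 / 4) * G0 \<tau> * wt (a - \<epsilon>\<^sup>2) (b - 1/2) n"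
          unfolding w3[symmetric] R1n by (simp add: distrib_left mult_ac)
        also have "\<dots> \<le> R1 n + 2 * (1 / \<kappa>) * R2 n + exp (- c0 / 4) * G0 \<tau> * wt (a - \<epsilon>\<^sup>2) (b - 1/2) n"
        proof -
          have "2 * (1 / \<kappa> * (L * (q * exc))) * (wt a b n * logl (real n) powr (- \<rho>c)) \<le> 2 * (1 / \<kappa> * (L * (q * exc))) * wt (-1/2) b n"
            using \<kappa>(1) L q exc0 by (intro mult_left_mono wc) auto
          also have "\<dots> = 2 * (1 / \<kappa>) * ((wt (-1/2) b n * L) * (q * exc))" by simp
          also have "\<dots> \<le> 2 * (1 / \<kappa>) * R2 n"
            unfolding R2n using \<kappa>(1) q exc0 by (intro mult_left_mono mult_right_mono w1) auto
          finally show ?thesis by simp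
        qed
        also have "\<dots> \<le> \<rho> n + exp (- c0 / 4) * G0 \<tau> * wt (a - \<epsilon>\<^sup>2) (b - 1/2) n"
          using C(1) R0(2,3)[of n] by (simp add: \<rho>_def algebra_simps)
        finally show ?thesis by (simp add: u_def y_def)
      qed
    qed
  qed
  then obtain n2 where "\<And>n \<epsilon>. n \<ge> n2 \<Longrightarrow> r < \<epsilon> \<and> \<epsilon> < r + \<delta>2 \<Longrightarrow>
     wt a b n * prob {\<omega> \<in> space M. \<bar>psum X n \<omega>\<bar> \<ge> s * phi (real n) * (\<epsilon> + \<alpha> n \<epsilon>)}
       \<le> \<rho> n + exp (- c0 / 4) * G0 \<tau> * wt (a - \<epsilon>\<^sup>2) (b - 1/2) n"
    unfolding eventually_sequentially by blast
  then show ?thesis using sm n0(1) unfolding r_def c0_def by blast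
qed

text \<open>The normalization tends to 0 and kills every part that is summable uniformly in
  \<epsilon>. With d = \<epsilon>^2 - a - 1 the remaining weights are those of
  \<open>wt_suminf_le\<close>, whose d^(-(b + 1/2)) it cancels exactly.\<close>

lemma limit_le:
  fixes Q :: "nat \<Rightarrow> real \<Rightarrow> real"
  assumes \<rho>: "summable \<rho>" and A: "0 \<le> A" and \<delta>: "0 < \<delta>"
    and Q: "\<And>n \<epsilon>. 0 \<le> Q n \<epsilon>" "\<And>n \<epsilon>. Q n \<epsilon> \<le> 1"
    and dom: "\<And>n \<epsilon>. n \<ge> N \<Longrightarrow> sqrt (1 + a) < \<epsilon> \<Longrightarrow> \<epsilon> < sqrt (1 + a) + \<delta> \<Longrightarrow>
       wt a b n * Q n \<epsilon> \<le> \<rho> n + A * wt (a - \<epsilon>\<^sup>2) (b - 1/2) n"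
    and lim: "((\<lambda>\<epsilon>. (\<epsilon>\<^sup>2 - a - 1) powr (b + 1/2) * (\<Sum>n. wt a b (Suc n) * Q (Suc n) \<epsilon>)) \<longlongrightarrow> l) (at_right (sqrt (1 + a)))"
  shows "l \<le> A * Gamma (b + 1/2)"
proof -
  define r where "r = sqrt (1 + a)"
  have r: "r > 0" "r\<^sup>2 = 1 + a" using a by (auto simp: r_def)
  \<comment> \<open>Domination is assumed only from \<open>N\<close> on. The finitely many earlier
    terms are replaced by \<open>wt a b n\<close>, which dominates because Q \<le> 1.\<close>
  define \<rho>' where "\<rho>' n = \<rho> n + (if n \<in> {..<N} then wt a b n - \<rho> n else 0)" for n
  have \<rho>': "summable \<rho>'"
    unfolding \<rho>'_def[abs_def] by (intro summable_add \<rho> summable_If_finite_set) simp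
  obtain K where K0: "\<forall>d>0. summable (wt (-1-d) (b - 1/2)) \<and> suminf (wt (-1-d) (b - 1/2)) \<le> K + Gamma (b + 1/2) * d powr (- (b + 1/2))"
    using wt_suminf_le[OF b] by (elim exE)
  have K: "summable (wt (-1-d) (b - 1/2))" "suminf (wt (-1-d) (b - 1/2)) \<le> K + Gamma (b + 1/2) * d powr (- (b + 1/2))" if "d > 0" for d
    using K0 that by simp_all
  have le: "(\<epsilon>\<^sup>2 - a - 1) powr (b + 1/2) * (\<Sum>n. wt a b (Suc n) * Q (Suc n) \<epsilon>)
      \<le> (\<epsilon>\<^sup>2 - a - 1) powr (b + 1/2) * (suminf \<rho>' + A * K) + A * Gamma (b + 1/2)"
    if \<epsilon>: "r < \<epsilon>" "\<epsilon> < r + \<delta>" for \<epsilon>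
  proof -
    define d where "d = \<epsilon>\<^sup>2 - a - 1"
    have "r\<^sup>2 < \<epsilon>\<^sup>2" using \<epsilon> r by (intro power_strict_mono) auto
    then have d: "d > 0" using r by (simp add: d_def)
    have ae: "a - \<epsilon>\<^sup>2 = - 1 - d" by (simp add: d_def)
    let ?f = "\<lambda>n. wt a b n * Q n \<epsilon>" and ?g = "\<lambda>n. \<rho>' n + A * wt (-1-d) (b - 1/2) n"
    have fg: "?f n \<le> ?g n" for n
    proof (cases "n \<ge> N")
      case True
      then show ?thesis using dom[of n \<epsilon>] \<epsilon> by (simp add: \<rho>'_def ae r_def)
    next
      case False
      have "?f n \<le> wt a b n * 1" by (intro mult_left_mono Q) simp
      then show ?thesis using False A by (simp add: \<rho>'_def add_increasing2)
    qed
    have sg: "summable ?g" by (intro summable_add \<rho>' summable_mult K d)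
    have sf: "summable ?f"
      by (rule summable_comparison_test'[OF sg, of 0]) (use fg Q in simp)
    have "(\<Sum>n. wt a b (Suc n) * Q (Suc n) \<epsilon>) = suminf ?f"
      using suminf_split_head[OF sf] by simp
    also have "\<dots> \<le> suminf ?g" by (intro suminf_le fg sf sg)
    also have "\<dots> = suminf \<rho>' + A * suminf (wt (-1-d) (b - 1/2))"
      by (subst suminf_add[symmetric]) (auto intro!: \<rho>' summable_mult K d simp: suminf_mult K(1)[OF d])
    also have "\<dots> \<le> suminf \<rho>' + A * (K + Gamma (b + 1/2) * d powr (- (b + 1/2)))"
      by (intro add_left_mono mult_left_mono K d A)
    finally have "d powr (b + 1/2) * (\<Sum>n. wt a b (Suc n) * Q (Suc n) \<epsilon>) \<le> d powr (b + 1/2) * (suminf \<rho>' + A * (K + Gamma (b + 1/2) * d powr (- (b + 1/2))))"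
      by (intro mult_left_mono) auto
    also have "\<dots> = d powr (b + 1/2) * (suminf \<rho>' + A * K) + A * Gamma (b + 1/2) * (d powr (b + 1/2) * d powr (- (b + 1/2)))"
      by (simp only: algebra_simps)
    also have "d powr (b + 1/2) * d powr (- (b + 1/2)) = 1" using d unfolding powr_add[symmetric] by simp
    finally show ?thesis by (simp add: d_def)
  qed
  have "((\<lambda>\<epsilon>. (\<epsilon>\<^sup>2 - a - 1) powr (b + 1/2) * (suminf \<rho>' + A * K) + A * Gamma (b + 1/2)) \<longlongrightarrow> 0 * (suminf \<rho>' + A * K) + A * Gamma (b + 1/2)) (at_right r)"
  proof (intro tendsto_intros)
    have "((\<lambda>\<epsilon>. \<epsilon>\<^sup>2 - a - 1) \<longlongrightarrow> r\<^sup>2 - a - 1) (at_right r)" by (intro tendsto_intros)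
    then have "((\<lambda>\<epsilon>. \<epsilon>\<^sup>2 - a - 1) \<longlongrightarrow> 0) (at_right r)" using r by simp
    moreover have "\<forall>\<^sub>F \<epsilon> in at_right r. 0 \<le> \<epsilon>\<^sup>2 - a - 1"
      using eventually_at_right_less[of r]
    proof eventually_elim
      case (elim \<epsilon>)
      then have "r\<^sup>2 \<le> \<epsilon>\<^sup>2" using r by (intro power_mono) auto
      then show ?case using r by simp
    qed
    ultimately show "((\<lambda>\<epsilon>. (\<epsilon>\<^sup>2 - a - 1) powr (b + 1/2)) \<longlongrightarrow> 0) (at_right r)"
      using b by (intro tendsto_zero_powrI[OF _ tendsto_const]) auto
  qed
  moreover have "\<forall>\<^sub>F \<epsilon> in at_right r. (\<epsilon>\<^sup>2 - a - 1) powr (b + 1/2) * (\<Sum>n. wt a b (Suc n) * Q (Suc n) \<epsilon>)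
      \<le> (\<epsilon>\<^sup>2 - a - 1) powr (b + 1/2) * (suminf \<rho>' + A * K) + A * Gamma (b + 1/2)"
    unfolding eventually_at_right[of r "r + 1", simplified] using le \<delta> by (intro exI[of _ "r + \<delta>"]) auto
  ultimately have "l \<le> 0 * (suminf \<rho>' + A * K) + A * Gamma (b + 1/2)"
    using lim[folded r_def] by (intro tendsto_le[OF trivial_limit_at_right_real])
  then show ?thesis by simp
qed

text \<open>A shift of order sqrt n would spoil the joint limit condition, so a smaller one has to
  serve in Ottaviani's inequality. For large \<open>j\<close> the central limit theorem gives P(S_j
  \<le> 0) close to 1/2, and for the finitely many other \<open>j\<close> Chebyshev's inequality
  applies because the shift tends to infinity with n.\<close>

lemma psum_median:
  assumes v: "expectation (\<lambda>\<omega>. (X 1 \<omega>)\<^sup>2) = s\<^sup>2" and q: "q < 1/2"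
  shows "\<forall>\<^sub>F n in sequentially. \<forall>j\<le>n. q \<le> prob {\<omega> \<in> space M. psum X j \<omega> \<le> s * sqrt (real n) / loglogl (real n)}"
proof -
  have s2: "0 < s\<^sup>2" using s by simp
  have "\<forall>\<^sub>F k in sequentially. q < prob {\<omega> \<in> space M. psum X k \<omega> \<le> 0 * sqrt (s\<^sup>2) * sqrt (real k)}"
    using q std_normal_cdf_0 by (intro order_tendstoD(1)[OF CLT_tail[OF int2 mean v s2]]) auto
  then obtain j0 where j0: "\<And>j. j \<ge> j0 \<Longrightarrow> q < prob {\<omega> \<in> space M. psum X j \<omega> \<le> 0}"
    by (auto simp: eventually_sequentially)
  have "filterlim (\<lambda>n. real n / (loglogl (real n))\<^sup>2) at_top sequentially"
    by (rule filterlim_seq_cong[of "\<lambda>n l L. n / L\<^sup>2"]) real_asymp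
  then have "\<forall>\<^sub>F n in sequentially. 2 * real j0 \<le> real n / (loglogl (real n))\<^sup>2"
    unfolding filterlim_at_top by blast
  then show ?thesis using eventually_gt_at_top[of 0]
  proof eventually_elim
    case (elim n)
    define w where "w = s * sqrt (real n) / loglogl (real n)"
    have w: "w > 0" using s elim(2) by (simp add: w_def)
    have w2: "2 * (real j0 * s\<^sup>2) \<le> w\<^sup>2"
    proof -
      have "w\<^sup>2 = s\<^sup>2 * (real n / (loglogl (real n))\<^sup>2)" by (simp add: w_def power_divide power_mult_distrib)
      then show ?thesis using mult_left_mono[OF elim(1), of "s\<^sup>2"] by (simp add: mult_ac)
    qed
    show ?case
    proof (intro allI impI)
      fix j assume "j \<le> n"
      show "q \<le> prob {\<omega> \<in> space M. psum X j \<omega> \<le> s * sqrt (real n) / loglogl (real n)}"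
      proof (cases "j \<ge> j0")
        case True
        have "q \<le> prob {\<omega> \<in> space M. psum X j \<omega> \<le> 0}" using j0[OF True] by simp
        also have "\<dots> \<le> prob {\<omega> \<in> space M. psum X j \<omega> \<le> w}" using w by (intro finite_measure_mono) auto
        finally show ?thesis by (simp add: w_def)
      next
        case False
        have "1/2 \<le> prob {\<omega> \<in> space M. psum X j \<omega> \<le> w}"
          using psum_Chebyshev_half(2)[OF int2 mean w, of j0 j] w2 v False by simp
        then show ?thesis using q by (simp add: w_def)
      qed
    qed
  qed
qed

text \<open>A \<open>q\<close> close to 1/2 makes 1 / q close to 2, the ratio between the limits for
  maxima and for sums.\<close>

lemma pmax_le_psum_sharp:
  assumes v: "expectation (\<lambda>\<omega>. (X 1 \<omega>)\<^sup>2) = s\<^sup>2" and q: "0 < q" "q < 1/2"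
  shows "\<forall>\<^sub>F n in sequentially. \<forall>u > s * sqrt (real n) / loglogl (real n).
     prob {\<omega> \<in> space M. pmax X n \<omega> \<ge> u} \<le> 1 / q * prob {\<omega> \<in> space M. \<bar>psum X n \<omega>\<bar> \<ge> u - s * sqrt (real n) / loglogl (real n)}"
proof -
  interpret N: iid_centered_l2 M "\<lambda>n \<omega>. - X n \<omega>" by (rule centered_uminus)
  have NL: "lil_moments M (\<lambda>n \<omega>. - X n \<omega>) a b s"
    by unfold_locales (use a b s intG in auto)
  have v': "expectation (\<lambda>\<omega>. (- X 1 \<omega>)\<^sup>2) = s\<^sup>2" using v by simp
  show ?thesis using psum_median[OF v q(2)] lil_moments.psum_median[OF NL v' q(2)]
  proof eventually_elim
    case (elim n)
    let ?w = "s * sqrt (real n) / loglogl (real n)"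
    have m: "{\<omega> \<in> space M. - psum X j \<omega> \<le> ?w} = {\<omega> \<in> space M. psum X j \<omega> \<ge> - ?w}" for j by auto
    show ?case
    proof (intro allI impI)
      fix u assume u: "u > ?w"
      have "q * prob {\<omega> \<in> space M. pmax X n \<omega> \<ge> u} \<le> prob {\<omega> \<in> space M. \<bar>psum X n \<omega>\<bar> \<ge> u - ?w}"
      proof (rule Ottaviani)
        show "q \<le> prob {\<omega> \<in> space M. psum X j \<omega> \<ge> - ?w}" if "j \<le> n" for j
          using elim(2)[rule_format, OF that] unfolding psum_uminus m .
        show "q \<le> prob {\<omega> \<in> space M. psum X j \<omega> \<le> ?w}" if "j \<le> n" for j
          using elim(1)[rule_format, OF that] .
      qed (use u q in auto)
      then show "prob {\<omega> \<in> space M. pmax X n \<omega> \<ge> u} \<le> 1 / q * prob {\<omega> \<in> space M. \<bar>psum X n \<omega>\<bar> \<ge> u - ?w}"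
        using q(1) by (simp add: field_simps)
    qed
  qed
qed

text \<open>The correction is the shift s sqrt n / log log n of \<open>pmax_le_psum_sharp\<close>
  divided by s \<open>phi\<close> n; multiplied by log log n it tends to 0, so \<tau> is
  unchanged.\<close>

lemma joint_limit_shift:
  assumes "joint_limit r \<tau> \<alpha>"
  shows "joint_limit r \<tau> (\<lambda>n \<epsilon>. \<alpha> n \<epsilon> - 1 / (sqrt 2 * loglogl (real n) * sqrt (loglogl (real n))))"
  unfolding joint_limit_def
proof (intro allI impI)
  fix \<eta> :: real assume \<eta>: "0 < \<eta>"
  obtain n0 \<delta> where n0: "\<delta> > 0" "\<And>n \<epsilon>. n \<ge> n0 \<Longrightarrow> r < \<epsilon> \<and> \<epsilon> < r + \<delta> \<Longrightarrow> \<bar>\<alpha> n \<epsilon> * loglogl (real n) - \<tau>\<bar> < \<eta> / 2"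
    using assms \<eta> unfolding joint_limit_def by (metis half_gt_zero)
  have "(\<lambda>n. 1 / (sqrt 2 * sqrt (loglogl (real n)))) \<longlonglongrightarrow> 0"
    by (rule filterlim_seq_cong[of "\<lambda>n l L. 1 / (sqrt 2 * sqrt L)"]) real_asymp
  then have "\<forall>\<^sub>F n in sequentially. 1 / (sqrt 2 * sqrt (loglogl (real n))) < \<eta> / 2" using \<eta> by (intro order_tendstoD) auto
  then obtain n1 where n1: "\<And>n. n \<ge> n1 \<Longrightarrow> 1 / (sqrt 2 * sqrt (loglogl (real n))) < \<eta> / 2" by (auto simp: eventually_sequentially)
  have "\<bar>(\<alpha> n \<epsilon> - 1 / (sqrt 2 * loglogl (real n) * sqrt (loglogl (real n)))) * loglogl (real n) - \<tau>\<bar> < \<eta>"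
    if "n \<ge> max n0 n1" "r < \<epsilon> \<and> \<epsilon> < r + \<delta>" for n \<epsilon>
  proof -
    have L: "loglogl (real n) > 0" by simp
    have close: "\<bar>A - \<tau>\<bar> < \<eta>" if "A = x - y" "0 < y" "\<bar>x - \<tau>\<bar> < \<eta> / 2" "y < \<eta> / 2" for A x y :: real
      using that by linarith
    have eq: "(\<alpha> n \<epsilon> - 1 / (sqrt 2 * loglogl (real n) * sqrt (loglogl (real n)))) * loglogl (real n)
      = \<alpha> n \<epsilon> * loglogl (real n) - 1 / (sqrt 2 * sqrt (loglogl (real n)))"
      using less_imp_neq[OF L] by (simp add: left_diff_distrib)
    have y0: "0 < 1 / (sqrt 2 * sqrt (loglogl (real n)))" by simp
    have d: "\<bar>\<alpha> n \<epsilon> * loglogl (real n) - \<tau>\<bar> < \<eta> / 2" "1 / (sqrt 2 * sqrt (loglogl (real n))) < \<eta> / 2"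
      using n0(2)[of n \<epsilon>] n1[of n] that by auto
    show ?thesis using close[OF eq y0 d] .
  qed
  then show "\<exists>n0 \<delta>. \<delta> > 0 \<and> (\<forall>n\<ge>n0. \<forall>\<epsilon>. r < \<epsilon> \<and> \<epsilon> < r + \<delta> \<longrightarrow>
     \<bar>(\<alpha> n \<epsilon> - 1 / (sqrt 2 * loglogl (real n) * sqrt (loglogl (real n)))) * loglogl (real n) - \<tau>\<bar> < \<eta>)"
    using n0(1) by blast
qed

text \<open>The factor \<open>q\<close> is the cost of passing from \<open>Q\<close> to the tail of
  |S_n|: slightly above 1 for sums and slightly above 2 for maxima.\<close>

lemma limit_psum_le:
  assumes v: "expectation (\<lambda>\<omega>. (X 1 \<omega>)\<^sup>2) = s\<^sup>2" and c: "0 < c"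
    and deficit: "\<And>\<kappa>. 0 < \<kappa> \<Longrightarrow> \<forall>\<^sub>F n in sequentially. var_trunc (level \<kappa> n) \<le> s\<^sup>2 - c / loglogl (real n)"
    and j: "joint_limit (sqrt (1 + a)) \<tau> \<alpha>" and q: "0 < q"
    and Q: "\<And>n \<epsilon>. 0 \<le> Q n \<epsilon>" "\<And>n \<epsilon>. Q n \<epsilon> \<le> 1"
    and \<delta>: "0 < \<delta>" and dom: "\<And>n \<epsilon>. n \<ge> N \<Longrightarrow> sqrt (1 + a) < \<epsilon> \<Longrightarrow> \<epsilon> < sqrt (1 + a) + \<delta> \<Longrightarrow>
       Q n \<epsilon> \<le> q * prob {\<omega> \<in> space M. \<bar>psum X n \<omega>\<bar> \<ge> s * phi (real n) * (\<epsilon> + \<alpha> n \<epsilon>)}"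
    and lim: "((\<lambda>\<epsilon>. (\<epsilon>\<^sup>2 - a - 1) powr (b + 1/2) * (\<Sum>n. wt a b (Suc n) * Q (Suc n) \<epsilon>)) \<longlongrightarrow> l) (at_right (sqrt (1 + a)))"
  shows "l \<le> q * (exp (- ((1 + a) * c / (4 * s\<^sup>2)) / 4) * G0 \<tau>) * Gamma (b + 1/2)"
proof -
  obtain \<rho> n2 \<delta>2 where d: "summable \<rho>" "\<delta>2 > 0" "\<And>n \<epsilon>. n \<ge> n2 \<Longrightarrow> sqrt (1 + a) < \<epsilon> \<and> \<epsilon> < sqrt (1 + a) + \<delta>2 \<Longrightarrow>
     wt a b n * prob {\<omega> \<in> space M. \<bar>psum X n \<omega>\<bar> \<ge> s * phi (real n) * (\<epsilon> + \<alpha> n \<epsilon>)}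
       \<le> \<rho> n + exp (- ((1 + a) * c / (4 * s\<^sup>2)) / 4) * G0 \<tau> * wt (a - \<epsilon>\<^sup>2) (b - 1/2) n"
    using main_domination[OF v c deficit j] by blast
  show ?thesis
  proof (rule limit_le[OF _ _ _ Q _ lim])
    show "summable (\<lambda>n. q * \<rho> n)" using d(1) by (rule summable_mult)
    show "0 \<le> q * (exp (- ((1 + a) * c / (4 * s\<^sup>2)) / 4) * G0 \<tau>)" using q a by (simp add: G0_def)
    show "0 < min \<delta> \<delta>2" using \<delta> d(2) by simp
    fix n \<epsilon> assume n: "n \<ge> max N n2" and e: "sqrt (1 + a) < \<epsilon>" "\<epsilon> < sqrt (1 + a) + min \<delta> \<delta>2"
    let ?P = "prob {\<omega> \<in> space M. \<bar>psum X n \<omega>\<bar> \<ge> s * phi (real n) * (\<epsilon> + \<alpha> n \<epsilon>)}"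
    have "wt a b n * Q n \<epsilon> \<le> wt a b n * (q * ?P)" using n e by (intro mult_left_mono dom) auto
    also have "\<dots> = q * (wt a b n * ?P)" by simp
    also have "\<dots> \<le> q * (\<rho> n + exp (- ((1 + a) * c / (4 * s\<^sup>2)) / 4) * G0 \<tau> * wt (a - \<epsilon>\<^sup>2) (b - 1/2) n)"
      using n e q by (intro mult_left_mono d(3)) auto
    finally show "wt a b n * Q n \<epsilon> \<le> q * \<rho> n + q * (exp (- ((1 + a) * c / (4 * s\<^sup>2)) / 4) * G0 \<tau>) * wt (a - \<epsilon>\<^sup>2) (b - 1/2) n"
      by (simp only: distrib_left mult.assoc)
  qed
qed

section \<open>Contradictions from a variance deficit and from a smaller variance\<close>

lemma Gamma_pos': "0 < Gamma (b + 1/2)" using b by (intro Gamma_real_pos) simp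

lemma G0_pos: "0 < G0 \<tau>" using a by (simp add: G0_def)

text \<open>\<open>m\<close> records the factor 2 or 1 of the assumed limit, so that both hypotheses
  share one argument. The passage to |S_n| may cost exp (c0 / 8), because the deficit gains exp (-
  c0 / 4).\<close>

lemma no_deficit:
  assumes v: "expectation (\<lambda>\<omega>. (X 1 \<omega>)\<^sup>2) = s\<^sup>2" and c: "0 < c"
    and deficit: "\<And>\<kappa>. 0 < \<kappa> \<Longrightarrow> \<forall>\<^sub>F n in sequentially. var_trunc (level \<kappa> n) \<le> s\<^sup>2 - c / loglogl (real n)"
    and j: "joint_limit (sqrt (1 + a)) \<tau> \<alpha>"
    and Q: "(Q = (\<lambda>n \<epsilon>. prob {\<omega> \<in> space M. pmax X n \<omega> \<ge> s * phi (real n) * (\<epsilon> + \<alpha> n \<epsilon>)}) \<and> m = 2) \<or>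
       (Q = (\<lambda>n \<epsilon>. prob {\<omega> \<in> space M. \<bar>psum X n \<omega>\<bar> \<ge> s * phi (real n) * (\<epsilon> + \<alpha> n \<epsilon>)}) \<and> m = 1)"
    and lim: "((\<lambda>\<epsilon>. (\<epsilon>\<^sup>2 - a - 1) powr (b + 1/2) * (\<Sum>n. wt a b (Suc n) * Q (Suc n) \<epsilon>)) \<longlongrightarrow> m * (G0 \<tau> * Gamma (b + 1/2))) (at_right (sqrt (1 + a)))"
  shows False
proof -
  define r where "r = sqrt (1 + a)"
  have r: "r > 0" using a by (simp add: r_def)
  define c0 where "c0 = (1 + a) * c / (4 * s\<^sup>2)"
  have c0: "c0 > 0" using a c s by (simp add: c0_def)
  have GG: "0 < G0 \<tau> * Gamma (b + 1/2)" using G0_pos Gamma_pos' by simp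
  have m0: "m > 0" using Q by auto
  have contra: False if "m * (G0 \<tau> * Gamma (b + 1/2)) \<le> m * exp (c0 / 8) * (exp (- c0 / 4) * G0 \<tau>) * Gamma (b + 1/2)"
  proof -
    have "m * exp (c0 / 8) * (exp (- c0 / 4) * G0 \<tau>) * Gamma (b + 1/2) = m * ((exp (c0 / 8) * exp (- c0 / 4)) * (G0 \<tau> * Gamma (b + 1/2)))"
      by (simp only: mult_ac)
    also have "exp (c0 / 8) * exp (- c0 / 4) = exp (- c0 / 8)" unfolding exp_add[symmetric] by simp
    finally have eq: "m * exp (c0 / 8) * (exp (- c0 / 4) * G0 \<tau>) * Gamma (b + 1/2) = m * (exp (- c0 / 8) * (G0 \<tau> * Gamma (b + 1/2)))" .
    have "G0 \<tau> * Gamma (b + 1/2) \<le> exp (- c0 / 8) * (G0 \<tau> * Gamma (b + 1/2))"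
      using that unfolding eq mult_le_cancel_left_pos[OF m0] .
    moreover have "exp (- c0 / 8) * (G0 \<tau> * Gamma (b + 1/2)) < 1 * (G0 \<tau> * Gamma (b + 1/2))"
      using c0 GG by (intro mult_strict_right_mono) auto
    ultimately show False by simp
  qed
  from Q show False
  proof (elim disjE conjE)
    assume Qe: "Q = (\<lambda>n \<epsilon>. prob {\<omega> \<in> space M. \<bar>psum X n \<omega>\<bar> \<ge> s * phi (real n) * (\<epsilon> + \<alpha> n \<epsilon>)})" and m: "m = 1"
    have "1 * (G0 \<tau> * Gamma (b + 1/2)) \<le> exp (c0 / 8) * (exp (- c0 / 4) * G0 \<tau>) * Gamma (b + 1/2)"
      unfolding c0_def
    proof (rule limit_psum_le[OF v c deficit j, where Q = Q and \<delta> = 1 and N = 0])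
      show "Q n \<epsilon> \<le> exp ((1 + a) * c / (4 * s\<^sup>2) / 8) * prob {\<omega> \<in> space M. \<bar>psum X n \<omega>\<bar> \<ge> s * phi (real n) * (\<epsilon> + \<alpha> n \<epsilon>)}" for n \<epsilon>
        unfolding Qe using mult_right_mono[of 1 "exp (c0 / 8)" "prob {\<omega> \<in> space M. \<bar>psum X n \<omega>\<bar> \<ge> s * phi (real n) * (\<epsilon> + \<alpha> n \<epsilon>)}"] c0
        by (simp add: c0_def)
    qed (use lim m in \<open>auto simp: Qe\<close>)
    then show False using contra by (simp add: m)
  next
    assume Qe: "Q = (\<lambda>n \<epsilon>. prob {\<omega> \<in> space M. pmax X n \<omega> \<ge> s * phi (real n) * (\<epsilon> + \<alpha> n \<epsilon>)})" and m: "m = 2"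
    \<comment> \<open>Then 1 / q = 2 exp (c0 / 8): the 2 belongs to the maximum, and exp (c0 / 8) is
      the price for having \<open>q\<close> strictly below 1/2.\<close>
    define q where "q = exp (- c0 / 8) / 2"
    have q: "0 < q" "q < 1/2" "1 / q = 2 * exp (c0 / 8)" using c0 by (auto simp: q_def exp_minus field_simps)
    define \<beta> where "\<beta> n = 1 / (sqrt 2 * loglogl (real n) * sqrt (loglogl (real n)))" for n :: nat
    define \<alpha>' where "\<alpha>' n \<epsilon> = \<alpha> n \<epsilon> - \<beta> n" for n \<epsilon>
    have j': "joint_limit r \<tau> \<alpha>'" using joint_limit_shift[OF j] unfolding \<alpha>'_def[abs_def] \<beta>_def r_def .
    obtain n0 \<delta>0 where n0: "\<delta>0 > 0" "\<And>n \<epsilon>. n \<ge> n0 \<Longrightarrow> r < \<epsilon> \<and> \<epsilon> < r + \<delta>0 \<Longrightarrow> (1 - 1/2) * r \<le> \<epsilon> + \<alpha>' n \<epsilon>"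
      using joint_limit_bounds[OF j' r, of "1/2" 1] by auto
    obtain n1 where n1: "\<And>n u. n \<ge> n1 \<Longrightarrow> u > s * sqrt (real n) / loglogl (real n) \<Longrightarrow>
       prob {\<omega> \<in> space M. pmax X n \<omega> \<ge> u} \<le> 1 / q * prob {\<omega> \<in> space M. \<bar>psum X n \<omega>\<bar> \<ge> u - s * sqrt (real n) / loglogl (real n)}"
      using pmax_le_psum_sharp[OF v q(1,2)] unfolding eventually_sequentially by blast
    have "2 * (G0 \<tau> * Gamma (b + 1/2)) \<le> (1 / q) * (exp (- c0 / 4) * G0 \<tau>) * Gamma (b + 1/2)"
      unfolding c0_def
    proof (rule limit_psum_le[OF v c deficit j'[unfolded r_def], where Q = Q and \<delta> = \<delta>0 and N = "max 1 (max n0 n1)"])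
      fix n \<epsilon> assume n: "n \<ge> max 1 (max n0 n1)" and e: "sqrt (1 + a) < \<epsilon>" "\<epsilon> < sqrt (1 + a) + \<delta>0"
      define L where "L = loglogl (real n)"
      define u where "u = s * phi (real n) * (\<epsilon> + \<alpha> n \<epsilon>)"
      have L: "L > 0" by (simp add: L_def)
      have rn: "sqrt (real n) > 0" using n by simp
      have "s * phi (real n) * \<beta> n = s * (sqrt 2 * (sqrt (real n) * sqrt L)) * (1 / (sqrt 2 * L * sqrt L))"
        by (simp add: phi_eq \<beta>_def L_def real_sqrt_mult)
      also have "\<dots> = s * sqrt (real n) / L" using L by simp
      finally have w: "s * phi (real n) * \<beta> n = s * sqrt (real n) / L" .
      have uw: "u - s * sqrt (real n) / L = s * phi (real n) * (\<epsilon> + \<alpha>' n \<epsilon>)"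
        unfolding w[symmetric] u_def \<alpha>'_def by (simp add: algebra_simps)
      have "0 < s * phi (real n) * (\<epsilon> + \<alpha>' n \<epsilon>)"
      proof -
        have "0 < \<epsilon> + \<alpha>' n \<epsilon>" 
        proof -
          have "1/2 * r \<le> \<epsilon> + \<alpha>' n \<epsilon>" using n0(2)[of n \<epsilon>] n e by (simp add: r_def)
          then show ?thesis using r by linarith
        qed
        then show ?thesis using s rn L by (simp add: phi_def L_def)
      qed
      then have "u > s * sqrt (real n) / L" using uw by linarith
      then show "Q n \<epsilon> \<le> 1 / q * prob {\<omega> \<in> space M. \<bar>psum X n \<omega>\<bar> \<ge> s * phi (real n) * (\<epsilon> + \<alpha>' n \<epsilon>)}"
        unfolding Qe uw[symmetric] u_def[symmetric] L_def using n by (intro n1) auto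
    qed (use lim m q n0 in \<open>auto simp: Qe\<close>)
    then show False using contra by (simp add: m q(3))
  qed
qed

text \<open>The dominating series from \<open>strict_variance_summable\<close> does not depend on
  \<epsilon>, so \<open>limit_le\<close> applies with A = 0 and the limit would be 0. The passage to
  |S_n| can be crude here: Chebyshev with 1/2 and the shift s sqrt (2 n), which fits into the margin
  \<eta> / 2 of the level.\<close>

lemma variance_not_less:
  assumes j: "joint_limit (sqrt (1 + a)) \<tau> \<alpha>"
    and Q: "(Q = (\<lambda>n \<epsilon>. prob {\<omega> \<in> space M. pmax X n \<omega> \<ge> s * phi (real n) * (\<epsilon> + \<alpha> n \<epsilon>)}) \<and> m = 2) \<or>
       (Q = (\<lambda>n \<epsilon>. prob {\<omega> \<in> space M. \<bar>psum X n \<omega>\<bar> \<ge> s * phi (real n) * (\<epsilon> + \<alpha> n \<epsilon>)}) \<and> m = 1)"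
    and lim: "((\<lambda>\<epsilon>. (\<epsilon>\<^sup>2 - a - 1) powr (b + 1/2) * (\<Sum>n. wt a b (Suc n) * Q (Suc n) \<epsilon>)) \<longlongrightarrow> m * (G0 \<tau> * Gamma (b + 1/2))) (at_right (sqrt (1 + a)))"
  shows "s\<^sup>2 \<le> expectation (\<lambda>\<omega>. (X 1 \<omega>)\<^sup>2)"
proof (rule ccontr)
  assume "\<not> s\<^sup>2 \<le> expectation (\<lambda>\<omega>. (X 1 \<omega>)\<^sup>2)"
  then have v: "expectation (\<lambda>\<omega>. (X 1 \<omega>)\<^sup>2) < s\<^sup>2" by simp
  define r where "r = sqrt (1 + a)"
  have r: "r > 0" using a by (simp add: r_def)
  obtain \<eta> where \<eta>: "0 < \<eta>" "\<eta> < 1"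
    and sm: "summable (\<lambda>n. wt a b n * prob {\<omega> \<in> space M. \<bar>psum X n \<omega>\<bar> \<ge> s * phi (real n) * ((1 - \<eta>) * r)})"
    using strict_variance_summable[OF v] unfolding r_def by blast
  obtain n0 \<delta> where n0: "\<delta> > 0" "\<And>n \<epsilon>. n \<ge> n0 \<Longrightarrow> r < \<epsilon> \<and> \<epsilon> < r + \<delta> \<Longrightarrow> (1 - \<eta> / 2) * r \<le> \<epsilon> + \<alpha> n \<epsilon>"
    using joint_limit_bounds[OF j[folded r_def] r, of "\<eta> / 2" 1] \<eta> by auto
  have "\<forall>\<^sub>F n in sequentially. (2 / (\<eta> * r))\<^sup>2 \<le> loglogl (real n)"
    using loglogl_top unfolding filterlim_at_top by blast
  then obtain n1 where n1: "\<And>n. n \<ge> n1 \<Longrightarrow> (2 / (\<eta> * r))\<^sup>2 \<le> loglogl (real n)"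
    by (auto simp: eventually_sequentially)
  have bound: "Q n \<epsilon> \<le> 2 * prob {\<omega> \<in> space M. \<bar>psum X n \<omega>\<bar> \<ge> s * phi (real n) * ((1 - \<eta>) * r)}"
    if n: "n \<ge> max 1 (max n0 n1)" and e: "r < \<epsilon>" "\<epsilon> < r + \<delta>" for n \<epsilon>
  proof -
    define u where "u = s * phi (real n) * (\<epsilon> + \<alpha> n \<epsilon>)"
    define L where "L = loglogl (real n)"
    define w where "w = s * (sqrt 2 * sqrt (real n))"
    have L: "L > 0" by (simp add: L_def)
    have rn: "sqrt (real n) > 0" using n by simp
    have ph: "phi (real n) = sqrt 2 * sqrt (real n) * sqrt L" by (simp add: phi_eq L_def real_sqrt_mult)
    have sp: "0 < s * phi (real n)" using s rn L by (simp add: ph)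
    have u1: "s * phi (real n) * ((1 - \<eta> / 2) * r) \<le> u"
      unfolding u_def using n0(2)[of n \<epsilon>] n e sp by (intro mult_left_mono) auto
    have wle: "w \<le> s * phi (real n) * (\<eta> / 2 * r)"
    proof -
      have "2 / (\<eta> * r) \<le> sqrt L" using n1[of n] n by (intro real_le_rsqrt) (auto simp: L_def)
      then have "1 \<le> sqrt L * (\<eta> / 2 * r)" using \<eta> r by (simp add: field_simps)
      then have "w * 1 \<le> w * (sqrt L * (\<eta> / 2 * r))" using s by (intro mult_left_mono) (auto simp: w_def)
      then show ?thesis by (simp add: w_def ph mult_ac)
    qed
    have low: "s * phi (real n) * ((1 - \<eta>) * r) \<le> u - w"
    proof -
      have "s * phi (real n) * ((1 - \<eta>) * r) = s * phi (real n) * ((1 - \<eta> / 2) * r) - s * phi (real n) * (\<eta> / 2 * r)"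
        by (simp add: algebra_simps)
      then show ?thesis using u1 wle by linarith
    qed
    have w0: "w > 0" using s rn by (simp add: w_def)
    have pos: "0 < s * phi (real n) * ((1 - \<eta>) * r)" using sp \<eta> r by simp
    have nv: "2 * (real n * expectation (\<lambda>\<omega>. (X 1 \<omega>)\<^sup>2)) \<le> w\<^sup>2"
    proof -
      have "real n * expectation (\<lambda>\<omega>. (X 1 \<omega>)\<^sup>2) \<le> real n * s\<^sup>2" using v by (intro mult_left_mono) auto
      moreover have "w\<^sup>2 = 2 * (real n * s\<^sup>2)" by (simp add: w_def power_mult_distrib)
      ultimately show ?thesis by linarith
    qed
    have mono: "prob {\<omega> \<in> space M. \<bar>psum X n \<omega>\<bar> \<ge> u - w} \<le> prob {\<omega> \<in> space M. \<bar>psum X n \<omega>\<bar> \<ge> s * phi (real n) * ((1 - \<eta>) * r)}"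
      using low by (intro finite_measure_mono) auto
    from Q show ?thesis
    proof (elim disjE conjE)
      assume Qe: "Q = (\<lambda>n \<epsilon>. prob {\<omega> \<in> space M. \<bar>psum X n \<omega>\<bar> \<ge> s * phi (real n) * (\<epsilon> + \<alpha> n \<epsilon>)})"
      have "Q n \<epsilon> \<le> prob {\<omega> \<in> space M. \<bar>psum X n \<omega>\<bar> \<ge> u - w}"
        unfolding Qe u_def[symmetric] using w0 by (intro finite_measure_mono) auto
      also note mono
      also have "prob {\<omega> \<in> space M. \<bar>psum X n \<omega>\<bar> \<ge> s * phi (real n) * ((1 - \<eta>) * r)} \<le> 2 * prob {\<omega> \<in> space M. \<bar>psum X n \<omega>\<bar> \<ge> s * phi (real n) * ((1 - \<eta>) * r)}" by simp
      finally show ?thesis .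
    next
      assume Qe: "Q = (\<lambda>n \<epsilon>. prob {\<omega> \<in> space M. pmax X n \<omega> \<ge> s * phi (real n) * (\<epsilon> + \<alpha> n \<epsilon>)})"
      have "1/2 * Q n \<epsilon> \<le> prob {\<omega> \<in> space M. \<bar>psum X n \<omega>\<bar> \<ge> u - w}"
        unfolding Qe u_def[symmetric]
      proof (rule Ottaviani)
        show "1/2 \<le> prob {\<omega> \<in> space M. psum X j \<omega> \<ge> - w}" if "j \<le> n" for j
          using psum_Chebyshev_half(1)[OF int2 mean w0 nv that] .
        show "1/2 \<le> prob {\<omega> \<in> space M. psum X j \<omega> \<le> w}" if "j \<le> n" for j
          using psum_Chebyshev_half(2)[OF int2 mean w0 nv that] .
        show "w < u" using low pos by linarith
      qed simp
      then show ?thesis using mono by linarith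
    qed
  qed
  have "m * (G0 \<tau> * Gamma (b + 1/2)) \<le> 0 * Gamma (b + 1/2)"
  proof (rule limit_le[OF _ _ n0(1) _ _ _ lim])
    show "summable (\<lambda>n. 2 * (wt a b n * prob {\<omega> \<in> space M. \<bar>psum X n \<omega>\<bar> \<ge> s * phi (real n) * ((1 - \<eta>) * r)}))"
      by (rule summable_mult[OF sm])
    show "0 \<le> Q n \<epsilon>" "Q n \<epsilon> \<le> 1" for n \<epsilon> using Q by auto
    fix n \<epsilon> assume n: "n \<ge> max 1 (max n0 n1)" and e: "sqrt (1 + a) < \<epsilon>" "\<epsilon> < sqrt (1 + a) + \<delta>"
    show "wt a b n * Q n \<epsilon> \<le> 2 * (wt a b n * prob {\<omega> \<in> space M. \<bar>psum X n \<omega>\<bar> \<ge> s * phi (real n) * ((1 - \<eta>) * r)}) + 0 * wt (a - \<epsilon>\<^sup>2) (b - 1/2) n"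
      using mult_left_mono[OF bound[OF n e[folded r_def]] wt_nonneg[of a b n]] by simp
  qed simp
  moreover have "0 < m * (G0 \<tau> * Gamma (b + 1/2))" using Q G0_pos Gamma_pos' by auto
  ultimately show False by simp
qed

end

text \<open>The hypothesis concerns |X| \<ge> t while truncation at \<open>k\<close> drops |X| > k,
  hence t = k + 1. Since k + 1 \<le> n eventually, log log t may be replaced by log log n.\<close>

lemma (in lil_moments) deficit_of_tail:
  assumes v: "expectation (\<lambda>\<omega>. (X 1 \<omega>)\<^sup>2) = s\<^sup>2" and c: "0 < c" and \<kappa>: "0 < \<kappa>"
    and ev: "\<forall>\<^sub>F t in at_top. c \<le> loglogl t * expectation (\<lambda>\<omega>. (X 1 \<omega>)\<^sup>2 * indicator {x. \<bar>x\<bar> \<ge> t} (X 1 \<omega>))"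
  shows "\<forall>\<^sub>F n in sequentially. var_trunc (level \<kappa> n) \<le> s\<^sup>2 - c / loglogl (real n)"
proof -
  have top: "filterlim (\<lambda>n. level \<kappa> n + 1) at_top sequentially"
    using filterlim_tendsto_add_at_top[OF tendsto_const[of 1] level_top[OF \<kappa>]] by (simp add: add.commute)
  have "filterlim (\<lambda>n. real n - (\<kappa> * sqrt (real n) / sqrt (loglogl (real n)) + 1)) at_top sequentially"
    by (rule filterlim_seq_cong[of "\<lambda>n l L. n - (\<kappa> * sqrt n / sqrt L + 1)"]) real_asymp
  then have "\<forall>\<^sub>F n in sequentially. 0 \<le> real n - (\<kappa> * sqrt (real n) / sqrt (loglogl (real n)) + 1)"
    unfolding filterlim_at_top by blast
  then show ?thesis using eventually_compose_filterlim[OF ev top]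
  proof eventually_elim
    case (elim n)
    define k where "k = level \<kappa> n"
    define J where "J = expectation (\<lambda>\<omega>. (X 1 \<omega>)\<^sup>2 * indicator {x. \<bar>x\<bar> \<ge> k + 1} (X 1 \<omega>))"
    have Jint: "integrable M (\<lambda>\<omega>. (X 1 \<omega>)\<^sup>2 * indicator {x. \<bar>x\<bar> \<ge> k + 1} (X 1 \<omega>))"
      by (rule Bochner_Integration.integrable_bound[OF int2]) (auto simp: indicator_def)
    have J0: "0 \<le> J" unfolding J_def by (intro integral_nonneg_AE) auto
    have "k + 1 \<le> real n" using elim(1) by (simp add: k_def level_eq)
    then have "loglogl (k + 1) * J \<le> loglogl (real n) * J" by (intro mult_right_mono loglogl_mono J0)
    then have "c \<le> loglogl (real n) * J" using elim(2) by (simp add: k_def J_def)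
    then have "c / loglogl (real n) \<le> J" using loglogl_pos[of "real n"] by (simp add: divide_le_eq mult.commute)
    also have "J \<le> expectation (\<lambda>\<omega>. (X 1 \<omega>)\<^sup>2 - (trunc k (X 1 \<omega>))\<^sup>2)"
      unfolding J_def
    proof (rule integral_mono[OF Jint])
      show "integrable M (\<lambda>\<omega>. (X 1 \<omega>)\<^sup>2 - (trunc k (X 1 \<omega>))\<^sup>2)"
        by (rule Bochner_Integration.integrable_diff[OF int2 integrable_trunc_square])
      show "(X 1 \<omega>)\<^sup>2 * indicator {x. \<bar>x\<bar> \<ge> k + 1} (X 1 \<omega>) \<le> (X 1 \<omega>)\<^sup>2 - (trunc k (X 1 \<omega>))\<^sup>2" for \<omega>
        by (auto simp: indicator_def trunc_def)
    qed
    also have "\<dots> = s\<^sup>2 - var_trunc k"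
      unfolding var_trunc_def v[symmetric] by (rule Bochner_Integration.integral_diff[OF int2 integrable_trunc_square])
    finally show ?case by (simp add: k_def)
  qed
qed

lemma (in iid_real) precise_rate_converse:
  fixes a b s \<tau> m :: real and \<alpha> :: "nat \<Rightarrow> real \<Rightarrow> real"
  assumes a: "- 1 < a" and b: "- 1/2 < b" and s: "0 < s"
    and j: "joint_limit (sqrt (1 + a)) \<tau> \<alpha>"
    and Q: "(Q = (\<lambda>n \<epsilon>. prob {\<omega> \<in> space M. pmax X n \<omega> \<ge> s * phi (real n) * (\<epsilon> + \<alpha> n \<epsilon>)}) \<and> m = 2) \<or>
       (Q = (\<lambda>n \<epsilon>. prob {\<omega> \<in> space M. \<bar>psum X n \<omega>\<bar> \<ge> s * phi (real n) * (\<epsilon> + \<alpha> n \<epsilon>)}) \<and> m = 1)"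
    and sm: "\<forall>\<^sub>F \<epsilon> in at_right (sqrt (1 + a)). summable (\<lambda>n. wt a b (Suc n) * Q (Suc n) \<epsilon>)"
    and lim: "((\<lambda>\<epsilon>. (\<epsilon>\<^sup>2 - a - 1) powr (b + 1/2) * (\<Sum>n. wt a b (Suc n) * Q (Suc n) \<epsilon>)) \<longlongrightarrow>
       m * (sqrt (1 / (pi * (a + 1))) * exp (- 2 * \<tau> * sqrt (1 + a)) * Gamma (b + 1/2))) (at_right (sqrt (1 + a)))"
  shows "integrable M (X 1) \<and> expectation (X 1) = 0
    \<and> integrable M (\<lambda>\<omega>. (X 1 \<omega>)\<^sup>2) \<and> expectation (\<lambda>\<omega>. (X 1 \<omega>)\<^sup>2) = s\<^sup>2
    \<and> integrable M (\<lambda>\<omega>. (X 1 \<omega>)\<^sup>2 * logl \<bar>X 1 \<omega>\<bar> powr a * loglogl \<bar>X 1 \<omega>\<bar> powr (b - 1))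
    \<and> Liminf at_top (\<lambda>t::real. ereal (loglogl t * expectation (\<lambda>\<omega>. (X 1 \<omega>)\<^sup>2 * indicator {x. \<bar>x\<bar> \<ge> t} (X 1 \<omega>)))) = 0"
proof -
  define r where "r = sqrt (1 + a)"
  have r: "r > 0" using a by (simp add: r_def)
  have sumx: "summable (\<lambda>n. wt a b n * prob {\<omega> \<in> space M. \<bar>psum X n \<omega>\<bar> \<ge> x * phi (real n)})" if x: "s * sqrt (1 + a) < x" for x
  proof -
    obtain n0 \<delta> where n0: "\<delta> > 0" "\<And>n \<epsilon>. n \<ge> n0 \<Longrightarrow> r < \<epsilon> \<and> \<epsilon> < r + \<delta> \<Longrightarrow> \<bar>\<alpha> n \<epsilon> * loglogl (real n) - \<tau>\<bar> < 1"
      using j[folded r_def] unfolding joint_limit_def by (metis zero_less_one)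
    \<comment> \<open>Midpoint between the critical level and x / s. An \<epsilon> below it leaves
      the fixed margin x / s - x' for \<alpha>, which is at most (|\<tau>| + 1) / log log n.\<close>
    define x' where "x' = (r + x / s) / 2"
    have x': "r < x'" "x' < x / s" using x s by (auto simp: x'_def r_def field_simps)
    have "\<forall>\<^sub>F \<epsilon> in at_right r. r < \<epsilon> \<and> \<epsilon> < r + \<delta> \<and> \<epsilon> < x' \<and> summable (\<lambda>n. wt a b (Suc n) * Q (Suc n) \<epsilon>)"
      using n0(1) x'(1) by (intro eventually_conj eventually_at_right_less sm[folded r_def] eventually_at_right_real[THEN eventually_mono, of r "r + \<delta>"]
          eventually_at_right_real[THEN eventually_mono, of r x']) auto
    then obtain \<epsilon> where \<epsilon>: "r < \<epsilon>" "\<epsilon> < r + \<delta>" "\<epsilon> < x'" and sm\<epsilon>: "summable (\<lambda>n. wt a b (Suc n) * Q (Suc n) \<epsilon>)"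
      using eventually_happens'[OF trivial_limit_at_right_real] by blast
    have sm': "summable (\<lambda>n. wt a b n * Q n \<epsilon>)" using sm\<epsilon> by (subst summable_Suc_iff[symmetric])
    have "\<forall>\<^sub>F n in sequentially. (\<bar>\<tau>\<bar> + 1) / (x / s - x') \<le> loglogl (real n)"
      using loglogl_top unfolding filterlim_at_top by blast
    then have "\<forall>\<^sub>F n in sequentially. norm (wt a b n * prob {\<omega> \<in> space M. \<bar>psum X n \<omega>\<bar> \<ge> x * phi (real n)}) \<le> wt a b n * Q n \<epsilon>"
      using eventually_ge_at_top[of n0]
    proof eventually_elim
      case (elim n)
      define L where "L = loglogl (real n)"
      have L: "L > 0" by (simp add: L_def)
      have "\<bar>\<alpha> n \<epsilon> * L - \<tau>\<bar> < 1" using n0(2)[OF elim(2)] \<epsilon> by (simp add: L_def)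
      then have "\<alpha> n \<epsilon> * L \<le> \<bar>\<tau>\<bar> + 1" by linarith
      also have "\<dots> \<le> (x / s - x') * L" using elim(1) x'(2) by (simp add: L_def pos_divide_le_eq mult.commute)
      finally have "\<alpha> n \<epsilon> \<le> x / s - x'" using L by simp
      then have "\<epsilon> + \<alpha> n \<epsilon> \<le> x / s" using \<epsilon>(3) by linarith
      moreover have ph: "0 \<le> phi (real n)" by (simp add: phi_def less_imp_le)
      ultimately have "s * phi (real n) * (\<epsilon> + \<alpha> n \<epsilon>) \<le> s * phi (real n) * (x / s)" using s by (intro mult_left_mono) auto
      then have th: "s * phi (real n) * (\<epsilon> + \<alpha> n \<epsilon>) \<le> x * phi (real n)" using s by (simp add: mult.commute)
      have "prob {\<omega> \<in> space M. \<bar>psum X n \<omega>\<bar> \<ge> x * phi (real n)} \<le> Q n \<epsilon>"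
        using Q
      proof (elim disjE conjE)
        assume "Q = (\<lambda>n \<epsilon>. prob {\<omega> \<in> space M. pmax X n \<omega> \<ge> s * phi (real n) * (\<epsilon> + \<alpha> n \<epsilon>)})"
        then show ?thesis using th by (auto intro!: finite_measure_mono simp: pmax_ge_iff)
      next
        assume "Q = (\<lambda>n \<epsilon>. prob {\<omega> \<in> space M. \<bar>psum X n \<omega>\<bar> \<ge> s * phi (real n) * (\<epsilon> + \<alpha> n \<epsilon>)})"
        then show ?thesis using th by (auto intro!: finite_measure_mono)
      qed
      then show ?case by (simp add: mult_left_mono)
    qed
    then show ?thesis by (rule summable_comparison_test_ev[OF _ sm'])
  qed
  note mom = moments_of_summable[OF s a sumx]
  interpret C: iid_centered_l2 M X by unfold_locales (use mom in auto)
  have "0 \<le> s * sqrt (1 + a)" using s a by simp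
  then have x1: "0 < s * sqrt (1 + a) + 1" by linarith
  have intG: "integrable M (\<lambda>\<omega>. (X 1 \<omega>)\<^sup>2 * logl \<bar>X 1 \<omega>\<bar> powr a * loglogl \<bar>X 1 \<omega>\<bar> powr (b - 1))"
    by (rule integrable_of_summable[OF mom(1,2) x1 sumx]) simp_all
  interpret L: lil_moments M X a b s by unfold_locales (use a b s intG in auto)
  have lim': "((\<lambda>\<epsilon>. (\<epsilon>\<^sup>2 - a - 1) powr (b + 1/2) * (\<Sum>n. wt a b (Suc n) * Q (Suc n) \<epsilon>)) \<longlongrightarrow> m * (L.G0 \<tau> * Gamma (b + 1/2))) (at_right (sqrt (1 + a)))"
    using lim by (simp add: L.G0_def)
  have v: "expectation (\<lambda>\<omega>. (X 1 \<omega>)\<^sup>2) = s\<^sup>2"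
    using mom(3) L.variance_not_less[OF j Q lim'] by simp
  define h where "h t = loglogl t * expectation (\<lambda>\<omega>. (X 1 \<omega>)\<^sup>2 * indicator {x. \<bar>x\<bar> \<ge> t} (X 1 \<omega>))" for t
  have h0: "0 \<le> h t" for t unfolding h_def by (intro mult_nonneg_nonneg integral_nonneg_AE) (auto simp: less_imp_le)
  have "Liminf at_top (\<lambda>t. ereal (h t)) = 0"
  proof (rule antisym)
    show "0 \<le> Liminf at_top (\<lambda>t. ereal (h t))" using h0 by (intro Liminf_bounded always_eventually) auto
    show "Liminf at_top (\<lambda>t. ereal (h t)) \<le> 0"
    proof (rule ccontr)
      assume "\<not> Liminf at_top (\<lambda>t. ereal (h t)) \<le> 0"
      then have "ereal 0 < Liminf at_top (\<lambda>t. ereal (h t))" by (simp add: zero_ereal_def[symmetric])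
      \<comment> \<open>Any constant strictly between 0 and a positive lower limit gives a variance
        deficit c / log log n at every truncation level, which \<open>no_deficit\<close>
        excludes.\<close>
      then obtain c where c: "ereal 0 < ereal c" "ereal c < Liminf at_top (\<lambda>t. ereal (h t))"
        using ereal_dense2 by blast
      have "\<forall>\<^sub>F t in at_top. ereal c < ereal (h t)" using less_LiminfD[OF c(2)] .
      then have ev: "\<forall>\<^sub>F t in at_top. c \<le> loglogl t * expectation (\<lambda>\<omega>. (X 1 \<omega>)\<^sup>2 * indicator {x. \<bar>x\<bar> \<ge> t} (X 1 \<omega>))"
        by eventually_elim (simp add: h_def)
      have c0: "0 < c" using c(1) by simp
      show False
        by (rule L.no_deficit[OF v c0 L.deficit_of_tail[OF v c0 _ ev] j Q lim'])
    qed
  qed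
  then show ?thesis using C.int1 mom intG v by (simp add: h_def)
qed

text \<open>A divergent real \<open>suminf\<close> has an unspecified value, so convergence of the
  series for \<epsilon> near sqrt (1 + a) is stated next to each limit. Likewise each expectation of
  the conclusion that is claimed to exist comes with integrability, since a non-integrable function
  has integral 0. Sums over n \<ge> 1 are indexed by \<open>Suc n\<close>.\<close>

theorem theorem1:
  fixes M :: "'a measure" and X :: "nat \<Rightarrow> 'a \<Rightarrow> real"
    and a b \<sigma> \<tau> :: real and an :: "nat \<Rightarrow> real \<Rightarrow> real"
  assumes "prob_space M"
    and rv: "\<And>n. n \<ge> 1 \<Longrightarrow> X n \<in> borel_measurable M"
    and indep: "prob_space.indep_vars M (\<lambda>_. borel) X {1..}"
    and ident: "\<And>n. n \<ge> 1 \<Longrightarrow> distr M borel (X n) = distr M borel (X 1)"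
    and ha: "a > -1" and hb: "b > -1/2" and hs: "0 < \<sigma>"
    and han: "\<forall>\<eta>>0. \<exists>n0 \<delta>. \<delta> > 0 \<and> (\<forall>n\<ge>n0. \<forall>\<epsilon>.
               sqrt (1 + a) < \<epsilon> \<and> \<epsilon> < sqrt (1 + a) + \<delta> \<longrightarrow>
               \<bar>an n \<epsilon> * loglogl (real n) - \<tau>\<bar> < \<eta>)"
    and hyp:
      "((\<forall>\<^sub>F \<epsilon> in at_right (sqrt (1 + a)). summable (\<lambda>n.
            logl (real (Suc n)) powr a * loglogl (real (Suc n)) powr b / real (Suc n) *
            measure M {\<omega> \<in> space M. pmax X (Suc n) \<omega> \<ge> \<sigma> * phi (real (Suc n)) * (\<epsilon> + an (Suc n) \<epsilon>)}))
        \<and> ((\<lambda>\<epsilon>. (\<epsilon>\<^sup>2 - a - 1) powr (b + 1/2) * (\<Sum>n.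
            logl (real (Suc n)) powr a * loglogl (real (Suc n)) powr b / real (Suc n) *
            measure M {\<omega> \<in> space M. pmax X (Suc n) \<omega> \<ge> \<sigma> * phi (real (Suc n)) * (\<epsilon> + an (Suc n) \<epsilon>)}))
           \<longlongrightarrow> 2 * sqrt (1 / (pi * (a + 1))) * exp (- 2 * \<tau> * sqrt (1 + a)) * Gamma (b + 1/2))
           (at_right (sqrt (1 + a))))
       \<or>
       ((\<forall>\<^sub>F \<epsilon> in at_right (sqrt (1 + a)). summable (\<lambda>n.
            logl (real (Suc n)) powr a * loglogl (real (Suc n)) powr b / real (Suc n) *
            measure M {\<omega> \<in> space M. \<bar>psum X (Suc n) \<omega>\<bar> \<ge> \<sigma> * phi (real (Suc n)) * (\<epsilon> + an (Suc n) \<epsilon>)}))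
        \<and> ((\<lambda>\<epsilon>. (\<epsilon>\<^sup>2 - a - 1) powr (b + 1/2) * (\<Sum>n.
            logl (real (Suc n)) powr a * loglogl (real (Suc n)) powr b / real (Suc n) *
            measure M {\<omega> \<in> space M. \<bar>psum X (Suc n) \<omega>\<bar> \<ge> \<sigma> * phi (real (Suc n)) * (\<epsilon> + an (Suc n) \<epsilon>)}))
           \<longlongrightarrow> sqrt (1 / (pi * (a + 1))) * exp (- 2 * \<tau> * sqrt (1 + a)) * Gamma (b + 1/2))
           (at_right (sqrt (1 + a))))"
  shows "integrable M (X 1) \<and> prob_space.expectation M (X 1) = 0
    \<and> integrable M (\<lambda>\<omega>. (X 1 \<omega>)\<^sup>2) \<and> prob_space.expectation M (\<lambda>\<omega>. (X 1 \<omega>)\<^sup>2) = \<sigma>\<^sup>2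
    \<and> integrable M (\<lambda>\<omega>. (X 1 \<omega>)\<^sup>2 * logl \<bar>X 1 \<omega>\<bar> powr a * loglogl \<bar>X 1 \<omega>\<bar> powr (b - 1))
    \<and> Liminf at_top (\<lambda>t::real. ereal (loglogl t *
         prob_space.expectation M (\<lambda>\<omega>. (X 1 \<omega>)\<^sup>2 * indicator {x. \<bar>x\<bar> \<ge> t} (X 1 \<omega>)))) = 0"
proof -
  interpret prob_space M by fact
  interpret iid_real M X by unfold_locales (fact rv indep ident)+
  have j: "joint_limit (sqrt (1 + a)) \<tau> an" using han unfolding joint_limit_def .
  note wt_Suc = wt_def[of a b "Suc n" for n, symmetric]
  from hyp show ?thesis
  proof (elim disjE conjE, goal_cases)
    case 1
    then show ?case
      by (intro precise_rate_converse[OF ha hb hs j, where m = 2 and Q = "\<lambda>n \<epsilon>. prob {\<omega> \<in> space M. pmax X n \<omega> \<ge> \<sigma> * phi (real n) * (\<epsilon> + an n \<epsilon>)}"])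
         (simp_all only: wt_Suc mult.assoc simp_thms)
  next
    case 2
    then show ?case
      by (intro precise_rate_converse[OF ha hb hs j, where m = 1 and Q = "\<lambda>n \<epsilon>. prob {\<omega> \<in> space M. \<bar>psum X n \<omega>\<bar> \<ge> \<sigma> * phi (real n) * (\<epsilon> + an n \<epsilon>)}"])
         (simp_all only: wt_Suc mult_1_left simp_thms)
  qed
qed

end
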